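(* Let $M_p$ be a weight sequence satisfying $(M.1)$, $(M.2)'$ and $(QA)$. Let $\ast$ denote either $(M_p)$ (Beurling case), in which case assume $p!\prec M_p$, or $\{M_p\}$ (Roumieu case), in which case assume $p!\subset M_p$. Let $\Omega\subseteq\mathbb{R}^d$ be open and let $\mathcal{M}=\{\Omega_i : i\in I\}$ be an open covering of $\Omega$. Write $\Omega_{i,j}=\Omega_i\cap\Omega_j$ and $\Omega_{i,j,k}=\Omega_i\cap\Omega_j\cap\Omega_k$. Then $H^1(\mathcal{M},\mathcal{E}^\ast)=0$. Explicitly, the sequence $$0\longrightarrow \mathcal{E}^\ast(\Omega)\longrightarrow \prod_{i\in I}\mathcal{E}^\ast(\Omega_i)\xrightarrow{\ \delta\ } Z^1(\mathcal{M},\mathcal{E}^\ast)\longrightarrow 0$$ is exact, where the first map is $\varphi\mapsto(\varphi_{|\Omega_i})_{i\in I}$, $$Z^1(\mathcal{M},\mathcal{E}^\ast)=\Big\{(\varphi_{i,j})\in\prod_{i,j\in I}\mathcal{E}^\ast(\Omega_{i,j}) : \varphi_{i,j}+\varphi_{j,k}+\varphi_{k,i}=0 \text{ on } \Omega_{i,j,k}\text{ for all } i,j,k\in I\Big\},$$ and $\delta((\varphi_i)_{i})=\big((\varphi_j-\varphi_i)_{|\Omega_{i,j}}\big)_{i,j}$.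
   Context: $\mathbb{N}=\{0,1,2,\dots\}$. A weight sequence is a sequence $(M_p)_{p\in\mathbb{N}}$ of positive reals with $M_0=1$ and $m_p:=M_p/M_{p-1}\to\infty$. Conditions: $(M.1)$ $M_p^2\le M_{p-1}M_{p+1}$ for $p\ge1$; $(M.2)'$ there are $A,H\ge1$ with $M_{p+1}\le AH^{p+1}M_p$ for all $p\in\mathbb{N}$; $(QA)$ $\sum_{p\ge1}1/m_p=\infty$. The relation $N_p\subset M_p$ means that there are $C,h>0$ with $N_p\le Ch^pM_p$ for all $p$; $N_p\prec M_p$ means that for every $h>0$ there is $C>0$ with $N_p\le Ch^pM_p$ for all $p$. Put $M_\alpha=M_{|\alpha|}$ for $\alpha\in\mathbb{N}^d$. For $\Omega\subseteq\mathbb{R}^d$ open, $\mathcal{E}^{(M_p)}(\Omega)$ (resp. $\mathcal{E}^{\{M_p\}}(\Omega)$) is the space of all $\varphi\in C^\infty(\Omega)$ such that for every compact $K\subset\Omega$ and every $h>0$ (resp. for every compact $K\subset\Omega$ there is some $h>0$ such that) $\sup_{\alpha\in\mathbb{N}^d}\sup_{x\in K}|\varphi^{(\alpha)}(x)|/(h^{|\alpha|}M_\alpha)<\infty$. $\mathcal{E}^\ast$ also denotes the sheaf $\Omega\mapsto\mathcal{E}^\ast(\Omega)$ on $\mathbb{R}^d$. $H^1(\mathcal{M},\mathcal{E}^\ast)$ is the first Čech cohomology group of the covering $\mathcal{M}$ with coefficients in $\mathcal{E}^\ast$, i.e. $Z^1(\mathcal{M},\mathcal{E}^\ast)$ modulo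 the image of $\delta$. *)

theory Defs
  imports "HOL-Analysis.Analysis" "HOL-Algebra.Product_Groups"
begin

section \<open>Weight sequences\<close>

definition quot_seq :: "(nat \<Rightarrow> real) \<Rightarrow> nat \<Rightarrow> real" where
  "quot_seq M p = M p / M (p - 1)"

text \<open>The value of \<^const>\<open>quot_seq\<close> at 0 is a junk value; it does not influence the limit below.\<close>

definition weight_sequence :: "(nat \<Rightarrow> real) \<Rightarrow> bool" where
  "weight_sequence M \<longleftrightarrow>
     (\<forall>p. 0 < M p) \<and> M 0 = 1 \<and> filterlim (quot_seq M) at_top sequentially"

definition M1 :: "(nat \<Rightarrow> real) \<Rightarrow> bool" where
  "M1 M \<longleftrightarrow> (\<forall>p\<ge>1. (M p)\<^sup>2 \<le> M (p - 1) * M (p + 1))"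

definition M2' :: "(nat \<Rightarrow> real) \<Rightarrow> bool" where
  "M2' M \<longleftrightarrow> (\<exists>A\<ge>1. \<exists>H\<ge>1. \<forall>p. M (p + 1) \<le> A * H ^ (p + 1) * M p)"

text \<open>For sequences with positive terms, divergence of the series means that its sum is infinite.\<close>

definition QA :: "(nat \<Rightarrow> real) \<Rightarrow> bool" where
  "QA M \<longleftrightarrow> \<not> summable (\<lambda>p. 1 / quot_seq M (Suc p))"

definition seq_subset :: "(nat \<Rightarrow> real) \<Rightarrow> (nat \<Rightarrow> real) \<Rightarrow> bool" where
  "seq_subset N M \<longleftrightarrow> (\<exists>C>0. \<exists>h>0. \<forall>p. N p \<le> C * h ^ p * M p)"

definition seq_prec :: "(nat \<Rightarrow> real) \<Rightarrow> (nat \<Rightarrow> real) \<Rightarrow> bool" where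
  "seq_prec N M \<longleftrightarrow> (\<forall>h>0. \<exists>C>0. \<forall>p. N p \<le> C * h ^ p * M p)"

section \<open>Smooth functions and their derivatives\<close>

definition partial_deriv ::
    "'d::finite \<Rightarrow> (real^'d \<Rightarrow> complex) \<Rightarrow> real^'d \<Rightarrow> complex" where
  "partial_deriv i f = (\<lambda>x. vector_derivative (\<lambda>t. f (x + t *\<^sub>R axis i 1)) (at 0))"

text \<open>The predicates \<open>Ck_on\<close> and \<open>smooth_on\<close> are meant for open sets; there, both they and the
  values of \<^const>\<open>partial_deriv\<close> on the set do not depend on the function outside the set.\<close>

primrec Ck_on :: "nat \<Rightarrow> (real^'d::finite) set \<Rightarrow> (real^'d \<Rightarrow> complex) \<Rightarrow> bool" where
  "Ck_on 0 \<Omega> f \<longleftrightarrow> continuous_on \<Omega> f"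
| "Ck_on (Suc k) \<Omega> f \<longleftrightarrow> f differentiable_on \<Omega> \<and> (\<forall>i. Ck_on k \<Omega> (partial_deriv i f))"

definition smooth_on :: "(real^'d::finite) set \<Rightarrow> (real^'d \<Rightarrow> complex) \<Rightarrow> bool" where
  "smooth_on \<Omega> f \<longleftrightarrow> (\<forall>k. Ck_on k \<Omega> f)"

text \<open>Multi-indices are functions \<open>'d \<Rightarrow> nat\<close>. The partial derivatives in \<open>multi_deriv\<close> are taken
  in the order of an arbitrary but fixed enumeration of the coordinates; for smooth functions
  the order is irrelevant.\<close>

definition coordinates :: "'d::finite list" where
  "coordinates = (SOME js. distinct js \<and> set js = UNIV)"

definition multi_deriv ::
    "('d::finite \<Rightarrow> nat) \<Rightarrow> (real^'d \<Rightarrow> complex) \<Rightarrow> real^'d \<Rightarrow> complex" where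
  "multi_deriv \<alpha> f = foldr (\<lambda>i. partial_deriv i ^^ \<alpha> i) coordinates f"

definition mi_abs :: "('d::finite \<Rightarrow> nat) \<Rightarrow> nat" where
  "mi_abs \<alpha> = (\<Sum>i\<in>UNIV. \<alpha> i)"

section \<open>Ultradifferentiable functions\<close>

datatype ultra_case = Beurling | Roumieu

definition ultra_bounded ::
    "(nat \<Rightarrow> real) \<Rightarrow> real \<Rightarrow> (real^'d::finite) set \<Rightarrow> (real^'d \<Rightarrow> complex) \<Rightarrow> bool" where
  "ultra_bounded M h K \<phi> \<longleftrightarrow>
     bdd_above ((\<lambda>(\<alpha>, x). norm (multi_deriv \<alpha> \<phi> x) / (h ^ mi_abs \<alpha> * M (mi_abs \<alpha>))) ` (UNIV \<times> K))"

text \<open>A function on \<open>\<Omega>\<close> is represented by the unique total function that agrees with it on \<open>\<Omega>\<close>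
  and is \<^const>\<open>undefined\<close> elsewhere, so that equality of representatives is equality on \<open>\<Omega>\<close>.\<close>

definition ultra_space ::
    "ultra_case \<Rightarrow> (nat \<Rightarrow> real) \<Rightarrow> (real^'d::finite) set \<Rightarrow> (real^'d \<Rightarrow> complex) set" where
  "ultra_space c M \<Omega> =
     {\<phi> \<in> extensional \<Omega>. smooth_on \<Omega> \<phi> \<and>
        (\<forall>K. compact K \<and> K \<subseteq> \<Omega> \<longrightarrow>
          (case c of
             Beurling \<Rightarrow> \<forall>h>0. ultra_bounded M h K \<phi>
           | Roumieu \<Rightarrow> \<exists>h>0. ultra_bounded M h K \<phi>))}"

definition ultra_group ::
    "ultra_case \<Rightarrow> (nat \<Rightarrow> real) \<Rightarrow> (real^'d::finite) set \<Rightarrow> (real^'d \<Rightarrow> complex) monoid" where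
  "ultra_group c M \<Omega> =
     \<lparr>carrier = ultra_space c M \<Omega>,
      monoid.mult = (\<lambda>\<phi> \<psi>. \<lambda>x\<in>\<Omega>. \<phi> x + \<psi> x),
      one = (\<lambda>x\<in>\<Omega>. 0)\<rparr>"

section \<open>Cech cochains of a covering\<close>

definition cochains0 ::
    "ultra_case \<Rightarrow> (nat \<Rightarrow> real) \<Rightarrow> 'i set \<Rightarrow> ('i \<Rightarrow> (real^'d::finite) set)
      \<Rightarrow> ('i \<Rightarrow> real^'d \<Rightarrow> complex) monoid" where
  "cochains0 c M I U = product_group I (\<lambda>i. ultra_group c M (U i))"

definition cochains1 ::
    "ultra_case \<Rightarrow> (nat \<Rightarrow> real) \<Rightarrow> 'i set \<Rightarrow> ('i \<Rightarrow> (real^'d::finite) set)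
      \<Rightarrow> ('i \<times> 'i \<Rightarrow> real^'d \<Rightarrow> complex) monoid" where
  "cochains1 c M I U = product_group (I \<times> I) (\<lambda>(i, j). ultra_group c M (U i \<inter> U j))"

definition cocycles1 ::
    "ultra_case \<Rightarrow> (nat \<Rightarrow> real) \<Rightarrow> 'i set \<Rightarrow> ('i \<Rightarrow> (real^'d::finite) set)
      \<Rightarrow> ('i \<times> 'i \<Rightarrow> real^'d \<Rightarrow> complex) monoid" where
  "cocycles1 c M I U = (cochains1 c M I U)
     \<lparr>carrier := {\<phi> \<in> carrier (cochains1 c M I U).
        \<forall>i\<in>I. \<forall>j\<in>I. \<forall>k\<in>I. \<forall>x \<in> U i \<inter> U j \<inter> U k. \<phi> (i, j) x + \<phi> (j, k) x + \<phi> (k, i) x = 0}\<rparr>"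

definition restr ::
    "'i set \<Rightarrow> ('i \<Rightarrow> (real^'d::finite) set) \<Rightarrow> (real^'d \<Rightarrow> complex)
      \<Rightarrow> 'i \<Rightarrow> real^'d \<Rightarrow> complex" where
  "restr I U \<phi> = (\<lambda>i\<in>I. restrict \<phi> (U i))"

definition cobound ::
    "'i set \<Rightarrow> ('i \<Rightarrow> (real^'d::finite) set) \<Rightarrow> ('i \<Rightarrow> real^'d \<Rightarrow> complex)
      \<Rightarrow> 'i \<times> 'i \<Rightarrow> real^'d \<Rightarrow> complex" where
  "cobound I U \<phi> = (\<lambda>(i, j)\<in>I \<times> I. \<lambda>x\<in>U i \<inter> U j. \<phi> j x - \<phi> i x)"

definition cohomology1 ::
    "ultra_case \<Rightarrow> (nat \<Rightarrow> real) \<Rightarrow> 'i set \<Rightarrow> ('i \<Rightarrow> (real^'d::finite) set)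
      \<Rightarrow> ('i \<times> 'i \<Rightarrow> real^'d \<Rightarrow> complex) set monoid" where
  "cohomology1 c M I U =
     cocycles1 c M I U Mod (cobound I U ` carrier (cochains0 c M I U))"

text \<open>Exactness at the middle term. The predicate \<open>exact_seq\<close> of HOL-Algebra cannot be used, as it
  requires all groups of the sequence to have the same type.\<close>

definition exact_at ::
    "'a monoid \<Rightarrow> ('a \<Rightarrow> 'b) \<Rightarrow> 'b monoid \<Rightarrow> ('b \<Rightarrow> 'c) \<Rightarrow> 'c monoid \<Rightarrow> bool" where
  "exact_at A f B g C \<longleftrightarrow>
     group_hom A B f \<and> group_hom B C g \<and> f ` carrier A = kernel B C g"

abbreviation zero_group :: "unit monoid" where
  "zero_group \<equiv> singleton_group ()"

end

theory Submission
  imports Defs "HOL-Complex_Analysis.Cauchy_Integral_Formula" "HOL-Probability.Sinc_Integral" "HOL-Real_Asymp.Real_Asymp"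
begin

text \<open>The space may be quasianalytic, so there are no compactly supported cutoffs of the class;
  entire cutoffs that are accurate up to exponentially small errors take their place.

  A partition of unity splits a cocycle as \<open>\<phi>\<^sub>i\<^sub>j = f\<^sub>j - f\<^sub>i\<close> with functions \<open>f\<^sub>i\<close> that are merely
  continuous. Integrate \<open>f\<close> over a cube against products of the kernels
  \<open>k\<^sub>m(w) = sin(m w) / (\<pi> w) exp(- m w\<^sup>2 / 2)\<close>; the result \<open>S\<^sub>m f\<close> is entire, and \<open>S\<^sub>m f\<close> tends to \<open>f\<close> inside
  the cube if \<open>f\<close> is ultradifferentiable. Up to an error \<open>exp(- c m)\<close>, the increment
  \<open>D\<^sub>m f = S\<^sub>m\<^sub>+\<^sub>1 f - S\<^sub>m f\<close> near a point depends only on \<open>f\<close> near that point; and if \<open>f\<close> is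
  ultradifferentiable there, with derivatives bounded by \<open>C h\<^sup>p M\<^sub>p\<close>, then integrating by parts gives
  \<open>\<bar>D\<^sub>m f\<bar> \<le> C' exp(L m \<rho>) ((\<kappa> h / m)\<^sup>p M\<^sub>p + exp(- c m))\<close> for all \<open>p\<close> at complex distance \<open>\<rho>\<close>. By Cauchy's
  estimates on polydiscs of radius \<open>\<rho>\<close> of order \<open>p / m\<close>, a series of entire functions with such bounds is
  ultradifferentiable.

  Let \<open>\<chi>\<^sub>n\<close> be entire cutoffs (depending on \<open>m\<close>) subordinate to a locally finite covering by cubes, the
  \<open>n\<close>-th one inside \<open>\<Omega>\<^sub>\<iota>\<^sub>(\<^sub>n\<^sub>)\<close>, and let \<open>u\<^sub>N = \<Sum>\<^sub>m\<^sub><\<^sub>N \<Sum>\<^sub>n \<chi>\<^sub>n D\<^sub>m f\<^sub>\<iota>\<^sub>(\<^sub>n\<^sub>)\<close>. Up to exponentially small errors, \<open>S\<^sub>N f\<^sub>j - u\<^sub>N\<close> is near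
  each point of \<open>\<Omega>\<^sub>j\<close> the sum of the terms \<open>\<chi>\<^sub>n D\<^sub>m (f\<^sub>j - f\<^sub>\<iota>\<^sub>(\<^sub>n\<^sub>))\<close>, where \<open>f\<^sub>j - f\<^sub>\<iota>\<^sub>(\<^sub>n\<^sub>)\<close> is ultradifferentiable, so
  it converges to an ultradifferentiable \<open>\<Phi>\<^sub>j\<close>. Since \<open>u\<^sub>N\<close> does not depend on \<open>j\<close>, \<open>\<Phi>\<^sub>j - \<Phi>\<^sub>i\<close> is the limit of
  \<open>S\<^sub>N \<phi>\<^sub>i\<^sub>j\<close>, that is, \<open>\<phi>\<^sub>i\<^sub>j\<close>.\<close>


section \<open>Entire functions of several variables\<close>

text \<open>A balance of exponents shapes the proof. The Gaussian exponent is linear in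
  \<open>m\<close>, so at a fixed distance the kernels decay like \<open>exp(- c m)\<close>, and the
  increment of \<open>exp(m (i w - w^2 / 2))\<close> in \<open>m\<close> is this exponential times a
  fixed function. At complex distance \<open>\<rho>\<close> they grow like
  \<open>exp(L m \<rho>)\<close>, but a derivative of order \<open>p\<close> needs only
  \<open>\<rho>\<close> near \<open>p / m\<close>, where this growth is geometric in
  \<open>p\<close>. There \<open>m^p exp(- c m)\<close> is a factorial up to a geometric factor, and
  so is the contribution of those \<open>m\<close> for which the radius \<open>p / m\<close> would
  be too large; the comparison of \<open>p!\<close> with \<open>M\<close> absorbs both.
  Log-convexity \<open>(M.1)\<close> controls the boundary terms of the repeated integrations by
  parts: these stop where \<open>(\<kappa> h / m)^p M p\<close> ceases to decrease. All bounds
  change \<open>h\<close> only by constant factors, so the Beurling and the Roumieu case are treated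
  together.\<close>

definition upd :: "'a^'d \<Rightarrow> 'd \<Rightarrow> 'a \<Rightarrow> 'a^'d" where
  "upd z j w = (\<chi> i. if i = j then w else z $ i)"

lemma upd_nth [simp]: "upd z j w $ i = (if i = j then w else z $ i)"
  by (simp add: upd_def)

lemma upd_same [simp]: "upd z j (z $ j) = z"
  by (simp add: upd_def vec_eq_iff)

lemma upd_upd [simp]: "upd (upd z j v) j w = upd z j w"
  by (simp add: upd_def vec_eq_iff)

lemma upd_commute: "i \<noteq> j \<Longrightarrow> upd (upd z i v) j w = upd (upd z j w) i v"
  by (auto simp: upd_def vec_eq_iff)

lemma continuous_on_upd [continuous_intros]:
  fixes f :: "'b::topological_space \<Rightarrow> 'a::real_normed_vector^'d::finite"
  assumes "continuous_on S f" "continuous_on S g"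
  shows "continuous_on S (\<lambda>x. upd (f x) j (g x))"
  unfolding upd_def
proof (intro continuous_on_vec_lambda)
  fix i show "continuous_on S (\<lambda>x. if i = j then g x else f x $ i)"
    using assms by (cases "i = j") (auto intro!: continuous_intros)
qed

text \<open>Cauchy's formula on the unit circle, written over a fixed real interval. The derivative
  thereby becomes an integral of values of \<open>g\<close>, to which the theorems on integrals with
  parameters apply.\<close>

lemma deriv_eq_circle_integral:
  assumes "g holomorphic_on UNIV"
  shows "deriv g \<zeta> = integral {0..1} (\<lambda>s. g (\<zeta> + exp (2 * of_real pi * \<i> * of_real s))
           * exp (- (2 * of_real pi * \<i> * of_real s)))"
proof -
  have "(g has_field_derivative (1 / (2 * of_real pi * \<i>) *
      contour_integral (circlepath \<zeta> 1) (\<lambda>u. g u / (u - \<zeta>)^2))) (at \<zeta>)"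
    by (rule Cauchy_derivative_integral_circlepath)
       (use assms in \<open>auto intro: holomorphic_on_imp_continuous_on holomorphic_on_subset\<close>)
  then have "deriv g \<zeta> = 1 / (2 * of_real pi * \<i>) *
      contour_integral (circlepath \<zeta> 1) (\<lambda>u. g u / (u - \<zeta>)^2)"
    by (rule DERIV_imp_deriv)
  also have "\<dots> = integral {0..1} (\<lambda>s. 1 / (2 * of_real pi * \<i>) * (g (circlepath \<zeta> 1 s) / (circlepath \<zeta> 1 s - \<zeta>)^2
      * vector_derivative (circlepath \<zeta> 1) (at s)))"
    by (subst contour_integral_integral, subst integral_mult_right[symmetric]) simp
  also have "\<dots> = integral {0..1} (\<lambda>s. g (\<zeta> + exp (2 * of_real pi * \<i> * of_real s))
           * exp (- (2 * of_real pi * \<i> * of_real s)))"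
    by (intro integral_cong, subst vector_derivative_circlepath)
       (simp add: circlepath exp_minus field_simps power2_eq_square)
  finally show ?thesis .
qed

text \<open>Leibniz's rule asks for a jointly continuous derivative. The circle integral yields it
  from joint continuity of \<open>f\<close> alone.\<close>

lemma continuous_on_deriv_param:
  fixes f :: "complex \<Rightarrow> 'b::topological_space \<Rightarrow> complex"
  assumes cont: "continuous_on (UNIV \<times> S) (\<lambda>(\<zeta>, t). f \<zeta> t)"
    and hol: "\<And>t. t \<in> S \<Longrightarrow> (\<lambda>\<zeta>. f \<zeta> t) holomorphic_on UNIV"
  shows "continuous_on (UNIV \<times> S) (\<lambda>(\<zeta>, t). deriv (\<lambda>\<zeta>. f \<zeta> t) \<zeta>)"
proof -
  define G where "G = (\<lambda>(p :: complex \<times> 'b) (s::real).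
     f (fst p + exp (2 * of_real pi * \<i> * of_real s)) (snd p) * exp (- (2 * of_real pi * \<i> * of_real s)))"
  have "continuous_on (UNIV \<times> S) (\<lambda>p. integral (cbox 0 1) (G p))"
  proof (rule integral_continuous_on_param)
    have "continuous_on ((UNIV \<times> S) \<times> cbox 0 1) (\<lambda>q. (\<lambda>(\<zeta>, t). f \<zeta> t)
       (fst (fst q) + exp (2 * of_real pi * \<i> * of_real (snd q)), snd (fst q)))"
      by (rule continuous_on_compose2[OF cont]) (auto intro!: continuous_intros)
    then show "continuous_on ((UNIV \<times> S) \<times> cbox 0 1) (\<lambda>(p, s). G p s)"
      unfolding G_def case_prod_unfold by (auto intro!: continuous_intros)
  qed
  moreover have "integral (cbox 0 1) (G p) = (\<lambda>(\<zeta>, t). deriv (\<lambda>\<zeta>. f \<zeta> t) \<zeta>) p" if "p \<in> UNIV \<times> S" for p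
    using that by (auto simp: G_def deriv_eq_circle_integral[OF hol])
  ultimately show ?thesis
    using continuous_on_eq by blast
qed

lemma holomorphic_integral_param:
  fixes f :: "complex \<Rightarrow> 'b::euclidean_space \<Rightarrow> complex"
  assumes cont: "continuous_on (UNIV \<times> cbox a b) (\<lambda>(\<zeta>, t). f \<zeta> t)"
    and hol: "\<And>t. t \<in> cbox a b \<Longrightarrow> (\<lambda>\<zeta>. f \<zeta> t) holomorphic_on UNIV"
  shows "(\<lambda>\<zeta>. integral (cbox a b) (f \<zeta>)) holomorphic_on UNIV"
proof (rule leibniz_rule_holomorphic)
  show "((\<lambda>\<zeta>. f \<zeta> t) has_field_derivative deriv (\<lambda>\<zeta>. f \<zeta> t) x) (at x within UNIV)"
    if "t \<in> cbox a b" for x t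
    using hol[OF that] by (simp add: holomorphic_derivI)
  show "f x integrable_on cbox a b" for x
  proof (rule integrable_continuous)
    have "continuous_on (cbox a b) (\<lambda>t. (\<lambda>(\<zeta>, t). f \<zeta> t) (x, t))"
      by (rule continuous_on_compose2[OF cont]) (auto intro!: continuous_intros)
    then show "continuous_on (cbox a b) (f x)"
      by simp
  qed
  show "continuous_on (UNIV \<times> cbox a b) (\<lambda>(x, t). deriv (\<lambda>\<zeta>. f \<zeta> t) x)"
    by (rule continuous_on_deriv_param[OF cont hol])
qed auto

text \<open>Continuity together with holomorphy in each variable separately. By Osgood's lemma this
  is joint holomorphy; in this form one-variable theory is enough to work with it.\<close>

definition entire :: "(complex^'d::finite \<Rightarrow> complex) \<Rightarrow> bool" where
  "entire F \<longleftrightarrow> continuous_on UNIV F \<and> (\<forall>z j. (\<lambda>\<zeta>. F (upd z j \<zeta>)) holomorphic_on UNIV)"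

definition cpd :: "'d::finite \<Rightarrow> (complex^'d \<Rightarrow> complex) \<Rightarrow> complex^'d \<Rightarrow> complex" where
  "cpd j F z = deriv (\<lambda>\<zeta>. F (upd z j \<zeta>)) (z $ j)"

lemma entire_continuous: "entire F \<Longrightarrow> continuous_on S F"
  unfolding entire_def by (meson continuous_on_subset subset_UNIV)

lemma entire_holomorphic: "entire F \<Longrightarrow> (\<lambda>\<zeta>. F (upd z j \<zeta>)) holomorphic_on S"
  unfolding entire_def by (meson holomorphic_on_subset subset_UNIV)

lemma entire_const: "entire (\<lambda>_. c)"
  by (simp add: entire_def)

lemma entire_add: "entire F \<Longrightarrow> entire G \<Longrightarrow> entire (\<lambda>z. F z + G z)"
  unfolding entire_def by (auto intro!: continuous_intros holomorphic_intros)

lemma entire_diff: "entire F \<Longrightarrow> entire G \<Longrightarrow> entire (\<lambda>z. F z - G z)"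
  unfolding entire_def by (auto intro!: continuous_intros holomorphic_intros)

lemma entire_mult: "entire F \<Longrightarrow> entire G \<Longrightarrow> entire (\<lambda>z. F z * G z)"
  unfolding entire_def by (auto intro!: continuous_intros holomorphic_intros)

lemma entire_sum: "(\<And>n. n \<in> A \<Longrightarrow> entire (F n)) \<Longrightarrow> entire (\<lambda>z. \<Sum>n\<in>A. F n z)"
  by (induction A rule: infinite_finite_induct) (auto intro: entire_const entire_add)

lemma entire_prod: "(\<And>n. n \<in> A \<Longrightarrow> entire (F n)) \<Longrightarrow> entire (\<lambda>z. \<Prod>n\<in>A. F n z)"
  by (induction A rule: infinite_finite_induct) (auto intro: entire_const entire_mult)

lemma cpd_eq: 
  assumes "entire F"
  shows "cpd j F z = integral (cbox 0 1) (\<lambda>s::real. F (upd z j (z $ j + exp (2 * of_real pi * \<i> * of_real s)))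
           * exp (- (2 * of_real pi * \<i> * of_real s)))"
  unfolding cpd_def by (simp add: deriv_eq_circle_integral entire_holomorphic assms)

text \<open>The circle integral inherits continuity and holomorphy from its integrand. In the
  direction \<open>j\<close> itself the integrand is a translate of \<open>F\<close> along a line,
  in any other direction the two updates commute.\<close>

lemma entire_cpd:
  assumes F: "entire F"
  shows "entire (cpd j F)"
  unfolding entire_def
proof safe
  define G where "G = (\<lambda>(z :: complex^'a) (s::real). F (upd z j (z $ j + exp (2 * of_real pi * \<i> * of_real s)))
           * exp (- (2 * of_real pi * \<i> * of_real s)))"
  have contG: "continuous_on (UNIV \<times> cbox 0 1) (\<lambda>(z, s). G z s)"
    unfolding G_def case_prod_unfold
    by (intro continuous_intros continuous_on_compose2[OF entire_continuous[OF F, of UNIV]]) auto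
  have eq: "cpd j F = (\<lambda>z. integral (cbox 0 1) (G z))"
    by (rule ext) (simp add: cpd_eq[OF F] G_def)
  show "continuous_on UNIV (cpd j F)"
    unfolding eq by (rule integral_continuous_on_param[OF contG])
  fix z i
  show "(\<lambda>\<zeta>. cpd j F (upd z i \<zeta>)) holomorphic_on UNIV"
    unfolding eq
  proof (rule holomorphic_integral_param)
    show "continuous_on (UNIV \<times> cbox 0 1) (\<lambda>(\<zeta>, t). G (upd z i \<zeta>) t)"
      using continuous_on_compose2[OF contG, of "UNIV \<times> cbox 0 1" "\<lambda>(\<zeta>, t). (upd z i \<zeta>, t)"]
      by (force simp: case_prod_unfold intro!: continuous_intros)
    fix t :: real
    show "(\<lambda>\<zeta>. G (upd z i \<zeta>) t) holomorphic_on UNIV"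
    proof (cases "i = j")
      case True
      have "(\<lambda>\<zeta>. F (upd z j \<zeta>)) \<circ> (\<lambda>\<zeta>. \<zeta> + exp (2 * of_real pi * \<i> * of_real t)) holomorphic_on UNIV"
        by (intro holomorphic_on_compose holomorphic_intros entire_holomorphic F)
      then show ?thesis
        using True by (auto simp: G_def o_def intro!: holomorphic_intros)
    next
      case False
      then show ?thesis
        by (simp add: G_def upd_commute[OF False])
          (intro holomorphic_intros entire_holomorphic[OF F])
    qed
  qed
qed

lemma entire_foldr_cpd: "entire F \<Longrightarrow> entire (foldr cpd js F)"
  by (induction js) (auto intro: entire_cpd)

lemma norm_cpd_le:
  assumes F: "entire F" and r: "r > 0"
    and B: "\<And>w. (\<And>i. norm (w $ i - z $ i) \<le> r) \<Longrightarrow> norm (F w) \<le> B"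
  shows "norm (cpd j F z) \<le> B / r"
proof -
  have "norm ((deriv ^^ 1) (\<lambda>\<zeta>. F (upd z j \<zeta>)) (z $ j)) \<le> fact 1 * B / r ^ 1"
  proof (rule Cauchy_inequality)
    show "continuous_on (cball (z $ j) r) (\<lambda>\<zeta>. F (upd z j \<zeta>))"
      by (intro holomorphic_on_imp_continuous_on entire_holomorphic F)
    show "norm (F (upd z j x)) \<le> B" if "norm (z $ j - x) = r" for x
      using that r by (intro B) (auto simp: norm_minus_commute)
  qed (use r in \<open>auto intro: entire_holomorphic F\<close>)
  then show ?thesis
    by (simp add: cpd_def)
qed

text \<open>Every derivative costs one Cauchy estimate of radius \<open>r\<close>, and after all of
  them each coordinate has moved by at most \<open>length js * r\<close>. Dividing a radius
  \<open>\<rho>\<close> into \<open>q\<close> equal steps gives the factor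
  \<open>(q / \<rho>)^q\<close>, a factorial up to a geometric factor, whatever the directions of
  the derivatives are.\<close>

lemma norm_foldr_cpd_le:
  assumes F: "entire F" and r: "r > 0"
    and B: "\<And>w. (\<And>i. norm (w $ i - z $ i) \<le> real (length js) * r) \<Longrightarrow> norm (F w) \<le> B"
  shows "norm (foldr cpd js F z) \<le> B / r ^ length js"
  using B
proof (induction js arbitrary: z)
  case Nil
  then show ?case by simp
next
  case (Cons j js)
  have "norm (cpd j (foldr cpd js F) z) \<le> (B / r ^ length js) / r"
  proof (rule norm_cpd_le[OF entire_foldr_cpd[OF F] r])
    fix w :: "complex^'a"
    assume w: "\<And>i. norm (w $ i - z $ i) \<le> r"
    show "norm (foldr cpd js F w) \<le> B / r ^ length js"
    proof (rule Cons.IH)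
      fix v :: "complex^'a"
      assume v: "\<And>i. norm (v $ i - w $ i) \<le> real (length js) * r"
      have "norm (v $ i - z $ i) \<le> real (length (j # js)) * r" for i
        using norm_triangle_mono[OF v[of i] w[of i]] by (simp add: algebra_simps)
      then show "norm (F v) \<le> B"
        by (rule Cons.prems)
    qed
  qed
  then show ?case
    by (simp add: field_simps)
qed

section \<open>Restriction of entire functions to real points\<close>

definition cvec :: "real^'d::finite \<Rightarrow> complex^'d" where
  "cvec x = (\<chi> i. of_real (x $ i))"

lemma cvec_nth [simp]: "cvec x $ i = of_real (x $ i)"
  by (simp add: cvec_def)

lemma continuous_on_cvec [continuous_intros]:
  "continuous_on S f \<Longrightarrow> continuous_on S (\<lambda>x. cvec (f x))"
  unfolding cvec_def by (intro continuous_intros)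

lemma cvec_add_axis: "cvec (x + t *\<^sub>R axis i 1) = upd (cvec x) i (of_real (x $ i + t))"
  by (auto simp: vec_eq_iff axis_def)

lemma partial_deriv_entire_aux:
  assumes F: "entire F"
  shows "((\<lambda>t. F (cvec (x + t *\<^sub>R axis i 1))) has_vector_derivative cpd i F (cvec (x + s *\<^sub>R axis i 1))) (at s)"
proof -
  have "((\<lambda>\<zeta>. F (upd (cvec x) i \<zeta>)) has_field_derivative cpd i F (cvec (x + s *\<^sub>R axis i 1)))
     (at (of_real (x $ i + s)))"
    using holomorphic_derivI[OF entire_holomorphic[OF F, where S = UNIV], of "of_real (x $ i + s)" "cvec x" i]
    unfolding cpd_def cvec_add_axis upd_upd by simp
  moreover have "((\<lambda>t. of_real (x $ i + t) :: complex) has_vector_derivative 1) (at s)"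
    by (auto intro!: derivative_eq_intros simp: has_vector_derivative_def scaleR_conv_of_real)
  ultimately have "((\<lambda>t. F (upd (cvec x) i (of_real (x $ i + t)))) has_vector_derivative
      1 * cpd i F (cvec (x + s *\<^sub>R axis i 1))) (at s)"
    by (rule field_vector_diff_chain_at[unfolded o_def, rotated])
  then show ?thesis
    by (simp add: cvec_add_axis)
qed


section \<open>Smooth functions and series of entire functions\<close>

text \<open>\<open>Ck_on\<close> asks for total differentiability, whereas entire functions provide
  partial derivatives. The way from \<open>x\<close> to \<open>x + v\<close> is taken one coordinate
  at a time, and on each axis-parallel segment the increment is compared with the partial derivative
  by the mean value inequality.\<close>

lemma has_derivative_continuous_partials:
  fixes f :: "real^'d::finite \<Rightarrow> 'a::real_normed_vector"
  assumes S: "open S" "x \<in> S"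
    and part: "\<And>y i. y \<in> S \<Longrightarrow> ((\<lambda>t. f (y + t *\<^sub>R axis i 1)) has_vector_derivative g i y) (at 0)"
    and cont: "\<And>i. continuous_on S (g i)"
  shows "(f has_derivative (\<lambda>v. \<Sum>i\<in>UNIV. (v $ i) *\<^sub>R g i x)) (at x)"
  unfolding has_derivative_at_alt
proof (intro conjI allI impI)
  show "bounded_linear (\<lambda>v. \<Sum>i\<in>UNIV. (v $ i) *\<^sub>R g i x)"
    by (intro bounded_linear_sum bounded_linear_scaleR_const bounded_linear_vec_nth)
  fix e :: real assume e: "e > 0"
  \<comment> \<open>Each coordinate contributes an error of \<open>3 * e'\<close>: twice
    \<open>e'\<close> for linearising along the segment at its starting point, once for replacing
    that starting point by \<open>x\<close>.\<close>
  define e' where "e' = e / (3 * real CARD('d))"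
  have e': "e' > 0" using e by (simp add: e'_def)
  have "\<forall>i. \<exists>d>0. \<forall>y\<in>S. dist y x < d \<longrightarrow> dist (g i y) (g i x) < e'"
    using cont S(2) e' unfolding continuous_on_iff by blast
  then obtain d1 where d1: "\<And>i. d1 i > 0" "\<And>i y. y \<in> S \<Longrightarrow> dist y x < d1 i \<Longrightarrow> dist (g i y) (g i x) < e'"
    by metis
  obtain d2 where d2: "d2 > 0" "ball x d2 \<subseteq> S"
    using S open_contains_ball by blast
  define d where "d = min d2 (Min (range d1))"
  have d: "d > 0" using d1(1) d2(1) by (simp add: d_def)
  have inS: "x + u \<in> S" if "norm u < d" for u
    using that d2 by (auto simp: d_def dist_norm)
  have gd: "norm (g i (x + u) - g i x) \<le> e'" if "norm u < d" for u i
  proof -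
    have "d \<le> d1 i" by (simp add: d_def min.coboundedI2)
    then show ?thesis
      using d1(2)[OF inS[OF that], of i] that by (simp add: dist_norm)
  qed
  have *: "norm (f (x + v) - f x - (\<Sum>i\<in>UNIV. (v $ i) *\<^sub>R g i x)) \<le> e * norm v" if v: "norm v < d" for v
  proof -
    define vA where "vA = (\<lambda>A. (\<chi> i. if i \<in> A then v $ i else 0) :: real^'d)"
    have claim: "norm (f (x + vA A) - f x - (\<Sum>i\<in>A. (v $ i) *\<^sub>R g i x)) \<le> (\<Sum>i\<in>A. 3 * e' * \<bar>v $ i\<bar>)"
      if "finite A" for A
      using that
    proof (induction A rule: finite_induct)
      case empty
      have "vA {} = 0" by (simp add: vA_def vec_eq_iff)
      then show ?case by simp
    next
      case (insert j A)
      have vAj: "vA (insert j A) = vA A + (v $ j) *\<^sub>R axis j 1"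
        using insert.hyps by (auto simp: vA_def vec_eq_iff axis_def)
      have small: "norm (vA A + t *\<^sub>R axis j 1) < d" if "t \<in> closed_segment 0 (v $ j)" for t
      proof -
        have "\<bar>t\<bar> \<le> \<bar>v $ j\<bar>"
          using that by (auto simp: closed_segment_eq_real_ivl split: if_splits)
        then have "norm (vA A + t *\<^sub>R axis j 1) \<le> norm v"
          using insert.hyps
          by (intro norm_le_componentwise_cart) (auto simp: vA_def axis_def)
        then show ?thesis using v by simp
      qed
      have small0: "norm (vA A) < d"
        using small[of 0] by simp
      define h where "h = (\<lambda>t. f (x + vA A + t *\<^sub>R axis j 1))"
      have "norm (h (v $ j) - h 0 - (v $ j - 0) *\<^sub>R g j (x + vA A + 0 *\<^sub>R axis j 1)) \<le> norm (v $ j - 0) * (2 * e')"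
      proof (rule vector_differentiable_bound_linearization[where S = "closed_segment 0 (v $ j)"
            and ?x0.0 = 0 and f' = "\<lambda>t. g j (x + vA A + t *\<^sub>R axis j 1)"])
        fix t assume t: "t \<in> closed_segment 0 (v $ j)"
        have yS: "x + vA A + t *\<^sub>R axis j 1 \<in> S"
          using inS[OF small[OF t]] by (simp add: add.assoc)
        have "((\<lambda>s. f ((x + vA A + t *\<^sub>R axis j 1) + s *\<^sub>R axis j 1)) \<circ> (\<lambda>s. s - t)
             has_vector_derivative (1 *\<^sub>R g j (x + vA A + t *\<^sub>R axis j 1))) (at t)"
          by (rule vector_diff_chain_at) (use part[OF yS, of j] in \<open>auto intro!: derivative_eq_intros\<close>)
        moreover have "(\<lambda>s. f ((x + vA A + t *\<^sub>R axis j 1) + s *\<^sub>R axis j 1)) \<circ> (\<lambda>s. s - t) = h"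
          by (auto simp: h_def o_def algebra_simps)
        ultimately show "(h has_vector_derivative g j (x + vA A + t *\<^sub>R axis j 1)) (at t within closed_segment 0 (v $ j))"
          by (simp add: has_vector_derivative_at_within)
        have "norm (g j (x + vA A + t *\<^sub>R axis j 1) - g j x) \<le> e'"
          using gd[OF small[OF t]] by (simp add: add.assoc)
        moreover have "norm (g j (x + vA A) - g j x) \<le> e'"
          by (rule gd[OF small0])
        ultimately show "norm (g j (x + vA A + t *\<^sub>R axis j 1) - g j (x + vA A + 0 *\<^sub>R axis j 1)) \<le> 2 * e'"
          using norm_triangle_le_diff[of "g j (x + vA A + t *\<^sub>R axis j 1) - g j x" "g j (x + vA A) - g j x" "2 * e'"]
          by simp
      qed auto
      then have 1: "norm (f (x + vA (insert j A)) - f (x + vA A) - (v $ j) *\<^sub>R g j (x + vA A)) \<le> 2 * e' * \<bar>v $ j\<bar>"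
        by (simp add: h_def vAj add.assoc mult.commute)
      have 2: "norm ((v $ j) *\<^sub>R g j (x + vA A) - (v $ j) *\<^sub>R g j x) \<le> e' * \<bar>v $ j\<bar>"
        using mult_right_mono[OF gd[OF small0, of j], of "\<bar>v $ j\<bar>"]
        by (simp flip: scaleR_diff_right add: mult.commute)
      have "norm (f (x + vA (insert j A)) - f x - (\<Sum>i\<in>insert j A. (v $ i) *\<^sub>R g i x))
          = norm ((f (x + vA (insert j A)) - f (x + vA A) - (v $ j) *\<^sub>R g j (x + vA A))
              + ((v $ j) *\<^sub>R g j (x + vA A) - (v $ j) *\<^sub>R g j x)
              + (f (x + vA A) - f x - (\<Sum>i\<in>A. (v $ i) *\<^sub>R g i x)))"
        using insert.hyps by (simp add: algebra_simps)
      also have "\<dots> \<le> 2 * e' * \<bar>v $ j\<bar> + e' * \<bar>v $ j\<bar> + (\<Sum>i\<in>A. 3 * e' * \<bar>v $ i\<bar>)"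
        by (intro norm_triangle_le add_mono 1 2 insert.IH)
      finally show ?case
        using insert.hyps by (simp add: algebra_simps)
    qed
    have "vA UNIV = v" by (simp add: vA_def vec_eq_iff)
    then have "norm (f (x + v) - f x - (\<Sum>i\<in>UNIV. (v $ i) *\<^sub>R g i x)) \<le> (\<Sum>i\<in>UNIV. 3 * e' * \<bar>v $ i\<bar>)"
      using claim[of UNIV] by simp
    also have "\<dots> \<le> (\<Sum>i\<in>(UNIV::'d set). 3 * e' * norm v)"
      using e' by (intro sum_mono mult_left_mono component_le_norm_cart) auto
    also have "\<dots> = e * norm v"
      by (simp add: e'_def)
    finally show ?thesis .
  qed
  show "\<exists>d>0. \<forall>y. norm (y - x) < d \<longrightarrow>
      norm (f y - f x - (\<Sum>i\<in>UNIV. ((y - x) $ i) *\<^sub>R g i x)) \<le> e * norm (y - x)"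
    using d *[of "y - x" for y] by (intro exI[of _ d]) auto
qed

section \<open>Smoothness on open sets\<close>

lemma partial_deriv_cong:
  assumes "open S" "x \<in> S" "\<And>y. y \<in> S \<Longrightarrow> f y = g y"
  shows "partial_deriv i f x = partial_deriv i g x"
  unfolding partial_deriv_def
proof (rule vector_derivative_cong_eq)
  have "((\<lambda>t. x + t *\<^sub>R axis i 1) \<longlongrightarrow> x + 0 *\<^sub>R axis i 1) (nhds 0)"
    by (intro tendsto_intros filterlim_ident)
  then have "eventually (\<lambda>t. x + t *\<^sub>R axis i 1 \<in> S) (nhds (0::real))"
    using assms(1,2) topological_tendstoD by fastforce
  then show "\<forall>\<^sub>F t in nhds 0. t \<in> UNIV \<longrightarrow> f (x + t *\<^sub>R axis i 1) = g (x + t *\<^sub>R axis i 1)"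
    by eventually_elim (use assms(3) in auto)
qed auto

lemma Ck_on_cong:
  assumes "open S" "\<And>y. y \<in> S \<Longrightarrow> f y = g y"
  shows "Ck_on k S f \<longleftrightarrow> Ck_on k S g"
  using assms(2)
proof (induction k arbitrary: f g)
  case 0
  then show ?case by (simp cong: continuous_on_cong)
next
  case (Suc k)
  have "f differentiable_on S \<longleftrightarrow> g differentiable_on S"
    unfolding differentiable_on_def using Suc.prems
    by (metis differentiable_transform_within zero_less_one)
  moreover have "Ck_on k S (partial_deriv i f) \<longleftrightarrow> Ck_on k S (partial_deriv i g)" for i
    by (rule Suc.IH) (rule partial_deriv_cong[OF assms(1)], use Suc.prems in auto)
  ultimately show ?case by simp
qed

lemma smooth_on_cong:
  assumes "open S" "\<And>y. y \<in> S \<Longrightarrow> f y = g y"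
  shows "smooth_on S f \<longleftrightarrow> smooth_on S g"
  unfolding smooth_on_def using Ck_on_cong[OF assms] by simp

text \<open>Smoothness as a greatest fixed point: a class of differentiable functions that is closed
  under partial derivatives, up to equality on \<open>S\<close>, consists of smooth functions. This
  replaces inductions on the order for series, for local properties and for linear
  combinations.\<close>

lemma smooth_on_coinduct:
  assumes S: "open S" and P: "P f"
    and step: "\<And>f. P f \<Longrightarrow> f differentiable_on S \<and> (\<forall>i. \<exists>g. P g \<and> (\<forall>x\<in>S. partial_deriv i f x = g x))"
  shows "smooth_on S f"
  unfolding smooth_on_def
proof
  fix k show "Ck_on k S f"
    using P
  proof (induction k arbitrary: f)
    case 0
    then show ?case using step[OF 0] by (auto intro: differentiable_imp_continuous_on)
  next
    case (Suc k)
    have "Ck_on k S (partial_deriv i f)" for i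
    proof -
      obtain g where g: "P g" "\<forall>x\<in>S. partial_deriv i f x = g x"
        using step[OF Suc.prems] by blast
      then show ?thesis
        using Suc.IH[OF g(1)] Ck_on_cong[OF S, of "partial_deriv i f" g k] by auto
    qed
    then show ?case using step[OF Suc.prems] by auto
  qed
qed

lemma foldr_partial_deriv_cong:
  assumes "open S" "\<And>y. y \<in> S \<Longrightarrow> f y = g y" "x \<in> S"
  shows "foldr partial_deriv js f x = foldr partial_deriv js g x"
  using assms(3)
proof (induction js arbitrary: x)
  case Nil
  then show ?case using assms by simp
next
  case (Cons j js)
  then show ?case
    using partial_deriv_cong[OF assms(1) Cons.prems, of "foldr partial_deriv js f"] by simp
qed

lemma smooth_on_partial_deriv: "smooth_on S f \<Longrightarrow> smooth_on S (partial_deriv i f)"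
  unfolding smooth_on_def using Ck_on.simps(2) by blast

lemma smooth_on_foldr: "smooth_on S f \<Longrightarrow> smooth_on S (foldr partial_deriv js f)"
  by (induction js) (auto intro: smooth_on_partial_deriv)

lemma smooth_on_imp_differentiable: "smooth_on S f \<Longrightarrow> f differentiable_on S"
  unfolding smooth_on_def using Ck_on.simps(2) by blast

lemma smooth_on_imp_continuous: "smooth_on S f \<Longrightarrow> continuous_on S f"
  by (intro differentiable_imp_continuous_on smooth_on_imp_differentiable)

lemma has_vector_derivative_partial_deriv:
  assumes "open S" "f differentiable_on S" "x + s *\<^sub>R axis i 1 \<in> S"
  shows "((\<lambda>t. f (x + t *\<^sub>R axis i 1)) has_vector_derivative partial_deriv i f (x + s *\<^sub>R axis i 1)) (at s)"
proof -
  let ?y = "x + s *\<^sub>R axis i 1"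
  have "f differentiable (at ?y)"
    using assms differentiable_on_eq_differentiable_at by blast
  then obtain f' where f': "(f has_derivative f') (at ?y)"
    using differentiable_def by blast
  have chain: "((\<lambda>t. f (u + t *\<^sub>R axis i 1)) has_vector_derivative f' (axis i 1)) (at r)"
    if "u + r *\<^sub>R axis i 1 = ?y" for u :: "real^'a" and r
  proof -
    have f'': "(f has_derivative f') (at (u + r *\<^sub>R axis i 1))"
      using f' that by simp
    have "((\<lambda>t. f (u + t *\<^sub>R axis i 1)) has_derivative (\<lambda>h. f' (h *\<^sub>R axis i 1))) (at r)"
      by (rule has_derivative_compose[where f = "\<lambda>t. u + t *\<^sub>R axis i 1" and g = f, OF _ f''])
         (auto intro!: derivative_eq_intros)
    moreover have "(\<lambda>h. f' (h *\<^sub>R axis i 1)) = (\<lambda>h. h *\<^sub>R f' (axis i 1))"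
      using f' by (simp add: has_derivative_def linear_simps)
    ultimately show ?thesis by (simp add: has_vector_derivative_def)
  qed
  have "partial_deriv i f ?y = f' (axis i 1)"
    unfolding partial_deriv_def using chain[of ?y 0] by (auto intro: vector_derivative_at)
  then show ?thesis using chain[of x s] by simp
qed

lemma partial_deriv_eqI:
  assumes "((\<lambda>t. f (x + t *\<^sub>R axis i 1)) has_vector_derivative D) (at 0)"
  shows "partial_deriv i f x = D"
  unfolding partial_deriv_def by (rule vector_derivative_at[OF assms])

lemma has_derivative_entire_cvec:
  assumes "entire F"
  shows "((\<lambda>x. F (cvec x)) has_derivative (\<lambda>v. \<Sum>i\<in>UNIV. (v $ i) *\<^sub>R cpd i F (cvec x))) (at x)"
proof (rule has_derivative_continuous_partials[where S = UNIV])
  show "((\<lambda>t. F (cvec (y + t *\<^sub>R axis i 1))) has_vector_derivative cpd i F (cvec y)) (at 0)" for y i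
    using partial_deriv_entire_aux[OF assms, of y i 0] by simp
  show "continuous_on UNIV (\<lambda>x. cpd i F (cvec x))" for i
    by (intro continuous_on_compose2[OF entire_continuous[OF entire_cpd[OF assms], of UNIV]] continuous_intros) auto
qed auto

section \<open>Termwise differentiation of dominated series\<close>

definition series_ok :: "(real^'d::finite) set \<Rightarrow> (nat \<Rightarrow> complex^'d \<Rightarrow> complex) \<Rightarrow> bool" where
  "series_ok S w \<longleftrightarrow> (\<forall>n. entire (w n)) \<and>
     (\<forall>js. \<exists>b. summable b \<and> (\<forall>n. \<forall>x\<in>S. norm (foldr cpd js (w n) (cvec x)) \<le> b n))"

lemma series_ok_entire: "series_ok S w \<Longrightarrow> entire (w n)"
  unfolding series_ok_def by blast

lemma series_ok_cpd:
  assumes "series_ok S w"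
  shows "series_ok S (\<lambda>n. cpd j (w n))"
  unfolding series_ok_def
proof (intro conjI allI)
  show "entire (cpd j (w n))" for n
    by (rule entire_cpd[OF series_ok_entire[OF assms]])
  fix js
  obtain b where "summable b" "\<forall>n. \<forall>x\<in>S. norm (foldr cpd (js @ [j]) (w n) (cvec x)) \<le> b n"
    using assms unfolding series_ok_def by blast
  then show "\<exists>b. summable b \<and> (\<forall>n. \<forall>x\<in>S. norm (foldr cpd js (cpd j (w n)) (cvec x)) \<le> b n)"
    by auto
qed

lemma series_ok_foldr: "series_ok S w \<Longrightarrow> series_ok S (\<lambda>n. foldr cpd js (w n))"
proof (induction js)
  case (Cons j js)
  then show ?case using series_ok_cpd[of S "\<lambda>n. foldr cpd js (w n)" j] by simp
qed simp

lemma series_ok_uniform_limit: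
  assumes "series_ok S w"
  shows "uniform_limit S (\<lambda>n x. \<Sum>k<n. w k (cvec x)) (\<lambda>x. \<Sum>k. w k (cvec x)) sequentially"
proof -
  obtain b where "summable b" "\<forall>n. \<forall>x\<in>S. norm (foldr cpd [] (w n) (cvec x)) \<le> b n"
    using assms unfolding series_ok_def by blast
  then show ?thesis
    by (intro Weierstrass_m_test[where M = b]) auto
qed

lemma series_ok_summable:
  assumes "series_ok S w" "x \<in> S"
  shows "summable (\<lambda>k. w k (cvec x))"
proof -
  obtain b where b: "summable b" and le: "\<forall>n. \<forall>x\<in>S. norm (foldr cpd [] (w n) (cvec x)) \<le> b n"
    using assms unfolding series_ok_def by blast
  have "norm (w n (cvec x)) \<le> b n" for n
    using bspec[OF spec[OF le] assms(2)] by (simp only: foldr.simps id_apply)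
  then show ?thesis
    by (rule summable_comparison_test'[OF b])
qed

text \<open>As there are finitely many coordinates, uniform convergence of the series of each
  partial derivative gives uniform convergence of the total derivatives as linear maps. Convexity of
  \<open>S\<close> is what the theorem on differentiating series needs to carry this over to the
  functions.\<close>

lemma series_ok_has_derivative:
  assumes ok: "series_ok S w" and S: "open S" "convex S" and x: "x \<in> S"
  shows "((\<lambda>x. \<Sum>n. w n (cvec x)) has_derivative
          (\<lambda>v. \<Sum>i\<in>UNIV. (v $ i) *\<^sub>R (\<Sum>n. cpd i (w n) (cvec x)))) (at x)"
proof -
  define f' where "f' = (\<lambda>n x (v :: real^'a). \<Sum>i\<in>UNIV. (v $ i) *\<^sub>R cpd i (w n) (cvec x))"
  define g' where "g' = (\<lambda>x (v :: real^'a). \<Sum>i\<in>UNIV. (v $ i) *\<^sub>R (\<Sum>n. cpd i (w n) (cvec x)))"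
  have "\<exists>g. \<forall>x\<in>S. (\<lambda>n. w n (cvec x)) sums (g x) \<and> (g has_derivative g' x) (at x within S)"
  proof (rule has_derivative_series[OF S(2) _ _ x])
    show "((\<lambda>x. w n (cvec x)) has_derivative f' n x) (at x within S)" for n x
      unfolding f'_def
      by (rule has_derivative_at_withinI[OF has_derivative_entire_cvec[OF series_ok_entire[OF ok]]])
    show "(\<lambda>n. w n (cvec x)) sums (\<Sum>n. w n (cvec x))"
      by (rule summable_sums[OF series_ok_summable[OF ok x]])
    fix e :: real assume e: "e > 0"
    define e' where "e' = e / real CARD('a)"
    have e': "e' > 0" using e by (simp add: e'_def)
    have ev: "\<forall>\<^sub>F n in sequentially. \<forall>x\<in>S. dist (\<Sum>k<n. cpd i (w k) (cvec x)) (\<Sum>k. cpd i (w k) (cvec x)) < e'" for i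
      using series_ok_uniform_limit[OF series_ok_cpd[OF ok, of i]] e' unfolding uniform_limit_iff by simp
    have "\<forall>\<^sub>F n in sequentially. \<forall>i. \<forall>x\<in>S. dist (\<Sum>k<n. cpd i (w k) (cvec x)) (\<Sum>k. cpd i (w k) (cvec x)) < e'"
      by (rule eventually_all_finite) (rule ev)
    then show "\<forall>\<^sub>F n in sequentially. \<forall>x\<in>S. \<forall>h. norm ((\<Sum>i<n. f' i x h) - g' x h) \<le> e * norm h"
    proof eventually_elim
      case (elim n)
      show ?case
      proof (intro ballI allI)
        fix x h assume xS: "x \<in> S"
        have eq: "(\<Sum>k<n. f' k x h) - g' x h = (\<Sum>i\<in>UNIV. (h $ i) *\<^sub>R ((\<Sum>k<n. cpd i (w k) (cvec x)) - (\<Sum>k. cpd i (w k) (cvec x))))"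
          unfolding f'_def g'_def scaleR_diff_right sum_subtractf scaleR_sum_right
          by (subst sum.swap) (rule refl)
        have "norm (\<Sum>i\<in>UNIV. (h $ i) *\<^sub>R ((\<Sum>k<n. cpd i (w k) (cvec x)) - (\<Sum>k. cpd i (w k) (cvec x)))) \<le> (\<Sum>i\<in>(UNIV::'a set). norm h * e')"
        proof (intro order_trans[OF norm_sum] sum_mono)
          fix i
          have "norm ((\<Sum>k<n. cpd i (w k) (cvec x)) - (\<Sum>k. cpd i (w k) (cvec x))) \<le> e'"
            using elim xS by (simp add: dist_norm less_imp_le)
          then show "norm ((h $ i) *\<^sub>R ((\<Sum>k<n. cpd i (w k) (cvec x)) - (\<Sum>k. cpd i (w k) (cvec x)))) \<le> norm h * e'"
            unfolding norm_scaleR by (intro mult_mono component_le_norm_cart) auto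
        qed
        also have "\<dots> = e * norm h" by (simp add: e'_def)
        finally show "norm ((\<Sum>k<n. f' k x h) - g' x h) \<le> e * norm h" unfolding eq .
      qed
    qed
  qed
  then obtain g where g0: "\<forall>x\<in>S. (\<lambda>n. w n (cvec x)) sums (g x) \<and> (g has_derivative g' x) (at x within S)" ..
  have g: "(\<lambda>n. w n (cvec x)) sums (g x)" "(g has_derivative g' x) (at x within S)" if "x \<in> S" for x
    using bspec[OF g0 that] by (rule conjunct1, rule conjunct2)
  have "(g has_derivative g' x) (at x)"
    using g(2)[OF x] at_within_open[OF x S(1)] by simp
  then have "((\<lambda>x. \<Sum>n. w n (cvec x)) has_derivative g' x) (at x)"
    by (rule has_derivative_transform_within_open[OF _ S(1) x]) (rule sums_unique[OF g(1)])
  then show ?thesis unfolding g'_def .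
qed

lemma series_ok_partial_deriv:
  assumes ok: "series_ok S w" and S: "open S" "convex S" and x: "x \<in> S"
  shows "partial_deriv i (\<lambda>x. \<Sum>n. w n (cvec x)) x = (\<Sum>n. cpd i (w n) (cvec x))"
proof (rule partial_deriv_eqI)
  have "((\<lambda>t::real. x + t *\<^sub>R axis i 1) has_derivative (\<lambda>t. t *\<^sub>R axis i 1)) (at 0)"
    by (auto intro!: derivative_eq_intros)
  moreover have "((\<lambda>x. \<Sum>n. w n (cvec x)) has_derivative
          (\<lambda>v. \<Sum>i\<in>UNIV. (v $ i) *\<^sub>R (\<Sum>n. cpd i (w n) (cvec x)))) (at (x + 0 *\<^sub>R axis i 1))"
    using series_ok_has_derivative[OF assms] by simp
  ultimately have "((\<lambda>t. \<Sum>n. w n (cvec (x + t *\<^sub>R axis i 1))) has_derivative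
     (\<lambda>t. \<Sum>k\<in>UNIV. ((t *\<^sub>R axis i 1) $ k) *\<^sub>R (\<Sum>n. cpd k (w n) (cvec x)))) (at 0)"
    by (rule has_derivative_compose)
  moreover have "(\<Sum>k\<in>UNIV. ((t *\<^sub>R axis i 1 :: real^'a) $ k) *\<^sub>R (\<Sum>n. cpd k (w n) (cvec x)))
      = t *\<^sub>R (\<Sum>n. cpd i (w n) (cvec x))" for t
  proof -
    have "((t *\<^sub>R axis i 1 :: real^'a) $ k) *\<^sub>R (\<Sum>n. cpd k (w n) (cvec x))
       = (if k = i then t *\<^sub>R (\<Sum>n. cpd i (w n) (cvec x)) else 0)" for k
      by (auto simp: axis_def)
    then show ?thesis by simp
  qed
  ultimately show "((\<lambda>t. \<Sum>n. w n (cvec (x + t *\<^sub>R axis i 1))) has_vector_derivative (\<Sum>n. cpd i (w n) (cvec x))) (at 0)"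
    by (simp add: has_vector_derivative_def)
qed

lemma series_ok_foldr_partial_deriv:
  assumes ok: "series_ok S w" and S: "open S" "convex S" and x: "x \<in> S"
  shows "foldr partial_deriv js (\<lambda>x. \<Sum>n. w n (cvec x)) x = (\<Sum>n. foldr cpd js (w n) (cvec x))"
  using x
proof (induction js arbitrary: x)
  case Nil
  then show ?case by simp
next
  case (Cons j js)
  have "partial_deriv j (foldr partial_deriv js (\<lambda>x. \<Sum>n. w n (cvec x))) x
      = partial_deriv j (\<lambda>x. \<Sum>n. foldr cpd js (w n) (cvec x)) x"
    by (rule partial_deriv_cong[OF S(1) Cons.prems Cons.IH])
  also have "\<dots> = (\<Sum>n. cpd j (foldr cpd js (w n)) (cvec x))"
    by (rule series_ok_partial_deriv[OF series_ok_foldr[OF ok] S Cons.prems])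
  finally show ?case by simp
qed

lemma series_ok_smooth:
  assumes ok: "series_ok S w" and S: "open S" "convex S"
  shows "smooth_on S (\<lambda>x. \<Sum>n. w n (cvec x))"
proof (rule smooth_on_coinduct[OF S(1), where P = "\<lambda>f. \<exists>w. series_ok S w \<and> f = (\<lambda>x. \<Sum>n. w n (cvec x))"])
  show "\<exists>v. series_ok S v \<and> (\<lambda>x. \<Sum>n. w n (cvec x)) = (\<lambda>x. \<Sum>n. v n (cvec x))"
    using ok by blast
  fix f :: "real^'a \<Rightarrow> complex" assume "\<exists>v. series_ok S v \<and> f = (\<lambda>x. \<Sum>n. v n (cvec x))"
  then obtain v where v: "series_ok S v" "f = (\<lambda>x. \<Sum>n. v n (cvec x))" by blast
  have "f differentiable_on S"
    unfolding v(2) differentiable_on_def differentiable_def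
    using series_ok_has_derivative[OF v(1) S] has_derivative_at_withinI by blast
  moreover have "\<exists>g. (\<exists>w. series_ok S w \<and> g = (\<lambda>x. \<Sum>n. w n (cvec x))) \<and> (\<forall>x\<in>S. partial_deriv i f x = g x)" for i
    using series_ok_cpd[OF v(1), of i] series_ok_partial_deriv[OF v(1) S, of _ i] v(2)
    by (intro exI[of _ "\<lambda>x. \<Sum>n. cpd i (v n) (cvec x)"]) auto
  ultimately show "f differentiable_on S \<and> (\<forall>i. \<exists>g. (\<exists>w. series_ok S w \<and> g = (\<lambda>x. \<Sum>n. w n (cvec x)))
      \<and> (\<forall>x\<in>S. partial_deriv i f x = g x))" by blast
qed


section \<open>Derivative bounds for series of entire functions\<close>

text \<open>The Beurling and the Roumieu condition differ only in the quantifier over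
  \<open>h\<close>. An argument that turns a bound with \<open>h\<close> into one with a fixed
  multiple of \<open>h\<close> serves both.\<close>

definition for_h :: "ultra_case \<Rightarrow> (real \<Rightarrow> bool) \<Rightarrow> bool" where
  "for_h c P = (case c of Beurling \<Rightarrow> \<forall>h>0. P h | Roumieu \<Rightarrow> \<exists>h>0. P h)"

lemma for_h_scale:
  assumes "for_h c P" "\<kappa> > 0" "\<And>h. h > 0 \<Longrightarrow> P h \<Longrightarrow> Q (\<kappa> * h)"
  shows "for_h c Q"
proof (cases c)
  case Beurling
  have "Q h" if "h > 0" for h
    using assms(3)[of "h / \<kappa>"] assms(1,2) that Beurling by (simp add: for_h_def)
  then show ?thesis using Beurling by (simp add: for_h_def)
next
  case Roumieu
  then obtain h where "h > 0" "P h" using assms(1) by (auto simp: for_h_def)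
  then show ?thesis using Roumieu assms(2,3) by (auto simp: for_h_def intro!: exI[of _ "\<kappa> * h"])
qed

lemma for_h_mono:
  assumes "for_h c P" "\<And>h. h > 0 \<Longrightarrow> P h \<Longrightarrow> Q h"
  shows "for_h c Q"
  using for_h_scale[OF assms(1), of 1 Q] assms(2) by simp

text \<open>In the Roumieu case the two witnesses may differ, so monotonicity in \<open>h\<close> is
  needed to pass to their maximum.\<close>

lemma for_h_conj:
  assumes "for_h c P" "for_h c Q"
    and "\<And>h h'. 0 < h \<Longrightarrow> h \<le> h' \<Longrightarrow> P h \<Longrightarrow> P h'"
    and "\<And>h h'. 0 < h \<Longrightarrow> h \<le> h' \<Longrightarrow> Q h \<Longrightarrow> Q h'"
  shows "for_h c (\<lambda>h. P h \<and> Q h)"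
proof (cases c)
  case Beurling
  then show ?thesis using assms by (simp add: for_h_def)
next
  case Roumieu
  then obtain h1 h2 where "h1 > 0" "P h1" "h2 > 0" "Q h2"
    using assms(1,2) by (auto simp: for_h_def)
  then have "max h1 h2 > 0 \<and> P (max h1 h2) \<and> Q (max h1 h2)"
    using assms(3)[of h1 "max h1 h2"] assms(4)[of h2 "max h1 h2"] by auto
  then show ?thesis using Roumieu by (auto simp: for_h_def)
qed

lemma for_h_ex: "for_h c P \<Longrightarrow> \<exists>h>0. P h"
  by (cases c) (auto simp: for_h_def intro: exI[of _ 1])

text \<open>A single term of the exponential series. It is the source of all factorials: powers of
  \<open>m\<close> are traded against part of an exponential decay in \<open>m\<close>.\<close>

lemma power_le_fact_exp:
  fixes x :: real
  assumes "x \<ge> 0"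
  shows "x ^ n \<le> fact n * exp x"
proof -
  have "x ^ n / fact n \<le> (\<Sum>k. x ^ k / fact k)"
    using sum_le_suminf[of "\<lambda>k. x ^ k / fact k" "{n}"] summable_exp[of x] assms
    by (simp add: field_simps)
  also have "\<dots> = exp x"
    by (simp add: exp_def field_simps)
  finally show ?thesis by (simp add: field_simps)
qed

text \<open>For \<open>T = fact\<close> this is the hypothesis that compares \<open>p!\<close> with
  \<open>M\<close>, in both cases at once.\<close>

definition dominates :: "ultra_case \<Rightarrow> (nat \<Rightarrow> real) \<Rightarrow> (nat \<Rightarrow> real) \<Rightarrow> bool" where
  "dominates c M T \<longleftrightarrow> for_h c (\<lambda>h. \<exists>C. \<forall>q. T q \<le> C * h ^ q * M q)"

lemma dominates_mono_h:
  fixes M :: "nat \<Rightarrow> real"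
  assumes M: "\<And>p. 0 < M p" and h: "0 < h" "h \<le> h'"
    and ex: "\<exists>C. \<forall>q. T q \<le> C * h ^ q * M q"
  shows "\<exists>C. \<forall>q. T q \<le> C * h' ^ q * M q"
proof -
  obtain C where C: "\<And>q. T q \<le> C * h ^ q * M q" using ex by blast
  have "T q \<le> max C 0 * h' ^ q * M q" for q
  proof -
    have "C * h ^ q * M q \<le> max C 0 * h' ^ q * M q"
      using M[of q] h by (intro mult_mono power_mono) (auto intro: less_imp_le)
    then show ?thesis using C[of q] by linarith
  qed
  then show ?thesis by blast
qed

text \<open>Iteration of \<open>(M.2)'\<close>: each of the \<open>k\<close> steps costs a constant
  and a factor geometric in \<open>q\<close>. It allows bounds of order \<open>q + k\<close> to be
  used for derivatives of order \<open>q\<close>, which gains \<open>k\<close> powers of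
  \<open>1 / m\<close>.\<close>

lemma shift_bound:
  fixes M :: "nat \<Rightarrow> real"
  assumes M: "\<And>p. 0 < M p" and M2: "M2' M"
  shows "\<exists>A>0. \<exists>H>0. \<forall>q. M (q + k) \<le> A * H ^ q * M q"
proof (induction k)
  case 0
  show ?case by (intro exI[of _ 1] conjI allI) auto
next
  case (Suc k)
  then obtain A H where AH: "A > 0" "H > 0" "\<And>q. M (q + k) \<le> A * H ^ q * M q" by blast
  obtain A' H' where A'H': "A' \<ge> 1" "H' \<ge> 1" "\<And>p. M (p + 1) \<le> A' * H' ^ (p + 1) * M p"
    using M2 unfolding M2'_def by blast
  have "M (q + Suc k) \<le> (A' * H' ^ (k + 1) * A) * (H' * H) ^ q * M q" for q
  proof -
    have "M (q + Suc k) \<le> A' * H' ^ (q + k + 1) * M (q + k)"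
      using A'H'(3)[of "q + k"] by simp
    also have "\<dots> \<le> A' * H' ^ (q + k + 1) * (A * H ^ q * M q)"
      using A'H' by (intro mult_left_mono AH) auto
    also have "\<dots> = (A' * H' ^ (k + 1) * A) * (H' * H) ^ q * M q"
      by (simp add: power_add power_mult_distrib algebra_simps)
    finally show ?thesis .
  qed
  moreover have "A' * H' ^ (k + 1) * A > 0" "H' * H > 0" using AH A'H' by auto
  ultimately show ?case by blast
qed

definition polydisc :: "real^'d::finite \<Rightarrow> real \<Rightarrow> (complex^'d) set" where
  "polydisc x \<rho> = {z. \<forall>i. norm (z $ i - of_real (x $ i)) \<le> \<rho>}"

lemma polydisc_mono: "\<rho> \<le> \<rho>' \<Longrightarrow> polydisc x \<rho> \<subseteq> polydisc x \<rho>'"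
  unfolding polydisc_def by (blast intro: order_trans)

text \<open>\<open>C\<close> is chosen before \<open>p\<close> and \<open>\<rho>\<close>, because
  these are fixed only when the order \<open>q\<close> of a derivative and \<open>m\<close> are
  known: \<open>p\<close> as \<open>q\<close> plus a constant, \<open>\<rho>\<close> as
  \<open>q / m\<close>.\<close>

definition fine_bound ::
  "ultra_case \<Rightarrow> (nat \<Rightarrow> real) \<Rightarrow> (real^'d::finite) set \<Rightarrow> real \<Rightarrow> real \<Rightarrow> nat \<Rightarrow> real
     \<Rightarrow> (nat \<Rightarrow> complex^'d \<Rightarrow> complex) \<Rightarrow> bool" where
  "fine_bound c M S \<delta> L K \<gamma> w \<longleftrightarrow> for_h c (\<lambda>h. \<exists>C\<ge>0. \<forall>p m \<rho> x z. 1 \<le> m \<longrightarrow> 0 \<le> \<rho> \<longrightarrow> \<rho> \<le> \<delta> \<longrightarrow> x \<in> S \<longrightarrow>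
     z \<in> polydisc x \<rho> \<longrightarrow>
     norm (w m z) \<le> C * real m ^ K * exp (L * real m * \<rho>) * ((h / real m) ^ p * M p + exp (- \<gamma> * real m)))"

text \<open>For a derivative of order \<open>q\<close> and large \<open>m\<close>, Cauchy's estimate
  with steps \<open>1 / m\<close> reaches to distance \<open>q / m\<close>, where
  \<open>exp(L m \<rho>)\<close> is only \<open>exp(L q)\<close>. With \<open>p = q + K + 2\<close>
  the powers of \<open>m\<close> in the main term collapse to \<open>1 / m^2\<close>, while
  \<open>m^(K + q) exp(- \<gamma> m)\<close> is bounded by a factorial times a summable sequence.
  For the remaining \<open>m\<close>, fewer than a multiple of \<open>q + k\<close> plus one, the
  polydisc of radius \<open>\<delta>\<close> and the crude bound again give a factorial. The
  factorials are absorbed by \<open>fac\<close>.\<close>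

lemma fine_bound_summable:
  fixes w :: "nat \<Rightarrow> complex^'d::finite \<Rightarrow> complex" and M :: "nat \<Rightarrow> real"
  assumes ent: "\<And>m. entire (w m)"
    and M: "\<And>p. 0 < M p" and M2: "M2' M" and fac: "dominates c M fact"
    and par: "0 < \<delta>" "0 \<le> L" "0 < \<gamma>" "0 \<le> C0"
    and crude: "\<And>m x z. x \<in> S \<Longrightarrow> z \<in> polydisc x \<delta> \<Longrightarrow> norm (w m z) \<le> C0 * exp (L * real m)"
    and fine: "fine_bound c M S \<delta> L K \<gamma> w"
  shows "for_h c (\<lambda>h. \<exists>C. \<forall>js. \<exists>b. summable b \<and> suminf b \<le> C * h ^ length js * M (length js) \<and>
           (\<forall>n. \<forall>x\<in>S. norm (foldr cpd js (w n) (cvec x)) \<le> b n))"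
proof -
  define Z where "Z = (\<Sum>m. 1 / (real m)\<^sup>2)"
  have sumZ: "summable (\<lambda>m. 1 / (real m)\<^sup>2)"
    using inverse_power_summable[of 2, where 'a = real] by (simp add: inverse_eq_divide)
  define G where "G = (\<Sum>m. exp (- \<gamma> / 2) ^ m)"
  have sumG: "summable (\<lambda>m. exp (- \<gamma> / 2) ^ m)"
    using par by (intro summable_geometric) auto
  \<comment> \<open>\<open>K\<close> powers of \<open>1 / m\<close> cancel the polynomial factor of
    the fine bound, two more make the sum over \<open>m\<close> converge.\<close>
  define k where "k = K + 2"
  \<comment> \<open>\<open>T3\<close> bounds a term with small \<open>m\<close>; \<open>T1\<close>
    and \<open>T2\<close> are the coefficients of \<open>1 / m^2\<close> and of the geometric
    sequence in the bound for large \<open>m\<close>; \<open>Tot\<close> adds up the three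
    sums.\<close>
  define T3 where "T3 = (\<lambda>q::nat. C0 * exp (L * (real (q + k) / \<delta>)) * (exp (real q + 1) * fact q) / \<delta> ^ q)"
  define T1 where "T1 = (\<lambda>h C (q::nat). C * exp (L * real q) * h ^ (q + k) * M (q + k))"
  define T2 where "T2 = (\<lambda>C (q::nat). C * exp (L * real q) * (fact (K + q) * (2 / \<gamma>) ^ (K + q)))"
  define Tot where "Tot = (\<lambda>h C q. (real (q + k) / \<delta> + 1) * T3 q + Z * T1 h C q + G * T2 C q)"
  have Zp: "Z \<ge> 0" "G \<ge> 0"
    unfolding Z_def G_def using sumZ sumG by (auto intro!: suminf_nonneg)
  have key: "\<exists>b. summable b \<and> suminf b \<le> Tot h C (length js) \<and> (\<forall>n. \<forall>x\<in>S. norm (foldr cpd js (w n) (cvec x)) \<le> b n)"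
    if h: "h > 0" and C: "C \<ge> 0"
      and B: "\<And>p m \<rho> x z. 1 \<le> m \<Longrightarrow> 0 \<le> \<rho> \<Longrightarrow> \<rho> \<le> \<delta> \<Longrightarrow> x \<in> S \<Longrightarrow> z \<in> polydisc x \<rho> \<Longrightarrow>
     norm (w m z) \<le> C * real m ^ K * exp (L * real m * \<rho>) * ((h / real m) ^ p * M p + exp (- \<gamma> * real m))"
    for h C js
  proof -
    let ?q = "length js"
    \<comment> \<open>These are the \<open>m\<close> for which the radius \<open>q / m\<close> might
      exceed \<open>\<delta>\<close>. Since \<open>k\<close> is positive, \<open>m = 0\<close>
      belongs to them.\<close>
    define J where "J = {m. real m < real (?q + k) / \<delta>}"
    have finJ: "finite J"
      unfolding J_def by (rule finite_subset[of _ "{..nat \<lceil>real (?q + k) / \<delta>\<rceil>}"]) (auto, linarith)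
    have "real (card J) \<le> real (?q + k) / \<delta> + 1"
    proof -
      have "J \<subseteq> {..<nat \<lceil>real (?q + k) / \<delta>\<rceil>}"
        unfolding J_def by (auto simp: nat_less_iff zless_nat_eq_int_zless less_ceiling_iff)
      then have "card J \<le> nat \<lceil>real (?q + k) / \<delta>\<rceil>"
        using card_mono[of "{..<nat \<lceil>real (?q + k) / \<delta>\<rceil>}" J] by simp
      moreover have "real (nat \<lceil>real (?q + k) / \<delta>\<rceil>) \<le> real (?q + k) / \<delta> + 1"
        using par by (simp add: of_nat_nat)
      ultimately show ?thesis by linarith
    qed
    note cardJ = this
    have T3p: "T3 ?q \<ge> 0" and T1p: "T1 h C ?q \<ge> 0" and T2p: "T2 C ?q \<ge> 0"
      using par h C less_imp_le[OF M] unfolding T3_def T1_def T2_def by auto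
    define b where "b = (\<lambda>m. (if m \<in> J then T3 ?q else 0) + T1 h C ?q * (1 / (real m)\<^sup>2) + T2 C ?q * exp (- \<gamma> / 2) ^ m)"
    have sb: "b sums (real (card J) * T3 ?q + T1 h C ?q * Z + T2 C ?q * G)"
      unfolding b_def
    proof (intro sums_add sums_mult)
      show "(\<lambda>m. if m \<in> J then T3 ?q else 0) sums (real (card J) * T3 ?q)"
        using sums_If_finite_set[OF finJ, of "\<lambda>_. T3 ?q"] by simp
      show "(\<lambda>m. 1 / (real m)\<^sup>2) sums Z" unfolding Z_def by (rule summable_sums[OF sumZ])
      show "(\<lambda>m. exp (- \<gamma> / 2) ^ m) sums G" unfolding G_def by (rule summable_sums[OF sumG])
    qed
    have "suminf b \<le> Tot h C ?q"
      unfolding sums_unique[OF sb, symmetric] Tot_def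
      using mult_right_mono[OF cardJ T3p] by (simp add: mult.commute)
    moreover have "norm (foldr cpd js (w m) (cvec x)) \<le> b m" if x: "x \<in> S" for m x
    proof (cases "m \<in> J")
      case True
      \<comment> \<open>Steps of length \<open>\<delta> / (q + 1)\<close> stay within
        \<open>\<delta>\<close> altogether and make sense for \<open>q = 0\<close> too.\<close>
      have "norm (foldr cpd js (w m) (cvec x)) \<le> (C0 * exp (L * real m)) / (\<delta> / (real ?q + 1)) ^ ?q"
      proof (rule norm_foldr_cpd_le[OF ent])
        fix z :: "complex^'d" assume z: "\<And>i. norm (z $ i - cvec x $ i) \<le> real ?q * (\<delta> / (real ?q + 1))"
        have le: "real ?q * (\<delta> / (real ?q + 1)) \<le> \<delta>" using par by (simp add: field_simps)
        have "z \<in> polydisc x \<delta>"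
          using order_trans[OF z le] by (simp add: polydisc_def)
        then show "norm (w m z) \<le> C0 * exp (L * real m)"
          by (rule crude[OF x])
      qed (use par in auto)
      also have "\<dots> = C0 * exp (L * real m) * (real ?q + 1) ^ ?q / \<delta> ^ ?q"
        by (simp add: power_divide)
      also have "\<dots> \<le> T3 ?q"
        unfolding T3_def
      proof (intro divide_right_mono mult_mono)
        show "exp (L * real m) \<le> exp (L * (real (?q + k) / \<delta>))"
          unfolding exp_le_cancel_iff
          by (rule mult_left_mono) (use True par in \<open>auto simp: J_def\<close>)
        show "(real ?q + 1) ^ ?q \<le> exp (real ?q + 1) * fact ?q"
          using power_le_fact_exp[of "real ?q + 1" ?q] by (simp add: mult.commute)
      qed (use par in auto)
      also have "\<dots> \<le> b m"
        unfolding b_def using True T1p T2p by simp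
      finally show ?thesis .
    next
      case False
      then have mge: "real m \<ge> real (?q + k) / \<delta>" by (simp add: J_def)
      have "real (?q + k) > 0" by (simp add: k_def)
      then have "real (?q + k) / \<delta> > 0" using par by simp
      then have mpos: "real m > 0" using mge by linarith
      then have m1: "1 \<le> m" by simp
      have rho: "real ?q / real m \<le> \<delta>"
      proof -
        have "real ?q / \<delta> \<le> real m" using mge par by (simp add: add_divide_distrib) (smt (verit) divide_nonneg_pos of_nat_0_le_iff)
        then show ?thesis using par mpos by (simp add: field_simps)
      qed
      let ?B = "C * real m ^ K * exp (L * real m * (real ?q / real m)) * ((h / real m) ^ (?q + k) * M (?q + k) + exp (- \<gamma> * real m))"
      have "norm (foldr cpd js (w m) (cvec x)) \<le> ?B / (1 / real m) ^ ?q"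
      proof (rule norm_foldr_cpd_le[OF ent])
        fix z :: "complex^'d" assume z: "\<And>i. norm (z $ i - cvec x $ i) \<le> real ?q * (1 / real m)"
        show "norm (w m z) \<le> ?B"
          by (rule B[OF m1 _ rho x]) (use z in \<open>auto simp: polydisc_def\<close>)
      qed (use mpos in auto)
      also have "\<dots> = C * exp (L * real ?q) * (real m ^ (K + ?q) * ((h / real m) ^ (?q + k) * M (?q + k)))
            + C * exp (L * real ?q) * (real m ^ (K + ?q) * exp (- \<gamma> * real m))"
        using mpos by (simp add: power_add power_divide field_simps)
      also have "real m ^ (K + ?q) * ((h / real m) ^ (?q + k) * M (?q + k)) = h ^ (?q + k) * M (?q + k) * (1 / (real m)\<^sup>2)"
        using mpos by (simp add: k_def power_divide power_add field_simps power2_eq_square)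
      also have "C * exp (L * real ?q) * (real m ^ (K + ?q) * exp (- \<gamma> * real m))
          \<le> C * exp (L * real ?q) * ((fact (K + ?q) * (2 / \<gamma>) ^ (K + ?q)) * exp (- \<gamma> / 2) ^ m)"
      proof (intro mult_left_mono)
        \<comment> \<open>Half of the decay pays for the power of \<open>m\<close>, the other half
          keeps the series summable.\<close>
        have "(\<gamma> * real m / 2) ^ (K + ?q) \<le> fact (K + ?q) * exp (\<gamma> * real m / 2)"
          by (rule power_le_fact_exp) (use par in auto)
        then have "(2 / \<gamma>) ^ (K + ?q) * (\<gamma> * real m / 2) ^ (K + ?q) \<le> (2 / \<gamma>) ^ (K + ?q) * (fact (K + ?q) * exp (\<gamma> * real m / 2))"
          using par by (intro mult_left_mono) auto
        then have "real m ^ (K + ?q) \<le> (2 / \<gamma>) ^ (K + ?q) * (fact (K + ?q) * exp (\<gamma> * real m / 2))"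
          using par by (simp flip: power_mult_distrib)
        then have "real m ^ (K + ?q) * exp (- \<gamma> * real m) \<le> ((2 / \<gamma>) ^ (K + ?q) * (fact (K + ?q) * exp (\<gamma> * real m / 2))) * exp (- \<gamma> * real m)"
          by (rule mult_right_mono) auto
        also have "\<dots> = (fact (K + ?q) * (2 / \<gamma>) ^ (K + ?q)) * (exp (\<gamma> * real m / 2) * exp (- \<gamma> * real m))"
          by (simp only: mult_ac)
        also have "exp (\<gamma> * real m / 2) * exp (- \<gamma> * real m) = exp (- \<gamma> / 2) ^ m"
          by (simp add: mult_exp_exp flip: exp_of_nat_mult)
        finally show "real m ^ (K + ?q) * exp (- \<gamma> * real m) \<le> (fact (K + ?q) * (2 / \<gamma>) ^ (K + ?q)) * exp (- \<gamma> / 2) ^ m" .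
      qed (use C in auto)
      finally have "norm (foldr cpd js (w m) (cvec x)) \<le> T1 h C ?q * (1 / (real m)\<^sup>2) + T2 C ?q * exp (- \<gamma> / 2) ^ m"
        by (simp add: T1_def T2_def mult.assoc)
      then show ?thesis
        unfolding b_def using False by simp
    qed
    ultimately show ?thesis
      using sums_summable[OF sb] by blast
  qed
  obtain A H where AH: "A > 0" "H > 0" "\<And>q. M (q + k) \<le> A * H ^ q * M q"
    using shift_bound[OF M M2] by blast
  obtain A' H' where AH': "A' > 0" "H' > 0" "\<And>q. M (q + K) \<le> A' * H' ^ q * M q"
    using shift_bound[OF M M2] by blast
  \<comment> \<open>The growth rates of \<open>T1\<close>, \<open>T2\<close> and \<open>T3\<close>
    relative to \<open>h^q * M q\<close>, after the shifts of the index in \<open>M\<close> and the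
    factorials have been absorbed. Their sum is the factor by which \<open>h\<close>
    deteriorates.\<close>
  define D1 where "D1 = exp L * H"
  define D2 where "D2 = exp L * (2 / \<gamma>) * H'"
  define D3 where "D3 = exp ((L + 1) / \<delta>) * exp 1 / \<delta> * H'"
  define \<kappa> where "\<kappa> = D1 + D2 + D3"
  have Dp: "D1 > 0" "D2 > 0" "D3 > 0"
    using AH AH' par by (auto simp: D1_def D2_def D3_def)
  have \<kappa>: "\<kappa> > 0" "D1 \<le> \<kappa>" "D2 \<le> \<kappa>" "D3 \<le> \<kappa>"
    using Dp by (auto simp: \<kappa>_def)
  define P where "P = (\<lambda>h. \<exists>C\<ge>0. \<forall>p m \<rho> x z. 1 \<le> m \<longrightarrow> 0 \<le> \<rho> \<longrightarrow> \<rho> \<le> \<delta> \<longrightarrow> x \<in> S \<longrightarrow>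
     z \<in> polydisc x \<rho> \<longrightarrow>
     norm (w m z) \<le> C * real m ^ K * exp (L * real m * \<rho>) * ((h / real m) ^ p * M p + exp (- \<gamma> * real m)))"
  define Q where "Q = (\<lambda>h. \<exists>C. \<forall>q. fact q \<le> C * h ^ q * M q)"
  have "for_h c (\<lambda>h. P h \<and> Q h)"
  proof (rule for_h_conj)
    show "for_h c P" using fine unfolding fine_bound_def P_def .
    show "for_h c Q" using fac unfolding dominates_def Q_def .
    show "Q h'" if "0 < h" "h \<le> h'" "Q h" for h h'
      using dominates_mono_h[OF M that(1,2)] that(3) unfolding Q_def .
    show "P h'" if h: "0 < h" "h \<le> h'" and "P h" for h h'
    proof -
      obtain C where C: "C \<ge> 0" and B: "\<And>p m \<rho> x z. 1 \<le> m \<Longrightarrow> 0 \<le> \<rho> \<Longrightarrow> \<rho> \<le> \<delta> \<Longrightarrow> x \<in> S \<Longrightarrow> z \<in> polydisc x \<rho> \<Longrightarrow>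
     norm (w m z) \<le> C * real m ^ K * exp (L * real m * \<rho>) * ((h / real m) ^ p * M p + exp (- \<gamma> * real m))"
        using \<open>P h\<close> unfolding P_def by blast
      have "C * real m ^ K * exp (L * real m * \<rho>) * ((h / real m) ^ p * M p + exp (- \<gamma> * real m))
         \<le> C * real m ^ K * exp (L * real m * \<rho>) * ((h' / real m) ^ p * M p + exp (- \<gamma> * real m))" for m p \<rho>
        using h C less_imp_le[OF M] by (intro mult_left_mono add_right_mono mult_right_mono power_mono divide_right_mono) auto
      then show ?thesis
        unfolding P_def using C B by (intro exI[of _ C]) (meson order_trans)
    qed
  qed
  then show ?thesis
  proof (rule for_h_scale[OF _ \<kappa>(1)])
    fix h :: real assume h: "h > 0" and "P h \<and> Q h"
    then obtain C Cf where C: "C \<ge> 0" and B: "\<And>p m \<rho> x z. 1 \<le> m \<Longrightarrow> 0 \<le> \<rho> \<Longrightarrow> \<rho> \<le> \<delta> \<Longrightarrow> x \<in> S \<Longrightarrow> z \<in> polydisc x \<rho> \<Longrightarrow>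
     norm (w m z) \<le> C * real m ^ K * exp (L * real m * \<rho>) * ((h / real m) ^ p * M p + exp (- \<gamma> * real m))"
      and Cf: "\<And>q. fact q \<le> Cf * h ^ q * M q"
      unfolding P_def Q_def by metis
    have Cf0: "Cf \<ge> 0" using order_trans[OF _ Cf[of 0], of 0] M[of 0] by (simp add: zero_le_mult_iff)
    define F where "F = Cf * h ^ K * A'"
    have F0: "F \<ge> 0" using Cf0 h AH' by (simp add: F_def)
    have facb: "fact (q + K) \<le> F * (H' * h) ^ q * M q" for q
    proof -
      have "fact (q + K) \<le> Cf * h ^ (q + K) * M (q + K)" by (rule Cf)
      also have "\<dots> \<le> Cf * h ^ (q + K) * (A' * H' ^ q * M q)"
        using Cf0 h by (intro mult_left_mono AH') auto
      also have "\<dots> = F * (H' * h) ^ q * M q"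
        by (simp add: F_def power_add power_mult_distrib)
      finally show ?thesis .
    qed
    have up: "D ^ q * h ^ q * M q \<le> (\<kappa> * h) ^ q * M q" if "0 < D" "D \<le> \<kappa>" for D q
      unfolding power_mult_distrib using that h less_imp_le[OF M] by (intro mult_right_mono power_mono) auto
    have T1b: "Z * T1 h C q \<le> Z * C * h ^ k * A * ((\<kappa> * h) ^ q * M q)" for q
    proof -
      have "T1 h C q \<le> C * exp (L * real q) * h ^ (q + k) * (A * H ^ q * M q)"
        unfolding T1_def using C h by (intro mult_left_mono AH) auto
      also have "\<dots> = C * h ^ k * A * (D1 ^ q * h ^ q * M q)"
        by (simp add: D1_def power_add power_mult_distrib mult.commute[of L] exp_of_nat_mult)
      also have "\<dots> \<le> C * h ^ k * A * ((\<kappa> * h) ^ q * M q)"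
        using C h AH by (intro mult_left_mono up Dp \<kappa>) auto
      finally show ?thesis
        using mult_left_mono[OF _ Zp(1)] by (simp add: mult.assoc)
    qed
    have T2b: "G * T2 C q \<le> G * C * (2 / \<gamma>) ^ K * F * ((\<kappa> * h) ^ q * M q)" for q
    proof -
      have "T2 C q \<le> C * exp (L * real q) * ((F * (H' * h) ^ q * M q) * (2 / \<gamma>) ^ (K + q))"
        unfolding T2_def using C h par facb[of q] by (intro mult_left_mono mult_right_mono) (auto simp: add.commute)
      also have "\<dots> = C * (2 / \<gamma>) ^ K * F * (D2 ^ q * h ^ q * M q)"
        by (simp add: D2_def power_add power_divide power_mult_distrib mult.commute[of L] exp_of_nat_mult)
      also have "\<dots> \<le> C * (2 / \<gamma>) ^ K * F * ((\<kappa> * h) ^ q * M q)"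
        using C h F0 par by (intro mult_left_mono up Dp \<kappa>) auto
      finally show ?thesis
        using mult_left_mono[OF _ Zp(2)] by (simp add: mult.assoc)
    qed
    have T3b: "(real (q + k) / \<delta> + 1) * T3 q \<le> C0 * exp ((L + 1) * real k / \<delta>) * exp 1 * F * ((\<kappa> * h) ^ q * M q)" for q
    proof -
      have "(real (q + k) / \<delta> + 1) * T3 q \<le> exp (real (q + k) / \<delta>) *
          (C0 * exp (L * (real (q + k) / \<delta>)) * (exp (real q + 1) * (F * (H' * h) ^ q * M q)) / \<delta> ^ q)"
        unfolding T3_def
      proof (intro mult_mono divide_right_mono mult_left_mono)
        show "real (q + k) / \<delta> + 1 \<le> exp (real (q + k) / \<delta>)"
          using exp_ge_add_one_self[of "real (q + k) / \<delta>"] by linarith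
        have "fact q \<le> (fact (q + K) :: real)" by (intro fact_mono) auto
        then show "fact q \<le> F * (H' * h) ^ q * M q" using facb[of q] by linarith
      qed (use par in auto)
      also have "\<dots> = C0 * (exp (real (q + k) / \<delta>) * exp (L * (real (q + k) / \<delta>)) * exp (real q + 1)) * (F * (H' * h) ^ q * M q) / \<delta> ^ q"
        by (simp add: mult_ac)
      also have "exp (real (q + k) / \<delta>) * exp (L * (real (q + k) / \<delta>)) * exp (real q + 1)
         = exp ((L + 1) * real k / \<delta>) * exp 1 * (exp ((L + 1) / \<delta>) * exp 1) ^ q"
        unfolding exp_of_nat_mult[symmetric] power_mult_distrib mult_exp_exp using par by (simp add: field_simps)
      also have "C0 * (exp ((L + 1) * real k / \<delta>) * exp 1 * (exp ((L + 1) / \<delta>) * exp 1) ^ q) * (F * (H' * h) ^ q * M q) / \<delta> ^ q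
         = C0 * exp ((L + 1) * real k / \<delta>) * exp 1 * F * (D3 ^ q * h ^ q * M q)"
        by (simp add: D3_def power_mult_distrib power_divide)
      also have "\<dots> \<le> C0 * exp ((L + 1) * real k / \<delta>) * exp 1 * F * ((\<kappa> * h) ^ q * M q)"
        using par F0 by (intro mult_left_mono up Dp \<kappa>) auto
      finally show ?thesis .
    qed
    define C' where "C' = C0 * exp ((L + 1) * real k / \<delta>) * exp 1 * F + Z * C * h ^ k * A + G * C * (2 / \<gamma>) ^ K * F"
    have Totb: "Tot h C q \<le> C' * (\<kappa> * h) ^ q * M q" for q
      using add_mono[OF add_mono[OF T3b[of q] T1b[of q]] T2b[of q]] unfolding Tot_def C'_def
      by (simp add: algebra_simps)
    show "\<exists>C. \<forall>js. \<exists>b. summable b \<and> suminf b \<le> C * (\<kappa> * h) ^ length js * M (length js) \<and>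
           (\<forall>n. \<forall>x\<in>S. norm (foldr cpd js (w n) (cvec x)) \<le> b n)"
    proof (intro exI[of _ C'] allI)
      fix js :: "'d list"
      have "\<exists>b. summable b \<and> suminf b \<le> Tot h C (length js) \<and> (\<forall>n. \<forall>x\<in>S. norm (foldr cpd js (w n) (cvec x)) \<le> b n)"
        by (rule key[OF h C]) (rule B)
      then show "\<exists>b. summable b \<and> suminf b \<le> C' * (\<kappa> * h) ^ length js * M (length js) \<and>
           (\<forall>n. \<forall>x\<in>S. norm (foldr cpd js (w n) (cvec x)) \<le> b n)"
        using Totb[of "length js"] by (meson order_trans)
    qed
  qed
qed


section \<open>The kernels\<close>

text \<open>Up to the removable singularity, \<open>exp(m (i w - w^2 / 2)) / (2 \<pi> i w)\<close>
  is the part of the \<open>m\<close>-th kernel with positive frequencies. \<open>amp\<close> is the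
  factor left over when its exponential is divided out of its increment in \<open>m\<close>; it does
  not depend on \<open>m\<close>.\<close>

definition amp :: "complex \<Rightarrow> complex" where
  "amp w = (if w = 0 then 1 / (2 * of_real pi) else (exp (\<i> * w - w\<^sup>2 / 2) - 1) / (2 * of_real pi * \<i> * w))"

text \<open>The Dirichlet kernel of the line, damped by a Gaussian of width
  \<open>1 / sqrt m\<close>. The sine alone would decay too slowly to make the operators
  local.\<close>

definition ker :: "nat \<Rightarrow> complex \<Rightarrow> complex" where
  "ker m w = (if w = 0 then of_nat m / of_real pi else sin (of_nat m * w) / (of_real pi * w)) * exp (- (of_nat m * w\<^sup>2 / 2))"

definition gk :: "nat \<Rightarrow> complex \<Rightarrow> complex" where
  "gk m w = exp (\<i> * of_nat m * w - of_nat m * w\<^sup>2 / 2) * amp w"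

lemma holomorphic_on_amp: "amp holomorphic_on S"
proof -
  define f where "f = (\<lambda>w::complex. exp (\<i> * w - w\<^sup>2 / 2))"
  have "(f has_field_derivative exp (\<i> * 0 - 0\<^sup>2 / 2) * (\<i> - 0)) (at 0)"
    unfolding f_def by (auto intro!: derivative_eq_intros)
  then have d: "deriv f 0 = \<i>" by (auto intro: DERIV_imp_deriv)
  have "f holomorphic_on UNIV"
    unfolding f_def by (intro holomorphic_intros) auto
  then have "(\<lambda>z. if z = 0 then deriv f 0 else (f z - f 0) / (z - 0)) holomorphic_on UNIV"
    by (rule pole_lemma_open) auto
  then have "(\<lambda>z. 1 / (2 * of_real pi * \<i>) * (if z = 0 then deriv f 0 else (f z - f 0) / (z - 0))) holomorphic_on UNIV"
    by (intro holomorphic_intros)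
  moreover have "1 / (2 * of_real pi * \<i>) * (if z = 0 then deriv f 0 else (f z - f 0) / (z - 0)) = amp z" for z
    by (simp add: amp_def d) (simp add: f_def)
  ultimately have "amp holomorphic_on UNIV" by simp
  then show ?thesis by (rule holomorphic_on_subset) auto
qed

lemma holomorphic_on_gk: "gk m holomorphic_on S"
  unfolding gk_def by (intro holomorphic_intros holomorphic_on_amp) auto

lemma holomorphic_on_ker: "ker m holomorphic_on S"
proof -
  define f where "f = (\<lambda>w::complex. sin (of_nat m * w))"
  have "(f has_field_derivative cos (of_nat m * 0) * of_nat m) (at 0)"
    unfolding f_def by (auto intro!: derivative_eq_intros)
  then have d: "deriv f 0 = of_nat m" by (auto intro: DERIV_imp_deriv)
  have "f holomorphic_on UNIV"
    unfolding f_def by (intro holomorphic_intros)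
  then have "(\<lambda>z. if z = 0 then deriv f 0 else (f z - f 0) / (z - 0)) holomorphic_on UNIV"
    by (rule pole_lemma_open) auto
  then have "(\<lambda>z. 1 / of_real pi * (if z = 0 then deriv f 0 else (f z - f 0) / (z - 0)) * exp (- (of_nat m * z\<^sup>2 / 2))) holomorphic_on UNIV"
    by (intro holomorphic_intros) auto
  moreover have "1 / of_real pi * (if z = 0 then deriv f 0 else (f z - f 0) / (z - 0)) * exp (- (of_nat m * z\<^sup>2 / 2)) = ker m z" for z
    by (simp add: ker_def d) (simp add: f_def)
  ultimately have "ker m holomorphic_on UNIV" by simp
  then show ?thesis by (rule holomorphic_on_subset) auto
qed

lemma ker_0 [simp]: "ker 0 w = 0"
  by (simp add: ker_def)

text \<open>Expressing the sine by exponentials splits the increment into a part with positive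
  frequencies and its mirror image. Each of them decays when its argument is moved into one half
  plane, which the kernel as a whole does not.\<close>

lemma ker_Suc_diff: "ker (Suc m) w - ker m w = gk m w + gk m (- w)"
proof (cases "w = 0")
  case True
  then show ?thesis by (simp add: ker_def gk_def amp_def field_simps)
next
  case False
  define E where "E = exp (\<i> * of_nat m * w)"
  define E' where "E' = exp (- (\<i> * of_nat m * w))"
  define F where "F = exp (\<i> * w)"
  define F' where "F' = exp (- (\<i> * w))"
  define Q where "Q = exp (- (of_nat m * w\<^sup>2 / 2))"
  define R where "R = exp (- (w\<^sup>2 / 2))"
  have 1: "sin (of_nat (Suc m) * w) = (E * F - E' * F') / (2 * \<i>)"
    by (simp add: sin_exp_eq E_def F_def E'_def F'_def mult_exp_exp algebra_simps)
  have 2: "sin (of_nat m * w) = (E - E') / (2 * \<i>)"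
    by (simp add: sin_exp_eq E_def E'_def algebra_simps)
  have 3: "exp (- (of_nat (Suc m) * w\<^sup>2 / 2)) = Q * R"
    by (simp add: Q_def R_def mult_exp_exp add_divide_distrib algebra_simps)
  have 4: "exp (\<i> * of_nat m * w - of_nat m * w\<^sup>2 / 2) = E * Q"
    by (simp add: Q_def E_def mult_exp_exp)
  have 5: "exp (\<i> * of_nat m * (- w) - of_nat m * (- w)\<^sup>2 / 2) = E' * Q"
    by (simp add: Q_def E'_def mult_exp_exp)
  have 6: "exp (\<i> * w - w\<^sup>2 / 2) = F * R" "exp (\<i> * (- w) - (- w)\<^sup>2 / 2) = F' * R"
    by (simp_all add: F_def F'_def R_def mult_exp_exp)
  show ?thesis
    unfolding ker_def gk_def amp_def 1 2 3 4 5 6 Q_def[symmetric] using False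
    by (simp add: field_simps)
qed

section \<open>Size of the kernels in horizontal strips\<close>

lemma norm_cos_le_exp: "norm (cos (z::complex)) \<le> exp \<bar>Im z\<bar>"
proof -
  have "norm (cos z) \<le> (norm (exp (\<i> * z)) + norm (exp (- (\<i> * z)))) / 2"
    unfolding cos_exp_eq using norm_triangle_ineq[of "exp (\<i> * z)" "exp (- (\<i> * z))"]
    by (simp add: norm_divide)
  also have "\<dots> = (exp (- Im z) + exp (Im z)) / 2" by simp
  also have "\<dots> \<le> (exp \<bar>Im z\<bar> + exp \<bar>Im z\<bar>) / 2"
    by (intro divide_right_mono add_mono) auto
  finally show ?thesis by simp
qed

lemma norm_sin_le_exp: "norm (sin (z::complex)) \<le> norm z * exp \<bar>Im z\<bar>"
proof -
  have "norm (sin z - sin 0) \<le> exp \<bar>Im z\<bar> * norm (z - 0)"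
  proof (rule field_differentiable_bound[where S = "closed_segment 0 z" and f' = cos])
    show "(sin has_field_derivative cos w) (at w within closed_segment 0 z)" for w
      by (rule DERIV_subset[OF DERIV_sin]) auto
    fix w assume "w \<in> closed_segment 0 z"
    then obtain u where u: "0 \<le> u" "u \<le> 1" "w = u *\<^sub>R z"
      by (auto simp: in_segment)
    then have "\<bar>Im w\<bar> \<le> \<bar>Im z\<bar>" by (simp add: abs_mult mult_left_le_one_le)
    then show "norm (cos w) \<le> exp \<bar>Im z\<bar>"
      using norm_cos_le_exp[of w] by (meson exp_le_cancel_iff order_trans)
  qed auto
  then show ?thesis by (simp add: mult.commute)
qed

lemma norm_ker_le:
  assumes "\<bar>Im w\<bar> \<le> \<rho>" "\<rho> \<le> 1"
  shows "norm (ker m w) \<le> real m * exp (2 * real m * \<rho> - real m * (Re w)\<^sup>2 / 2)"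
proof -
  have rho: "0 \<le> \<rho>" using assms by linarith
  have mpi: "x / pi \<le> x" if "x \<ge> 0" for x
    using mult_left_mono[of 1 pi x] that pi_ge_two by (simp add: divide_le_eq)
  have e: "norm (exp (- (of_nat m * w\<^sup>2 / 2))) \<le> exp (real m * \<rho> / 2 - real m * (Re w)\<^sup>2 / 2)"
  proof -
    have "(Im w)\<^sup>2 \<le> \<rho>\<^sup>2" using assms by (intro abs_le_square_iff[THEN iffD1]) auto
    also have "\<rho>\<^sup>2 \<le> \<rho>" using rho assms by (simp add: power2_eq_square mult_left_le_one_le)
    finally have "real m * (Im w)\<^sup>2 \<le> real m * \<rho>" by (intro mult_left_mono) auto
    then show ?thesis by (simp add: power2_eq_square algebra_simps add_divide_distrib diff_divide_distrib)
  qed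
  have s: "norm (if w = 0 then of_nat m / of_real pi else sin (of_nat m * w) / (of_real pi * w)) \<le> real m * exp (real m * \<rho>)"
  proof (cases "w = 0")
    case True
    have "real m / pi \<le> real m * 1" using mpi[of "real m"] by simp
    also have "\<dots> \<le> real m * exp (real m * \<rho>)" using rho by (intro mult_left_mono) auto
    finally show ?thesis using True by (simp add: norm_divide)
  next
    case False
    have "norm (sin (of_nat m * w)) \<le> real m * norm w * exp \<bar>Im (of_nat m * w)\<bar>"
      using norm_sin_le_exp[of "of_nat m * w"] by (simp add: norm_mult)
    also have "\<dots> \<le> real m * norm w * exp (real m * \<rho>)"
      using assms by (intro mult_left_mono) (auto simp: abs_mult intro!: mult_left_mono)
    finally have "norm (sin (of_nat m * w)) / (pi * norm w) \<le> real m * norm w * exp (real m * \<rho>) / (pi * norm w)"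
      by (intro divide_right_mono) auto
    also have "\<dots> = real m * exp (real m * \<rho>) / pi" using False by simp
    also have "\<dots> \<le> real m * exp (real m * \<rho>)" by (rule mpi) auto
    finally show ?thesis using False by (simp add: norm_divide norm_mult)
  qed
  have "norm (ker m w) \<le> (real m * exp (real m * \<rho>)) * exp (real m * \<rho> / 2 - real m * (Re w)\<^sup>2 / 2)"
    unfolding ker_def norm_mult by (intro mult_mono s e) auto
  also have "\<dots> = real m * exp (3 / 2 * real m * \<rho> - real m * (Re w)\<^sup>2 / 2)"
    by (simp add: mult_exp_exp)
  also have "\<dots> \<le> real m * exp (2 * real m * \<rho> - real m * (Re w)\<^sup>2 / 2)"
    using rho by (intro mult_left_mono) auto
  finally show ?thesis .
qed

text \<open>A vertical shift by \<open>s\<close> turns the imaginary part into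
  \<open>t = Im w + s\<close> and the exponent into \<open>m\<close> times
  \<open>- t + t^2 / 2\<close>, minus the Gaussian term. For \<open>0 \<le> t \<le> 1\<close> this
  is at most \<open>- t / 2\<close>; for negative \<open>t\<close> the shift is at most
  \<open>\<rho>\<close>, and \<open>3 * \<rho>\<close> covers the loss.\<close>

lemma norm_osc_le:
  assumes y: "\<bar>Im w\<bar> \<le> \<rho>" and s: "0 \<le> s" "\<rho> + s \<le> 1"
  shows "norm (exp (\<i> * of_nat m * (w + \<i> * of_real s) - of_nat m * (w + \<i> * of_real s)\<^sup>2 / 2))
     \<le> exp (3 * real m * \<rho> - real m * s / 2 - real m * (Re w)\<^sup>2 / 2)"
proof -
  define t where "t = Im w + s"
  have "- t + t\<^sup>2 / 2 \<le> 3 * \<rho> - s / 2"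
  proof (cases "t \<ge> 0")
    case True
    have "t\<^sup>2 \<le> t" using True y s by (simp add: power2_eq_square mult_left_le_one_le t_def)
    then have "- t + t\<^sup>2 / 2 \<le> - t / 2" by simp
    also have "\<dots> \<le> 3 * \<rho> - s / 2" using y by (simp add: t_def)
    finally show ?thesis .
  next
    case False
    then have t: "\<bar>t\<bar> \<le> \<rho>" "s \<le> \<rho>" using y s by (auto simp: t_def)
    have "t\<^sup>2 = \<bar>t\<bar> * \<bar>t\<bar>" by (simp add: power2_eq_square)
    also have "\<dots> \<le> 1 * \<bar>t\<bar>" using t s by (intro mult_right_mono) auto
    finally show ?thesis using t by linarith
  qed
  then have "real m * (- t + t\<^sup>2 / 2) \<le> real m * (3 * \<rho> - s / 2)"
    by (intro mult_left_mono) auto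
  moreover have "Re (\<i> * of_nat m * (w + \<i> * of_real s) - of_nat m * (w + \<i> * of_real s)\<^sup>2 / 2)
      = real m * (- t + t\<^sup>2 / 2) - real m * (Re w)\<^sup>2 / 2"
    by (simp add: t_def power2_eq_square field_simps)
  ultimately show ?thesis by (simp add: algebra_simps)
qed

lemma ex_amp_bound: "\<exists>B>0. \<forall>w. \<bar>Re w\<bar> \<le> 2 \<longrightarrow> \<bar>Im w\<bar> \<le> 2 \<longrightarrow> norm (amp w) \<le> B"
proof -
  have "compact (amp ` cball 0 4)"
    by (intro compact_continuous_image holomorphic_on_imp_continuous_on holomorphic_on_amp) auto
  then obtain B where B: "B > 0" "\<forall>y\<in>amp ` cball 0 4. norm y \<le> B"
    using compact_imp_bounded bounded_pos by metis
  have "norm (amp w) \<le> B" if "\<bar>Re w\<bar> \<le> 2" "\<bar>Im w\<bar> \<le> 2" for w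
  proof -
    have "norm w \<le> 4" using cmod_le[of w] that by linarith
    then show ?thesis using B(2) by auto
  qed
  then show ?thesis using B(1) by blast
qed

text \<open>By log-convexity \<open>a^l * M l\<close> decreases up to some index and does not
  decrease again afterwards. \<open>P\<close> is that index or \<open>p\<close>, whichever comes
  first: its value is at most the one at \<open>p\<close>, and no earlier value exceeds the initial
  value 1. Stopping integrations by parts at \<open>P\<close> keeps all intermediate terms under
  control.\<close>

lemma log_convex_prefix:
  fixes M :: "nat \<Rightarrow> real"
  assumes M: "\<And>p. 0 < M p" "M 0 = 1" and lc: "M1 M" and lm: "a > 0"
  shows "\<exists>P\<le>p. a ^ P * M P \<le> a ^ p * M p \<and> (\<forall>l\<le>P. a ^ l * M l \<le> 1)"
proof -
  define A where "A = (\<lambda>l. a ^ l * M l)"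
  have Ap: "A l > 0" for l using M lm by (simp add: A_def)
  have conv: "A (Suc l) ^ 2 \<le> A l * A (Suc (Suc l))" for l
  proof -
    have "(M (Suc l))\<^sup>2 \<le> M l * M (Suc (Suc l))"
      using lc unfolding M1_def by (auto dest: spec[of _ "Suc l"])
    then have "(a ^ Suc l)\<^sup>2 * (M (Suc l))\<^sup>2 \<le> (a ^ Suc l)\<^sup>2 * (M l * M (Suc (Suc l)))"
      by (intro mult_left_mono) auto
    then show ?thesis by (simp add: A_def power2_eq_square algebra_simps)
  qed
  \<comment> \<open>The last conjunct records that the turning point has been passed; log-convexity
    then propagates the increase from \<open>p\<close> to \<open>Suc p\<close>.\<close>
  have "\<exists>P\<le>p. A P \<le> A p \<and> (\<forall>l\<le>P. A l \<le> 1) \<and> (P < p \<longrightarrow> A (p - 1) \<le> A p)"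
  proof (induction p)
    case 0
    then show ?case by (auto simp: A_def M)
  next
    case (Suc p)
    then obtain P where P: "P \<le> p" "A P \<le> A p" "\<forall>l\<le>P. A l \<le> 1" "P < p \<longrightarrow> A (p - 1) \<le> A p" by blast
    show ?case
    proof (cases "P = p \<and> A (Suc p) \<le> A p")
      case True
      then have "\<forall>l\<le>Suc p. A l \<le> 1" using P by (auto simp: le_Suc_eq intro: order_trans)
      then show ?thesis by blast
    next
      case False
      have "A p \<le> A (Suc p)"
      proof (cases "P = p")
        case True then show ?thesis using False by auto
      next
        case False
        then have pp: "P < p" using P by auto
        then obtain q where q: "p = Suc q" by (cases p) auto
        have "A q \<le> A (Suc q)" using P(4) pp q by simp
        then have "A q * A (Suc q) \<le> A (Suc q) * A (Suc q)" using Ap[of "Suc q"] by (intro mult_right_mono) auto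
        also have "\<dots> \<le> A q * A (Suc (Suc q))" using conv[of q] by (simp add: power2_eq_square)
        finally have "A (Suc q) \<le> A (Suc (Suc q))" using Ap[of q] by simp
        then show ?thesis using q by simp
      qed
      then show ?thesis using P by (intro exI[of _ P]) auto
    qed
  qed
  then show ?thesis unfolding A_def by blast
qed


section \<open>Integration by parts against the increments of the kernels\<close>

lemma integral_by_parts_kernel:
  fixes g :: "complex \<Rightarrow> complex" and u u' :: "real \<Rightarrow> complex"
  assumes ab: "a \<le> b" and g: "g holomorphic_on UNIV"
    and u: "\<And>t. t \<in> {a..b} \<Longrightarrow> (u has_vector_derivative u' t) (at t within {a..b})"
    and cu': "continuous_on {a..b} u'"
  shows "integral {a..b} (\<lambda>t. deriv g (\<zeta> - of_real t) * u t)
    = integral {a..b} (\<lambda>t. g (\<zeta> - of_real t) * u' t) + (g (\<zeta> - of_real a) * u a - g (\<zeta> - of_real b) * u b)"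
proof -
  have cu: "continuous_on {a..b} u"
    by (rule continuous_on_vector_derivative[OF u])
  have cg: "continuous_on {a..b} (\<lambda>t. g (\<zeta> - of_real t))"
    by (rule continuous_on_compose2[OF holomorphic_on_imp_continuous_on[OF g]]) (auto intro!: continuous_intros)
  have "continuous_on UNIV (deriv g)"
    by (intro holomorphic_on_imp_continuous_on holomorphic_deriv g) auto
  then have cg': "continuous_on {a..b} (\<lambda>t. deriv g (\<zeta> - of_real t))"
    by (rule continuous_on_compose2) (auto intro!: continuous_intros)
  have dg: "((\<lambda>t. g (\<zeta> - of_real t)) has_vector_derivative - deriv g (\<zeta> - of_real t)) (at t within {a..b})" for t
  proof -
    have "(g has_field_derivative deriv g (\<zeta> - of_real t)) (at (\<zeta> - of_real t))"
      using g by (simp add: holomorphic_derivI)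
    moreover have "((\<lambda>t. \<zeta> - of_real t) has_vector_derivative - 1) (at t within {a..b})"
      by (auto intro!: derivative_eq_intros simp: has_vector_derivative_def scaleR_conv_of_real)
    ultimately have "(g \<circ> (\<lambda>t. \<zeta> - of_real t) has_vector_derivative (- 1) * deriv g (\<zeta> - of_real t)) (at t within {a..b})"
      by (rule field_vector_diff_chain_within[rotated, OF has_field_derivative_at_within])
    then show ?thesis by (simp add: o_def)
  qed
  have "((\<lambda>t. g (\<zeta> - of_real t) * u' t + (- deriv g (\<zeta> - of_real t)) * u t) has_integral
      (g (\<zeta> - of_real b) * u b - g (\<zeta> - of_real a) * u a)) {a..b}"
    by (rule fundamental_theorem_of_calculus[OF ab]) (rule has_vector_derivative_mult[OF dg u])
  moreover have "((\<lambda>t. g (\<zeta> - of_real t) * u' t) has_integral integral {a..b} (\<lambda>t. g (\<zeta> - of_real t) * u' t)) {a..b}"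
    by (intro integrable_integral integrable_continuous_interval continuous_intros cg cu')
  ultimately have "((\<lambda>t. g (\<zeta> - of_real t) * u' t - (g (\<zeta> - of_real t) * u' t + (- deriv g (\<zeta> - of_real t)) * u t)) has_integral
      integral {a..b} (\<lambda>t. g (\<zeta> - of_real t) * u' t) - (g (\<zeta> - of_real b) * u b - g (\<zeta> - of_real a) * u a)) {a..b}"
    by (intro has_integral_diff)
  then show ?thesis
    by (simp add: integral_unique)
qed

text \<open>Moving the argument upwards differentiates the kernel, and integration by parts hands
  the derivative over to \<open>u\<close>, leaving boundary terms at \<open>a\<close> and
  \<open>b\<close>. Derivatives of \<open>u\<close> thus become derivatives with respect to the
  vertical shift.\<close>

lemma has_vector_derivative_vertical_integral:
  fixes g :: "complex \<Rightarrow> complex" and u u' :: "real \<Rightarrow> complex"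
  assumes ab: "a \<le> b" and g: "g holomorphic_on UNIV"
    and u: "\<And>t. t \<in> {a..b} \<Longrightarrow> (u has_vector_derivative u' t) (at t within {a..b})"
    and cu': "continuous_on {a..b} u'" and s: "s \<in> {0..\<eta>}"
  shows "((\<lambda>s. integral {a..b} (\<lambda>t. g (z + \<i> * of_real s - of_real t) * u t)) has_vector_derivative
     \<i> * (integral {a..b} (\<lambda>t. g (z + \<i> * of_real s - of_real t) * u' t)
        + (g (z + \<i> * of_real s - of_real a) * u a - g (z + \<i> * of_real s - of_real b) * u b))) (at s within {0..\<eta>})"
proof -
  have cu: "continuous_on {a..b} u"
    by (rule continuous_on_vector_derivative[OF u])
  have cg: "continuous_on UNIV g"
    by (rule holomorphic_on_imp_continuous_on[OF g])
  have cg': "continuous_on UNIV (deriv g)"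
    by (intro holomorphic_on_imp_continuous_on holomorphic_deriv g) auto
  have "((\<lambda>s. integral (cbox a b) (\<lambda>t. g (z + \<i> * of_real s - of_real t) * u t)) has_vector_derivative
     integral (cbox a b) (\<lambda>t. \<i> * deriv g (z + \<i> * of_real s - of_real t) * u t)) (at s within {0..\<eta>})"
  proof (rule leibniz_rule_vector_derivative[OF _ _ _ s])
    fix s t assume "t \<in> cbox a b"
    have "(g has_field_derivative deriv g (z + \<i> * of_real s - of_real t)) (at (z + \<i> * of_real s - of_real t))"
      using g by (simp add: holomorphic_derivI)
    moreover have "((\<lambda>s. z + \<i> * of_real s - of_real t) has_vector_derivative \<i>) (at s within {0..\<eta>})"
      by (auto intro!: derivative_eq_intros simp: has_vector_derivative_def scaleR_conv_of_real mult.commute)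
    ultimately have "(g \<circ> (\<lambda>s. z + \<i> * of_real s - of_real t) has_vector_derivative \<i> * deriv g (z + \<i> * of_real s - of_real t)) (at s within {0..\<eta>})"
      by (rule field_vector_diff_chain_within[rotated, OF has_field_derivative_at_within])
    then show "((\<lambda>s. g (z + \<i> * of_real s - of_real t) * u t) has_vector_derivative
       \<i> * deriv g (z + \<i> * of_real s - of_real t) * u t) (at s within {0..\<eta>})"
      unfolding o_def by (rule has_vector_derivative_mult_left)
  next
    fix s
    show "(\<lambda>t. g (z + \<i> * of_real s - of_real t) * u t) integrable_on cbox a b"
      using cu by (intro integrable_continuous continuous_on_mult continuous_on_compose2[OF cg]) (auto intro!: continuous_intros)
  next
    show "continuous_on ({0..\<eta>} \<times> cbox a b) (\<lambda>(s, t). \<i> * deriv g (z + \<i> * of_real s - of_real t) * u t)"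
      unfolding case_prod_unfold
      by (intro continuous_intros continuous_on_compose2[OF cg'] continuous_on_compose2[OF cu]) auto
  qed auto
  moreover have "integral (cbox a b) (\<lambda>t. \<i> * deriv g (z + \<i> * of_real s - of_real t) * u t)
      = \<i> * integral {a..b} (\<lambda>t. deriv g (z + \<i> * of_real s - of_real t) * u t)"
    by (simp add: mult.assoc)
  ultimately show ?thesis
    using integral_by_parts_kernel[OF ab g u cu', of "z + \<i> * of_real s"] by simp
qed


text \<open>Let \<open>J l s\<close> be the integral of \<open>v l\<close> against the kernel
  shifted up by \<open>s\<close>, so that the derivative of \<open>J l\<close> in \<open>s\<close>
  is \<open>i (J (l + 1) + \<beta> l)\<close>. Taylor's formula for \<open>J 0 0\<close> about
  \<open>s = 1/2\<close>, up to the order \<open>P\<close> of \<open>log_convex_prefix\<close>,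
  leaves three kinds of terms. Those at \<open>s = 1/2\<close> are exponentially small because the
  kernel decays upwards, the boundary terms \<open>\<beta> l\<close> because of the Gaussian. The
  remainder is of the size of \<open>h^P * M P\<close> times the integral of
  \<open>s^(P - 1) exp(- m s / 2) / (P - 1)!\<close>, hence essentially
  \<open>(2 h / m)^P * M P\<close>.\<close>

lemma gk_integral_bound:
  fixes v :: "nat \<Rightarrow> real \<Rightarrow> complex" and M :: "nat \<Rightarrow> real"
  assumes M: "\<And>p. 0 < M p" "M 0 = 1" and lc: "M1 M" and h: "h > 0" and C: "C \<ge> 0"
    and ab: "a \<le> b" "b - a \<le> 1" and r: "0 < r" "r \<le> 1" and x: "x \<in> {a + r..b - r}"
    and z: "norm (z - of_real x) \<le> \<rho>" and rho: "\<rho> \<le> 1/4" "\<rho> \<le> r / 2" and m: "1 \<le> m"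
    and v: "\<And>k t. t \<in> {a..b} \<Longrightarrow> (v k has_vector_derivative v (Suc k) t) (at t within {a..b})"
    and vb: "\<And>k t. t \<in> {a..b} \<Longrightarrow> norm (v k t) \<le> C * h ^ k * M k"
    and B: "B > 0" "\<And>w. \<bar>Re w\<bar> \<le> 2 \<Longrightarrow> \<bar>Im w\<bar> \<le> 2 \<Longrightarrow> norm (amp w) \<le> B"
  shows "norm (integral {a..b} (\<lambda>t. gk m (z - of_real t) * v 0 t))
    \<le> B * C * exp (3 * real m * \<rho>) * (real m * ((16 * h / real m) ^ p * M p) + 4 * exp (- (r\<^sup>2 / 8) * real m))"
proof -
  have mpos: "real m > 0" using m by simp
  have rho0: "0 \<le> \<rho>" using z norm_ge_zero order_trans by blast
  have cv: "continuous_on {a..b} (v k)" for k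
    by (rule continuous_on_vector_derivative[OF v])
  define J where "J = (\<lambda>l s. integral {a..b} (\<lambda>t. gk m (z + \<i> * of_real s - of_real t) * v l t))"
  define \<beta> where "\<beta> = (\<lambda>l s. gk m (z + \<i> * of_real s - of_real a) * v l a - gk m (z + \<i> * of_real s - of_real b) * v l b)"
  have dJ: "(J l has_vector_derivative \<i> * (J (Suc l) s + \<beta> l s)) (at s within {0..1/2})" if "s \<in> {0..1/2}" for l s
    unfolding J_def \<beta>_def
    by (rule has_vector_derivative_vertical_integral[OF ab(1) holomorphic_on_gk v cv that])
  have cJ: "continuous_on {0..1/2} (J l)" for l
    by (rule continuous_on_vector_derivative[OF dJ])
  have cgk: "continuous_on UNIV (gk m)" by (rule holomorphic_on_imp_continuous_on[OF holomorphic_on_gk])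
  have c\<beta>: "continuous_on {0..1/2} (\<beta> l)" for l
    unfolding \<beta>_def by (intro continuous_intros continuous_on_compose2[OF cgk]) auto
  \<comment> \<open>Up to a power of the imaginary unit, \<open>I p\<close> is the remainder after
    \<open>p\<close> steps; \<open>I 0\<close> is the integral to be bounded.\<close>
  define I where "I = (\<lambda>p. case p of 0 \<Rightarrow> J 0 0 | Suc q \<Rightarrow> integral {0..1/2} (\<lambda>s. of_real (s ^ q / fact q) * J (Suc q) s))"
  define N where "N = (\<lambda>l. norm (of_real ((1/2) ^ l / fact l) * J l (1/2)) + norm (integral {0..1/2} (\<lambda>s. of_real (s ^ l / fact l) * \<beta> l s)))"
  have rec: "norm (I l) \<le> norm (I (Suc l)) + N l" for l
  proof -
    define E where "E = (\<lambda>s. of_real (s ^ l / fact l) * J l s)"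
    define E' where "E' = (\<lambda>s. of_real (s ^ l / fact l) * (\<i> * (J (Suc l) s + \<beta> l s)) + of_real (real l * s ^ (l - 1) / fact l) * J l s)"
    have "(E' has_integral (E (1/2) - E 0)) {0..1/2}"
    proof (rule fundamental_theorem_of_calculus)
      fix s :: real assume s: "s \<in> {0..1/2}"
      have "((\<lambda>s. s ^ l / fact l) has_real_derivative real l * s ^ (l - 1) / fact l) (at s within {0..1/2})"
        by (auto intro!: derivative_eq_intros)
      then have "((\<lambda>s. of_real (s ^ l / fact l) :: complex) has_vector_derivative of_real (real l * s ^ (l - 1) / fact l)) (at s within {0..1/2})"
        by (rule has_vector_derivative_of_real)
      from has_vector_derivative_mult[OF this dJ[OF s, of l]]
      show "(E has_vector_derivative E' s) (at s within {0..1/2})"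
        unfolding E_def E'_def by simp
    qed simp
    then have int: "integral {0..1/2} E' = E (1/2) - E 0" by (rule integral_unique)
    define P1 where "P1 = (\<lambda>s. of_real (s ^ l / fact l) * J (Suc l) s)"
    define P2 where "P2 = (\<lambda>s. of_real (s ^ l / fact l) * \<beta> l s)"
    define P3 where "P3 = (\<lambda>s. of_real (real l * s ^ (l - 1) / fact l) * J l s)"
    have ints: "P1 integrable_on {0..1/2}" "P2 integrable_on {0..1/2}" "P3 integrable_on {0..1/2}"
      unfolding P1_def P2_def P3_def
      by (intro integrable_continuous_interval continuous_intros cJ c\<beta>; simp)+
    have "E' = (\<lambda>s. \<i> * P1 s + \<i> * P2 s + P3 s)"
      by (auto simp: E'_def P1_def P2_def P3_def algebra_simps)
    then have "integral {0..1/2} E' = \<i> * integral {0..1/2} P1 + \<i> * integral {0..1/2} P2 + integral {0..1/2} P3"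
      using ints by (simp add: integral_add integrable_add)
    moreover have "integral {0..1/2} P1 = I (Suc l)" by (simp add: I_def P1_def)
    \<comment> \<open>For \<open>l = 0\<close> the integral vanishes through its factor
      \<open>real l\<close>, and \<open>E 0\<close> is \<open>J 0 0\<close>. For
      \<open>l > 0\<close> it is \<open>E 0\<close> that vanishes.\<close>
    moreover have "integral {0..1/2} P3 + E 0 = I l"
    proof (cases l)
      case 0
      then show ?thesis by (simp add: P3_def E_def I_def)
    next
      case (Suc q)
      have "real l * s ^ (l - 1) / fact l = s ^ q / fact q" for s :: real
        using Suc by (simp add: field_simps del: of_nat_Suc)
      then show ?thesis using Suc by (simp add: P3_def E_def I_def)
    qed
    ultimately have "I l = E (1/2) - \<i> * I (Suc l) - \<i> * integral {0..1/2} P2"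
      using int by (simp add: algebra_simps)
    also have "norm \<dots> \<le> norm (E (1/2)) + norm (I (Suc l)) + norm (integral {0..1/2} P2)"
      by (intro order_trans[OF norm_triangle_ineq4] add_mono) (auto simp: norm_mult)
    finally show ?thesis by (simp add: N_def E_def P2_def)
  qed
  have sum: "norm (I 0) \<le> norm (I P) + (\<Sum>l<P. N l)" for P
  proof (induction P)
    case (Suc P)
    then show ?case using rec[of P] by simp
  qed simp
  have gkb: "norm (gk m (z + \<i> * of_real s - of_real t)) \<le> B * exp (3 * real m * \<rho> - real m * s / 2 - real m * (Re z - t)\<^sup>2 / 2)"
    if s: "s \<in> {0..1/2}" and t: "t \<in> {a..b}" for s t
  proof -
    define w where "w = z - of_real t"
    have imw: "\<bar>Im w\<bar> \<le> \<rho>" using z abs_Im_le_cmod[of "z - of_real x"] by (simp add: w_def)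
    have rew: "\<bar>Re w\<bar> \<le> 2"
      using abs_Re_le_cmod[of "z - of_real x"] z rho x t ab r by (auto simp: w_def abs_le_iff)
    have eq: "z + \<i> * of_real s - of_real t = w + \<i> * of_real s" by (simp add: w_def)
    have "norm (amp (w + \<i> * of_real s)) \<le> B"
      using imw rew rho s by (intro B(2)) auto
    moreover have "norm (exp (\<i> * of_nat m * (w + \<i> * of_real s) - of_nat m * (w + \<i> * of_real s)\<^sup>2 / 2))
       \<le> exp (3 * real m * \<rho> - real m * s / 2 - real m * (Re w)\<^sup>2 / 2)"
      using s rho by (intro norm_osc_le imw) auto
    ultimately have "norm (gk m (w + \<i> * of_real s)) \<le> exp (3 * real m * \<rho> - real m * s / 2 - real m * (Re w)\<^sup>2 / 2) * B"
      unfolding gk_def norm_mult by (intro mult_mono) auto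
    then show ?thesis unfolding eq by (simp add: w_def mult.commute)
  qed
  have gkb0: "norm (gk m (z + \<i> * of_real s - of_real t)) \<le> B * exp (3 * real m * \<rho> - real m * s / 2)"
    if s: "s \<in> {0..1/2}" and t: "t \<in> {a..b}" for s t
    using gkb[OF that] by (rule order_trans) (use B(1) in \<open>auto intro!: mult_left_mono\<close>)
  have Jb: "norm (J l s) \<le> B * C * exp (3 * real m * \<rho>) * (exp (- (real m * s / 2)) * (h ^ l * M l))" if s: "s \<in> {0..1/2}" for l s
  proof -
    have "norm (J l s) \<le> (B * exp (3 * real m * \<rho> - real m * s / 2) * (C * h ^ l * M l)) * (b - a)"
      unfolding J_def
    proof (rule integral_bound[OF ab(1)])
      show "continuous_on {a..b} (\<lambda>t. gk m (z + \<i> * of_real s - of_real t) * v l t)"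
        by (intro continuous_intros cv continuous_on_compose2[OF cgk]) auto
      show "norm (gk m (z + \<i> * of_real s - of_real t) * v l t) \<le> B * exp (3 * real m * \<rho> - real m * s / 2) * (C * h ^ l * M l)"
        if "t \<in> {a..b}" for t
        unfolding norm_mult using B(1) by (intro mult_mono gkb0 vb s that) auto
    qed
    also have "\<dots> \<le> (B * exp (3 * real m * \<rho> - real m * s / 2) * (C * h ^ l * M l)) * 1"
      using ab B(1) C h less_imp_le[OF M(1)] by (intro mult_left_mono) auto
    also have "exp (3 * real m * \<rho> - real m * s / 2) = exp (3 * real m * \<rho>) * exp (- (real m * s / 2))"
      by (simp add: mult_exp_exp)
    finally show ?thesis by (simp only: mult_1_right mult_ac)
  qed
  have \<beta>b: "norm (\<beta> l s) \<le> 2 * (B * C * exp (3 * real m * \<rho>) * (exp (- (real m * s / 2)) * exp (- (r\<^sup>2 / 8) * real m) * (h ^ l * M l)))"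
    if s: "s \<in> {0..1/2}" for l s
  proof -
    have one: "norm (gk m (z + \<i> * of_real s - of_real t) * v l t) \<le> B * C * exp (3 * real m * \<rho>) * (exp (- (real m * s / 2)) * exp (- (r\<^sup>2 / 8) * real m) * (h ^ l * M l))"
      if t: "t = a \<or> t = b" for t
    proof -
      have tab: "t \<in> {a..b}" using t ab by auto
      have "\<bar>Re z - x\<bar> \<le> \<rho>" using abs_Re_le_cmod[of "z - of_real x"] z by simp
      then have "r / 2 \<le> \<bar>Re z - t\<bar>" using t x rho by auto
      then have "(r / 2)\<^sup>2 \<le> \<bar>Re z - t\<bar>\<^sup>2" using r by (intro power_mono) auto
      then have "real m * (r\<^sup>2 / 8) \<le> real m * (Re z - t)\<^sup>2 / 2"
        using mult_left_mono[of "(r / 2)\<^sup>2 / 2" "(Re z - t)\<^sup>2 / 2" "real m"] by (simp add: power_divide)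
      then have "exp (3 * real m * \<rho> - real m * s / 2 - real m * (Re z - t)\<^sup>2 / 2) \<le> exp (3 * real m * \<rho> - real m * s / 2 - real m * (r\<^sup>2 / 8))"
        by simp
      then have "norm (gk m (z + \<i> * of_real s - of_real t)) \<le> B * exp (3 * real m * \<rho> - real m * s / 2 - real m * (r\<^sup>2 / 8))"
        using B(1) by (intro order_trans[OF gkb[OF s tab]] mult_left_mono) auto
      then have "norm (gk m (z + \<i> * of_real s - of_real t)) * norm (v l t) \<le> B * exp (3 * real m * \<rho> - real m * s / 2 - real m * (r\<^sup>2 / 8)) * (C * h ^ l * M l)"
        using B(1) by (intro mult_mono vb tab) auto
      also have "exp (3 * real m * \<rho> - real m * s / 2 - real m * (r\<^sup>2 / 8)) = exp (3 * real m * \<rho>) * (exp (- (real m * s / 2)) * exp (- (r\<^sup>2 / 8) * real m))"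
        unfolding mult_exp_exp by (simp add: algebra_simps)
      finally show ?thesis by (simp only: norm_mult mult_ac)
    qed
    show ?thesis unfolding \<beta>_def
      by (rule order_trans[OF norm_triangle_ineq4]) (use one[of a] one[of b] in linarith)
  qed
  define X where "X = B * C * exp (3 * real m * \<rho>)"
  have X0: "X \<ge> 0" using B C by (simp add: X_def)
  \<comment> \<open>With the factor 16, the terms up to \<open>P\<close> satisfy
    \<open>h^l * M l \<le> (m / 16)^l\<close>. Comparing \<open>(m s / 8)^l / l!\<close> with
    \<open>exp(m s / 8)\<close> then leaves a geometric factor \<open>(1/2)^l\<close>, and the decay
    \<open>exp(- m s / 2)\<close> outweighs the exponential.\<close>
  obtain P where P: "P \<le> p" "(16 * h / real m) ^ P * M P \<le> (16 * h / real m) ^ p * M p" "\<forall>l\<le>P. (16 * h / real m) ^ l * M l \<le> 1"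
    using log_convex_prefix[OF M lc, of "16 * h / real m" p] h mpos by auto
  have hM: "h ^ l * M l \<le> (real m / 16) ^ l" if "l \<le> P" for l
    using P(3) that mpos h by (auto simp: power_divide power_mult_distrib field_simps)
  have pf: "s ^ l / fact l * (real m / 16) ^ l \<le> (1/2) ^ l * exp (real m * s / 8)" if "0 \<le> s" for s l
  proof -
    have "(real m * s / 8) ^ l \<le> fact l * exp (real m * s / 8)"
      using that mpos by (intro power_le_fact_exp) auto
    then have "(1/2) ^ l * (real m * s / 8) ^ l / fact l \<le> (1/2) ^ l * (fact l * exp (real m * s / 8)) / fact l"
      by (intro divide_right_mono mult_left_mono) auto
    moreover have "(1/2) ^ l * (real m * s / 8) ^ l / fact l = s ^ l / fact l * (real m / 16) ^ l"
      by (simp add: power_divide power_mult_distrib mult.commute[of "fact l"] mult.commute[of "s ^ l"]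
          flip: power_mult_distrib[of 2 8])
    ultimately show ?thesis by simp
  qed
  have r2: "r\<^sup>2 / 8 \<le> 1/8" using r by (simp add: power_le_one)
  have Nb: "N l \<le> 2 * X * exp (- (r\<^sup>2 / 8) * real m) * (1/2) ^ l" if l: "l \<le> P" for l
  proof -
    have "norm (of_real ((1/2) ^ l / fact l) * J l (1/2)) \<le> (1/2) ^ l / fact l * (X * (exp (- (real m * (1/2) / 2)) * (real m / 16) ^ l))"
    proof -
      have "norm (J l (1/2)) \<le> X * (exp (- (real m * (1/2) / 2)) * (h ^ l * M l))"
        using Jb[of "1/2" l] unfolding X_def by simp
      also have "\<dots> \<le> X * (exp (- (real m * (1/2) / 2)) * (real m / 16) ^ l)"
        using X0 by (intro mult_left_mono hM l) auto
      finally have "(1/2) ^ l / fact l * norm (J l (1/2)) \<le> (1/2) ^ l / fact l * (X * (exp (- (real m * (1/2) / 2)) * (real m / 16) ^ l))"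
        by (intro mult_left_mono) auto
      then show ?thesis by (simp add: norm_mult norm_divide norm_power)
    qed
    also have "\<dots> = X * exp (- (real m / 4)) * ((1/2) ^ l / fact l * (real m / 16) ^ l)" by simp
    also have "\<dots> \<le> X * exp (- (real m / 4)) * ((1/2) ^ l * exp (real m * (1/2) / 8))"
      using X0 by (intro mult_left_mono pf) auto
    also have "\<dots> = X * exp (- (real m * (3/16))) * (1/2) ^ l"
    proof -
      have "exp (- (real m / 4)) * exp (real m * (1/2) / 8) = exp (- (real m * (3/16)))"
        by (simp add: mult_exp_exp)
      then show ?thesis by (metis mult.assoc mult.commute)
    qed
    also have "\<dots> \<le> X * exp (- (r\<^sup>2 / 8) * real m) * (1/2) ^ l"
      using X0 r2 mpos by (intro mult_right_mono mult_left_mono) (auto simp: mult.commute intro!: mult_right_mono)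
    finally have 1: "norm (of_real ((1/2) ^ l / fact l) * J l (1/2)) \<le> X * exp (- (r\<^sup>2 / 8) * real m) * (1/2) ^ l" .
    have "norm (integral {0..1/2} (\<lambda>s. of_real (s ^ l / fact l) * \<beta> l s)) \<le> (2 * X * exp (- (r\<^sup>2 / 8) * real m) * (1/2) ^ l) * (1/2 - 0)"
    proof (rule integral_bound)
      show "continuous_on {0..1/2} (\<lambda>s. of_real (s ^ l / fact l) * \<beta> l s)"
        by (intro continuous_intros c\<beta>) auto
      fix s :: real assume s: "s \<in> {0..1/2}"
      have "norm (\<beta> l s) \<le> 2 * (X * (exp (- (real m * s / 2)) * exp (- (r\<^sup>2 / 8) * real m) * (h ^ l * M l)))"
        using \<beta>b[OF s, of l] unfolding X_def .
      also have "\<dots> \<le> 2 * (X * (exp (- (real m * s / 2)) * exp (- (r\<^sup>2 / 8) * real m) * (real m / 16) ^ l))"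
        using X0 by (intro mult_left_mono hM l) auto
      finally have "s ^ l / fact l * norm (\<beta> l s) \<le> s ^ l / fact l * (2 * (X * (exp (- (real m * s / 2)) * exp (- (r\<^sup>2 / 8) * real m) * (real m / 16) ^ l)))"
        using s by (intro mult_left_mono) auto
      also have "\<dots> = 2 * X * exp (- (r\<^sup>2 / 8) * real m) * exp (- (real m * s / 2)) * (s ^ l / fact l * (real m / 16) ^ l)"
        by (simp only: mult_ac)
      also have "\<dots> \<le> 2 * X * exp (- (r\<^sup>2 / 8) * real m) * exp (- (real m * s / 2)) * ((1/2) ^ l * exp (real m * s / 8))"
        using X0 s by (intro mult_left_mono pf) auto
      also have "\<dots> = 2 * X * exp (- (r\<^sup>2 / 8) * real m) * (1/2) ^ l * (exp (- (real m * s / 2)) * exp (real m * s / 8))"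
        by (simp only: mult_ac)
      also have "\<dots> \<le> 2 * X * exp (- (r\<^sup>2 / 8) * real m) * (1/2) ^ l * 1"
        using X0 s mpos by (intro mult_left_mono) (auto simp: mult_exp_exp)
      finally show "norm (of_real (s ^ l / fact l) * \<beta> l s) \<le> 2 * X * exp (- (r\<^sup>2 / 8) * real m) * (1/2) ^ l"
        using s by (simp add: norm_mult norm_divide norm_power)
    qed auto
    with 1 show ?thesis unfolding N_def by simp
  qed
  have "(\<Sum>l<P. N l) \<le> (\<Sum>l<P. 2 * X * exp (- (r\<^sup>2 / 8) * real m) * (1/2) ^ l)"
    by (intro sum_mono Nb) auto
  also have "\<dots> = 2 * X * exp (- (r\<^sup>2 / 8) * real m) * (\<Sum>l<P. (1/2) ^ l)"
    by (simp add: sum_distrib_left)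
  also have "\<dots> \<le> 2 * X * exp (- (r\<^sup>2 / 8) * real m) * 2"
  proof (intro mult_left_mono)
    have "(\<Sum>l<P. (1/2::real) ^ l) = 2 - 2 * (1/2) ^ P" by (induction P) auto
    then show "(\<Sum>l<P. (1/2::real) ^ l) \<le> 2" by simp
  qed (use X0 in auto)
  finally have sumN: "(\<Sum>l<P. N l) \<le> 4 * X * exp (- (r\<^sup>2 / 8) * real m)" by simp
  have IP: "norm (I P) \<le> X * (real m * ((16 * h / real m) ^ P * M P))"
  proof (cases P)
    case 0
    have "norm (I P) \<le> X * 1"
      using Jb[of 0 0] M unfolding X_def 0 I_def by simp
    also have "\<dots> \<le> X * real m" using X0 m by (intro mult_left_mono) auto
    finally show ?thesis using 0 M by simp
  next
    case (Suc q)
    have "norm (integral {0..1/2} (\<lambda>s. of_real (s ^ q / fact q) * J (Suc q) s)) \<le> (X * ((2 / real m) ^ q * (h ^ P * M P))) * (1/2 - 0)"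
    proof (rule integral_bound)
      show "continuous_on {0..1/2} (\<lambda>s. of_real (s ^ q / fact q) * J (Suc q) s)"
        by (intro continuous_intros cJ) auto
      fix s :: real assume s: "s \<in> {0..1/2}"
      have "(real m * s / 2) ^ q \<le> fact q * exp (real m * s / 2)"
        using s mpos by (intro power_le_fact_exp) auto
      then have "s ^ q / fact q \<le> (2 / real m) ^ q * exp (real m * s / 2)"
        using mpos by (simp add: power_divide power_mult_distrib field_simps)
      then have "s ^ q / fact q * norm (J (Suc q) s) \<le> (2 / real m) ^ q * exp (real m * s / 2) * (X * (exp (- (real m * s / 2)) * (h ^ P * M P)))"
        using s Jb[OF s, of "Suc q"] Suc unfolding X_def by (intro mult_mono) auto
      also have "\<dots> = X * ((2 / real m) ^ q * (h ^ P * M P)) * (exp (real m * s / 2) * exp (- (real m * s / 2)))"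
        by (simp only: mult_ac)
      also have "\<dots> = X * ((2 / real m) ^ q * (h ^ P * M P))"
        by (simp add: mult_exp_exp)
      finally show "norm (of_real (s ^ q / fact q) * J (Suc q) s) \<le> X * ((2 / real m) ^ q * (h ^ P * M P))"
        using s by (simp add: norm_mult norm_divide norm_power)
    qed auto
    also have "\<dots> = X * (real m / 4 * ((2 * h / real m) ^ P * M P))"
      using mpos Suc by (simp add: power_divide power_mult_distrib field_simps)
    also have "\<dots> \<le> X * (real m * ((16 * h / real m) ^ P * M P))"
      using X0 h mpos less_imp_le[OF M(1)] by (intro mult_left_mono mult_mono power_mono divide_right_mono) auto
    finally show ?thesis using Suc by (simp add: I_def)
  qed
  have "norm (I 0) \<le> X * (real m * ((16 * h / real m) ^ P * M P)) + 4 * X * exp (- (r\<^sup>2 / 8) * real m)"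
    using sum[of P] IP sumN by linarith
  also have "\<dots> \<le> X * (real m * ((16 * h / real m) ^ p * M p)) + 4 * X * exp (- (r\<^sup>2 / 8) * real m)"
    using X0 P(2) by (intro add_right_mono mult_left_mono) auto
  finally show ?thesis
    by (simp add: I_def J_def X_def algebra_simps)
qed


text \<open>Under reflection of \<open>t\<close> the part with negative frequencies becomes the one
  with positive frequencies; the derivatives of the reflected function are
  \<open>(-1)^k * v k (- t)\<close>.\<close>

lemma ker_increment_bound:
  fixes v :: "nat \<Rightarrow> real \<Rightarrow> complex" and M :: "nat \<Rightarrow> real"
  assumes M: "\<And>p. 0 < M p" "M 0 = 1" and lc: "M1 M" and h: "h > 0" and C: "C \<ge> 0"
    and ab: "a \<le> b" "b - a \<le> 1" and r: "0 < r" "r \<le> 1" and x: "x \<in> {a + r..b - r}"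
    and z: "norm (z - of_real x) \<le> \<rho>" and rho: "\<rho> \<le> 1/4" "\<rho> \<le> r / 2" and m: "1 \<le> m"
    and v: "\<And>k t. t \<in> {a..b} \<Longrightarrow> (v k has_vector_derivative v (Suc k) t) (at t within {a..b})"
    and vb: "\<And>k t. t \<in> {a..b} \<Longrightarrow> norm (v k t) \<le> C * h ^ k * M k"
    and B: "B > 0" "\<And>w. \<bar>Re w\<bar> \<le> 2 \<Longrightarrow> \<bar>Im w\<bar> \<le> 2 \<Longrightarrow> norm (amp w) \<le> B"
  shows "norm (integral {a..b} (\<lambda>t. (ker (Suc m) (z - of_real t) - ker m (z - of_real t)) * v 0 t))
    \<le> 2 * (B * C * exp (3 * real m * \<rho>) * (real m * ((16 * h / real m) ^ p * M p) + 4 * exp (- (r\<^sup>2 / 8) * real m)))"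
proof -
  let ?R = "B * C * exp (3 * real m * \<rho>) * (real m * ((16 * h / real m) ^ p * M p) + 4 * exp (- (r\<^sup>2 / 8) * real m))"
  have cv: "continuous_on {a..b} (v k)" for k
    by (rule continuous_on_vector_derivative[OF v])
  have cgk: "continuous_on UNIV (gk m)" by (rule holomorphic_on_imp_continuous_on[OF holomorphic_on_gk])
  define u where "u = (\<lambda>k t. (-1) ^ k * v k (- t))"
  have "norm (integral {-b..-a} (\<lambda>t. gk m (- z - of_real t) * u 0 t)) \<le> ?R"
  proof (rule gk_integral_bound[OF M lc h C _ _ r _ _ rho m _ _ B])
    show "- x \<in> {- b + r..- a - r}" using x by auto
    show "norm (- z - of_real (- x)) \<le> \<rho>" using z by (simp add: norm_minus_commute)
    fix k :: nat and t assume t: "t \<in> {-b..-a}"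
    have "(v k has_vector_derivative v (Suc k) (- t)) (at (- t) within uminus ` {-b..-a})"
      using v[of "- t" k] t by simp
    moreover have "(uminus has_vector_derivative - 1) (at t within {-b..-a})"
      by (auto intro!: derivative_eq_intros)
    ultimately have "((v k \<circ> uminus) has_vector_derivative (- 1) *\<^sub>R v (Suc k) (- t)) (at t within {-b..-a})"
      by (rule vector_diff_chain_within[rotated])
    then have "((\<lambda>t. (-1) ^ k * v k (- t)) has_vector_derivative (-1) ^ k * ((- 1) *\<^sub>R v (Suc k) (- t))) (at t within {-b..-a})"
      unfolding o_def by (rule has_vector_derivative_mult_right)
    then show "(u k has_vector_derivative u (Suc k) t) (at t within {-b..-a})"
      by (simp add: u_def)
    show "norm (u k t) \<le> C * h ^ k * M k"
      using vb[of "- t" k] t by (simp add: u_def norm_mult norm_power)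
  qed (use ab in auto)
  moreover have "integral {-b..-a} (\<lambda>t. gk m (- z - of_real t) * u 0 t) = integral {a..b} (\<lambda>t. gk m (- (z - of_real t)) * v 0 t)"
    using Henstock_Kurzweil_Integration.integral_reflect_real[where a = a and b = b and f = "\<lambda>t. gk m (- (z - of_real t)) * v 0 t"]
    by (simp add: u_def)
  ultimately have 1: "norm (integral {a..b} (\<lambda>t. gk m (- (z - of_real t)) * v 0 t)) \<le> ?R" by simp
  have 2: "norm (integral {a..b} (\<lambda>t. gk m (z - of_real t) * v 0 t)) \<le> ?R"
    by (rule gk_integral_bound[OF M lc h C ab r x z rho m v vb B])
  have "integral {a..b} (\<lambda>t. (ker (Suc m) (z - of_real t) - ker m (z - of_real t)) * v 0 t)
     = integral {a..b} (\<lambda>t. gk m (z - of_real t) * v 0 t + gk m (- (z - of_real t)) * v 0 t)"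
    by (simp only: ker_Suc_diff ring_distribs)
  also have "\<dots> = integral {a..b} (\<lambda>t. gk m (z - of_real t) * v 0 t) + integral {a..b} (\<lambda>t. gk m (- (z - of_real t)) * v 0 t)"
    by (intro integral_add integrable_continuous_interval continuous_on_mult cv continuous_on_compose2[OF cgk]) (auto intro!: continuous_intros)
  finally show ?thesis using 1 2 norm_triangle_mono by fastforce
qed


section \<open>The kernels as an approximate identity\<close>

lemma gauss_integral_le:
  assumes m: "1 \<le> m" and ab: "a \<le> b"
  shows "integral {a..b} (\<lambda>t. exp (- (real m * (t - x)\<^sup>2 / 2))) \<le> pi / sqrt (real m / 2)"
proof -
  define s where "s = sqrt (real m / 2)"
  have s: "s > 0" "s\<^sup>2 = real m / 2" using m by (auto simp: s_def)
  \<comment> \<open>The Gaussian is dominated by a Cauchy density, whose primitive is an arctangent.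
    Only the decay like \<open>1 / sqrt m\<close> matters, not the constant.\<close>
  have "((\<lambda>t. 1 / (1 + (s * (t - x))\<^sup>2)) has_integral (arctan (s * (b - x)) / s - arctan (s * (a - x)) / s)) {a..b}"
  proof (rule fundamental_theorem_of_calculus[OF ab])
    fix t
    have "((\<lambda>t. arctan (s * (t - x)) / s) has_real_derivative (inverse (1 + (s * (t - x))\<^sup>2) * s) / s) (at t within {a..b})"
      using s by (auto intro!: derivative_eq_intros)
    then show "((\<lambda>t. arctan (s * (t - x)) / s) has_vector_derivative 1 / (1 + (s * (t - x))\<^sup>2)) (at t within {a..b})"
      using s by (simp add: has_real_derivative_iff_has_vector_derivative inverse_eq_divide)
  qed
  note I = this
  have "integral {a..b} (\<lambda>t. exp (- (real m * (t - x)\<^sup>2 / 2))) \<le> integral {a..b} (\<lambda>t. 1 / (1 + (s * (t - x))\<^sup>2))"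
  proof (rule integral_le)
    show "(\<lambda>t. exp (- (real m * (t - x)\<^sup>2 / 2))) integrable_on {a..b}"
      by (intro integrable_continuous_interval continuous_intros) auto
    show "(\<lambda>t. 1 / (1 + (s * (t - x))\<^sup>2)) integrable_on {a..b}"
      using I by blast
    fix t
    have "1 + real m * (t - x)\<^sup>2 / 2 \<le> exp (real m * (t - x)\<^sup>2 / 2)"
      by (rule exp_ge_add_one_self)
    moreover have "0 < 1 + real m * (t - x)\<^sup>2 / 2" by (simp add: add_pos_nonneg)
    ultimately have "1 / exp (real m * (t - x)\<^sup>2 / 2) \<le> 1 / (1 + real m * (t - x)\<^sup>2 / 2)"
      by (intro divide_left_mono mult_pos_pos) auto
    then show "exp (- (real m * (t - x)\<^sup>2 / 2)) \<le> 1 / (1 + (s * (t - x))\<^sup>2)"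
      by (simp add: power_mult_distrib s(2) exp_minus inverse_eq_divide)
  qed
  also have "\<dots> = arctan (s * (b - x)) / s - arctan (s * (a - x)) / s"
    using I by (rule integral_unique)
  also have "\<dots> \<le> pi / s"
  proof -
    have "arctan (s * (b - x)) - arctan (s * (a - x)) \<le> pi"
      using arctan_ubound[of "s * (b - x)"] arctan_lbound[of "s * (a - x)"] by linarith
    then show ?thesis using s(1) by (simp add: divide_right_mono flip: diff_divide_distrib)
  qed
  finally show ?thesis by (simp add: s_def)
qed

lemma gauss_bound_tendsto_0: "(\<lambda>m. C * (pi / sqrt (real m / 2))) \<longlonglongrightarrow> 0"
  by real_asymp

text \<open>The kernel at real arguments, written with \<open>sinc\<close> so that the sine integral
  \<open>Si\<close> supplies a primitive of the undamped part.\<close>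

definition kr :: "nat \<Rightarrow> real \<Rightarrow> real" where
  "kr m t = real m / pi * sinc (real m * t) * exp (- (real m * t\<^sup>2 / 2))"

lemma ker_of_real: "ker m (of_real t) = of_real (kr m t)"
proof -
  have e1: "sin (of_nat m * complex_of_real t) = of_real (sin (real m * t))"
    by (metis of_real_mult of_real_of_nat_eq sin_of_real)
  have "complex_of_real (exp (- (real m * t\<^sup>2 / 2))) = exp (of_real (- (real m * t\<^sup>2 / 2)))"
    by (rule exp_of_real[symmetric])
  then have e2: "exp (- (of_nat m * (complex_of_real t)\<^sup>2 / 2)) = of_real (exp (- (real m * t\<^sup>2 / 2)))"
    by simp
  show ?thesis
    unfolding ker_def kr_def e1 e2 by (cases "m = 0") (auto simp: mult.commute)
qed

lemma kr_even: "kr m (- t) = kr m t"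
  by (simp add: kr_def)

lemma continuous_on_kr [continuous_intros]: "continuous_on S f \<Longrightarrow> continuous_on S (\<lambda>t. kr m (f t))"
  unfolding kr_def by (intro continuous_intros) auto

text \<open>\<open>Si(m t) / \<pi> - 1/2\<close> is the primitive of the undamped kernel that
  vanishes at infinity. Integration by parts puts the derivative on the Gaussian: the boundary term
  at 0 contributes \<open>1/2\<close>, the one at \<open>d\<close> tends to 0, and the remainder
  \<open>R\<close> tends to 0 because \<open>Si\<close> is close to \<open>\<pi> / 2\<close> except
  on a bounded range of arguments.\<close>

lemma kr_half_tendsto:
  assumes d: "d > 0"
  shows "(\<lambda>m. integral {0..d} (kr m)) \<longlonglongrightarrow> 1/2"
proof -
  obtain B0 where B0: "\<And>T. \<bar>Si T\<bar> \<le> B0" using bounded_Si by blast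
  define B where "B = B0 + pi / 2"
  have B: "\<bar>Si T\<bar> \<le> B" "\<bar>Si T - pi / 2\<bar> \<le> B" for T
    using B0[of T] pi_gt_zero unfolding B_def by linarith+
  have B0': "B \<ge> 0" using B(1)[of 0] by linarith
  define e where "e = (\<lambda>m t. exp (- (real m * t\<^sup>2 / 2)))"
  define R where "R = (\<lambda>m. integral {0..d} (\<lambda>t. (Si (real m * t) - pi / 2) * (real m * t) * e m t))"
  have contSi: "continuous_on S Si" for S
    using isCont_Si continuous_at_imp_continuous_on by blast
  have id: "integral {0..d} (kr m) = (Si (real m * d) / pi - 1/2) * e m d + 1/2 + R m / pi" for m
  proof -
    have "((\<lambda>t. kr m t - (Si (real m * t) - pi / 2) * (real m * t) * e m t / pi) has_integral
        ((Si (real m * d) / pi - 1/2) * e m d - (Si (real m * 0) / pi - 1/2) * e m 0)) {0..d}"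
    proof (rule fundamental_theorem_of_calculus)
      fix t
      have "((\<lambda>t. Si (real m * t)) has_real_derivative sinc (real m * t) * real m) (at t within {0..d})"
        by (rule DERIV_chain2[OF DERIV_Si]) (auto intro!: derivative_eq_intros)
      moreover have "(e m has_real_derivative e m t * (- (real m * t))) (at t within {0..d})"
        unfolding e_def by (auto intro!: derivative_eq_intros)
      ultimately have "((\<lambda>t. (Si (real m * t) / pi - 1/2) * e m t) has_real_derivative
          (sinc (real m * t) * real m / pi) * e m t + (e m t * (- (real m * t))) * (Si (real m * t) / pi - 1/2)) (at t within {0..d})"
        by (intro DERIV_mult DERIV_cdivide derivative_intros) (auto intro!: derivative_eq_intros)
      moreover have "(sinc (real m * t) * real m / pi) * e m t + (e m t * (- (real m * t))) * (Si (real m * t) / pi - 1/2)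
        = kr m t - (Si (real m * t) - pi / 2) * (real m * t) * e m t / pi"
        unfolding kr_def e_def by (simp add: field_simps)
      ultimately show "((\<lambda>t. (Si (real m * t) / pi - 1/2) * e m t) has_vector_derivative
          kr m t - (Si (real m * t) - pi / 2) * (real m * t) * e m t / pi) (at t within {0..d})"
        by (simp add: has_real_derivative_iff_has_vector_derivative)
    qed (use d in auto)
    moreover have "((\<lambda>t. (Si (real m * t) - pi / 2) * (real m * t) * e m t / pi) has_integral R m / pi) {0..d}"
      unfolding R_def
      by (intro has_integral_divide integrable_integral integrable_continuous_interval)
         (auto simp: e_def intro!: continuous_intros continuous_on_compose2[OF contSi[of UNIV]])
    ultimately have "((\<lambda>t. (kr m t - (Si (real m * t) - pi / 2) * (real m * t) * e m t / pi) + (Si (real m * t) - pi / 2) * (real m * t) * e m t / pi) has_integral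
        ((Si (real m * d) / pi - 1/2) * e m d - (Si (real m * 0) / pi - 1/2) * e m 0) + R m / pi) {0..d}"
      by (rule has_integral_add)
    moreover have "Si 0 = 0" using Si_neg[of 0] by simp
    ultimately show ?thesis
      by (intro integral_unique) (simp add: e_def)
  qed
  have R0: "R \<longlonglongrightarrow> 0"
  proof (rule LIMSEQ_I)
    fix \<epsilon> :: real assume eps: "\<epsilon> > 0"
    define \<epsilon>' where "\<epsilon>' = \<epsilon> / 2"
    have eps': "\<epsilon>' > 0" using eps by (simp add: \<epsilon>'_def)
    obtain T0 where T0: "\<And>y. y \<ge> T0 \<Longrightarrow> \<bar>Si y - pi / 2\<bar> < \<epsilon>'"
      using tendstoD[OF Si_at_top eps'] unfolding eventually_at_top_linorder dist_real_def by blast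
    define T where "T = max T0 0"
    \<comment> \<open>Beyond \<open>T\<close> the first factor is small; below \<open>T\<close> it
      is bounded and \<open>y\<close> is at most \<open>T\<close>. Against the Gaussian, the first
      summand is integrated exactly and the second is of order \<open>1 / sqrt m\<close>.\<close>
    have pw: "\<bar>(Si y - pi / 2) * y\<bar> \<le> \<epsilon>' * y + B * T" if "y \<ge> 0" for y
    proof (cases "y \<ge> T")
      case True
      then have "\<bar>Si y - pi / 2\<bar> * y \<le> \<epsilon>' * y"
        using T0[of y] that by (intro mult_right_mono) (auto simp: T_def)
      moreover have "B * T \<ge> 0" using B0' by (simp add: T_def)
      ultimately show ?thesis using that by (simp add: abs_mult)
    next
      case False
      then have "\<bar>Si y - pi / 2\<bar> * y \<le> B * T"
        using B(2)[of y] that B0' by (intro mult_mono) auto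
      moreover have "\<epsilon>' * y \<ge> 0" using eps' that by simp
      ultimately show ?thesis using that by (simp add: abs_mult)
    qed
    have "(\<lambda>m. B * T * (pi / sqrt (real m / 2))) \<longlonglongrightarrow> 0" by (rule gauss_bound_tendsto_0)
    then have "\<forall>\<^sub>F m in sequentially. \<bar>B * T * (pi / sqrt (real m / 2))\<bar> < \<epsilon>'"
      using tendstoD[OF _ eps'] by fastforce
    then have "\<forall>\<^sub>F m in sequentially. norm (R m - 0) < \<epsilon>"
      using eventually_ge_at_top[of 1]
    proof eventually_elim
      case (elim m)
      have ie: "((\<lambda>t. real m * t * e m t) has_integral (- e m d - (- e m 0))) {0..d}"
      proof (rule fundamental_theorem_of_calculus)
        fix t
        have "((\<lambda>t. - e m t) has_real_derivative real m * t * e m t) (at t within {0..d})"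
          unfolding e_def by (auto intro!: derivative_eq_intros)
        then show "((\<lambda>t. - e m t) has_vector_derivative real m * t * e m t) (at t within {0..d})"
          by (simp add: has_real_derivative_iff_has_vector_derivative)
      qed (use d in auto)
      have "norm (R m) \<le> integral {0..d} (\<lambda>t. \<epsilon>' * (real m * t * e m t) + B * T * e m t)"
        unfolding R_def
      proof (rule Henstock_Kurzweil_Integration.integral_norm_bound_integral)
        show "(\<lambda>t. (Si (real m * t) - pi / 2) * (real m * t) * e m t) integrable_on {0..d}"
          by (intro integrable_continuous_interval)
            (auto simp: e_def intro!: continuous_intros continuous_on_compose2[OF contSi[of UNIV]])
        show "(\<lambda>t. \<epsilon>' * (real m * t * e m t) + B * T * e m t) integrable_on {0..d}"
          by (intro integrable_continuous_interval) (auto simp: e_def intro!: continuous_intros)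
        fix t assume "t \<in> {0..d}"
        then have "\<bar>(Si (real m * t) - pi / 2) * (real m * t)\<bar> * e m t \<le> (\<epsilon>' * (real m * t) + B * T) * e m t"
          by (intro mult_right_mono pw) (auto simp: e_def)
        moreover have "norm ((Si (real m * t) - pi / 2) * (real m * t) * e m t) = \<bar>(Si (real m * t) - pi / 2) * (real m * t)\<bar> * e m t"
          by (simp add: abs_mult e_def)
        ultimately show "norm ((Si (real m * t) - pi / 2) * (real m * t) * e m t) \<le> \<epsilon>' * (real m * t * e m t) + B * T * e m t"
          by (simp add: distrib_right mult.assoc)
      qed
      also have "\<dots> = \<epsilon>' * (1 - e m d) + B * T * integral {0..d} (e m)"
      proof (rule integral_unique, intro has_integral_add has_integral_mult_right integrable_integral)
        show "((\<lambda>t. real m * t * e m t) has_integral (1 - e m d)) {0..d}"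
          using ie by (simp add: e_def)
        show "e m integrable_on {0..d}"
          by (intro integrable_continuous_interval) (auto simp: e_def intro!: continuous_intros)
      qed
      also have "\<dots> \<le> \<epsilon>' * 1 + B * T * (pi / sqrt (real m / 2))"
        using eps' B0' gauss_integral_le[OF elim(2), of 0 d 0] d
        by (intro add_mono mult_left_mono) (auto simp: e_def T_def)
      also have "\<dots> < \<epsilon>"
        using abs_le_D1[OF less_imp_le[OF elim(1)]] elim(1) unfolding \<epsilon>'_def by linarith
      finally show ?case by simp
    qed
    then show "\<exists>no. \<forall>n\<ge>no. norm (R n - 0) < \<epsilon>" by (simp add: eventually_sequentially)
  qed
  have E0: "(\<lambda>m. (Si (real m * d) / pi - 1/2) * e m d) \<longlonglongrightarrow> 0"
  proof (rule Lim_null_comparison)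
    show "\<forall>\<^sub>F m in sequentially. norm ((Si (real m * d) / pi - 1/2) * e m d) \<le> B / pi * e m d"
    proof (intro always_eventually allI)
      fix m
      have "\<bar>Si (real m * d) / pi - 1/2\<bar> = \<bar>Si (real m * d) - pi/2\<bar> / pi" 
      proof -
        have "Si (real m * d) / pi - 1/2 = (Si (real m * d) - pi/2) / pi" by (simp add: diff_divide_distrib)
        then show ?thesis by (simp add: abs_divide)
      qed
      also have "\<dots> \<le> B / pi" using B(2) by (intro divide_right_mono) auto
      finally have "\<bar>Si (real m * d) / pi - 1/2\<bar> * e m d \<le> B / pi * e m d"
        by (rule mult_right_mono) (simp add: e_def)
      then show "norm ((Si (real m * d) / pi - 1/2) * e m d) \<le> B / pi * e m d"
        by (simp add: abs_mult e_def)
    qed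
    show "(\<lambda>m. B / pi * e m d) \<longlonglongrightarrow> 0"
      unfolding e_def using d by real_asymp
  qed
  have "(\<lambda>m. (Si (real m * d) / pi - 1/2) * e m d + 1/2 + R m / pi) \<longlonglongrightarrow> 0 + 1/2 + 0 / pi"
    by (intro tendsto_intros E0 R0) auto
  then show ?thesis by (simp add: id)
qed

lemma kr_integral_tendsto:
  assumes "a < x" "x < b"
  shows "(\<lambda>m. integral {a..b} (\<lambda>t. kr m (x - t))) \<longlonglongrightarrow> 1"
proof -
  have "integral {a..b} (\<lambda>t. kr m (x - t)) = integral {0..x - a} (kr m) + integral {0..b - x} (kr m)" for m
  proof -
    have "integral {a..b} (\<lambda>t. kr m (x - t)) = integral {a..x} (\<lambda>t. kr m (x - t)) + integral {x..b} (\<lambda>t. kr m (x - t))"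
      using assms by (intro Henstock_Kurzweil_Integration.integral_combine[symmetric] integrable_continuous_interval continuous_intros) auto
    also have "integral {x..b} (\<lambda>t. kr m (x - t)) = integral {x..b} (\<lambda>t. kr m (t + (- x)))"
      by (rule arg_cong[where f = "integral {x..b}"]) (use kr_even[of m "x - t" for t] in \<open>simp add: fun_eq_iff\<close>)
    also have "\<dots> = integral {0..b - x} (kr m)"
      using integral_shift_real_ivl[where a = 0 and b = "b - x" and c = "- x" and f = "kr m"] by simp
    also have "integral {a..x} (\<lambda>t. kr m (x - t)) = integral {-x..-a} (\<lambda>t. kr m (t + x))"
      using Henstock_Kurzweil_Integration.integral_reflect_real[where a = a and b = x and f = "\<lambda>t. kr m (x - t)"] by (simp add: add.commute)
    also have "\<dots> = integral {0..x - a} (kr m)"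
      using integral_shift_real_ivl[where a = 0 and b = "x - a" and c = x and f = "kr m"] by simp
    finally show ?thesis .
  qed
  moreover have "(\<lambda>m. integral {0..x - a} (kr m) + integral {0..b - x} (kr m)) \<longlonglongrightarrow> 1/2 + 1/2"
    using assms by (intro tendsto_add kr_half_tendsto) auto
  ultimately show ?thesis by simp
qed

text \<open>The absolute mass of the kernels grows with \<open>m\<close>, so the oscillation is
  exploited only for the constant \<open>v x\<close>. In the rest the Lipschitz bound cancels the
  denominator of the kernel and leaves a Gaussian integral, which tends to 0.\<close>

lemma ker_integral_tendsto:
  assumes x: "a < x" "x < b" and v: "continuous_on {a..b} v"
    and lip: "\<And>t. t \<in> {a..b} \<Longrightarrow> norm (v t - v x) \<le> C * \<bar>t - x\<bar>"
  shows "(\<lambda>m. integral {a..b} (\<lambda>t. ker m (of_real x - of_real t) * v t)) \<longlonglongrightarrow> v x"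
proof -
  have C: "C \<ge> 0" using lip[of b] x by (smt (verit) norm_ge_zero atLeastAtMost_iff mult_nonneg_nonneg zero_le_mult_iff)
  have ck: "continuous_on UNIV (ker m)" for m by (rule holomorphic_on_imp_continuous_on[OF holomorphic_on_ker])
  have split: "integral {a..b} (\<lambda>t. ker m (of_real x - of_real t) * v t)
    = of_real (integral {a..b} (\<lambda>t. kr m (x - t))) * v x
      + integral {a..b} (\<lambda>t. ker m (of_real x - of_real t) * (v t - v x))" for m
  proof -
    have "((\<lambda>t. of_real (kr m (x - t)) * v x) has_integral of_real (integral {a..b} (\<lambda>t. kr m (x - t))) * v x) {a..b}"
      by (intro has_integral_mult_left has_integral_of_real integrable_integral integrable_continuous_interval continuous_intros)
    moreover have "((\<lambda>t. ker m (of_real x - of_real t) * (v t - v x)) has_integral integral {a..b} (\<lambda>t. ker m (of_real x - of_real t) * (v t - v x))) {a..b}"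
      by (intro integrable_integral integrable_continuous_interval continuous_intros v continuous_on_compose2[OF ck]) auto
    ultimately have "((\<lambda>t. of_real (kr m (x - t)) * v x + ker m (of_real x - of_real t) * (v t - v x)) has_integral
      of_real (integral {a..b} (\<lambda>t. kr m (x - t))) * v x + integral {a..b} (\<lambda>t. ker m (of_real x - of_real t) * (v t - v x))) {a..b}"
      by (rule has_integral_add)
    moreover have "of_real (kr m (x - t)) * v x + ker m (of_real x - of_real t) * (v t - v x) = ker m (of_real x - of_real t) * v t" for t
      using ker_of_real[of m "x - t"] by (simp add: algebra_simps)
    ultimately show ?thesis by (simp add: integral_unique)
  qed
  have "(\<lambda>m. integral {a..b} (\<lambda>t. ker m (of_real x - of_real t) * (v t - v x))) \<longlonglongrightarrow> 0"
  proof (rule Lim_null_comparison)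
    show "(\<lambda>m. C * (pi / sqrt (real m / 2))) \<longlonglongrightarrow> 0" by (rule gauss_bound_tendsto_0)
    show "\<forall>\<^sub>F m in sequentially. norm (integral {a..b} (\<lambda>t. ker m (of_real x - of_real t) * (v t - v x))) \<le> C * (pi / sqrt (real m / 2))"
      using eventually_ge_at_top[of 1]
    proof eventually_elim
      case (elim m)
      have "norm (integral {a..b} (\<lambda>t. ker m (of_real x - of_real t) * (v t - v x)))
        \<le> integral {a..b} (\<lambda>t. C * exp (- (real m * (t - x)\<^sup>2 / 2)))"
      proof (rule Henstock_Kurzweil_Integration.integral_norm_bound_integral)
        show "(\<lambda>t. ker m (of_real x - of_real t) * (v t - v x)) integrable_on {a..b}"
          by (intro integrable_continuous_interval continuous_intros v continuous_on_compose2[OF ck]) auto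
        show "(\<lambda>t. C * exp (- (real m * (t - x)\<^sup>2 / 2))) integrable_on {a..b}"
          by (intro integrable_continuous_interval continuous_intros) auto
        fix t assume t: "t \<in> {a..b}"
        have k: "\<bar>kr m (x - t)\<bar> * \<bar>t - x\<bar> \<le> exp (- (real m * (t - x)\<^sup>2 / 2))"
        proof (cases "t = x")
          case False
          have "\<bar>kr m (x - t)\<bar> * \<bar>t - x\<bar> = \<bar>sin (real m * (x - t))\<bar> / pi * exp (- (real m * (t - x)\<^sup>2 / 2))"
          proof -
            have "kr m (x - t) = sin (real m * (x - t)) / (pi * (x - t)) * exp (- (real m * (t - x)\<^sup>2 / 2))"
              using False elim by (simp add: kr_def power2_commute[of x t])
            then show ?thesis using False by (simp add: abs_mult abs_minus_commute[of x t])
          qed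
          also have "\<dots> \<le> 1 * exp (- (real m * (t - x)\<^sup>2 / 2))"
          proof (intro mult_right_mono)
            have "\<bar>sin (real m * (x - t))\<bar> \<le> pi"
              using abs_sin_le_one[of "real m * (x - t)"] pi_ge_two by linarith
            then show "\<bar>sin (real m * (x - t))\<bar> / pi \<le> 1" by simp
          qed auto
          finally show ?thesis by simp
        qed auto
        have "norm (ker m (of_real x - of_real t) * (v t - v x)) = \<bar>kr m (x - t)\<bar> * norm (v t - v x)"
          using ker_of_real[of m "x - t"] by (simp add: norm_mult)
        also have "\<dots> \<le> \<bar>kr m (x - t)\<bar> * (C * \<bar>t - x\<bar>)"
          using lip[OF t] by (intro mult_left_mono) auto
        also have "\<dots> = C * (\<bar>kr m (x - t)\<bar> * \<bar>t - x\<bar>)" by simp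
        also have "\<dots> \<le> C * exp (- (real m * (t - x)\<^sup>2 / 2))" using C k by (intro mult_left_mono) auto
        finally show "norm (ker m (of_real x - of_real t) * (v t - v x)) \<le> C * exp (- (real m * (t - x)\<^sup>2 / 2))" .
      qed
      also have "\<dots> = C * integral {a..b} (\<lambda>t. exp (- (real m * (t - x)\<^sup>2 / 2)))" by simp
      also have "\<dots> \<le> C * (pi / sqrt (real m / 2))"
        using C x by (intro mult_left_mono gauss_integral_le elim) auto
      finally show ?case .
    qed
  qed
  moreover have "(\<lambda>m. of_real (integral {a..b} (\<lambda>t. kr m (x - t))) * v x) \<longlonglongrightarrow> of_real 1 * v x"
    by (intro tendsto_intros kr_integral_tendsto x)
  ultimately show ?thesis
    using tendsto_add by (fastforce simp: split)
qed


section \<open>Iterated kernel operators\<close>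

text \<open>\<open>F\<close> is defined on complex vectors although only real values of the
  integrated coordinate enter. In this form the operators for different coordinates can be composed,
  each of them making one more variable holomorphic.\<close>

definition Top :: "(complex \<Rightarrow> complex) \<Rightarrow> real^'d::finite \<Rightarrow> real^'d \<Rightarrow> 'd \<Rightarrow> (complex^'d \<Rightarrow> complex) \<Rightarrow> complex^'d \<Rightarrow> complex" where
  "Top \<kappa> a b j F z = integral {a $ j..b $ j} (\<lambda>t. \<kappa> (z $ j - of_real t) * F (upd z j (of_real t)))"

abbreviation Sop :: "(complex \<Rightarrow> complex) \<Rightarrow> real^'d::finite \<Rightarrow> real^'d \<Rightarrow> 'd list \<Rightarrow> (complex^'d \<Rightarrow> complex) \<Rightarrow> complex^'d \<Rightarrow> complex" where
  "Sop \<kappa> a b js F \<equiv> foldr (Top \<kappa> a b) js F"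

lemma continuous_on_Top_integrand:
  assumes \<kappa>: "\<kappa> holomorphic_on UNIV" and F: "continuous_on UNIV F"
    and f: "continuous_on S f" and g: "continuous_on S g"
  shows "continuous_on S (\<lambda>x. \<kappa> (f x $ j - of_real (g x)) * F (upd (f x) j (of_real (g x))))"
  by (intro continuous_intros continuous_on_compose2[OF holomorphic_on_imp_continuous_on[OF \<kappa>]]
      continuous_on_compose2[OF F] f g) auto

lemma Top_integrable:
  assumes "\<kappa> holomorphic_on UNIV" "continuous_on UNIV F"
  shows "(\<lambda>t. \<kappa> (z $ j - of_real t) * F (upd z j (of_real t))) integrable_on {c..d}"
  by (intro integrable_continuous_interval continuous_on_Top_integrand[OF assms] continuous_intros)

lemma continuous_on_Top:
  assumes "\<kappa> holomorphic_on UNIV" "continuous_on UNIV F"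
  shows "continuous_on UNIV (Top \<kappa> a b j F)"
proof -
  have "continuous_on UNIV (\<lambda>z. integral (cbox (a $ j) (b $ j)) (\<lambda>t. \<kappa> (z $ j - of_real t) * F (upd z j (of_real t))))"
    by (rule integral_continuous_on_param, unfold case_prod_unfold)
       (intro continuous_on_Top_integrand[OF assms] continuous_intros)
  then show ?thesis by (simp add: Top_def[abs_def])
qed

lemma holomorphic_Top_same:
  assumes \<kappa>: "\<kappa> holomorphic_on UNIV" and F: "continuous_on UNIV F"
  shows "(\<lambda>\<zeta>. Top \<kappa> a b j F (upd z j \<zeta>)) holomorphic_on UNIV"
proof -
  have "(\<lambda>\<zeta>. integral (cbox (a $ j) (b $ j)) (\<lambda>t. \<kappa> (\<zeta> - of_real t) * F (upd z j (of_real t)))) holomorphic_on UNIV"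
  proof (rule holomorphic_integral_param)
    show "continuous_on (UNIV \<times> cbox (a $ j) (b $ j)) (\<lambda>(\<zeta>, t). \<kappa> (\<zeta> - of_real t) * F (upd z j (of_real t)))"
      unfolding case_prod_unfold
      by (intro continuous_intros continuous_on_compose2[OF holomorphic_on_imp_continuous_on[OF \<kappa>]]
          continuous_on_compose2[OF F]) auto
    fix t
    have "(\<kappa> \<circ> (\<lambda>\<zeta>. \<zeta> - of_real t)) holomorphic_on UNIV"
      by (intro holomorphic_on_compose holomorphic_intros holomorphic_on_subset[OF \<kappa>]) auto
    then show "(\<lambda>\<zeta>. \<kappa> (\<zeta> - of_real t) * F (upd z j (of_real t))) holomorphic_on UNIV"
      by (intro holomorphic_intros) (simp add: o_def)
  qed
  then show ?thesis by (simp add: Top_def)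
qed

lemma holomorphic_Top_other:
  assumes \<kappa>: "\<kappa> holomorphic_on UNIV" and F: "continuous_on UNIV F"
    and hol: "\<And>z. (\<lambda>\<zeta>. F (upd z i \<zeta>)) holomorphic_on UNIV" and ij: "i \<noteq> j"
  shows "(\<lambda>\<zeta>. Top \<kappa> a b j F (upd z i \<zeta>)) holomorphic_on UNIV"
proof -
  have "(\<lambda>\<zeta>. integral (cbox (a $ j) (b $ j)) (\<lambda>t. \<kappa> (z $ j - of_real t) * F (upd (upd z j (of_real t)) i \<zeta>))) holomorphic_on UNIV"
  proof (rule holomorphic_integral_param)
    show "continuous_on (UNIV \<times> cbox (a $ j) (b $ j)) (\<lambda>(\<zeta>, t). \<kappa> (z $ j - of_real t) * F (upd (upd z j (of_real t)) i \<zeta>))"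
      unfolding case_prod_unfold
      by (intro continuous_intros continuous_on_compose2[OF holomorphic_on_imp_continuous_on[OF \<kappa>]]
          continuous_on_compose2[OF F]) auto
    show "(\<lambda>\<zeta>. \<kappa> (z $ j - of_real t) * F (upd (upd z j (of_real t)) i \<zeta>)) holomorphic_on UNIV" for t
      by (intro holomorphic_intros hol)
  qed
  then show ?thesis using ij by (simp add: Top_def upd_commute[OF ij])
qed

lemma continuous_on_Sop:
  assumes "\<kappa> holomorphic_on UNIV" "continuous_on UNIV F"
  shows "continuous_on UNIV (Sop \<kappa> a b js F)"
  using assms(2) by (induction js) (auto intro: continuous_on_Top[OF assms(1)])

text \<open>A variable becomes holomorphic with its own kernel operator, since it then occurs in the
  kernel only, and remains so under the operators of the other coordinates.\<close>

lemma holomorphic_Sop: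
  assumes \<kappa>: "\<kappa> holomorphic_on UNIV" and F: "continuous_on UNIV F" and i: "i \<in> set js"
  shows "(\<lambda>\<zeta>. Sop \<kappa> a b js F (upd z i \<zeta>)) holomorphic_on UNIV"
  using i
proof (induction js arbitrary: z)
  case (Cons j js)
  note c = continuous_on_Sop[OF \<kappa> F, of a b js]
  show ?case
  proof (cases "i = j")
    case True
    then show ?thesis using holomorphic_Top_same[OF \<kappa> c] by simp
  next
    case False
    then have "i \<in> set js" using Cons.prems by simp
    then show ?thesis using holomorphic_Top_other[OF \<kappa> c Cons.IH False] by simp
  qed
qed simp

lemma entire_Sop:
  assumes "\<kappa> holomorphic_on UNIV" "continuous_on UNIV F" "set js = UNIV"
  shows "entire (Sop \<kappa> a b js F)"
  unfolding entire_def using continuous_on_Sop holomorphic_Sop assms by blast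

lemma norm_Top_le:
  assumes \<kappa>: "\<kappa> holomorphic_on UNIV" and F: "continuous_on UNIV F"
    and ab: "a $ j \<le> b $ j" "b $ j - a $ j \<le> 1" and N: "0 \<le> N" and C: "0 \<le> C"
    and k: "\<And>t. t \<in> {a $ j..b $ j} \<Longrightarrow> norm (\<kappa> (z $ j - of_real t)) \<le> N"
    and f: "\<And>t. t \<in> {a $ j..b $ j} \<Longrightarrow> norm (F (upd z j (of_real t))) \<le> C"
  shows "norm (Top \<kappa> a b j F z) \<le> N * C"
proof -
  have "norm (Top \<kappa> a b j F z) \<le> N * C * (b $ j - a $ j)"
    unfolding Top_def
  proof (rule integral_bound[OF ab(1)])
    show "continuous_on {a $ j..b $ j} (\<lambda>t. \<kappa> (z $ j - of_real t) * F (upd z j (of_real t)))"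
      by (intro continuous_on_Top_integrand[OF \<kappa> F] continuous_intros)
    show "norm (\<kappa> (z $ j - of_real t) * F (upd z j (of_real t))) \<le> N * C" if "t \<in> {a $ j..b $ j}" for t
      unfolding norm_mult using N by (intro mult_mono k f that) auto
  qed
  also have "\<dots> \<le> N * C * 1" using N C ab by (intro mult_left_mono) auto
  finally show ?thesis by simp
qed

lemma Top_diff:
  assumes "\<kappa> holomorphic_on UNIV" "continuous_on UNIV F" "continuous_on UNIV G"
  shows "Top \<kappa> a b j (\<lambda>w. F w - G w) z = Top \<kappa> a b j F z - Top \<kappa> a b j G z"
  unfolding Top_def right_diff_distrib
  by (intro integral_diff Top_integrable assms)

lemma Top_kernel_diff:
  assumes "\<kappa> holomorphic_on UNIV" "\<kappa>' holomorphic_on UNIV" "continuous_on UNIV F"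
  shows "Top (\<lambda>w. \<kappa> w - \<kappa>' w) a b j F z = Top \<kappa> a b j F z - Top \<kappa>' a b j F z"
  unfolding Top_def left_diff_distrib
  by (intro integral_diff Top_integrable assms)

lemma Top_commute:
  assumes \<kappa>: "\<kappa> holomorphic_on UNIV" "\<kappa>' holomorphic_on UNIV" and F: "continuous_on UNIV F" and ij: "i \<noteq> j"
  shows "Top \<kappa> a b i (Top \<kappa>' a b j F) = Top \<kappa>' a b j (Top \<kappa> a b i F)"
proof
  fix z
  define G where "G = (\<lambda>s t. \<kappa> (z $ i - of_real s) * (\<kappa>' (z $ j - of_real t) * F (upd (upd z i (of_real s)) j (of_real t))))"
  have "continuous_on (cbox (a $ i, a $ j) (b $ i, b $ j)) (\<lambda>(s, t). G s t)"
    unfolding G_def case_prod_unfold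
    by (intro continuous_intros continuous_on_compose2[OF holomorphic_on_imp_continuous_on[OF \<kappa>(1)]]
        continuous_on_compose2[OF holomorphic_on_imp_continuous_on[OF \<kappa>(2)]] continuous_on_compose2[OF F]) auto
  then have "integral (cbox (a $ i) (b $ i)) (\<lambda>s. integral (cbox (a $ j) (b $ j)) (G s))
     = integral (cbox (a $ j) (b $ j)) (\<lambda>t. integral (cbox (a $ i) (b $ i)) (\<lambda>s. G s t))"
    by (rule integral_swap_continuous)
  moreover have "Top \<kappa> a b i (Top \<kappa>' a b j F) z = integral (cbox (a $ i) (b $ i)) (\<lambda>s. integral (cbox (a $ j) (b $ j)) (G s))"
    using ij by (simp add: Top_def G_def)
  moreover have "Top \<kappa>' a b j (Top \<kappa> a b i F) z = integral (cbox (a $ j) (b $ j)) (\<lambda>t. integral (cbox (a $ i) (b $ i)) (\<lambda>s. G s t))"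
  proof -
    have "G s t = \<kappa>' (z $ j - of_real t) * (\<kappa> (z $ i - of_real s) * F (upd (upd z j (of_real t)) i (of_real s)))" for s t
      using upd_commute[OF ij, of z "of_real s" "of_real t"] by (simp add: G_def)
    then show ?thesis using ij by (simp add: Top_def)
  qed
  ultimately show "Top \<kappa> a b i (Top \<kappa>' a b j F) z = Top \<kappa>' a b j (Top \<kappa> a b i F) z"
    by simp
qed

text \<open>Fubini's theorem, applied coordinate by coordinate. It moves an operator next to the
  original function, where its effect can be estimated.\<close>

lemma Sop_Top_commute:
  assumes \<kappa>: "\<kappa> holomorphic_on UNIV" "\<kappa>' holomorphic_on UNIV" and F: "continuous_on UNIV F" and j: "j \<notin> set js"
  shows "Top \<kappa>' a b j (Sop \<kappa> a b js F) = Sop \<kappa> a b js (Top \<kappa>' a b j F)"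
  using j
proof (induction js)
  case (Cons i js)
  then have "j \<noteq> i" by auto
  from Top_commute[OF \<kappa>(2,1) continuous_on_Sop[OF \<kappa>(1) F] this]
  show ?case using Cons by simp
qed simp

definition unit_box :: "real^'d::finite \<Rightarrow> real^'d \<Rightarrow> bool" where
  "unit_box a b \<longleftrightarrow> (\<forall>i. a $ i \<le> b $ i \<and> b $ i - a $ i \<le> 1)"

text \<open>Over an interval of length at most 1, \<open>N\<close> also bounds the norm of the
  operator of one coordinate. The condition \<open>1 \<le> N\<close> allows powers of
  \<open>N\<close> to be enlarged.\<close>

definition kbound :: "(complex \<Rightarrow> complex) \<Rightarrow> real \<Rightarrow> real \<Rightarrow> bool" where
  "kbound \<kappa> \<rho> N \<longleftrightarrow> \<kappa> holomorphic_on UNIV \<and> 0 \<le> \<rho> \<and> 1 \<le> N \<and> (\<forall>w. \<bar>Im w\<bar> \<le> \<rho> \<longrightarrow> norm (\<kappa> w) \<le> N)"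

lemma norm_Sop_le:
  assumes ab: "unit_box a b" and k: "kbound \<kappa> \<rho> N" and F: "continuous_on UNIV F" and C: "0 \<le> C"
    and z: "\<And>i. \<bar>Im (z $ i)\<bar> \<le> \<rho>"
    and f: "\<And>w. (\<And>i. \<bar>Im (w $ i)\<bar> \<le> \<rho>) \<Longrightarrow> (\<And>i. i \<notin> set js \<Longrightarrow> w $ i = z $ i) \<Longrightarrow> norm (F w) \<le> C"
  shows "norm (Sop \<kappa> a b js F z) \<le> N ^ length js * C"
  using z f
proof (induction js arbitrary: z)
  case Nil
  then show ?case by simp
next
  case (Cons j js)
  have "norm (Top \<kappa> a b j (Sop \<kappa> a b js F) z) \<le> N * (N ^ length js * C)"
  proof (rule norm_Top_le)
    show "continuous_on UNIV (Sop \<kappa> a b js F)"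
      using k F by (intro continuous_on_Sop) (auto simp: kbound_def)
    show "norm (\<kappa> (z $ j - of_real t)) \<le> N" for t
      using k Cons.prems(1)[of j] by (auto simp: kbound_def)
    show "norm (Sop \<kappa> a b js F (upd z j (of_real t))) \<le> N ^ length js * C" for t
    proof (rule Cons.IH)
      show "\<bar>Im (upd z j (of_real t) $ i)\<bar> \<le> \<rho>" for i
        using Cons.prems(1)[of i] k by (auto simp: kbound_def)
      fix w :: "complex^'a" assume w: "\<And>i. \<bar>Im (w $ i)\<bar> \<le> \<rho>" "\<And>i. i \<notin> set js \<Longrightarrow> w $ i = upd z j (of_real t) $ i"
      show "norm (F w) \<le> C"
        by (rule Cons.prems(2)) (use w in auto)
    qed
  qed (use ab k C in \<open>auto simp: unit_box_def kbound_def\<close>)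
  then show ?case by simp
qed

text \<open>The difference of two products of operators telescopes into terms in which one factor
  carries the difference of the kernels. Commuted to the innermost position, this factor acts on
  \<open>F\<close> itself, where the hypothesis applies; the remaining factors cost at most
  \<open>N\<close> each.\<close>

lemma Sop_increment:
  assumes ab: "unit_box a b" and k: "kbound \<kappa> \<rho> N" "kbound \<kappa>' \<rho> N" and F: "continuous_on UNIV F"
    and \<beta>: "0 \<le> \<beta>" and js: "distinct js" and z: "\<And>i. \<bar>Im (z $ i)\<bar> \<le> \<rho>"
    and f: "\<And>j w. j \<in> set js \<Longrightarrow> w $ j = z $ j \<Longrightarrow> norm (Top (\<lambda>w. \<kappa>' w - \<kappa> w) a b j F w) \<le> \<beta>"
  shows "norm (Sop \<kappa>' a b js F z - Sop \<kappa> a b js F z) \<le> real (length js) * N ^ length js * \<beta>"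
  using js z f
proof (induction js arbitrary: z)
  case Nil
  then show ?case using \<beta> by simp
next
  case (Cons j js)
  have hol: "\<kappa> holomorphic_on UNIV" "\<kappa>' holomorphic_on UNIV" and N: "1 \<le> N" and rho: "0 \<le> \<rho>"
    using k by (auto simp: kbound_def)
  have hold: "(\<lambda>w. \<kappa>' w - \<kappa> w) holomorphic_on UNIV" by (intro holomorphic_intros hol)
  note c = continuous_on_Sop[OF hol(1) F, of a b js] continuous_on_Sop[OF hol(2) F, of a b js]
  have eq: "Sop \<kappa>' a b (j # js) F z - Sop \<kappa> a b (j # js) F z
      = Sop \<kappa>' a b js (Top (\<lambda>w. \<kappa>' w - \<kappa> w) a b j F) z + Top \<kappa> a b j (\<lambda>w. Sop \<kappa>' a b js F w - Sop \<kappa> a b js F w) z"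
    using Cons.prems(1)
    by (simp add: Sop_Top_commute[OF hol(2) hold F, symmetric] Top_kernel_diff[OF hol(2,1) c(2)] Top_diff[OF hol(1) c(2,1)])
  have 1: "norm (Sop \<kappa>' a b js (Top (\<lambda>w. \<kappa>' w - \<kappa> w) a b j F) z) \<le> N ^ length js * \<beta>"
  proof (rule norm_Sop_le[OF ab k(2) _ \<beta> Cons.prems(2)])
    show "continuous_on UNIV (Top (\<lambda>w. \<kappa>' w - \<kappa> w) a b j F)"
      by (rule continuous_on_Top[OF hold F])
    show "norm (Top (\<lambda>w. \<kappa>' w - \<kappa> w) a b j F w) \<le> \<beta>" if "\<And>i. i \<notin> set js \<Longrightarrow> w $ i = z $ i" for w
      using Cons.prems(1) that by (intro Cons.prems(3)) auto
  qed
  have 2: "norm (Top \<kappa> a b j (\<lambda>w. Sop \<kappa>' a b js F w - Sop \<kappa> a b js F w) z) \<le> N * (real (length js) * N ^ length js * \<beta>)"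
  proof (rule norm_Top_le[OF hol(1)])
    show "continuous_on UNIV (\<lambda>w. Sop \<kappa>' a b js F w - Sop \<kappa> a b js F w)"
      by (intro continuous_intros c)
    show "norm (\<kappa> (z $ j - of_real t)) \<le> N" for t
      using k(1) Cons.prems(2)[of j] by (auto simp: kbound_def)
    show "norm (Sop \<kappa>' a b js F (upd z j (of_real t)) - Sop \<kappa> a b js F (upd z j (of_real t))) \<le> real (length js) * N ^ length js * \<beta>" for t
    proof (rule Cons.IH)
      show "\<bar>Im (upd z j (of_real t) $ i)\<bar> \<le> \<rho>" for i
        using Cons.prems(2)[of i] rho by auto
      show "norm (Top (\<lambda>w. \<kappa>' w - \<kappa> w) a b i F w) \<le> \<beta>" if "i \<in> set js" "w $ i = upd z j (of_real t) $ i" for i w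
        using Cons.prems(1) that by (intro Cons.prems(3)) auto
    qed (use Cons.prems(1) in auto)
  qed (use ab N \<beta> in \<open>auto simp: unit_box_def\<close>)
  have "N ^ length js * \<beta> \<le> N ^ Suc (length js) * \<beta>"
    using N \<beta> by (intro mult_right_mono power_increasing) auto
  then show ?case
    unfolding eq using norm_triangle_mono[OF 1 2] by (simp add: algebra_simps)
qed

lemma Sop_cong:
  assumes "\<And>w. (\<And>i. i \<in> set js \<Longrightarrow> w $ i \<in> of_real ` {a $ i..b $ i}) \<Longrightarrow> (\<And>i. i \<notin> set js \<Longrightarrow> w $ i = z $ i) \<Longrightarrow> F w = G w"
  shows "Sop \<kappa> a b js F z = Sop \<kappa> a b js G z"
  using assms
proof (induction js arbitrary: z)
  case Nil
  then show ?case by simp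
next
  case (Cons j js)
  have "Sop \<kappa> a b js F (upd z j (of_real t)) = Sop \<kappa> a b js G (upd z j (of_real t))" if t: "t \<in> {a $ j..b $ j}" for t
  proof (rule Cons.IH)
    fix w :: "complex^'a"
    assume w: "\<And>i. i \<in> set js \<Longrightarrow> w $ i \<in> of_real ` {a $ i..b $ i}" "\<And>i. i \<notin> set js \<Longrightarrow> w $ i = upd z j (of_real t) $ i"
    show "F w = G w"
    proof (rule Cons.prems)
      fix i
      show "w $ i \<in> of_real ` {a $ i..b $ i}" if "i \<in> set (j # js)"
        using w(1)[of i] w(2)[of i] that t by (cases "i \<in> set js") auto
      show "w $ i = z $ i" if "i \<notin> set (j # js)"
        using w(2)[of i] that by auto
    qed
  qed
  then have "Top \<kappa> a b j (Sop \<kappa> a b js F) z = Top \<kappa> a b j (Sop \<kappa> a b js G) z"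
    unfolding Top_def[of \<kappa> a b j "Sop \<kappa> a b js F" z] Top_def[of \<kappa> a b j "Sop \<kappa> a b js G" z]
    by (intro Henstock_Kurzweil_Integration.integral_cong) simp
  then show ?case by simp
qed

lemma norm_Top_box_diff_le:
  assumes \<kappa>: "\<kappa> holomorphic_on UNIV" and F: "continuous_on UNIV F"
    and ab: "a $ j \<le> a' $ j" "a' $ j \<le> b' $ j" "b' $ j \<le> b $ j" "b $ j - a $ j \<le> 1" and \<eta>: "0 \<le> \<eta>" and C: "0 \<le> C"
    and k: "\<And>t. t \<in> {a $ j..a' $ j} \<union> {b' $ j..b $ j} \<Longrightarrow> norm (\<kappa> (z $ j - of_real t)) \<le> \<eta>"
    and f: "\<And>t. norm (F (upd z j (of_real t))) \<le> C"
  shows "norm (Top \<kappa> a b j F z - Top \<kappa> a' b' j F z) \<le> 2 * \<eta> * C"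
proof -
  let ?f = "\<lambda>t. \<kappa> (z $ j - of_real t) * F (upd z j (of_real t))"
  have 1: "integral {a $ j..b $ j} ?f = integral {a $ j..a' $ j} ?f + integral {a' $ j..b $ j} ?f"
    using ab by (intro Henstock_Kurzweil_Integration.integral_combine[symmetric] Top_integrable[OF \<kappa> F]) auto
  have 2: "integral {a' $ j..b $ j} ?f = integral {a' $ j..b' $ j} ?f + integral {b' $ j..b $ j} ?f"
    using ab by (intro Henstock_Kurzweil_Integration.integral_combine[symmetric] Top_integrable[OF \<kappa> F]) auto
  have bound: "norm (integral {c..d} ?f) \<le> \<eta> * C" if cd: "c \<le> d" "d - c \<le> 1" "{c..d} \<subseteq> {a $ j..a' $ j} \<union> {b' $ j..b $ j}" for c d
  proof -
    have "norm (integral {c..d} ?f) \<le> \<eta> * C * (d - c)"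
    proof (rule integral_bound[OF cd(1)])
      show "continuous_on {c..d} ?f"
        by (intro continuous_on_Top_integrand[OF \<kappa> F] continuous_intros)
      show "norm (?f t) \<le> \<eta> * C" if "t \<in> {c..d}" for t
        unfolding norm_mult using that cd(3) \<eta> by (intro mult_mono k f) auto
    qed
    also have "\<dots> \<le> \<eta> * C * 1" using cd \<eta> C by (intro mult_left_mono) auto
    finally show ?thesis by simp
  qed
  have "Top \<kappa> a b j F z - Top \<kappa> a' b' j F z = integral {a $ j..a' $ j} ?f + integral {b' $ j..b $ j} ?f"
    unfolding Top_def 1 2 by simp
  also have "norm \<dots> \<le> \<eta> * C + \<eta> * C"
    using ab by (intro norm_triangle_mono bound) auto
  finally show ?thesis by (simp add: mult_ac)
qed

text \<open>The boxes are exchanged one coordinate at a time. Each exchange leaves integrals over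
  the two end pieces, on which the kernel is at most \<open>\<eta>\<close>.\<close>

lemma Sop_local:
  assumes ab: "unit_box a b" "unit_box a' b'" "\<And>i. a $ i \<le> a' $ i" "\<And>i. b' $ i \<le> b $ i"
    and k: "kbound \<kappa> \<rho> N" and F: "continuous_on UNIV F" and C: "0 \<le> C" "\<And>w. norm (F w) \<le> C" and \<eta>: "0 \<le> \<eta>"
    and z: "\<And>i. \<bar>Im (z $ i)\<bar> \<le> \<rho>"
    and far: "\<And>j t. j \<in> set js \<Longrightarrow> t \<in> {a $ j..a' $ j} \<union> {b' $ j..b $ j} \<Longrightarrow> norm (\<kappa> (z $ j - of_real t)) \<le> \<eta>"
    and js: "distinct js"
  shows "norm (Sop \<kappa> a b js F z - Sop \<kappa> a' b' js F z) \<le> 2 * real (length js) * N ^ length js * \<eta> * C"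
  using z far js
proof (induction js arbitrary: z)
  case Nil
  then show ?case using C by simp
next
  case (Cons j js)
  have hol: "\<kappa> holomorphic_on UNIV" and N: "1 \<le> N" and rho: "0 \<le> \<rho>"
    using k by (auto simp: kbound_def)
  note c = continuous_on_Sop[OF hol F, of a b js] continuous_on_Sop[OF hol F, of a' b' js]
  have eq: "Sop \<kappa> a b (j # js) F z - Sop \<kappa> a' b' (j # js) F z
      = (Top \<kappa> a b j (Sop \<kappa> a b js F) z - Top \<kappa> a' b' j (Sop \<kappa> a b js F) z)
        + Top \<kappa> a' b' j (\<lambda>w. Sop \<kappa> a b js F w - Sop \<kappa> a' b' js F w) z"
    by (simp add: Top_diff[OF hol c])
  have im: "\<bar>Im (upd z j (of_real t) $ i)\<bar> \<le> \<rho>" for i t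
    using Cons.prems(1)[of i] rho by auto
  have 1: "norm (Top \<kappa> a b j (Sop \<kappa> a b js F) z - Top \<kappa> a' b' j (Sop \<kappa> a b js F) z) \<le> 2 * \<eta> * (N ^ length js * C)"
  proof (rule norm_Top_box_diff_le[OF hol c(1)])
    show "norm (Sop \<kappa> a b js F (upd z j (of_real t))) \<le> N ^ length js * C" for t
      by (rule norm_Sop_le[OF ab(1) k F C(1) im C(2)])
    show "norm (\<kappa> (z $ j - of_real t)) \<le> \<eta>" if "t \<in> {a $ j..a' $ j} \<union> {b' $ j..b $ j}" for t
      using that by (intro Cons.prems(2)) auto
  qed (use ab \<eta> C N in \<open>auto simp: unit_box_def\<close>)
  have 2: "norm (Top \<kappa> a' b' j (\<lambda>w. Sop \<kappa> a b js F w - Sop \<kappa> a' b' js F w) z) \<le> N * (2 * real (length js) * N ^ length js * \<eta> * C)"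
  proof (rule norm_Top_le[OF hol])
    show "continuous_on UNIV (\<lambda>w. Sop \<kappa> a b js F w - Sop \<kappa> a' b' js F w)"
      by (intro continuous_intros c)
    show "norm (\<kappa> (z $ j - of_real t)) \<le> N" for t
      using k Cons.prems(1)[of j] by (auto simp: kbound_def)
    show "norm (Sop \<kappa> a b js F (upd z j (of_real t)) - Sop \<kappa> a' b' js F (upd z j (of_real t))) \<le> 2 * real (length js) * N ^ length js * \<eta> * C" for t
    proof (rule Cons.IH)
      show "norm (\<kappa> (upd z j (of_real t) $ i - of_real s)) \<le> \<eta>"
        if "i \<in> set js" "s \<in> {a $ i..a' $ i} \<union> {b' $ i..b $ i}" for i s
        using Cons.prems(2)[of i s] Cons.prems(3) that by auto
    qed (use im Cons.prems(3) in auto)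
  qed (use ab N \<eta> C in \<open>auto simp: unit_box_def\<close>)
  have "2 * \<eta> * (N ^ length js * C) \<le> 2 * \<eta> * (N ^ Suc (length js) * C)"
    using N \<eta> C by (intro mult_left_mono mult_right_mono power_increasing) auto
  then show ?case
    unfolding eq using norm_triangle_mono[OF 1 2] by (simp add: algebra_simps)
qed

lemma Sop_approx:
  assumes ab: "unit_box a b" and k: "kbound \<kappa> \<rho> N" and F: "continuous_on UNIV F"
    and \<beta>: "0 \<le> \<beta>" and js: "distinct js" and z: "\<And>i. \<bar>Im (z $ i)\<bar> \<le> \<rho>"
    and f: "\<And>j w. j \<in> set js \<Longrightarrow> w $ j = z $ j \<Longrightarrow> norm (Top \<kappa> a b j F w - F w) \<le> \<beta>"
  shows "norm (Sop \<kappa> a b js F z - F z) \<le> real (length js) * N ^ length js * \<beta>"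
  using js z f
proof (induction js arbitrary: z)
  case Nil
  then show ?case using \<beta> by simp
next
  case (Cons j js)
  have hol: "\<kappa> holomorphic_on UNIV" and N: "1 \<le> N" and rho: "0 \<le> \<rho>"
    using k by (auto simp: kbound_def)
  note c = continuous_on_Sop[OF hol F, of a b js]
  have eq: "Sop \<kappa> a b (j # js) F z - F z = Top \<kappa> a b j (\<lambda>w. Sop \<kappa> a b js F w - F w) z + (Top \<kappa> a b j F z - F z)"
    by (simp add: Top_diff[OF hol c F])
  have 1: "norm (Top \<kappa> a b j F z - F z) \<le> \<beta>" by (rule Cons.prems(3)) auto
  have 2: "norm (Top \<kappa> a b j (\<lambda>w. Sop \<kappa> a b js F w - F w) z) \<le> N * (real (length js) * N ^ length js * \<beta>)"
  proof (rule norm_Top_le[OF hol])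
    show "continuous_on UNIV (\<lambda>w. Sop \<kappa> a b js F w - F w)"
      by (intro continuous_intros c F)
    show "norm (\<kappa> (z $ j - of_real t)) \<le> N" for t
      using k Cons.prems(2)[of j] by (auto simp: kbound_def)
    show "norm (Sop \<kappa> a b js F (upd z j (of_real t)) - F (upd z j (of_real t))) \<le> real (length js) * N ^ length js * \<beta>" for t
    proof (rule Cons.IH)
      show "norm (Top \<kappa> a b i F w - F w) \<le> \<beta>" if "i \<in> set js" "w $ i = upd z j (of_real t) $ i" for i w
        using Cons.prems(1) that by (intro Cons.prems(3)) auto
      show "\<bar>Im (upd z j (of_real t) $ i)\<bar> \<le> \<rho>" for i
        using Cons.prems(2)[of i] rho by auto
    qed (use Cons.prems in auto)
  qed (use ab N \<beta> in \<open>auto simp: unit_box_def\<close>)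
  have "1 * \<beta> \<le> N ^ Suc (length js) * \<beta>"
    using N \<beta> by (intro mult_right_mono one_le_power) auto
  then show ?case
    unfolding eq using norm_triangle_mono[OF 2 1] by (simp add: algebra_simps)
qed


text \<open>A single coordinate with a small kernel makes the whole product small; the other
  coordinates contribute their norms.\<close>

lemma Sop_far:
  assumes ab: "unit_box a b" and k: "kbound \<kappa> \<rho> N" and F: "continuous_on UNIV F" and C: "0 \<le> C" "\<And>w. norm (F w) \<le> C" and \<eta>: "0 \<le> \<eta>"
    and z: "\<And>i. \<bar>Im (z $ i)\<bar> \<le> \<rho>"
    and far: "\<And>t. t \<in> {a $ j..b $ j} \<Longrightarrow> norm (\<kappa> (z $ j - of_real t)) \<le> \<eta>"
    and j: "j \<in> set js" "distinct js"
  shows "norm (Sop \<kappa> a b js F z) \<le> N ^ length js * \<eta> * C"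
  using z far j
proof (induction js arbitrary: z)
  case (Cons i js)
  have hol: "\<kappa> holomorphic_on UNIV" and N: "1 \<le> N" and rho: "0 \<le> \<rho>"
    using k by (auto simp: kbound_def)
  note c = continuous_on_Sop[OF hol F, of a b js]
  have im: "\<bar>Im (upd z i (of_real t) $ l)\<bar> \<le> \<rho>" for l t
    using Cons.prems(1)[of l] rho by auto
  show ?case
  proof (cases "i = j")
    case True
    have "norm (Top \<kappa> a b i (Sop \<kappa> a b js F) z) \<le> \<eta> * (N ^ length js * C)"
    proof (rule norm_Top_le[OF hol c])
      show "norm (Sop \<kappa> a b js F (upd z i (of_real t))) \<le> N ^ length js * C" for t
        by (rule norm_Sop_le[OF ab k F C(1) im C(2)])
      show "norm (\<kappa> (z $ i - of_real t)) \<le> \<eta>" if "t \<in> {a $ i..b $ i}" for t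
        using True that Cons.prems(2) by auto
    qed (use ab N \<eta> C in \<open>auto simp: unit_box_def\<close>)
    also have "\<dots> \<le> \<eta> * (N ^ Suc (length js) * C)"
      using N \<eta> C by (intro mult_left_mono mult_right_mono power_increasing) auto
    finally show ?thesis by (simp add: mult_ac)
  next
    case False
    have "norm (Top \<kappa> a b i (Sop \<kappa> a b js F) z) \<le> N * (N ^ length js * \<eta> * C)"
    proof (rule norm_Top_le[OF hol c])
      show "norm (Sop \<kappa> a b js F (upd z i (of_real t))) \<le> N ^ length js * \<eta> * C" for t
      proof (rule Cons.IH[OF im])
        show "norm (\<kappa> (upd z i (of_real t) $ j - of_real s)) \<le> \<eta>" if "s \<in> {a $ j..b $ j}" for s
          using False that Cons.prems(2) by auto
      qed (use False Cons.prems in auto)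
      show "norm (\<kappa> (z $ i - of_real t)) \<le> N" for t
        using k Cons.prems(1)[of i] by (auto simp: kbound_def)
    qed (use ab N \<eta> C in \<open>auto simp: unit_box_def\<close>)
    then show ?thesis by (simp add: mult_ac)
  qed
qed simp


lemma coordinates: "distinct (coordinates :: 'd::finite list)" "set (coordinates :: 'd list) = UNIV"
proof -
  have "\<exists>js :: 'd list. distinct js \<and> set js = UNIV"
    using finite_distinct_list[of "UNIV :: 'd set"] by auto
  then have "distinct (coordinates :: 'd list) \<and> set (coordinates :: 'd list) = UNIV"
    unfolding coordinates_def by (rule someI_ex)
  then show "distinct (coordinates :: 'd list)" "set (coordinates :: 'd list) = UNIV" by auto
qed

lemma length_coordinates: "length (coordinates :: 'd::finite list) = CARD('d)"
  using distinct_card[of "coordinates :: 'd list"] coordinates[where 'd = 'd] by simp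

section \<open>Smoothing over cubes\<close>

definition lo :: "real^'d::finite \<Rightarrow> real \<Rightarrow> real^'d" where "lo x r = (\<chi> i. x $ i - r)"
definition hi :: "real^'d::finite \<Rightarrow> real \<Rightarrow> real^'d" where "hi x r = (\<chi> i. x $ i + r)"
definition cube :: "real^'d::finite \<Rightarrow> real \<Rightarrow> (real^'d) set" where "cube x r = cbox (lo x r) (hi x r)"

lemma lo_nth [simp]: "lo x r $ i = x $ i - r" and hi_nth [simp]: "hi x r $ i = x $ i + r"
  by (simp_all add: lo_def hi_def)

lemma mem_cube: "y \<in> cube x r \<longleftrightarrow> (\<forall>i. \<bar>y $ i - x $ i\<bar> \<le> r)"
  by (auto simp: cube_def mem_box_cart abs_le_iff algebra_simps)

lemma cube_subset_iff:
  assumes "0 \<le> r" "cube x r \<subseteq> cube y s"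
  shows "y $ i - s \<le> x $ i - r" "x $ i + r \<le> y $ i + s"
proof -
  have "lo x r \<in> cube x r" "hi x r \<in> cube x r"
    using assms(1) by (simp_all add: mem_cube)
  then have "lo x r \<in> cube y s" "hi x r \<in> cube y s"
    using assms(2) by (blast dest: subsetD)+
  then show "y $ i - s \<le> x $ i - r" "x $ i + r \<le> y $ i + s"
    by (auto simp: mem_cube abs_le_iff dest!: spec[of _ i])
qed

text \<open>A common bound for \<open>ker m\<close> and \<open>ker (Suc m)\<close> on the strip of
  half width \<open>\<rho>\<close>. The successor keeps it at least 1, even for
  \<open>m = 0\<close>.\<close>

definition NN :: "nat \<Rightarrow> real \<Rightarrow> real" where
  "NN m \<rho> = real (Suc m) * exp (2 * real (Suc m) * \<rho>)"

lemma NN_ge: "0 \<le> \<rho> \<Longrightarrow> real (Suc m) \<le> NN m \<rho>" "0 \<le> \<rho> \<Longrightarrow> 1 \<le> NN m \<rho>"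
proof -
  assume "0 \<le> \<rho>"
  then have "real (Suc m) * 1 \<le> NN m \<rho>"
    unfolding NN_def by (intro mult_left_mono) auto
  then show "real (Suc m) \<le> NN m \<rho>" by simp
  then show "1 \<le> NN m \<rho>" by simp
qed

lemma ker_far:
  assumes i: "i = m \<or> i = Suc m" and w: "\<bar>Im w\<bar> \<le> \<rho>" "\<rho> \<le> 1" and R: "0 \<le> R" "R \<le> \<bar>Re w\<bar>"
  shows "norm (ker i w) \<le> NN m \<rho> * exp (- (R\<^sup>2 / 2) * real m)"
proof -
  have rho: "0 \<le> \<rho>" using w by linarith
  have sq: "R\<^sup>2 \<le> (Re w)\<^sup>2" using power_mono[OF R(2,1), of 2] by simp
  have im: "real m \<le> real i" "real i \<le> real (Suc m)" using i by auto
  have "real m * R\<^sup>2 \<le> real i * (Re w)\<^sup>2"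
    by (intro mult_mono sq im) auto
  then have e: "2 * real i * \<rho> - real i * (Re w)\<^sup>2 / 2 \<le> 2 * real (Suc m) * \<rho> - real m * R\<^sup>2 / 2"
    using mult_right_mono[OF im(2) rho] by (simp add: algebra_simps)
  have "norm (ker i w) \<le> real i * exp (2 * real i * \<rho> - real i * (Re w)\<^sup>2 / 2)"
    by (rule norm_ker_le[OF w])
  also have "\<dots> \<le> real (Suc m) * exp (2 * real (Suc m) * \<rho> - real m * R\<^sup>2 / 2)"
    using e im by (intro mult_mono) auto
  also have "\<dots> = NN m \<rho> * exp (- (R\<^sup>2 / 2) * real m)"
    unfolding NN_def mult.assoc mult_exp_exp by (simp add: algebra_simps)
  finally show ?thesis .
qed

lemma kbound_ker:
  assumes "i = m \<or> i = Suc m" "0 \<le> \<rho>" "\<rho> \<le> 1"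
  shows "kbound (ker i) \<rho> (NN m \<rho>)"
  unfolding kbound_def using ker_far[OF assms(1) _ assms(3), of _ 0] NN_ge[OF assms(2)] assms(2)
  by (auto intro: holomorphic_on_ker)

text \<open>Clamping the real parts and ignoring the imaginary parts extends \<open>f\<close> from
  the cube to a continuous function with the same bounds. The extension is a device for composing
  operators: integration over all coordinates uses its values at real points of the cube
  only.\<close>

definition cext :: "real^'d::finite \<Rightarrow> real \<Rightarrow> (real^'d \<Rightarrow> complex) \<Rightarrow> complex^'d \<Rightarrow> complex" where
  "cext x r f z = f (\<chi> i. max (x $ i - r) (min (x $ i + r) (Re (z $ i))))"

definition SS :: "nat \<Rightarrow> real^'d::finite \<Rightarrow> real \<Rightarrow> (real^'d \<Rightarrow> complex) \<Rightarrow> complex^'d \<Rightarrow> complex" where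
  "SS m x r f = Sop (ker m) (lo x r) (hi x r) coordinates (cext x r f)"

lemma clamp_in_cube: "0 \<le> r \<Longrightarrow> (\<chi> i. max (x $ i - r) (min (x $ i + r) (Re (z $ i)))) \<in> cube x r"
  by (auto simp: mem_cube abs_le_iff max_def min_def)

lemma continuous_on_cext:
  assumes "continuous_on (cube x r) f" "0 \<le> r"
  shows "continuous_on UNIV (cext x r f)"
  unfolding cext_def
  by (rule continuous_on_compose2[OF assms(1)])
     (auto intro!: continuous_intros clamp_in_cube assms(2))

lemma norm_cext_le:
  assumes "\<And>y. y \<in> cube x r \<Longrightarrow> norm (f y) \<le> C" "0 \<le> r"
  shows "norm (cext x r f z) \<le> C"
  unfolding cext_def by (intro assms clamp_in_cube)

lemma cext_of_real:
  assumes "\<And>i. z $ i = of_real (y $ i)" "y \<in> cube x r"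
  shows "cext x r f z = f y"
proof -
  have "(\<chi> i. max (x $ i - r) (min (x $ i + r) (Re (z $ i)))) = y"
    using assms by (auto simp: vec_eq_iff mem_cube abs_le_iff max_def min_def) (smt (verit))+
  then show ?thesis by (simp add: cext_def)
qed

lemma cext_const: "cext x r (\<lambda>_. c) = (\<lambda>_. c)"
  by (auto simp: cext_def)

lemma unit_box_cube: "0 \<le> r \<Longrightarrow> r \<le> 1/2 \<Longrightarrow> unit_box (lo x r) (hi x r)"
  by (auto simp: unit_box_def)

lemma entire_SS:
  assumes "continuous_on (cube x r) f" "0 \<le> r"
  shows "entire (SS m x r f)"
  unfolding SS_def by (intro entire_Sop holomorphic_on_ker continuous_on_cext assms coordinates)

text \<open>There is at least one coordinate, and its kernel \<open>ker 0\<close> vanishes. Hence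
  the increments of \<open>SS\<close> telescope to \<open>SS\<close> without an initial
  term.\<close>

lemma SS_0: "SS 0 x r f = (\<lambda>z. 0)"
proof -
  obtain j js where js: "(coordinates :: 'a list) = j # js"
    using coordinates(2)[where 'd = 'a] by (cases "coordinates :: 'a list") auto
  show ?thesis unfolding SS_def js by (simp add: Top_def[abs_def])
qed

lemma norm_SS_le:
  fixes x :: "real^'d::finite"
  assumes i: "i = m \<or> i = Suc m" and r: "0 \<le> r" "r \<le> 1/2" and f: "continuous_on (cube x r) f"
    and C: "\<And>y. y \<in> cube x r \<Longrightarrow> norm (f y) \<le> C" "0 \<le> C"
    and z: "\<And>i. \<bar>Im (z $ i)\<bar> \<le> \<rho>" and rho: "0 \<le> \<rho>" "\<rho> \<le> 1"
  shows "norm (SS i x r f z) \<le> NN m \<rho> ^ CARD('d) * C"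
  unfolding SS_def length_coordinates[symmetric]
  by (intro norm_Sop_le[where \<rho> = \<rho>] unit_box_cube r kbound_ker i rho continuous_on_cext f C(2) z norm_cext_le C(1))

lemma norm_SS_far:
  fixes x :: "real^'d::finite"
  assumes i: "i = m \<or> i = Suc m" and r: "0 \<le> r" "r \<le> 1/2" and f: "continuous_on (cube x r) f"
    and C: "\<And>y. y \<in> cube x r \<Longrightarrow> norm (f y) \<le> C" "0 \<le> C"
    and z: "\<And>i. \<bar>Im (z $ i)\<bar> \<le> \<rho>" and rho: "0 \<le> \<rho>" "\<rho> \<le> 1"
    and R: "0 \<le> R" "\<And>t. t \<in> {x $ j - r..x $ j + r} \<Longrightarrow> R \<le> \<bar>Re (z $ j) - t\<bar>"
  shows "norm (SS i x r f z) \<le> NN m \<rho> ^ CARD('d) * (NN m \<rho> * exp (- (R\<^sup>2 / 2) * real m)) * C"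
  unfolding SS_def length_coordinates[symmetric]
proof (rule Sop_far[where \<rho> = \<rho> and j = j])
  show "norm (ker i (z $ j - of_real t)) \<le> NN m \<rho> * exp (- (R\<^sup>2 / 2) * real m)" if "t \<in> {lo x r $ j..hi x r $ j}" for t
    using that z[of j] R by (intro ker_far i rho) auto
  show "0 \<le> NN m \<rho> * exp (- (R\<^sup>2 / 2) * real m)" using NN_ge(2)[OF rho(1), of m] by simp
qed (intro unit_box_cube r kbound_ker i rho continuous_on_cext f C(2) z norm_cext_le C(1) | simp add: coordinates)+

lemma SS_local:
  fixes x :: "real^'d::finite"
  assumes i: "i = m \<or> i = Suc m" and r: "r \<le> 1/2" and f: "continuous_on (cube x r) f"
    and C: "\<And>y. y \<in> cube x r \<Longrightarrow> norm (f y) \<le> C" "0 \<le> C"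
    and z: "\<And>i. \<bar>Im (z $ i)\<bar> \<le> \<rho>" and rho: "0 \<le> \<rho>" "\<rho> \<le> 1"
    and R: "0 \<le> R" "cube x0 R \<subseteq> cube x r" and \<sigma>: "0 \<le> \<sigma>" "\<And>i. \<bar>Re (z $ i) - x0 $ i\<bar> \<le> R - \<sigma>"
  shows "norm (SS i x r f z - SS i x0 R f z) \<le> 2 * real CARD('d) * NN m \<rho> ^ CARD('d) * (NN m \<rho> * exp (- (\<sigma>\<^sup>2 / 2) * real m)) * C"
proof -
  note sub = cube_subset_iff[OF R]
  have r0: "0 \<le> r" using sub[of undefined] R(1) by linarith
  have Rle: "R \<le> 1/2" using sub[of undefined] r by linarith
  \<comment> \<open>The operator over the small cube sees only the real points of that cube, where
    both extensions coincide with \<open>f\<close>.\<close>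
  have "SS i x0 R f z = Sop (ker i) (lo x0 R) (hi x0 R) coordinates (cext x r f) z"
    unfolding SS_def
  proof (rule Sop_cong)
    fix w :: "complex^'d"
    assume w: "\<And>i. i \<in> set coordinates \<Longrightarrow> w $ i \<in> of_real ` {lo x0 R $ i..hi x0 R $ i}"
    have "\<exists>t. w $ i = of_real t \<and> x0 $ i - R \<le> t \<and> t \<le> x0 $ i + R" for i
      using w[of i] by (auto simp: coordinates)
    then obtain t where t: "\<And>i. w $ i = of_real (t i)" "\<And>i. x0 $ i - R \<le> t i" "\<And>i. t i \<le> x0 $ i + R"
      by metis
    define y :: "real^'d" where "y = (\<chi> i. t i)"
    have y0: "y \<in> cube x0 R" using t by (auto simp: y_def mem_cube abs_le_iff algebra_simps)
    then have "y \<in> cube x r" using R by auto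
    then show "cext x0 R f w = cext x r f w"
      using cext_of_real[of w y x0 R f] cext_of_real[of w y x r f] t y0 by (simp add: y_def)
  qed
  moreover have "norm (SS i x r f z - Sop (ker i) (lo x0 R) (hi x0 R) coordinates (cext x r f) z)
      \<le> 2 * real CARD('d) * NN m \<rho> ^ CARD('d) * (NN m \<rho> * exp (- (\<sigma>\<^sup>2 / 2) * real m)) * C"
    unfolding SS_def length_coordinates[symmetric]
  proof (rule Sop_local[where \<rho> = \<rho>])
    show "norm (ker i (z $ j - of_real t)) \<le> NN m \<rho> * exp (- (\<sigma>\<^sup>2 / 2) * real m)"
      if "t \<in> {lo x r $ j..lo x0 R $ j} \<union> {hi x0 R $ j..hi x r $ j}" for j t
      using that z[of j] \<sigma>(2)[of j] by (intro ker_far i rho \<sigma>(1)) auto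
    show "0 \<le> NN m \<rho> * exp (- (\<sigma>\<^sup>2 / 2) * real m)" using NN_ge(2)[OF rho(1), of m] by simp
    show "lo x r $ i \<le> lo x0 R $ i" "hi x0 R $ i \<le> hi x r $ i" for i using sub[of i] by auto
  qed (intro unit_box_cube r r0 Rle R(1) kbound_ker i rho continuous_on_cext f C(2) z norm_cext_le C(1) | simp add: z coordinates)+
  ultimately show ?thesis by simp
qed

section \<open>Rates of approximation\<close>

lemma ker_approx:
  fixes v :: "real \<Rightarrow> complex"
  assumes x: "a < x" "x < b" and v: "continuous_on {a..b} v"
    and lip: "\<And>t. t \<in> {a..b} \<Longrightarrow> norm (v t - v x) \<le> C * \<bar>t - x\<bar>"
    and b: "\<And>k. norm (integral {a..b} (\<lambda>t. (ker (Suc (m + k)) (of_real x - of_real t) - ker (m + k) (of_real x - of_real t)) * v t)) \<le> \<beta> k"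
    and s: "summable \<beta>"
  shows "norm (integral {a..b} (\<lambda>t. ker m (of_real x - of_real t) * v t) - v x) \<le> suminf \<beta>"
proof -
  define T where "T = (\<lambda>n. integral {a..b} (\<lambda>t. ker n (of_real x - of_real t) * v t))"
  have ck: "continuous_on UNIV (ker m)" for m by (rule holomorphic_on_imp_continuous_on[OF holomorphic_on_ker])
  have d: "integral {a..b} (\<lambda>t. (ker (Suc k) (of_real x - of_real t) - ker k (of_real x - of_real t)) * v t) = T (Suc k) - T k" for k
    unfolding T_def left_diff_distrib
    by (intro integral_diff integrable_continuous_interval continuous_intros v continuous_on_compose2[OF ck]) auto
  have "norm (T (m + n) - T m) \<le> suminf \<beta>" for n
  proof -
    have "T (m + n) - T m = (\<Sum>k<n. T (m + Suc k) - T (m + k))"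
      by (subst sum_lessThan_telescope) simp
    also have "norm \<dots> \<le> (\<Sum>k<n. \<beta> k)"
      using b d by (intro sum_norm_le) simp
    also have "\<dots> \<le> suminf \<beta>"
      using b order_trans[OF norm_ge_zero] by (intro sum_le_suminf s) auto
    finally show ?thesis .
  qed
  moreover have "(\<lambda>n. norm (T (m + n) - T m)) \<longlonglongrightarrow> norm (v x - T m)"
  proof -
    have "T \<longlonglongrightarrow> v x" unfolding T_def by (rule ker_integral_tendsto[OF x v lip])
    then have "(\<lambda>n. T (n + m)) \<longlonglongrightarrow> v x" by (rule LIMSEQ_ignore_initial_segment)
    then show ?thesis by (intro tendsto_intros) (simp add: add.commute)
  qed
  ultimately have "norm (v x - T m) \<le> suminf \<beta>"
    by (intro LIMSEQ_le_const2) auto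
  then show ?thesis by (simp add: T_def norm_minus_commute)
qed

text \<open>The constant 1 has vanishing derivatives, so the bound for increments holds with every
  \<open>h > 0\<close> and only its exponentially small part survives; a geometric series then
  measures the distance to the limit 1 at the real point \<open>Re \<zeta>\<close>. On the vertical
  way from there to \<open>\<zeta>\<close> the derivative of the integral consists of boundary terms
  alone, which are exponentially small as well.\<close>

lemma ker_cutoff_approx:
  assumes B: "B > 0" "\<And>w. \<bar>Re w\<bar> \<le> 2 \<Longrightarrow> \<bar>Im w\<bar> \<le> 2 \<Longrightarrow> norm (amp w) \<le> B"
    and ab: "a \<le> b" "b - a \<le> 1" and r: "0 < r" "r \<le> 1" and \<zeta>: "Re \<zeta> \<in> {a + r..b - r}" "\<bar>Im \<zeta>\<bar> \<le> \<rho>" and rho: "\<rho> \<le> 1/2" and m: "1 \<le> m"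
  shows "norm (integral {a..b} (\<lambda>t. ker m (\<zeta> - of_real t)) - 1)
     \<le> (8 * B / (1 - exp (- (r\<^sup>2 / 8))) + 1) * (NN m \<rho> * exp (- (r\<^sup>2 / 8) * real m))"
proof -
  have rho0: "0 \<le> \<rho>" using \<zeta> by linarith
  define x where "x = Re \<zeta>"
  define q where "q = exp (- (r\<^sup>2 / 8))"
  have q: "0 < q" "q < 1" using r by (auto simp: q_def)
  define G where "G = (\<lambda>\<zeta>. integral {a..b} (\<lambda>t. ker m (\<zeta> - of_real t) * 1))"
  have inc: "norm (integral {a..b} (\<lambda>t. (ker (Suc k) (of_real x - of_real t) - ker k (of_real x - of_real t)) * 1)) \<le> 8 * B * q ^ k"
    if k: "1 \<le> k" for k
  proof -
    define I where "I = norm (integral {a..b} (\<lambda>t. (ker (Suc k) (of_real x - of_real t) - ker k (of_real x - of_real t)) * 1))"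
    \<comment> \<open>For the weight sequence with constant value 1 and \<open>p = 1\<close> the
      first term of the bound is proportional to \<open>h\<close>, which is still free.\<close>
    have hI: "I \<le> 32 * B * h + 8 * B * q ^ k" if h: "h > 0" for h
    proof -
      define v where "v = (\<lambda>(j::nat) (t::real). if j = 0 then 1 else 0 :: complex)"
      have "norm (integral {a..b} (\<lambda>t. (ker (Suc k) (of_real x - of_real t) - ker k (of_real x - of_real t)) * v 0 t))
        \<le> 2 * (B * 1 * exp (3 * real k * 0) * (real k * ((16 * h / real k) ^ 1 * 1) + 4 * exp (- (r\<^sup>2 / 8) * real k)))"
      proof (rule ker_increment_bound[where M = "\<lambda>_. 1" and h = h])
        show "M1 (\<lambda>_. 1)" by (simp add: M1_def)
        show "x \<in> {a + r..b - r}" using \<zeta> by (simp add: x_def)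
        show "norm (v j t) \<le> 1 * h ^ j * 1" for j t using h by (auto simp: v_def)
      qed (use ab r k h B in \<open>auto simp: v_def\<close>)
      also have "\<dots> = 32 * B * h + 8 * B * exp (- (r\<^sup>2 / 8) * real k)"
        using k by (simp add: algebra_simps)
      also have "exp (- (r\<^sup>2 / 8) * real k) = q ^ k"
        by (simp add: q_def mult.commute flip: exp_of_nat_mult)
      finally show ?thesis by (simp add: v_def I_def)
    qed
    have "I \<le> 8 * B * q ^ k + e" if "e > 0" for e
      using hI[of "e / (32 * B)"] that B(1) by simp
    then have "I \<le> 8 * B * q ^ k" by (rule field_le_epsilon)
    then show ?thesis by (simp add: I_def)
  qed
  have real: "norm (G (of_real x) - 1) \<le> 8 * B / (1 - q) * q ^ m"
  proof -
    have s: "(\<lambda>k. 8 * B * q ^ (m + k)) sums (8 * B * q ^ m * (1 / (1 - q)))"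
      using sums_mult[OF geometric_sums[of q], of "8 * B * q ^ m"] q by (simp add: power_add mult.assoc)
    have "norm (G (of_real x) - 1) \<le> suminf (\<lambda>k. 8 * B * q ^ (m + k))"
      unfolding G_def
    proof (rule ker_approx[where C = 0])
      show "norm (integral {a..b} (\<lambda>t. (ker (Suc (m + k)) (of_real x - of_real t) - ker (m + k) (of_real x - of_real t)) * 1)) \<le> 8 * B * q ^ (m + k)" for k
        using m by (intro inc) simp
    qed (use \<zeta> r s in \<open>auto simp: x_def sums_iff\<close>)
    then show ?thesis using s by (simp add: sums_iff field_simps)
  qed
  have far: "norm (ker m w) \<le> NN m \<rho> * q ^ m" if "\<bar>Im w\<bar> \<le> \<rho>" "r \<le> \<bar>Re w\<bar>" for w
  proof -
    have "norm (ker m w) \<le> NN m \<rho> * exp (- (r\<^sup>2 / 2) * real m)"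
      using that rho r by (intro ker_far) auto
    also have "\<dots> \<le> NN m \<rho> * exp (- (r\<^sup>2 / 8) * real m)"
      using NN_ge(2)[OF rho0, of m] by (intro mult_left_mono) (auto intro!: mult_right_mono)
    finally show ?thesis by (simp add: q_def mult.commute flip: exp_of_nat_mult)
  qed
  have vert: "norm (G (z0 + \<i> * of_real \<eta>) - G z0) \<le> NN m \<rho> * q ^ m"
    if eta: "0 \<le> \<eta>" "\<eta> \<le> \<rho>" and z0: "Re z0 = x" "\<And>s. 0 \<le> s \<Longrightarrow> s \<le> \<eta> \<Longrightarrow> \<bar>Im z0 + s\<bar> \<le> \<rho>" for z0 \<eta>
  proof -
    \<comment> \<open>The integral in \<open>D\<close> is the one against the derivative of the
      constant 1; it is kept to fit the shape of the vertical derivative.\<close>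
    define D where "D = (\<lambda>s. \<i> * (integral {a..b} (\<lambda>t. ker m (z0 + \<i> * of_real s - of_real t) * 0)
        + (ker m (z0 + \<i> * of_real s - of_real a) * 1 - ker m (z0 + \<i> * of_real s - of_real b) * 1)))"
    have "(D has_integral (G (z0 + \<i> * of_real \<eta>) - G (z0 + \<i> * of_real 0))) {0..\<eta>}"
      unfolding G_def D_def
      by (rule fundamental_theorem_of_calculus[OF eta(1) has_vector_derivative_vertical_integral[OF ab(1) holomorphic_on_ker]]) auto
    moreover have "norm (D s) \<le> 2 * (NN m \<rho> * q ^ m)" if s: "s \<in> {0..\<eta>}" for s
    proof -
      have "norm (D s) \<le> norm (ker m (z0 + \<i> * of_real s - of_real a)) + norm (ker m (z0 + \<i> * of_real s - of_real b))"
        unfolding D_def by (simp add: norm_mult norm_triangle_ineq4)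
      also have "\<dots> \<le> NN m \<rho> * q ^ m + NN m \<rho> * q ^ m"
        using s z0 \<zeta> by (intro add_mono far) (auto simp: x_def)
      finally show ?thesis by (simp only: mult_2)
    qed
    ultimately have "norm (G (z0 + \<i> * of_real \<eta>) - G (z0 + \<i> * of_real 0)) \<le> 2 * (NN m \<rho> * q ^ m) * (\<eta> - 0)"
      using has_integral_bound_real[where B = "2 * (NN m \<rho> * q ^ m)" and f = D and a = 0 and b = \<eta> and S = "{}"]
        NN_ge(2)[OF rho0, of m] q eta by simp
    also have "\<dots> \<le> (NN m \<rho> * q ^ m) * 1"
    proof -
      have "(NN m \<rho> * q ^ m) * (2 * \<eta>) \<le> (NN m \<rho> * q ^ m) * 1"
        using eta rho NN_ge(2)[OF rho0, of m] q by (intro mult_left_mono) auto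
      then show ?thesis by (simp add: mult_ac)
    qed
    finally show ?thesis by simp
  qed
  \<comment> \<open>The vertical path always starts at the lower of the two points, hence the two
    cases.\<close>
  have "norm (G \<zeta> - G (of_real x)) \<le> NN m \<rho> * q ^ m"
  proof (cases "0 \<le> Im \<zeta>")
    case True
    have "\<zeta> = of_real x + \<i> * of_real (Im \<zeta>)" by (simp add: x_def complex_eq_iff)
    then show ?thesis using vert[of "Im \<zeta>" "of_real x"] True \<zeta> by simp
  next
    case False
    have "of_real x = \<zeta> + \<i> * of_real (- Im \<zeta>)" by (simp add: x_def complex_eq_iff)
    then show ?thesis using vert[of "- Im \<zeta>" \<zeta>] False \<zeta> by (simp add: x_def norm_minus_commute)
  qed
  moreover have "8 * B / (1 - q) * q ^ m \<le> 8 * B / (1 - q) * (NN m \<rho> * q ^ m)"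
    using NN_ge(2)[OF rho0, of m] q B by (intro mult_left_mono) auto
  ultimately have "norm (G \<zeta> - 1) \<le> NN m \<rho> * q ^ m + 8 * B / (1 - q) * (NN m \<rho> * q ^ m)"
    using real norm_triangle_ineq[of "G \<zeta> - G (of_real x)" "G (of_real x) - 1"] by simp
  then show ?thesis
    by (simp add: G_def q_def algebra_simps mult.commute[of _ "real m"] flip: exp_of_nat_mult)
qed


text \<open>Only pure derivatives in one direction are bounded, since the integrations by parts take
  place in one coordinate at a time. Smoothness is asked on an open neighbourhood, so that
  derivatives at the faces of the cube make sense.\<close>

definition jet_bound :: "(nat \<Rightarrow> real) \<Rightarrow> real \<Rightarrow> real \<Rightarrow> real^'d::finite \<Rightarrow> real \<Rightarrow> (real^'d \<Rightarrow> complex) \<Rightarrow> bool" where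
  "jet_bound M h C x0 R \<psi> \<longleftrightarrow> (\<exists>W. open W \<and> cube x0 R \<subseteq> W \<and> smooth_on W \<psi>) \<and>
     (\<forall>k j. \<forall>y\<in>cube x0 R. norm ((partial_deriv j ^^ k) \<psi> y) \<le> C * h ^ k * M k)"

lemma smooth_on_funpow: "smooth_on W f \<Longrightarrow> smooth_on W ((partial_deriv j ^^ k) f)"
  by (induction k) (auto intro: smooth_on_partial_deriv)

lemma upd_real_line: "upd y j t = upd y j 0 + t *\<^sub>R axis j (1::real)"
  by (auto simp: vec_eq_iff axis_def)

lemma jet_line:
  assumes jet: "jet_bound M h C x0 R \<psi>" and y: "y \<in> cube x0 R" and t: "t \<in> {x0 $ j - R..x0 $ j + R}"
  shows "((\<lambda>t. (partial_deriv j ^^ k) \<psi> (upd y j t)) has_vector_derivative (partial_deriv j ^^ Suc k) \<psi> (upd y j t)) (at t within T)"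
    and "norm ((partial_deriv j ^^ k) \<psi> (upd y j t)) \<le> C * h ^ k * M k"
    and "upd y j t \<in> cube x0 R"
proof -
  show mem: "upd y j t \<in> cube x0 R"
    using y t by (auto simp: mem_cube abs_le_iff)
  obtain W where W: "open W" "cube x0 R \<subseteq> W" "smooth_on W \<psi>" using jet by (auto simp: jet_bound_def)
  have "upd y j 0 + t *\<^sub>R axis j 1 \<in> W" using mem W(2) upd_real_line[of y j t] by auto
  from has_vector_derivative_partial_deriv[OF W(1) smooth_on_imp_differentiable[OF smooth_on_funpow[OF W(3)]] this]
  have "((\<lambda>t. (partial_deriv j ^^ k) \<psi> (upd y j 0 + t *\<^sub>R axis j 1)) has_vector_derivative
     partial_deriv j ((partial_deriv j ^^ k) \<psi>) (upd y j 0 + t *\<^sub>R axis j 1)) (at t)" .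
  then show "((\<lambda>t. (partial_deriv j ^^ k) \<psi> (upd y j t)) has_vector_derivative (partial_deriv j ^^ Suc k) \<psi> (upd y j t)) (at t within T)"
    unfolding upd_real_line[of y j, symmetric] by (simp add: has_vector_derivative_at_within)
  show "norm ((partial_deriv j ^^ k) \<psi> (upd y j t)) \<le> C * h ^ k * M k"
    using jet mem by (simp add: jet_bound_def)
qed

lemma jet_bound_continuous: "jet_bound M h C x0 R \<psi> \<Longrightarrow> continuous_on (cube x0 R) \<psi>"
  unfolding jet_bound_def by (meson smooth_on_imp_continuous continuous_on_subset)

lemma cext_upd:
  assumes "t \<in> {x $ j - r..x $ j + r}"
  shows "cext x r f (upd w j (of_real t)) = f (upd (\<chi> i. max (x $ i - r) (min (x $ i + r) (Re (w $ i)))) j t)"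
proof -
  have "(\<chi> i. max (x $ i - r) (min (x $ i + r) (Re (upd w j (of_real t) $ i)))) =
     upd (\<chi> i. max (x $ i - r) (min (x $ i + r) (Re (w $ i)))) j t"
    using assms by (auto simp: vec_eq_iff)
  then show ?thesis by (simp add: cext_def)
qed

lemma Top_increment:
  fixes M :: "nat \<Rightarrow> real"
  assumes M: "\<And>p. 0 < M p" "M 0 = 1" and lc: "M1 M" and h: "h > 0" and C: "C \<ge> 0"
    and B: "B > 0" "\<And>w. \<bar>Re w\<bar> \<le> 2 \<Longrightarrow> \<bar>Im w\<bar> \<le> 2 \<Longrightarrow> norm (amp w) \<le> B"
    and jet: "jet_bound M h C x0 R \<psi>" and R: "0 \<le> R" "R \<le> 1/2" and r: "0 < r" "r \<le> 1"
    and x: "\<bar>x - x0 $ j\<bar> \<le> R - r" and w: "norm (w $ j - of_real x) \<le> \<rho>"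
    and rho: "\<rho> \<le> 1/4" "\<rho> \<le> r / 2" and m: "1 \<le> m"
  shows "norm (Top (\<lambda>w. ker (Suc m) w - ker m w) (lo x0 R) (hi x0 R) j (cext x0 R \<psi>) w)
     \<le> 2 * (B * C * exp (3 * real m * \<rho>) * (real m * ((16 * h / real m) ^ p * M p) + 4 * exp (- (r\<^sup>2 / 8) * real m)))"
proof -
  define y :: "real^'a" where "y = (\<chi> i. max (x0 $ i - R) (min (x0 $ i + R) (Re (w $ i))))"
  have y: "y \<in> cube x0 R" unfolding y_def by (rule clamp_in_cube[OF R(1)])
  define v where "v = (\<lambda>k t. (partial_deriv j ^^ k) \<psi> (upd y j t))"
  note line = jet_line[OF jet y, of _ j, folded v_def]
  have "Top (\<lambda>w. ker (Suc m) w - ker m w) (lo x0 R) (hi x0 R) j (cext x0 R \<psi>) w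
    = integral {x0 $ j - R..x0 $ j + R} (\<lambda>t. (ker (Suc m) (w $ j - of_real t) - ker m (w $ j - of_real t)) * v 0 t)"
    unfolding Top_def lo_nth hi_nth
    by (intro Henstock_Kurzweil_Integration.integral_cong) (simp add: cext_upd v_def y_def)
  also have "norm \<dots> \<le> 2 * (B * C * exp (3 * real m * \<rho>) * (real m * ((16 * h / real m) ^ p * M p) + 4 * exp (- (r\<^sup>2 / 8) * real m)))"
  proof (rule ker_increment_bound[OF M lc h C _ _ r _ w rho m _ _ B])
    show "x \<in> {x0 $ j - R + r..x0 $ j + R - r}" using x by (auto simp: abs_le_iff)
    show "(v k has_vector_derivative v (Suc k) t) (at t within {x0 $ j - R..x0 $ j + R})"
      if "t \<in> {x0 $ j - R..x0 $ j + R}" for k t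
      using jet_line(1)[OF jet y that, of k] unfolding v_def .
    show "norm (v k t) \<le> C * h ^ k * M k" if "t \<in> {x0 $ j - R..x0 $ j + R}" for k t
      using jet_line(2)[OF jet y that, of k] unfolding v_def .
  qed (use R in auto)
  finally show ?thesis .
qed

lemma SS_increment:
  fixes M :: "nat \<Rightarrow> real" and x0 :: "real^'d::finite"
  assumes M: "\<And>p. 0 < M p" "M 0 = 1" and lc: "M1 M" and h: "h > 0" and C: "C \<ge> 0"
    and B: "B > 0" "\<And>w. \<bar>Re w\<bar> \<le> 2 \<Longrightarrow> \<bar>Im w\<bar> \<le> 2 \<Longrightarrow> norm (amp w) \<le> B"
    and jet: "jet_bound M h C x0 R \<psi>" and R: "0 \<le> R" "R \<le> 1/2" and r: "0 < r" "r \<le> 1"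
    and x: "x \<in> cube x0 (R - r)" and z: "z \<in> polydisc x \<rho>"
    and rho: "0 \<le> \<rho>" "\<rho> \<le> 1/4" "\<rho> \<le> r / 2" and m: "1 \<le> m"
  shows "norm (SS (Suc m) x0 R \<psi> z - SS m x0 R \<psi> z) \<le> real CARD('d) * NN m \<rho> ^ CARD('d) *
     (2 * (B * C * exp (3 * real m * \<rho>) * (real m * ((16 * h / real m) ^ p * M p) + 4 * exp (- (r\<^sup>2 / 8) * real m))))"
  unfolding SS_def length_coordinates[symmetric]
proof (rule Sop_increment[where \<rho> = \<rho>])
  have im: "\<bar>Im (z $ i)\<bar> \<le> \<rho>" for i
    using z abs_Im_le_cmod[of "z $ i - of_real (x $ i)"] order_trans by (fastforce simp: polydisc_def)
  show "\<bar>Im (z $ i)\<bar> \<le> \<rho>" for i by (rule im)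
  show "norm (Top (\<lambda>w. ker (Suc m) w - ker m w) (lo x0 R) (hi x0 R) j (cext x0 R \<psi>) w)
     \<le> 2 * (B * C * exp (3 * real m * \<rho>) * (real m * ((16 * h / real m) ^ p * M p) + 4 * exp (- (r\<^sup>2 / 8) * real m)))"
    if "w $ j = z $ j" for j w
    using x z that by (intro Top_increment[OF M lc h C B jet R r, where x = "x $ j"] rho m) (auto simp: mem_cube polydisc_def)
  show "continuous_on UNIV (cext x0 R \<psi>)" by (intro continuous_on_cext jet_bound_continuous[OF jet] R)
  show "0 \<le> 2 * (B * C * exp (3 * real m * \<rho>) * (real m * ((16 * h / real m) ^ p * M p) + 4 * exp (- (r\<^sup>2 / 8) * real m)))"
    using B(1) C h less_imp_le[OF M(1)] by auto
qed (use rho R in \<open>auto intro!: unit_box_cube kbound_ker coordinates\<close>)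

text \<open>In one coordinate the approximation converges faster than any power of
  \<open>1 / m\<close>. The operators of the other coordinates grow at most like powers of
  \<open>m\<close>, with total exponent at most \<open>d\<close>, so the rate
  \<open>1 / m^(d + 1)\<close> per coordinate suffices.\<close>

lemma SS_tendsto:
  fixes M :: "nat \<Rightarrow> real" and x0 :: "real^'d::finite"
  assumes M: "\<And>p. 0 < M p" "M 0 = 1" and lc: "M1 M" and h: "h > 0" and C: "C \<ge> 0"
    and jet: "jet_bound M h C x0 R \<psi>" and R: "0 \<le> R" "R \<le> 1/2" and r: "0 < r" "r \<le> 1"
    and x: "x \<in> cube x0 (R - r)"
  shows "(\<lambda>m. SS m x0 R \<psi> (cvec x)) \<longlonglongrightarrow> \<psi> x"
proof -
  obtain B where B: "B > 0" "\<And>w. \<bar>Re w\<bar> \<le> 2 \<Longrightarrow> \<bar>Im w\<bar> \<le> 2 \<Longrightarrow> norm (amp w) \<le> B"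
    using ex_amp_bound by blast
  define d where "d = CARD('d)"
  define \<gamma> where "\<gamma> = r\<^sup>2 / 8"
  have \<gamma>: "\<gamma> > 0" using r by (simp add: \<gamma>_def)
  \<comment> \<open>Order \<open>d + 4\<close> in the bound for increments loses one power of
    \<open>n\<close> to the factor in front. Of the remaining \<open>d + 3\<close>, two are spent on
    the sum over the increments and \<open>d + 1\<close> give the rate in \<open>m\<close>.\<close>
  define E where "E = 2 * B * C * ((16 * h) ^ (d + 4) * M (d + 4) + 4 * (fact (d + 3) / \<gamma> ^ (d + 3)))"
  have E0: "E \<ge> 0" unfolding E_def using B(1) C h less_imp_le[OF M(1)] \<gamma> by auto
  define Z where "Z = (\<Sum>k. 1 / (real (Suc k))\<^sup>2)"
  have sumZ: "summable (\<lambda>k. 1 / (real (Suc k))\<^sup>2)"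
    using inverse_power_summable[of 2, where 'a = real] summable_Suc_iff[of "\<lambda>k. 1 / (real k)\<^sup>2"] by (simp add: inverse_eq_divide)
  have xR: "x \<in> cube x0 R" using x r by (auto simp: mem_cube abs_le_iff) (smt (verit))+
  have cF: "continuous_on UNIV (cext x0 R \<psi>)" by (intro continuous_on_cext jet_bound_continuous[OF jet] R)
  have app: "norm (Top (ker m) (lo x0 R) (hi x0 R) j (cext x0 R \<psi>) w - cext x0 R \<psi> w) \<le> E / real m ^ (d + 1) * Z"
    if m: "1 \<le> m" and w: "w $ j = of_real (x $ j)" for m j w
  proof -
    define y :: "real^'d" where "y = (\<chi> i. max (x0 $ i - R) (min (x0 $ i + R) (Re (w $ i))))"
    have y: "y \<in> cube x0 R" unfolding y_def by (rule clamp_in_cube[OF R(1)])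
    define v where "v = (\<lambda>t. \<psi> (upd y j t))"
    let ?I = "{x0 $ j - R..x0 $ j + R}"
    have xj: "x0 $ j - R + r \<le> x $ j" "x $ j \<le> x0 $ j + R - r"
      using x by (auto simp: mem_cube abs_le_iff dest!: spec[of _ j])
    have fw: "cext x0 R \<psi> (upd w j (of_real t)) = v t" if "t \<in> ?I" for t
      using cext_upd[OF that, of \<psi> w] by (simp add: v_def y_def)
    have Tk: "Top \<kappa> (lo x0 R) (hi x0 R) j (cext x0 R \<psi>) w = integral ?I (\<lambda>t. \<kappa> (of_real (x $ j) - of_real t) * v t)" for \<kappa>
      unfolding Top_def lo_nth hi_nth w
      by (intro Henstock_Kurzweil_Integration.integral_cong) (simp add: fw)
    have vx: "cext x0 R \<psi> w = v (x $ j)"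
      using fw[of "x $ j"] xj r upd_same[of w j] by (simp add: w)
    have dv: "(v has_vector_derivative partial_deriv j \<psi> (upd y j t)) (at t within ?I)"
      and bv: "norm (partial_deriv j \<psi> (upd y j t)) \<le> C * h * M 1" if "t \<in> ?I" for t
      using jet_line(1)[OF jet y that, of 0] jet_line(2)[OF jet y that, of 1] by (simp_all add: v_def)
    have "norm (integral ?I (\<lambda>t. ker m (of_real (x $ j) - of_real t) * v t) - v (x $ j)) \<le> suminf (\<lambda>k. E / real m ^ (d + 1) * (1 / (real (Suc k))\<^sup>2))"
    proof (rule ker_approx[where C = "C * h * M 1"])
      show "continuous_on ?I v" by (rule continuous_on_vector_derivative[OF dv])
      show "norm (v t - v (x $ j)) \<le> C * h * M 1 * \<bar>t - x $ j\<bar>" if "t \<in> ?I" for t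
        using differentiable_bound[of ?I v "\<lambda>t s. s *\<^sub>R partial_deriv j \<psi> (upd y j t)" "C * h * M 1" t "x $ j"]
          dv bv that xj r by (auto simp: has_vector_derivative_def onorm_scaleR_left bounded_linear_ident onorm_id)
      fix k
      define n where "n = m + k"
      have n: "1 \<le> n" "real n > 0" "real m \<le> real n" "real (Suc k) \<le> real n" using m by (auto simp: n_def)
      have "norm (Top (\<lambda>w. ker (Suc n) w - ker n w) (lo x0 R) (hi x0 R) j (cext x0 R \<psi>) w)
        \<le> 2 * (B * C * exp (3 * real n * 0) * (real n * ((16 * h / real n) ^ (d + 4) * M (d + 4)) + 4 * exp (- (r\<^sup>2 / 8) * real n)))"
        by (rule Top_increment[OF M lc h C B jet R r, where x = "x $ j"])
           (use xj w n(1) r in \<open>auto simp: abs_le_iff\<close>)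
      also have "\<dots> = 2 * B * C * (real n * ((16 * h / real n) ^ (d + 4) * M (d + 4)) + 4 * exp (- \<gamma> * real n))"
        by (simp add: \<gamma>_def)
      also have "\<dots> \<le> 2 * B * C * ((16 * h) ^ (d + 4) * M (d + 4) * (1 / real n ^ (d + 3)) + 4 * (fact (d + 3) / \<gamma> ^ (d + 3) * (1 / real n ^ (d + 3))))"
      proof (intro mult_left_mono add_mono)
        show "real n * ((16 * h / real n) ^ (d + 4) * M (d + 4)) \<le> (16 * h) ^ (d + 4) * M (d + 4) * (1 / real n ^ (d + 3))"
        proof -
          have "d + 4 = Suc (d + 3)" by simp
          then have eq: "real n * (16 * h / real n) ^ (d + 4) = (16 * h) ^ (d + 4) * (1 / real n ^ (d + 3))"
            using n(2) unfolding power_divide by (simp only: power_Suc) (simp add: field_simps)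
          have "real n * ((16 * h / real n) ^ (d + 4) * M (d + 4)) = real n * (16 * h / real n) ^ (d + 4) * M (d + 4)"
            by (simp only: mult.assoc)
          also have "\<dots> = (16 * h) ^ (d + 4) * M (d + 4) * (1 / real n ^ (d + 3))"
            unfolding eq by (simp only: mult_ac)
          finally show ?thesis by simp
        qed
        have "(\<gamma> * real n) ^ (d + 3) \<le> fact (d + 3) * exp (\<gamma> * real n)"
          using \<gamma> by (intro power_le_fact_exp) auto
        then have "exp (- (\<gamma> * real n)) \<le> fact (d + 3) / (\<gamma> * real n) ^ (d + 3)"
          using \<gamma> n(2) by (simp add: exp_minus field_simps)
        then show "exp (- \<gamma> * real n) \<le> fact (d + 3) / \<gamma> ^ (d + 3) * (1 / real n ^ (d + 3))"
          by (simp add: power_mult_distrib)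
      qed (use B(1) C in auto)
      also have "\<dots> = E * (1 / real n ^ (d + 3))"
        by (simp add: E_def algebra_simps add_divide_distrib)
      also have "\<dots> \<le> E * (1 / (real m ^ (d + 1) * (real (Suc k))\<^sup>2))"
      proof (intro mult_left_mono divide_left_mono)
        have "real m ^ (d + 1) * (real (Suc k))\<^sup>2 \<le> real n ^ (d + 1) * (real n)\<^sup>2"
          using n by (intro mult_mono power_mono) auto
        also have "\<dots> = real n ^ (d + 3)" by (simp add: power_add power2_eq_square power3_eq_cube)
        finally show "real m ^ (d + 1) * (real (Suc k))\<^sup>2 \<le> real n ^ (d + 3)" .
      qed (use E0 n m in auto)
      also have "\<dots> = E / real m ^ (d + 1) * (1 / (real (Suc k))\<^sup>2)" by simp
      finally show "norm (integral ?I (\<lambda>t. (ker (Suc (m + k)) (of_real (x $ j) - of_real t) - ker (m + k) (of_real (x $ j) - of_real t)) * v t))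
          \<le> E / real m ^ (d + 1) * (1 / (real (Suc k))\<^sup>2)"
        by (simp add: Tk n_def)
      show "summable (\<lambda>k. E / real m ^ (d + 1) * (1 / (real (Suc k))\<^sup>2))"
        by (rule summable_mult[OF sumZ])
    qed (use xj r in auto)
    also have "\<dots> = E / real m ^ (d + 1) * Z"
      unfolding Z_def by (rule suminf_mult[OF sumZ])
    finally show ?thesis by (simp add: Tk vx)
  qed
  have Z0: "Z \<ge> 0" unfolding Z_def by (intro suminf_nonneg sumZ) auto
  have bound: "norm (SS m x0 R \<psi> (cvec x) - \<psi> x) \<le> (real d * 2 ^ d * E * Z) * (1 / real m)" if m: "1 \<le> m" for m
  proof -
    have "norm (Sop (ker m) (lo x0 R) (hi x0 R) coordinates (cext x0 R \<psi>) (cvec x) - cext x0 R \<psi> (cvec x))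
       \<le> real (length (coordinates :: 'd list)) * NN m 0 ^ length (coordinates :: 'd list) * (E / real m ^ (d + 1) * Z)"
    proof (rule Sop_approx[where \<rho> = 0])
      show "norm (Top (ker m) (lo x0 R) (hi x0 R) j (cext x0 R \<psi>) w - cext x0 R \<psi> w) \<le> E / real m ^ (d + 1) * Z"
        if "w $ j = cvec x $ j" for j w
        using that by (intro app m) simp
    qed (use R cF E0 Z0 in \<open>auto intro!: unit_box_cube kbound_ker coordinates\<close>)
    also have "\<dots> = real d * real (Suc m) ^ d * (E / real m ^ (d + 1) * Z)"
      by (simp add: length_coordinates d_def NN_def)
    also have "\<dots> \<le> real d * (2 * real m) ^ d * (E / real m ^ (d + 1) * Z)"
      using E0 Z0 m by (intro mult_right_mono mult_left_mono power_mono) auto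
    also have "\<dots> = (real d * 2 ^ d * E * Z) * (1 / real m)"
      using m by (simp add: power_mult_distrib)
    finally show ?thesis
      using cext_of_real[of "cvec x" x x0 R \<psi>] xR by (simp add: SS_def)
  qed
  have "(\<lambda>m. SS m x0 R \<psi> (cvec x) - \<psi> x) \<longlonglongrightarrow> 0"
  proof (rule Lim_null_comparison)
    show "\<forall>\<^sub>F m in sequentially. norm (SS m x0 R \<psi> (cvec x) - \<psi> x) \<le> (real d * 2 ^ d * E * Z) * (1 / real m)"
      using eventually_ge_at_top[of 1] by eventually_elim (rule bound)
    show "(\<lambda>m. (real d * 2 ^ d * E * Z) * (1 / real m)) \<longlonglongrightarrow> 0"
      by (intro tendsto_mult_right_zero lim_1_over_n)
  qed
  then show ?thesis by (rule LIM_zero_cancel)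
qed

lemma SS_one_near:
  fixes x :: "real^'d::finite"
  assumes B: "B > 0" "\<And>w. \<bar>Re w\<bar> \<le> 2 \<Longrightarrow> \<bar>Im w\<bar> \<le> 2 \<Longrightarrow> norm (amp w) \<le> B"
    and r: "0 \<le> r" "r \<le> 1/2" and \<sigma>: "0 < \<sigma>" "\<sigma> \<le> 1" and z: "\<And>i. \<bar>Im (z $ i)\<bar> \<le> \<rho>" "\<And>i. \<bar>Re (z $ i) - x $ i\<bar> \<le> r - \<sigma>"
    and rho: "0 \<le> \<rho>" "\<rho> \<le> 1/2" and m: "1 \<le> m"
  shows "norm (SS m x r (\<lambda>_. 1) z - 1) \<le> real CARD('d) * NN m \<rho> ^ CARD('d) *
     ((8 * B / (1 - exp (- (\<sigma>\<^sup>2 / 8))) + 1) * (NN m \<rho> * exp (- (\<sigma>\<^sup>2 / 8) * real m)))"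
  unfolding SS_def cext_const length_coordinates[symmetric]
proof (rule Sop_approx[where \<rho> = \<rho>])
  show "0 \<le> (8 * B / (1 - exp (- (\<sigma>\<^sup>2 / 8))) + 1) * (NN m \<rho> * exp (- (\<sigma>\<^sup>2 / 8) * real m))"
    using B(1) \<sigma> NN_ge(2)[OF rho(1), of m] by (intro mult_nonneg_nonneg add_nonneg_nonneg divide_nonneg_nonneg) auto
  fix j and w :: "complex^'d" assume w: "w $ j = z $ j"
  show "norm (Top (ker m) (lo x r) (hi x r) j (\<lambda>_. 1) w - 1) \<le> (8 * B / (1 - exp (- (\<sigma>\<^sup>2 / 8))) + 1) * (NN m \<rho> * exp (- (\<sigma>\<^sup>2 / 8) * real m))"
    unfolding Top_def w mult_1_right
    by (rule ker_cutoff_approx[OF B]) (use r \<sigma> z[of j] rho m in \<open>auto simp: abs_le_iff\<close>)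
qed (use rho r z in \<open>auto intro!: unit_box_cube kbound_ker coordinates\<close>)


section \<open>Gluing with analytic cutoffs\<close>

lemma Sop_diff:
  assumes "\<kappa> holomorphic_on UNIV" "continuous_on UNIV F" "continuous_on UNIV G"
  shows "Sop \<kappa> a b js (\<lambda>w. F w - G w) = (\<lambda>w. Sop \<kappa> a b js F w - Sop \<kappa> a b js G w)"
proof (induction js)
  case (Cons j js)
  show ?case
    using Top_diff[OF assms(1) continuous_on_Sop[OF assms(1,2)] continuous_on_Sop[OF assms(1,3)], of a b j] Cons
    by auto
qed simp

lemma SS_diff:
  assumes "continuous_on (cube x r) f" "continuous_on (cube x r) g" "0 \<le> r"
  shows "SS m x r (\<lambda>y. f y - g y) z = SS m x r f z - SS m x r g z"
proof -
  have "cext x r (\<lambda>y. f y - g y) = (\<lambda>w. cext x r f w - cext x r g w)" by (rule ext) (simp add: cext_def)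
  then show ?thesis
    unfolding SS_def by (simp add: Sop_diff[OF holomorphic_on_ker continuous_on_cext continuous_on_cext] assms)
qed

lemma SS_cong:
  assumes "\<And>y. y \<in> cube x r \<Longrightarrow> f y = g y" "0 \<le> r"
  shows "SS m x r f = SS m x r g"
proof -
  have "cext x r f = cext x r g" unfolding cext_def using assms clamp_in_cube by blast
  then show ?thesis by (simp add: SS_def)
qed

text \<open>Each function takes its share of what its predecessors have left over, and the product
  is what remains at the end. The identity is purely algebraic, so it also applies to complex-valued
  cutoffs that are only approximately 0 or 1.\<close>

lemma telescoping_partition:
  fixes X :: "nat \<Rightarrow> 'a::comm_ring_1"
  assumes "finite A"
  shows "(\<Sum>n\<in>A. X n * (\<Prod>k\<in>{k\<in>A. k < n}. 1 - X k)) = 1 - (\<Prod>n\<in>A. 1 - X n)"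
  using assms
proof (induction A rule: finite_linorder_max_induct)
  case (insert b A)
  have 1: "{k \<in> insert b A. k < b} = A" using insert by auto
  have 2: "{k \<in> insert b A. k < n} = {k \<in> A. k < n}" if "n \<in> A" for n using insert that by force
  have b: "b \<notin> A" using insert by auto
  have "(\<Sum>n\<in>A. X n * (\<Prod>k\<in>{k\<in>insert b A. k < n}. 1 - X k)) = (\<Sum>n\<in>A. X n * (\<Prod>k\<in>{k\<in>A. k < n}. 1 - X k))"
    by (intro sum.cong refl) (simp only: 2)
  then have "(\<Sum>n\<in>insert b A. X n * (\<Prod>k\<in>{k\<in>insert b A. k < n}. 1 - X k)) = X b * (\<Prod>k\<in>A. 1 - X k) + (1 - (\<Prod>n\<in>A. 1 - X n))"
    by (simp only: sum.insert[OF insert(1) b] 1 insert.IH)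
  also have "\<dots> = 1 - (\<Prod>n\<in>insert b A. 1 - X n)"
    by (simp only: prod.insert[OF insert(1) b]) (simp add: algebra_simps)
  finally show ?case .
qed simp

lemma for_h_ball:
  assumes "finite P" "\<And>n. n \<in> P \<Longrightarrow> for_h c (Q n)"
    and "\<And>n h h'. n \<in> P \<Longrightarrow> 0 < h \<Longrightarrow> h \<le> h' \<Longrightarrow> Q n h \<Longrightarrow> Q n h'"
  shows "for_h c (\<lambda>h. \<forall>n\<in>P. Q n h)"
  using assms
proof (induction P rule: finite_induct)
  case empty
  have "\<exists>h::real. h > 0" by (rule exI[of _ 1]) simp
  then show ?case by (cases c) (simp_all add: for_h_def)
next
  case (insert n P)
  have "for_h c (\<lambda>h. Q n h \<and> (\<forall>n\<in>P. Q n h))"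
  proof (rule for_h_conj)
    show "\<forall>n\<in>P. Q n h'" if "0 < h" "h \<le> h'" "\<forall>n\<in>P. Q n h" for h h'
      using that insert.prems(2) by blast
    show "Q n h'" if "0 < h" "h \<le> h'" "Q n h" for h h'
      using insert.prems(2)[of n h h'] that by simp
    show "for_h c (Q n)" by (rule insert.prems(1)) simp
    show "for_h c (\<lambda>h. \<forall>n\<in>P. Q n h)"
    proof (rule insert.IH)
      show "for_h c (Q n)" if "n \<in> P" for n using that by (intro insert.prems(1)) simp
      show "Q n h'" if "n \<in> P" "0 < h" "h \<le> h'" "Q n h" for n h h'
        using insert.prems(2)[of n h h'] that by simp
    qed
  qed
  then show ?case by (rule for_h_mono) simp
qed

lemma jet_bound_mono:
  assumes "\<And>p. 0 < M p" "0 < h" "h \<le> h'" "0 \<le> C" "C \<le> C'" "jet_bound M h C x0 R \<psi>"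
  shows "jet_bound M h' C' x0 R \<psi>"
proof -
  have "C * h ^ k * M k \<le> C' * h' ^ k * M k" for k
    using assms less_imp_le[OF assms(1)] by (intro mult_mono power_mono) auto
  then show ?thesis
    using assms(6) unfolding jet_bound_def by (meson order_trans)
qed

text \<open>Cubes are products of intervals: if no coordinate separated them, a common point could
  be assembled coordinate by coordinate. The coordinate found here is the one in which a kernel is
  small.\<close>

lemma disjoint_cubes_coordinate:
  fixes x y :: "real^'d::finite"
  assumes "cube x s \<inter> cube y t = {}" "0 \<le> s" "0 \<le> t"
  shows "\<exists>j. s + t < \<bar>x $ j - y $ j\<bar>"
proof (rule ccontr)
  assume "\<not> ?thesis"
  then have le: "\<bar>x $ j - y $ j\<bar> \<le> s + t" for j by (simp add: not_less)
  define w :: "real^'d" where "w = (\<chi> j. max (x $ j - s) (y $ j - t))"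
  have "w \<in> cube x s \<inter> cube y t"
    using le assms(2,3) by (auto simp: mem_cube w_def abs_le_iff max_def) (smt (verit))+
  then show False using assms(1) by auto
qed

text \<open>The bound on \<open>\<rho>\<close> keeps the exponential growth of the \<open>k\<close>
  factors below \<open>exp(\<gamma> m / 2)\<close>, because \<open>2 * (m + 1) \<le> 4 * m\<close>;
  the other half of the decay absorbs the powers of \<open>m\<close>. The additional factor
  \<open>m\<close> stands for the number of active cubes, or serves as a rate of
  convergence.\<close>

lemma NN_power_small:
  assumes \<gamma>: "0 < \<gamma>" and \<rho>: "0 \<le> \<rho>" "\<rho> \<le> \<gamma> / (8 * real k)" and k: "1 \<le> k" and m: "1 \<le> m"
  shows "real m * (NN m \<rho> ^ k * exp (- \<gamma> * real m)) \<le> fact (k + 1) * (2 / \<gamma>) ^ (k + 1) * exp (\<gamma> / 2)"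
proof -
  have "2 * real (Suc m) * \<rho> \<le> 4 * real m * \<rho>"
    using m \<rho> by (intro mult_right_mono) auto
  then have "real k * (2 * real (Suc m) * \<rho>) \<le> real k * (4 * real m * (\<gamma> / (8 * real k)))"
    using m \<rho> by (intro mult_left_mono order_trans[OF \<open>2 * real (Suc m) * \<rho> \<le> 4 * real m * \<rho>\<close>]) auto
  also have "\<dots> = \<gamma> * real m / 2" using k by simp
  finally have "exp (real k * (2 * real (Suc m) * \<rho>)) \<le> exp (\<gamma> * real m / 2)" by simp
  then have "NN m \<rho> ^ k \<le> real (Suc m) ^ k * exp (\<gamma> * real m / 2)"
    unfolding NN_def power_mult_distrib by (intro mult_left_mono) (auto simp flip: exp_of_nat_mult)
  then have "real m * (NN m \<rho> ^ k * exp (- \<gamma> * real m)) \<le> real (Suc m) * ((real (Suc m) ^ k * exp (\<gamma> * real m / 2)) * exp (- \<gamma> * real m))"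
    using NN_ge(2)[OF \<rho>(1), of m] by (intro mult_mono) auto
  also have "\<dots> = real (Suc m) ^ (k + 1) * (exp (\<gamma> * real m / 2) * exp (- \<gamma> * real m))"
    by (simp only: mult_ac power_add power_one_right)
  also have "\<dots> = real (Suc m) ^ (k + 1) * exp (- (\<gamma> * real m / 2))"
    by (simp add: mult_exp_exp)
  also have "\<dots> \<le> (fact (k + 1) * (2 / \<gamma>) ^ (k + 1) * exp (\<gamma> * real (Suc m) / 2)) * exp (- (\<gamma> * real m / 2))"
  proof (intro mult_right_mono)
    have "(\<gamma> * real (Suc m) / 2) ^ (k + 1) \<le> fact (k + 1) * exp (\<gamma> * real (Suc m) / 2)"
      using \<gamma> by (intro power_le_fact_exp) auto
    then have le: "(2 / \<gamma>) ^ (k + 1) * (\<gamma> * real (Suc m) / 2) ^ (k + 1) \<le> (2 / \<gamma>) ^ (k + 1) * (fact (k + 1) * exp (\<gamma> * real (Suc m) / 2))"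
      using \<gamma> by (intro mult_left_mono) auto
    have eq: "2 / \<gamma> * (\<gamma> * real (Suc m) / 2) = real (Suc m)" using \<gamma> by simp
    show "real (Suc m) ^ (k + 1) \<le> fact (k + 1) * (2 / \<gamma>) ^ (k + 1) * exp (\<gamma> * real (Suc m) / 2)"
      using le unfolding power_mult_distrib[symmetric] eq by (simp only: mult_ac)
  qed auto
  also have "\<dots> = fact (k + 1) * (2 / \<gamma>) ^ (k + 1) * (exp (\<gamma> * real (Suc m) / 2) * exp (- (\<gamma> * real m / 2)))"
    by (simp only: mult.assoc)
  also have "exp (\<gamma> * real (Suc m) / 2) * exp (- (\<gamma> * real m / 2)) = exp (\<gamma> / 2)"
    unfolding mult_exp_exp by (simp add: algebra_simps add_divide_distrib)
  finally show ?thesis .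
qed

text \<open>The cutoff of index \<open>n\<close> lives on the cube of radius \<open>r n\<close>
  about \<open>p n\<close>, the function \<open>g n\<close> on the doubled cube, so that
  \<open>g n\<close> is available in a neighbourhood of each point of the smaller closed cube. The
  bounds \<open>b n\<close> may grow arbitrarily with \<open>n\<close>.\<close>

locale glue =
  fixes M :: "nat \<Rightarrow> real" and c :: ultra_case and N :: "nat set"
    and p :: "nat \<Rightarrow> real^'d::finite" and r :: "nat \<Rightarrow> real" and g :: "nat \<Rightarrow> real^'d \<Rightarrow> complex" and b :: "nat \<Rightarrow> real"
  assumes M: "\<And>q. 0 < M q" "M 0 = 1" and lc: "M1 M" and M2: "M2' M" and fac: "dominates c M fact"
    and r: "\<And>n. n \<in> N \<Longrightarrow> 0 < r n" "\<And>n. n \<in> N \<Longrightarrow> r n \<le> 1/4"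
    and g: "\<And>n. n \<in> N \<Longrightarrow> continuous_on (cube (p n) (2 * r n)) (g n)"
    and b: "\<And>n y. n \<in> N \<Longrightarrow> y \<in> cube (p n) (2 * r n) \<Longrightarrow> norm (g n y) \<le> b n" "\<And>n. 0 \<le> b n"
begin

definition X :: "nat \<Rightarrow> nat \<Rightarrow> complex^'d \<Rightarrow> complex" where
  "X n m z = SS m (p n) (r n) (\<lambda>_. 1) z"

text \<open>At stage \<open>m\<close> only finitely many cubes take part, and only those on which \<open>g n\<close> is bounded by \<open>m\<close>,
  so that the exponentially small errors survive summation over them. Each cube is eventually active.\<close>
definition act :: "nat \<Rightarrow> nat set" where
  "act m = {n \<in> N. n < m \<and> b n \<le> real m}"

text \<open>Shaped so that \<open>1 - (\<Sum>n\<in>act m. chi n m z)\<close> is the product of the factors \<open>1 - X n m z\<close>, one of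
  which is exponentially small.\<close>
definition chi :: "nat \<Rightarrow> nat \<Rightarrow> complex^'d \<Rightarrow> complex" where
  "chi n m z = X n m z * (\<Prod>k\<in>{k \<in> act m. k < n}. 1 - X k m z)"

definition Dd :: "nat \<Rightarrow> nat \<Rightarrow> complex^'d \<Rightarrow> complex" where
  "Dd n m z = SS (Suc m) (p n) (2 * r n) (g n) z - SS m (p n) (2 * r n) (g n) z"

definition corr :: "nat \<Rightarrow> complex^'d \<Rightarrow> complex" where
  "corr m z = (\<Sum>n\<in>act m. chi n m z * Dd n m z)"

lemma finite_act: "finite (act m)" and card_act: "card (act m) \<le> m" and act_N: "act m \<subseteq> N"
proof -
  have "act m \<subseteq> {..<m}" by (auto simp: act_def)
  then show "finite (act m)" "card (act m) \<le> m"
    using finite_subset[of "act m" "{..<m}"] card_mono[of "{..<m}" "act m"] by auto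
  show "act m \<subseteq> N" by (auto simp: act_def)
qed

lemma entire_corr: "entire (corr m)"
  unfolding corr_def chi_def X_def Dd_def
proof (intro entire_sum entire_mult entire_prod entire_diff entire_const)
  show "entire (SS m (p n) (r n) (\<lambda>_. 1))" if "n \<in> act m" for n
    using that act_N r(1) by (intro entire_SS) (auto intro: less_imp_le)
  show "entire (SS m (p n) (r n) (\<lambda>_. 1))" if "n \<in> {k \<in> act m. k < n'}" for n n'
    using that act_N r(1) by (intro entire_SS) (auto intro: less_imp_le)
  show "entire (SS (Suc m) (p n) (2 * r n) (g n))" "entire (SS m (p n) (2 * r n) (g n))" if "n \<in> act m" for n
    using that act_N r(1) g by (intro entire_SS; force intro: less_imp_le)+
qed

lemma sum_chi: "(\<Sum>n\<in>act m. chi n m z) = 1 - (\<Prod>n\<in>act m. 1 - X n m z)"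
  unfolding chi_def by (rule telescoping_partition[OF finite_act])

text \<open>With \<open>F\<close> the increment of \<open>f\<close>, the quantity to be bounded is
  \<open>F\<close> times the product of all \<open>1 - X n\<close>, plus the sum of
  \<open>chi n * (F - Dd n)\<close>. The product contains the exponentially small factor of
  \<open>k0\<close>, whose cube surrounds the point. For \<open>n\<close> outside \<open>P\<close>
  the cutoff \<open>X n\<close> is exponentially small. For \<open>n\<close> in \<open>P\<close> the
  difference \<open>F - Dd n\<close> is the increment of \<open>\<psi> n\<close>, up to
  exponentially small errors from changing the cube. Growth in \<open>m\<close> is collected in
  powers of \<open>NN m \<rho>\<close>.\<close>

lemma local_estimate:
  fixes x0 :: "real^'d" and f :: "real^'d \<Rightarrow> complex" and \<psi> :: "nat \<Rightarrow> real^'d \<Rightarrow> complex"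
  assumes B: "B > 0" "\<And>w. \<bar>Re w\<bar> \<le> 2 \<Longrightarrow> \<bar>Im w\<bar> \<le> 2 \<Longrightarrow> norm (amp w) \<le> B"
    and R: "0 < R" "R \<le> 1/2" and f: "continuous_on (cube x0 R) f" "\<And>y. y \<in> cube x0 R \<Longrightarrow> norm (f y) \<le> Cf" "0 \<le> Cf"
    and P: "finite P" "P \<subseteq> N" "\<And>n. n \<in> P \<Longrightarrow> cube x0 R \<subseteq> cube (p n) (2 * r n)"
      "\<And>n. n \<in> N - P \<Longrightarrow> cube x0 R \<inter> cube (p n) (r n) = {}" "k0 \<in> P" "cube x0 R \<subseteq> cube (p k0) (r k0)"
    and bP: "\<And>n. n \<in> P \<Longrightarrow> b n \<le> bm" "0 \<le> bm"
    and \<psi>: "\<And>n y. n \<in> P \<Longrightarrow> y \<in> cube x0 R \<Longrightarrow> \<psi> n y = f y - g n y"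
    and jet: "\<And>n. n \<in> P \<Longrightarrow> jet_bound M h C x0 R (\<psi> n)" and h: "0 < h" "0 \<le> C"
    and \<gamma>: "\<gamma> = R\<^sup>2 / 32" and D: "D = 8 * B / (1 - exp (- \<gamma>)) + 1" and E: "E = fact (CARD('d) + 2) * (2 / \<gamma>) ^ (CARD('d) + 2) * exp (\<gamma> / 2)"
    and \<rho>: "0 \<le> \<rho>" "\<rho> \<le> R / 4" "\<rho> \<le> \<gamma> / (8 * real (CARD('d) + 1))" and x: "x \<in> cube x0 (R / 4)" and z: "z \<in> polydisc x \<rho>"
    and m: "1 \<le> m" "P \<subseteq> act m"
  shows "norm (SS (Suc m) x0 R f z - SS m x0 R f z - corr m z)
     \<le> exp E * 2 ^ card P * (2 * Cf * real CARD('d) * D + 2 * (Cf + 1) + real (card P) * (8 * real CARD('d) * B * C + 4 * real CARD('d) * bm))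
       * NN m \<rho> ^ (2 * CARD('d) + 3 + CARD('d) * card P) * ((16 * h / real m) ^ q * M q + exp (- \<gamma> * real m))"
proof -
  define d where "d = CARD('d)"
  define G where "G = NN m \<rho>"
  define e where "e = exp (- \<gamma> * real m)"
  define A where "A = (16 * h / real m) ^ q * M q"
  have A0: "0 \<le> A" using h M(1)[of q] by (simp add: A_def less_imp_le)
  \<comment> \<open>\<open>\<gamma>\<close> is \<open>(R / 2)^2 / 8\<close>, the smallest of the
    decay rates that occur at distance \<open>R / 2\<close>; in some of the estimates the rate is
    \<open>(R / 2)^2 / 2\<close>.\<close>
  have \<gamma>0: "\<gamma> > 0" using R by (simp add: \<gamma>)
  have e0: "0 < e" "e \<le> 1" using \<gamma>0 by (auto simp: e_def)
  have G1: "1 \<le> G" "real m \<le> G" using NN_ge[OF \<rho>(1), of m] by (auto simp: G_def)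
  have \<rho>1: "\<rho> \<le> 1/4" "\<rho> \<le> 1" "\<rho> \<le> 1/2" using \<rho> R by auto
  have D0: "D \<ge> 0" using B(1) \<gamma>0 unfolding D by (intro add_nonneg_nonneg divide_nonneg_nonneg) auto
  have im: "\<bar>Im (z $ i)\<bar> \<le> \<rho>" for i
    using z abs_Im_le_cmod[of "z $ i - of_real (x $ i)"] order_trans by (fastforce simp: polydisc_def)
  have re: "\<bar>Re (z $ i) - x0 $ i\<bar> \<le> R / 2" for i
  proof -
    have "\<bar>Re (z $ i) - x $ i\<bar> \<le> \<rho>"
      using z abs_Re_le_cmod[of "z $ i - of_real (x $ i)"] order_trans by (fastforce simp: polydisc_def)
    moreover have "\<bar>x $ i - x0 $ i\<bar> \<le> R / 4" using x by (simp add: mem_cube)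
    ultimately show ?thesis using \<rho>(2) by linarith
  qed
  have r2: "0 \<le> 2 * r n" "2 * r n \<le> 1/2" "0 \<le> r n" "r n \<le> 1/2" if "n \<in> N" for n using r[OF that] by auto
  define F where "F = SS (Suc m) x0 R f z - SS m x0 R f z"
  have Fb: "norm F \<le> 2 * G ^ d * Cf"
    using norm_triangle_ineq4[of "SS (Suc m) x0 R f z" "SS m x0 R f z"]
      norm_SS_le[of "Suc m" m R x0 f Cf z \<rho>] norm_SS_le[of m m R x0 f Cf z \<rho>] R f im \<rho> \<rho>1
    unfolding F_def G_def d_def by simp
  have Db: "norm (Dd n m z) \<le> 2 * G ^ d * b n" if n: "n \<in> N" for n
    using norm_triangle_ineq4[of "SS (Suc m) (p n) (2 * r n) (g n) z" "SS m (p n) (2 * r n) (g n) z"]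
      norm_SS_le[of "Suc m" m "2 * r n" "p n" "g n" "b n" z \<rho>] norm_SS_le[of m m "2 * r n" "p n" "g n" "b n" z \<rho>] r2[OF n] g[OF n] b(1)[OF n] b(2)[of n] im \<rho> \<rho>1
    unfolding Dd_def G_def d_def by simp
  have Xb: "norm (X n m z) \<le> G ^ d" if n: "n \<in> N" for n
    using norm_SS_le[of m m "r n" "p n" "\<lambda>_. 1" 1 z \<rho>] r2[OF n] im \<rho> \<rho>1
    unfolding X_def G_def d_def by simp
  have Xfar: "norm (X n m z) \<le> G ^ (d + 1) * e" if n: "n \<in> N - P" for n
  proof -
    \<comment> \<open>The real part of \<open>z\<close> is within \<open>R / 2\<close> of
      \<open>x0\<close>, so at least \<open>R / 2\<close> remains between it and the interval of
      integration.\<close>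
    obtain j where j: "R + r n < \<bar>x0 $ j - p n $ j\<bar>"
      using disjoint_cubes_coordinate[OF P(4)[OF n]] R r[of n] n by fastforce
    have "norm (X n m z) \<le> NN m \<rho> ^ CARD('d) * (NN m \<rho> * exp (- ((R / 2)\<^sup>2 / 2) * real m)) * 1"
      unfolding X_def
    proof (rule norm_SS_far[where j = j])
      show "R / 2 \<le> \<bar>Re (z $ j) - t\<bar>" if "t \<in> {p n $ j - r n..p n $ j + r n}" for t
      proof -
        have "\<bar>t - p n $ j\<bar> \<le> r n" using that by auto
        then show ?thesis using j re[of j] by linarith
      qed
    qed (use r2[of n] n im \<rho> \<rho>1 R in auto)
    also have "exp (- ((R / 2)\<^sup>2 / 2) * real m) \<le> e"
      unfolding e_def \<gamma> by (simp add: power_divide mult_right_mono)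
    finally show ?thesis
      using G1 by (simp add: G_def d_def mult_ac)
  qed
  have Xnear: "norm (1 - X k0 m z) \<le> real d * D * G ^ (d + 1) * e"
  proof -
    have kN: "k0 \<in> N" using P by auto
    note sub = cube_subset_iff[OF less_imp_le[OF R(1)] P(6)]
    have "norm (SS m (p k0) (r k0) (\<lambda>_. 1) z - 1) \<le> real CARD('d) * NN m \<rho> ^ CARD('d) *
     ((8 * B / (1 - exp (- ((R / 2)\<^sup>2 / 8))) + 1) * (NN m \<rho> * exp (- ((R / 2)\<^sup>2 / 8) * real m)))"
    proof (rule SS_one_near[OF B])
      show "\<bar>Re (z $ i) - p k0 $ i\<bar> \<le> r k0 - R / 2" for i
        using re[of i] sub[of i] by linarith
    qed (use r2[OF kN] R im \<rho> \<rho>1 m in auto)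
    moreover have "(R / 2)\<^sup>2 / 8 = \<gamma>" by (simp add: \<gamma> power_divide)
    ultimately show ?thesis
      by (simp add: X_def D G_def d_def e_def norm_minus_commute mult_ac)
  qed
  have near: "norm (F - Dd n m z) \<le> (8 * real d * B * C + 4 * real d * bm) * G ^ (d + 3) * (A + e)" if n: "n \<in> P" for n
  proof -
    have nN: "n \<in> N" using n P by auto
    have gc: "continuous_on (cube x0 R) (g n)" by (rule continuous_on_subset[OF g[OF nN] P(3)[OF n]])
    have loc: "norm (SS i (p n) (2 * r n) (g n) z - SS i x0 R (g n) z) \<le> 2 * real d * G ^ (d + 3) * e * bm" if i: "i = m \<or> i = Suc m" for i
    proof -
      have "norm (SS i (p n) (2 * r n) (g n) z - SS i x0 R (g n) z) \<le> 2 * real CARD('d) * NN m \<rho> ^ CARD('d) * (NN m \<rho> * exp (- ((R / 2)\<^sup>2 / 2) * real m)) * b n"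
        by (rule SS_local[OF i r2(2)[OF nN] g[OF nN] b(1)[OF nN] b(2)[of n] im \<rho>(1) \<rho>1(2) _ P(3)[OF n]])
           (use R re in auto)
      also have "\<dots> \<le> 2 * real CARD('d) * NN m \<rho> ^ CARD('d) * (NN m \<rho> ^ 3 * e) * bm"
      proof (intro mult_mono mult_left_mono)
        show "NN m \<rho> \<le> NN m \<rho> ^ 3" using G1 power_increasing[of 1 3 G] by (simp add: G_def)
        show "exp (- ((R / 2)\<^sup>2 / 2) * real m) \<le> e"
          unfolding e_def \<gamma> by (simp add: power_divide mult_right_mono)
      qed (use bP n b(2) G1 e0 in \<open>auto simp: G_def\<close>)
      finally show ?thesis by (simp add: G_def d_def power_add mult_ac)
    qed
    have eq: "SS i x0 R (\<psi> n) z = SS i x0 R f z - SS i x0 R (g n) z" for i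
      using SS_cong[of x0 R "\<psi> n" "\<lambda>y. f y - g n y" i] SS_diff[OF f(1) gc, of i z] \<psi>[OF n] R by simp
    have H: "norm (SS (Suc m) x0 R (\<psi> n) z - SS m x0 R (\<psi> n) z) \<le> 8 * real d * B * C * G ^ (d + 3) * (A + e)"
    proof -
      have "norm (SS (Suc m) x0 R (\<psi> n) z - SS m x0 R (\<psi> n) z) \<le> real CARD('d) * NN m \<rho> ^ CARD('d) *
        (2 * (B * C * exp (3 * real m * \<rho>) * (real m * ((16 * h / real m) ^ q * M q) + 4 * exp (- ((R / 2)\<^sup>2 / 8) * real m))))"
      proof (rule SS_increment[OF M lc h B jet[OF n], where x = x])
        have "\<bar>x $ i - x0 $ i\<bar> \<le> R - R / 2" for i
        proof -
          have "\<bar>x $ i - x0 $ i\<bar> \<le> R / 4" using x by (simp add: mem_cube)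
          then show ?thesis using R(1) by linarith
        qed
        then show "x \<in> cube x0 (R - R / 2)" by (simp add: mem_cube)
      qed (use R z \<rho> \<rho>1 m in auto)
      also have "(R / 2)\<^sup>2 / 8 = \<gamma>" by (simp add: \<gamma> power_divide)
      also have "real CARD('d) * NN m \<rho> ^ CARD('d) *
        (2 * (B * C * exp (3 * real m * \<rho>) * (real m * ((16 * h / real m) ^ q * M q) + 4 * exp (- \<gamma> * real m))))
        \<le> real d * G ^ d * (2 * (B * C * G ^ 2 * (4 * G * (A + e))))"
        unfolding d_def G_def[symmetric]
      proof (intro mult_left_mono mult_mono)
        have "3 * real m * \<rho> \<le> real 2 * (2 * real (Suc m) * \<rho>)"
          using \<rho> by (simp add: algebra_simps)
        then have "exp (3 * real m * \<rho>) \<le> exp (2 * real (Suc m) * \<rho>) ^ 2"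
          unfolding exp_of_nat_mult[symmetric] by simp
        also have "\<dots> \<le> G ^ 2" unfolding G_def NN_def by (intro power_mono) auto
        finally show "exp (3 * real m * \<rho>) \<le> G ^ 2" .
        have "real m * A + 4 * e \<le> 4 * G * A + 4 * G * e"
          using G1 A0 e0 by (intro add_mono mult_mono) auto
        then show "real m * ((16 * h / real m) ^ q * M q) + 4 * exp (- \<gamma> * real m) \<le> 4 * G * (A + e)"
          by (simp add: A_def e_def algebra_simps)
      qed (use B(1) h G1 A0 e0 in \<open>auto simp: A_def[symmetric] e_def[symmetric]\<close>)
      also have "\<dots> = 8 * real d * B * C * G ^ (d + 3) * (A + e)"
        by (simp add: power_add power2_eq_square power3_eq_cube mult_ac)
      finally show ?thesis .
    qed
    have "F - Dd n m z = (SS (Suc m) x0 R (\<psi> n) z - SS m x0 R (\<psi> n) z)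
        + (SS m (p n) (2 * r n) (g n) z - SS m x0 R (g n) z) - (SS (Suc m) (p n) (2 * r n) (g n) z - SS (Suc m) x0 R (g n) z)"
      by (simp add: F_def Dd_def eq)
    also have "norm \<dots> \<le> 8 * real d * B * C * G ^ (d + 3) * (A + e) + 2 * real d * G ^ (d + 3) * e * bm + 2 * real d * G ^ (d + 3) * e * bm"
      by (intro norm_triangle_le_diff norm_triangle_mono add_mono order_trans[OF norm_triangle_ineq] order_trans[OF norm_triangle_ineq4] H loc) auto
    also have "\<dots> \<le> 8 * real d * B * C * G ^ (d + 3) * (A + e) + 4 * real d * bm * G ^ (d + 3) * (A + e)"
    proof -
      have "4 * real d * bm * G ^ (d + 3) * e \<le> 4 * real d * bm * G ^ (d + 3) * (A + e)"
        using bP G1 A0 by (intro mult_left_mono) auto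
      then show ?thesis by (simp add: mult_ac)
    qed
    finally show ?thesis by (simp add: algebra_simps)
  qed
  define Hh where "Hh = exp E * (2 * G ^ d) ^ card P"
  \<comment> \<open>There are at most \<open>m\<close> factors away from \<open>P\<close>, each
    within \<open>G^(d + 1) * e\<close> of 1 and hence with a bounded product; the at most
    \<open>card P\<close> others are bounded by \<open>2 * G^d\<close> each.\<close>
  have prodb: "norm (\<Prod>k\<in>S. 1 - X k m z) \<le> Hh" if S: "S \<subseteq> act m" for S
  proof -
    have fS: "finite S" using S finite_act finite_subset by blast
    have SN: "S \<subseteq> N" using S act_N by blast
    have "(\<Prod>k\<in>S. 1 - X k m z) = (\<Prod>k\<in>S - P. 1 - X k m z) * (\<Prod>k\<in>S \<inter> P. 1 - X k m z)"
      by (subst prod.Int_Diff[OF fS, of _ P]) (simp add: mult.commute)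
    moreover have "norm (\<Prod>k\<in>S - P. 1 - X k m z) \<le> exp E"
    proof -
      have "norm (\<Prod>k\<in>S - P. 1 - X k m z) \<le> (\<Prod>k\<in>S - P. 1 + G ^ (d + 1) * e)"
        unfolding prod_norm[symmetric]
      proof (rule prod_mono)
        fix k assume "k \<in> S - P"
        then have "norm (X k m z) \<le> G ^ (d + 1) * e" using SN by (intro Xfar) auto
        then show "0 \<le> norm (1 - X k m z) \<and> norm (1 - X k m z) \<le> 1 + G ^ (d + 1) * e"
          using norm_triangle_ineq4[of 1 "X k m z"] by simp
      qed
      also have "\<dots> \<le> (1 + G ^ (d + 1) * e) ^ m"
      proof -
        have "card (S - P) \<le> card (act m)" using S finite_act by (intro card_mono) auto
        then show ?thesis using card_act[of m] G1 e0 by (simp add: power_increasing)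
      qed
      also have "\<dots> \<le> exp (G ^ (d + 1) * e) ^ m"
        using G1 e0 by (intro power_mono exp_ge_add_one_self) auto
      also have "\<dots> = exp (real m * (G ^ (d + 1) * e))" by (simp add: exp_of_nat_mult)
      also have "\<dots> \<le> exp E"
      proof -
        have "real m * (G ^ (d + 1) * e) \<le> fact (d + 1 + 1) * (2 / \<gamma>) ^ (d + 1 + 1) * exp (\<gamma> / 2)"
          unfolding G_def e_def by (rule NN_power_small[OF \<gamma>0 \<rho>(1)]) (use \<rho>(3) m in \<open>auto simp: d_def\<close>)
        then show ?thesis by (simp add: E d_def)
      qed
      finally show ?thesis .
    qed
    moreover have "norm (\<Prod>k\<in>S \<inter> P. 1 - X k m z) \<le> (2 * G ^ d) ^ card P"
    proof -
      have Gd: "1 \<le> G ^ d" using G1 by simp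
      have "norm (\<Prod>k\<in>S \<inter> P. 1 - X k m z) \<le> (\<Prod>k\<in>S \<inter> P. 2 * G ^ d)"
        unfolding prod_norm[symmetric]
      proof (rule prod_mono)
        fix k assume "k \<in> S \<inter> P"
        then have "norm (X k m z) \<le> G ^ d" using SN by (intro Xb) auto
        then show "0 \<le> norm (1 - X k m z) \<and> norm (1 - X k m z) \<le> 2 * G ^ d"
          using norm_triangle_ineq4[of 1 "X k m z"] Gd by simp
      qed
      also have "\<dots> = (2 * G ^ d) ^ card (S \<inter> P)" by simp
      also have "\<dots> \<le> (2 * G ^ d) ^ card P"
        using Gd P(1) by (intro power_increasing card_mono) auto
      finally show ?thesis .
    qed
    ultimately show ?thesis
      unfolding Hh_def norm_mult by (simp add: norm_mult mult_mono)
  qed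
  have Hh0: "0 \<le> Hh" using G1 by (simp add: Hh_def)
  have chib: "norm (chi n m z) \<le> norm (X n m z) * Hh" for n
    unfolding chi_def norm_mult by (intro mult_left_mono prodb) auto
  \<comment> \<open>The largest power of \<open>G\<close> among the three contributions below, not
    counting the powers contained in \<open>Hh\<close>.\<close>
  define K where "K = 2 * d + 3"
  have i1: "2 * d + 1 = d + (d + 1)" "2 * d + 3 = 1 + ((d + 1) + (d + 1))" "K = d + (d + 3)"
    by (simp_all add: K_def)
  have pw: "G ^ (2 * d + 1) = G ^ d * G ^ (d + 1)" "G ^ (2 * d + 3) = G * (G ^ (d + 1) * G ^ (d + 1))" "G ^ K = G ^ d * G ^ (d + 3)"
    by (simp_all only: i1 power_add power_one_right)
  have Gle: "G ^ i \<le> G ^ K" if "i \<le> K" for i using G1 that by (intro power_increasing) auto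
  have T1: "norm (F * (\<Prod>n\<in>act m. 1 - X n m z)) \<le> 2 * Cf * real d * D * Hh * G ^ K * (A + e)"
  proof -
    have "k0 \<in> act m" using P(5) m(2) by auto
    then have "(\<Prod>n\<in>act m. 1 - X n m z) = (1 - X k0 m z) * (\<Prod>n\<in>act m - {k0}. 1 - X n m z)"
      by (rule prod.remove[OF finite_act])
    then have "norm (F * (\<Prod>n\<in>act m. 1 - X n m z)) = norm F * (norm (1 - X k0 m z) * norm (\<Prod>n\<in>act m - {k0}. 1 - X n m z))"
      by (simp only: norm_mult)
    also have "\<dots> \<le> (2 * G ^ d * Cf) * ((real d * D * G ^ (d + 1) * e) * Hh)"
    proof (intro mult_mono Fb Xnear prodb)
      show "0 \<le> 2 * G ^ d * Cf" using G1 f(3) by simp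
      show "0 \<le> real d * D * G ^ (d + 1) * e" using G1 D0 e0 by simp
    qed auto
    also have "\<dots> = 2 * Cf * real d * D * Hh * G ^ (2 * d + 1) * e"
      unfolding pw by (simp only: mult_ac)
    also have "\<dots> \<le> 2 * Cf * real d * D * Hh * G ^ K * (A + e)"
      using G1 f(3) D0 e0 A0 Hh0 by (intro mult_mono Gle) (auto simp: K_def)
    finally show ?thesis .
  qed
  \<comment> \<open>Here the definition of \<open>act\<close> enters: at most \<open>m\<close>
    summands with \<open>b n \<le> m\<close>, which costs two further powers of
    \<open>G\<close>.\<close>
  have T2: "norm (\<Sum>n\<in>act m - P. chi n m z * (F - Dd n m z)) \<le> 2 * (Cf + 1) * Hh * G ^ K * (A + e)"
  proof -
    have "norm (\<Sum>n\<in>act m - P. chi n m z * (F - Dd n m z)) \<le> (\<Sum>n\<in>act m - P. (G ^ (d + 1) * e * Hh) * (2 * G ^ d * Cf + 2 * G ^ d * G))"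
    proof (rule sum_norm_le)
      fix n assume n: "n \<in> act m - P"
      then have nN: "n \<in> N" "b n \<le> real m" by (auto simp: act_def)
      have "norm (chi n m z) \<le> G ^ (d + 1) * e * Hh"
        using chib[of n] Xfar[of n] n nN Hh0 by (intro order_trans[OF chib] mult_right_mono) auto
      moreover have "norm (F - Dd n m z) \<le> 2 * G ^ d * Cf + 2 * G ^ d * G"
      proof -
        have "2 * G ^ d * b n \<le> 2 * G ^ d * G" using nN G1 by (intro mult_left_mono) auto
        then show ?thesis using norm_triangle_ineq4[of F "Dd n m z"] Fb Db[OF nN(1)] by linarith
      qed
      ultimately show "norm (chi n m z * (F - Dd n m z)) \<le> (G ^ (d + 1) * e * Hh) * (2 * G ^ d * Cf + 2 * G ^ d * G)"
        unfolding norm_mult using G1 e0 Hh0 by (intro mult_mono) auto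
    qed
    also have "\<dots> = real (card (act m - P)) * ((G ^ (d + 1) * e * Hh) * (2 * G ^ d * Cf + 2 * G ^ d * G))" by simp
    also have "\<dots> \<le> G * ((G ^ (d + 1) * e * Hh) * (2 * (Cf + 1) * G ^ (d + 1)))"
    proof (intro mult_mono mult_left_mono)
      have "card (act m - P) \<le> m" using card_act[of m] card_mono[OF finite_act, of "act m - P" m] by auto
      then show "real (card (act m - P)) \<le> G" using G1(2) by linarith
      have "2 * G ^ d * Cf \<le> 2 * G ^ (d + 1) * Cf"
        using G1 f(3) by (intro mult_right_mono mult_left_mono power_increasing) auto
      then show "2 * G ^ d * Cf + 2 * G ^ d * G \<le> 2 * (Cf + 1) * G ^ (d + 1)" by (simp add: algebra_simps)
    qed (use G1 e0 Hh0 f(3) in auto)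
    also have "\<dots> = 2 * (Cf + 1) * Hh * G ^ (2 * d + 3) * e"
      unfolding pw by (simp only: mult_ac)
    also have "\<dots> \<le> 2 * (Cf + 1) * Hh * G ^ K * (A + e)"
      using G1 f(3) e0 A0 Hh0 by (intro mult_mono Gle) (auto simp: K_def)
    finally show ?thesis .
  qed
  have T3: "norm (\<Sum>n\<in>P. chi n m z * (F - Dd n m z)) \<le> real (card P) * (8 * real d * B * C + 4 * real d * bm) * Hh * G ^ K * (A + e)"
  proof -
    have "norm (\<Sum>n\<in>P. chi n m z * (F - Dd n m z)) \<le> (\<Sum>n\<in>P. (G ^ d * Hh) * ((8 * real d * B * C + 4 * real d * bm) * G ^ (d + 3) * (A + e)))"
    proof (rule sum_norm_le)
      fix n assume n: "n \<in> P"
      then have nN: "n \<in> N" using P by auto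
      have "norm (chi n m z) \<le> G ^ d * Hh"
        using Xb[OF nN] Hh0 by (intro order_trans[OF chib] mult_right_mono) auto
      then show "norm (chi n m z * (F - Dd n m z)) \<le> (G ^ d * Hh) * ((8 * real d * B * C + 4 * real d * bm) * G ^ (d + 3) * (A + e))"
        unfolding norm_mult using near[OF n] G1 Hh0 by (intro mult_mono) auto
    qed
    also have "\<dots> = real (card P) * (8 * real d * B * C + 4 * real d * bm) * Hh * G ^ K * (A + e)"
      unfolding pw sum_constant by (simp only: mult_ac)
    finally show ?thesis .
  qed
  have "SS (Suc m) x0 R f z - SS m x0 R f z - corr m z
      = F * (\<Prod>n\<in>act m. 1 - X n m z) + (\<Sum>n\<in>act m. chi n m z * (F - Dd n m z))"
  proof -
    have "(\<Sum>n\<in>act m. chi n m z * (F - Dd n m z)) = (\<Sum>n\<in>act m. chi n m z) * F - corr m z"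
      by (simp add: corr_def right_diff_distrib sum_subtractf sum_distrib_right)
    then show ?thesis by (simp add: sum_chi F_def algebra_simps)
  qed
  also have "(\<Sum>n\<in>act m. chi n m z * (F - Dd n m z)) = (\<Sum>n\<in>act m - P. chi n m z * (F - Dd n m z)) + (\<Sum>n\<in>P. chi n m z * (F - Dd n m z))"
    by (rule sum.subset_diff[OF m(2) finite_act])
  also have "norm (F * (\<Prod>n\<in>act m. 1 - X n m z) + \<dots>) \<le> 2 * Cf * real d * D * Hh * G ^ K * (A + e) +
     (2 * (Cf + 1) * Hh * G ^ K * (A + e) + real (card P) * (8 * real d * B * C + 4 * real d * bm) * Hh * G ^ K * (A + e))"
    by (intro norm_triangle_mono T1 T2 T3)
  also have "\<dots> = exp E * 2 ^ card P * (2 * Cf * real d * D + 2 * (Cf + 1) + real (card P) * (8 * real d * B * C + 4 * real d * bm))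
       * (G ^ K * G ^ (d * card P)) * (A + e)"
    unfolding Hh_def power_mult_distrib power_mult by (simp add: algebra_simps)
  also have "G ^ K * G ^ (d * card P) = G ^ (2 * d + 3 + d * card P)"
    by (simp add: K_def power_add)
  finally show ?thesis
    unfolding d_def G_def A_def e_def .
qed

end


section \<open>Summation of the local estimates\<close>

lemma entire_bounded_polydiscs:
  assumes F: "entire F"
  shows "\<exists>B. \<forall>x\<in>cube x0 R. \<forall>z\<in>polydisc x \<delta>. norm (F z) \<le> B"
proof -
  define \<rho> where "\<rho> = (\<Sum>i\<in>UNIV. \<bar>x0 $ i\<bar> + R + \<delta>)"
  have "compact (F ` cball 0 \<rho>)"
    by (intro compact_continuous_image entire_continuous F) auto
  then obtain B where B: "\<And>w. w \<in> cball 0 \<rho> \<Longrightarrow> norm (F w) \<le> B"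
    using compact_imp_bounded bounded_iff by (metis imageI)
  have "norm (F z) \<le> B" if x: "x \<in> cube x0 R" and z: "z \<in> polydisc x \<delta>" for x z
  proof (rule B)
    have "norm (z $ i) \<le> \<bar>x0 $ i\<bar> + R + \<delta>" for i
    proof -
      have "norm (z $ i) \<le> norm (z $ i - of_real (x $ i)) + \<bar>x $ i\<bar>"
        using norm_triangle_ineq[of "z $ i - of_real (x $ i)" "of_real (x $ i)"] by simp
      moreover have "norm (z $ i - of_real (x $ i)) \<le> \<delta>" using z by (simp add: polydisc_def)
      moreover have "\<bar>x $ i - x0 $ i\<bar> \<le> R" using x by (simp add: mem_cube)
      ultimately show ?thesis by linarith
    qed
    then have "(\<Sum>i\<in>UNIV. norm (z $ i)) \<le> \<rho>" unfolding \<rho>_def by (intro sum_mono)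
    moreover have "norm z \<le> (\<Sum>i\<in>UNIV. norm (z $ i))"
      unfolding norm_vec_def by (rule L2_set_le_sum) auto
    ultimately show "z \<in> cball 0 \<rho>" by simp
  qed
  then show ?thesis by blast
qed

context glue
begin

text \<open>The increment of \<open>S\<^sub>N f - u\<^sub>N\<close> at \<open>N = m\<close> in the
  notation of the overview, with the smoothing taken over the cube of radius \<open>R\<close> about
  \<open>x0\<close>.\<close>

definition wser :: "real^'d \<Rightarrow> real \<Rightarrow> (real^'d \<Rightarrow> complex) \<Rightarrow> nat \<Rightarrow> complex^'d \<Rightarrow> complex" where
  "wser x0 R f m z = SS (Suc m) x0 R f z - SS m x0 R f z - corr m z"

lemma entire_wser:
  assumes "continuous_on (cube x0 R) f" "0 \<le> R"
  shows "entire (wser x0 R f m)"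
  unfolding wser_def by (intro entire_diff entire_SS entire_corr assms)

text \<open>Once all cubes of \<open>P\<close> are active, \<open>local_estimate\<close> applies and
  has the shape of \<open>fine_bound\<close>. The finitely many earlier terms are bounded on the
  polydiscs and are absorbed into the constant.\<close>

lemma local_series:
  fixes x0 :: "real^'d"
  assumes R: "0 < R" "R \<le> 1/2" and f: "continuous_on (cube x0 R) f"
    and P: "finite P" "P \<subseteq> N" "\<And>n. n \<in> P \<Longrightarrow> cube x0 R \<subseteq> cube (p n) (2 * r n)"
      "\<And>n. n \<in> N - P \<Longrightarrow> cube x0 R \<inter> cube (p n) (r n) = {}" "k0 \<in> P" "cube x0 R \<subseteq> cube (p k0) (r k0)"
    and \<psi>: "\<And>n y. n \<in> P \<Longrightarrow> y \<in> cube x0 R \<Longrightarrow> \<psi> n y = f y - g n y"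
    and jet: "\<And>n. n \<in> P \<Longrightarrow> for_h c (\<lambda>h. \<exists>C\<ge>0. jet_bound M h C x0 R (\<psi> n))"
  shows "for_h c (\<lambda>h. \<exists>C. \<forall>js. \<exists>bb. summable bb \<and> suminf bb \<le> C * h ^ length js * M (length js) \<and>
           (\<forall>n. \<forall>x\<in>cube x0 (R / 4). norm (foldr cpd js (wser x0 R f n) (cvec x)) \<le> bb n))"
proof -
  obtain B where B: "B > 0" "\<And>w. \<bar>Re w\<bar> \<le> 2 \<Longrightarrow> \<bar>Im w\<bar> \<le> 2 \<Longrightarrow> norm (amp w) \<le> B"
    using ex_amp_bound by blast
  have "compact (f ` cube x0 R)"
    unfolding cube_def using f by (intro compact_continuous_image compact_cbox) (simp add: cube_def)
  then obtain Cf where Cf: "Cf > 0" "\<And>y. y \<in> cube x0 R \<Longrightarrow> norm (f y) \<le> Cf"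
    using compact_imp_bounded bounded_pos by (metis imageI)
  define bm where "bm = (\<Sum>n\<in>P. b n)"
  have bm: "b n \<le> bm" if "n \<in> P" for n
    unfolding bm_def using P(1) b(2) that by (intro member_le_sum) auto
  have bm0: "0 \<le> bm" unfolding bm_def by (intro sum_nonneg b(2))
  define \<gamma> where "\<gamma> = R\<^sup>2 / 32"
  have \<gamma>: "\<gamma> > 0" using R by (simp add: \<gamma>_def)
  define D where "D = 8 * B / (1 - exp (- \<gamma>)) + 1"
  have D: "D \<ge> 0" unfolding D_def using B(1) \<gamma> by (intro add_nonneg_nonneg divide_nonneg_nonneg) auto
  define E where "E = fact (CARD('d) + 2) * (2 / \<gamma>) ^ (CARD('d) + 2) * exp (\<gamma> / 2)"
  \<comment> \<open>\<open>R / 4\<close> keeps the polydiscs in the range of the local estimates;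
    the second bound ensures that \<open>CARD('d) + 1\<close> factors \<open>NN m \<rho>\<close> do
    not outweigh \<open>exp(- \<gamma> m)\<close>.\<close>
  define \<delta> where "\<delta> = min (R / 4) (\<gamma> / (8 * real (CARD('d) + 1)))"
  have \<delta>: "0 < \<delta>" "\<delta> \<le> 1" "\<delta> \<le> R / 4" "\<delta> \<le> \<gamma> / (8 * real (CARD('d) + 1))"
  proof -
    show "0 < \<delta>" unfolding \<delta>_def using R \<gamma> by simp
    show le: "\<delta> \<le> R / 4" unfolding \<delta>_def by (rule min.cobounded1)
    then show "\<delta> \<le> 1" using R by linarith
    show "\<delta> \<le> \<gamma> / (8 * real (CARD('d) + 1))" unfolding \<delta>_def by (rule min.cobounded2)
  qed
  define K where "K = 2 * CARD('d) + 3 + CARD('d) * card P"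
  \<comment> \<open>By \<open>NN m \<rho> \<le> 2 m exp(4 m \<rho>)\<close>, the \<open>K\<close>
    factors of \<open>local_estimate\<close> grow with the rate \<open>4 * K\<close>. The larger
    value \<open>6 * K\<close> leaves room for the power \<open>m^K\<close> in the crude
    bound.\<close>
  define L where "L = 6 * real K"
  define m0 where "m0 = Suc (\<Sum>n\<in>P. n + nat \<lceil>b n\<rceil>)"
  have actP: "P \<subseteq> act m" if "m0 \<le> m" for m
  proof
    fix n assume n: "n \<in> P"
    have "n + nat \<lceil>b n\<rceil> \<le> (\<Sum>n\<in>P. n + nat \<lceil>b n\<rceil>)"
      using P(1) n by (intro member_le_sum) auto
    then have "n < m" "nat \<lceil>b n\<rceil> \<le> m" using that unfolding m0_def by linarith+
    moreover have "b n \<le> real (nat \<lceil>b n\<rceil>)" by (rule real_nat_ceiling_ge)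
    ultimately have "n < m" "b n \<le> real m" by linarith+
    then show "n \<in> act m" using n P(2) by (auto simp: act_def)
  qed
  have "\<forall>m. \<exists>B. \<forall>x\<in>cube x0 (R / 4). \<forall>z\<in>polydisc x \<delta>. norm (wser x0 R f m z) \<le> B"
    using entire_bounded_polydiscs[OF entire_wser[OF f]] R by auto
  then obtain Bm where Bm: "\<And>m x z. x \<in> cube x0 (R / 4) \<Longrightarrow> z \<in> polydisc x \<delta> \<Longrightarrow> norm (wser x0 R f m z) \<le> Bm m"
    by metis
  define B0 where "B0 = (\<Sum>m<m0. \<bar>Bm m\<bar>)"
  have B0: "0 \<le> B0" unfolding B0_def by (intro sum_nonneg) auto
  have small: "norm (wser x0 R f m z) \<le> B0" if "m < m0" "x \<in> cube x0 (R / 4)" "z \<in> polydisc x \<delta>" for m x z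
  proof -
    have "\<bar>Bm m\<bar> \<le> B0" unfolding B0_def using that by (intro member_le_sum) auto
    then show ?thesis using Bm[OF that(2,3), of m] by linarith
  qed
  define Ct where "Ct = (\<lambda>C. exp E * 2 ^ card P * (2 * Cf * real CARD('d) * D + 2 * (Cf + 1) + real (card P) * (8 * real CARD('d) * B * C + 4 * real CARD('d) * bm)))"
  define C' where "C' = (\<lambda>C. Ct C * 2 ^ K + B0 * exp (\<gamma> * real m0))"
  have C'0: "0 \<le> C' C" if "0 \<le> C" for C
    unfolding C'_def Ct_def using that Cf(1) D B(1) bm0 B0 by simp
  have main: "norm (wser x0 R f m z) \<le> C' C * real m ^ K * exp (4 * real K * real m * \<rho>) * ((16 * h / real m) ^ q * M q + exp (- \<gamma> * real m))"
    if h: "0 < h" "0 \<le> C" and jets: "\<And>n. n \<in> P \<Longrightarrow> jet_bound M h C x0 R (\<psi> n)"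
      and m: "1 \<le> m" and \<rho>: "0 \<le> \<rho>" "\<rho> \<le> \<delta>" and x: "x \<in> cube x0 (R / 4)" and z: "z \<in> polydisc x \<rho>" for h C m \<rho> x z q
  proof -
    define A where "A = (16 * h / real m) ^ q * M q"
    have A0: "0 \<le> A" using h M(1)[of q] by (simp add: A_def less_imp_le)
    have Ct0: "0 \<le> Ct C" unfolding Ct_def using h Cf(1) D B(1) bm0 by simp
    have mK: "1 \<le> real m ^ K" using m by simp
    have e1: "1 \<le> exp (4 * real K * real m * \<rho>)" using \<rho> by simp
    show ?thesis
    proof (cases "m < m0")
      case True
      have "norm (wser x0 R f m z) \<le> B0"
        using polydisc_mono[OF \<rho>(2), of x] z by (intro small[OF True x]) auto
      \<comment> \<open>The exponential of \<open>\<gamma> * m0\<close> compensates the decay for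
        all \<open>m < m0\<close>; the factors 1 are placeholders for \<open>real m ^ K\<close> and
        the exponential in \<open>\<rho>\<close>.\<close>
      also have "B0 \<le> B0 * exp (\<gamma> * real m0) * 1 * 1 * exp (- \<gamma> * real m)"
      proof -
        have "1 \<le> exp (\<gamma> * real m0) * exp (- \<gamma> * real m)"
          unfolding mult_exp_exp using True \<gamma> by simp
        then show ?thesis using B0 mult_left_mono[of 1 "exp (\<gamma> * real m0) * exp (- \<gamma> * real m)" B0] by (simp add: mult_ac)
      qed
      also have "\<dots> \<le> C' C * real m ^ K * exp (4 * real K * real m * \<rho>) * (A + exp (- \<gamma> * real m))"
      proof (intro mult_mono)
        show "B0 * exp (\<gamma> * real m0) \<le> C' C" unfolding C'_def using Ct0 by simp
      qed (use mK e1 A0 B0 C'0[OF h(2)] in auto)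
      finally show ?thesis by (simp add: A_def)
    next
      case False
      have "norm (wser x0 R f m z) \<le> Ct C * NN m \<rho> ^ K * (A + exp (- \<gamma> * real m))"
        unfolding wser_def Ct_def K_def A_def
        by (rule local_estimate[OF B R f(1) Cf(2) _ P bm bm0 \<psi> jets h \<gamma>_def D_def E_def \<rho>(1) _ _ x z m])
           (use Cf \<rho> \<delta> actP[of m] False in auto)
      also have "\<dots> \<le> Ct C * (2 ^ K * real m ^ K * exp (4 * real K * real m * \<rho>)) * (A + exp (- \<gamma> * real m))"
      proof (intro mult_right_mono mult_left_mono)
        have "NN m \<rho> \<le> (2 * real m) * exp (4 * real m * \<rho>)"
          unfolding NN_def using m \<rho> by (intro mult_mono) (auto intro!: mult_right_mono)
        then have "NN m \<rho> ^ K \<le> ((2 * real m) * exp (4 * real m * \<rho>)) ^ K"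
          using NN_ge(2)[OF \<rho>(1), of m] by (intro power_mono) auto
        also have "\<dots> = 2 ^ K * real m ^ K * exp (4 * real K * real m * \<rho>)"
          by (simp add: power_mult_distrib mult_ac flip: exp_of_nat_mult)
        finally show "NN m \<rho> ^ K \<le> 2 ^ K * real m ^ K * exp (4 * real K * real m * \<rho>)" .
      qed (use Ct0 A0 in auto)
      also have "\<dots> = (Ct C * 2 ^ K) * real m ^ K * exp (4 * real K * real m * \<rho>) * (A + exp (- \<gamma> * real m))"
        by (simp only: mult_ac)
      also have "\<dots> \<le> C' C * real m ^ K * exp (4 * real K * real m * \<rho>) * (A + exp (- \<gamma> * real m))"
        unfolding C'_def using B0 A0 by (intro mult_right_mono) auto
      finally show ?thesis by (simp add: A_def)
    qed
  qed
  have jets: "for_h c (\<lambda>h. \<exists>C\<ge>0. \<forall>n\<in>P. jet_bound M h C x0 R (\<psi> n))"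
  proof -
    have "for_h c (\<lambda>h. \<forall>n\<in>P. \<exists>C\<ge>0. jet_bound M h C x0 R (\<psi> n))"
    proof (rule for_h_ball[OF P(1) jet])
      show "\<exists>C\<ge>0. jet_bound M h' C x0 R (\<psi> n)" if hh: "0 < h" "h \<le> h'" and ex: "\<exists>C\<ge>0. jet_bound M h C x0 R (\<psi> n)" for n h h'
      proof -
        obtain C where C: "0 \<le> C" "jet_bound M h C x0 R (\<psi> n)" using ex by blast
        have "jet_bound M h' C x0 R (\<psi> n)" by (rule jet_bound_mono[OF M(1) hh C(1) order_refl C(2)])
        with C(1) show ?thesis by blast
      qed
    qed
    then show ?thesis
    proof (rule for_h_mono)
      fix h :: real assume h: "h > 0" and "\<forall>n\<in>P. \<exists>C\<ge>0. jet_bound M h C x0 R (\<psi> n)"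
      then obtain Cn where Cn: "\<And>n. n \<in> P \<Longrightarrow> 0 \<le> Cn n" "\<And>n. n \<in> P \<Longrightarrow> jet_bound M h (Cn n) x0 R (\<psi> n)" by metis
      have "jet_bound M h (\<Sum>n\<in>P. Cn n) x0 R (\<psi> n)" if "n \<in> P" for n
        using that Cn P(1) by (intro jet_bound_mono[OF M(1) h order_refl _ _ Cn(2)[OF that]] member_le_sum) auto
      moreover have "0 \<le> (\<Sum>n\<in>P. Cn n)" using Cn(1) by (rule sum_nonneg)
      ultimately show "\<exists>C\<ge>0. \<forall>n\<in>P. jet_bound M h C x0 R (\<psi> n)" by blast
    qed
  qed
  \<comment> \<open>The crude bound needs no control of \<open>h\<close>: one jet bound, used with
    order 0, is enough.\<close>
  obtain h1 C1 where h1: "0 < h1" "0 \<le> C1" "\<And>n. n \<in> P \<Longrightarrow> jet_bound M h1 C1 x0 R (\<psi> n)"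
    using for_h_ex[OF jets] by blast
  show ?thesis
  proof (rule fine_bound_summable[where \<delta> = \<delta> and L = L and K = K and \<gamma> = \<gamma> and ?C0.0 = "B0 + 2 * C' C1"])
    show "entire (wser x0 R f m)" for m using R by (intro entire_wser f) auto
    show "fine_bound c M (cube x0 (R / 4)) \<delta> L K \<gamma> (wser x0 R f)"
      unfolding fine_bound_def
    proof (rule for_h_scale[OF jets, of 16])
      fix h :: real assume h: "h > 0" and "\<exists>C\<ge>0. \<forall>n\<in>P. jet_bound M h C x0 R (\<psi> n)"
      then obtain C where C: "0 \<le> C" "\<And>n. n \<in> P \<Longrightarrow> jet_bound M h C x0 R (\<psi> n)" by blast
      have "norm (wser x0 R f m z) \<le> C' C * real m ^ K * exp (L * real m * \<rho>) * ((16 * h / real m) ^ q * M q + exp (- \<gamma> * real m))"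
        if a: "1 \<le> m" "0 \<le> \<rho>" "\<rho> \<le> \<delta>" "x \<in> cube x0 (R / 4)" "z \<in> polydisc x \<rho>" for q m \<rho> x z
      proof -
        have "norm (wser x0 R f m z) \<le> C' C * real m ^ K * exp (4 * real K * real m * \<rho>) * ((16 * h / real m) ^ q * M q + exp (- \<gamma> * real m))"
          by (rule main[OF h C a])
        also have "\<dots> \<le> C' C * real m ^ K * exp (L * real m * \<rho>) * ((16 * h / real m) ^ q * M q + exp (- \<gamma> * real m))"
          using a C'0[OF C(1)] h less_imp_le[OF M(1)] unfolding L_def
          by (intro mult_right_mono mult_left_mono) (auto intro!: mult_right_mono add_nonneg_nonneg mult_nonneg_nonneg)
        finally show ?thesis .
      qed
      then show "\<exists>C\<ge>0. \<forall>q m \<rho> x z. 1 \<le> m \<longrightarrow> 0 \<le> \<rho> \<longrightarrow> \<rho> \<le> \<delta> \<longrightarrow> x \<in> cube x0 (R / 4) \<longrightarrow> z \<in> polydisc x \<rho> \<longrightarrow>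
        norm (wser x0 R f m z) \<le> C * real m ^ K * exp (L * real m * \<rho>) * ((16 * h / real m) ^ q * M q + exp (- \<gamma> * real m))"
        using C'0[OF C(1)] by blast
    qed simp
    show "norm (wser x0 R f m z) \<le> (B0 + 2 * C' C1) * exp (L * real m)" if x: "x \<in> cube x0 (R / 4)" and z: "z \<in> polydisc x \<delta>" for m x z
    proof (cases "m = 0")
      case True
      have "norm (wser x0 R f m z) \<le> B0" by (rule small[OF _ x z]) (simp add: True m0_def)
      then show ?thesis using C'0[OF h1(2)] True by simp
    next
      case False
      then have m: "1 \<le> m" by simp
      have "norm (wser x0 R f m z) \<le> C' C1 * real m ^ K * exp (4 * real K * real m * \<delta>) * ((16 * h1 / real m) ^ 0 * M 0 + exp (- \<gamma> * real m))"
        using main[OF h1 m _ order_refl x z, of 0] \<delta> by simp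
      also have "\<dots> \<le> C' C1 * exp (real K * real m) * exp (5 * real K * real m) * 2"
      proof (intro mult_mono mult_left_mono)
        have "real m \<le> exp (real m)" using exp_ge_add_one_self[of "real m"] by linarith
        then have "real m ^ K \<le> exp (real m) ^ K" by (intro power_mono) auto
        then show "real m ^ K \<le> exp (real K * real m)" by (simp add: exp_of_nat_mult)
        have "4 * real K * real m * \<delta> \<le> 4 * real K * real m * 1" using \<delta> by (intro mult_left_mono) auto
        also have "\<dots> \<le> 5 * real K * real m" by simp
        finally show "exp (4 * real K * real m * \<delta>) \<le> exp (5 * real K * real m)" by simp
        show "(16 * h1 / real m) ^ 0 * M 0 + exp (- \<gamma> * real m) \<le> 2" using \<gamma> M(2) by simp
      qed (use C'0[OF h1(2)] M(2) in auto)
      also have "\<dots> = 2 * C' C1 * (exp (real K * real m) * exp (5 * real K * real m))" by simp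
      also have "exp (real K * real m) * exp (5 * real K * real m) = exp (L * real m)"
        unfolding mult_exp_exp L_def by (simp add: algebra_simps)
      also have "2 * C' C1 * exp (L * real m) \<le> (B0 + 2 * C' C1) * exp (L * real m)"
        using B0 by (intro mult_right_mono) auto
      finally show ?thesis .
    qed
  qed (use M M2 fac \<delta> \<gamma> B0 C'0[OF h1(2)] in \<open>auto simp: L_def\<close>)
qed

end


section \<open>The corrected limit as a function on an open set\<close>

lemma cube_mono: "r \<le> s \<Longrightarrow> cube x r \<subseteq> cube x s"
  unfolding subset_iff mem_cube by (meson order_trans)

lemma eventually_cube_subset:
  assumes "open U" "x \<in> U"
  shows "\<forall>\<^sub>F R in at_right 0. cube x R \<subseteq> U"
proof -
  obtain e where e: "e > 0" "ball x e \<subseteq> U" using assms open_contains_ball by blast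
  define d where "d = e / (2 * real CARD('a))"
  have d: "d > 0" using e by (simp add: d_def)
  have "cube x R \<subseteq> U" if R: "R < d" for R
  proof
    fix y assume y: "y \<in> cube x R"
    have "norm (y - x) \<le> (\<Sum>i\<in>UNIV. \<bar>(y - x) $ i\<bar>)" by (rule norm_le_l1_cart)
    also have "\<dots> \<le> (\<Sum>i\<in>(UNIV :: 'a set). d)"
      using y R by (intro sum_mono) (force simp: mem_cube intro: order_trans)
    also have "\<dots> < e" using e by (simp add: d_def)
    finally show "y \<in> U" using e by (auto simp: dist_norm norm_minus_commute)
  qed
  then show ?thesis using d by (auto simp: eventually_at_right_field)
qed

definition rad :: "(real^'d::finite) set \<Rightarrow> real^'d \<Rightarrow> real" where
  "rad U x = (SOME R. 0 < R \<and> R \<le> 1/2 \<and> cube x R \<subseteq> U)"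

lemma rad:
  assumes "open U" "x \<in> U"
  shows "0 < rad U x" "rad U x \<le> 1/2" "cube x (rad U x) \<subseteq> U"
proof -
  have "\<forall>\<^sub>F R in at_right (0::real). 0 < R \<and> R \<le> 1/2"
    by (auto simp: eventually_at_right_field intro: exI[of _ "1/2"])
  then have "\<forall>\<^sub>F R in at_right 0. 0 < R \<and> R \<le> 1/2 \<and> cube x R \<subseteq> U"
    using eventually_cube_subset[OF assms] by eventually_elim auto
  then have "\<exists>R. 0 < R \<and> R \<le> 1/2 \<and> cube x R \<subseteq> U"
    using eventually_happens by fastforce
  then have "0 < rad U x \<and> rad U x \<le> 1/2 \<and> cube x (rad U x) \<subseteq> U"
    unfolding rad_def by (rule someI_ex)
  then show "0 < rad U x" "rad U x \<le> 1/2" "cube x (rad U x) \<subseteq> U" by auto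
qed

lemma mem_cube_self: "0 \<le> r \<Longrightarrow> x \<in> cube x r"
  by (simp add: mem_cube)

text \<open>Both operators are evaluated at the centre \<open>x\<close> of the smaller cube, and
  outside that cube the kernel is exponentially small in one coordinate. Limits of smoothings
  therefore do not depend on the chosen cube.\<close>

lemma SS_change_cube:
  fixes x0 :: "real^'d::finite"
  assumes R: "R \<le> 1/2" and f: "continuous_on (cube x0 R) f" and R': "0 < R'" "cube x R' \<subseteq> cube x0 R"
  shows "(\<lambda>n. SS n x0 R f (cvec x) - SS n x R' f (cvec x)) \<longlonglongrightarrow> 0"
proof -
  have "compact (f ` cube x0 R)"
    unfolding cube_def using f by (intro compact_continuous_image compact_cbox) (simp add: cube_def)
  then obtain C where C: "C > 0" "\<And>y. y \<in> cube x0 R \<Longrightarrow> norm (f y) \<le> C"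
    using compact_imp_bounded bounded_pos by (metis imageI)
  define \<gamma> where "\<gamma> = R'\<^sup>2 / 2"
  have \<gamma>: "\<gamma> > 0" using R' by (simp add: \<gamma>_def)
  define d where "d = CARD('d)"
  define E where "E = fact (d + 1 + 1) * (2 / \<gamma>) ^ (d + 1 + 1) * exp (\<gamma> / 2)"
  show ?thesis
  proof (rule Lim_null_comparison)
    show "(\<lambda>n. (2 * real d * C * E) * (1 / real n)) \<longlonglongrightarrow> 0"
      by (intro tendsto_mult_right_zero lim_1_over_n)
    show "\<forall>\<^sub>F n in sequentially. norm (SS n x0 R f (cvec x) - SS n x R' f (cvec x)) \<le> (2 * real d * C * E) * (1 / real n)"
      using eventually_ge_at_top[of 1]
    proof eventually_elim
      case (elim n)
      have "norm (SS n x0 R f (cvec x) - SS n x R' f (cvec x)) \<le> 2 * real CARD('d) * NN n 0 ^ CARD('d) * (NN n 0 * exp (- (R'\<^sup>2 / 2) * real n)) * C"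
        by (rule SS_local) (use R f C R' in auto)
      also have "\<dots> = 2 * real d * C * (NN n 0 ^ (d + 1) * exp (- \<gamma> * real n))"
        by (simp add: d_def \<gamma>_def mult_ac)
      also have "NN n 0 ^ (d + 1) * exp (- \<gamma> * real n) \<le> E * (1 / real n)"
        using NN_power_small[OF \<gamma>, of 0 "d + 1" n] elim \<gamma> by (simp add: E_def field_simps)
      finally show ?case using C by (simp add: d_def mult_left_mono)
    qed
  qed
qed

context glue
begin

text \<open>Each point is evaluated with a cube of its own, which makes the function independent of
  local choices. Near a given point it coincides with the sum of a series over one fixed cube, from
  which regularity is read off.\<close>

definition Phi :: "(real^'d) set \<Rightarrow> (real^'d \<Rightarrow> complex) \<Rightarrow> real^'d \<Rightarrow> complex" where
  "Phi U f x = lim (\<lambda>n. SS n x (rad U x) f (cvec x) - (\<Sum>m<n. corr m (cvec x)))"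

lemma sum_wser: "(\<Sum>m<n. wser x0 R f m z) = SS n x0 R f z - (\<Sum>m<n. corr m z)"
proof -
  have "(\<Sum>m<n. wser x0 R f m z) = (\<Sum>m<n. SS (Suc m) x0 R f z - SS m x0 R f z) - (\<Sum>m<n. corr m z)"
    by (simp add: wser_def sum_subtractf)
  then show ?thesis using sum_lessThan_telescope[of "\<lambda>m. SS m x0 R f z" n] by (simp add: SS_0)
qed

lemma Phi_tendsto:
  assumes U: "open U" and f: "continuous_on U f" and R: "0 < R" "R \<le> 1/2" "cube x0 R \<subseteq> U"
    and x: "x \<in> cube x0 (R / 4)" and s: "summable (\<lambda>m. wser x0 R f m (cvec x))"
  shows "(\<lambda>n. SS n x (rad U x) f (cvec x) - (\<Sum>m<n. corr m (cvec x))) \<longlonglongrightarrow> (\<Sum>m. wser x0 R f m (cvec x))"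
proof -
  have sub4: "cube x (R / 2) \<subseteq> cube x0 R"
  proof
    fix y assume y: "y \<in> cube x (R / 2)"
    have "\<bar>y $ i - x0 $ i\<bar> \<le> R" for i
    proof -
      have "\<bar>y $ i - x $ i\<bar> \<le> R / 2" "\<bar>x $ i - x0 $ i\<bar> \<le> R / 4" using x y by (simp_all add: mem_cube)
      then show ?thesis using R by linarith
    qed
    then show "y \<in> cube x0 R" by (simp add: mem_cube)
  qed
  have xU: "x \<in> U" using sub4 R mem_cube_self[of "R / 2" x] by auto
  note rd = rad[OF U xU]
  \<comment> \<open>A cube about \<open>x\<close> that lies in both cubes mediates between the two
    smoothings.\<close>
  define R'' where "R'' = min (R / 2) (rad U x)"
  have R'': "0 < R''" using R rd by (simp add: R''_def)
  have s1: "cube x R'' \<subseteq> cube x0 R"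
    by (rule order_trans[OF cube_mono sub4]) (simp add: R''_def)
  have s2: "cube x R'' \<subseteq> cube x (rad U x)"
    by (rule cube_mono) (simp add: R''_def)
  have 1: "(\<lambda>n. SS n x0 R f (cvec x) - (\<Sum>m<n. corr m (cvec x))) \<longlonglongrightarrow> (\<Sum>m. wser x0 R f m (cvec x))"
    using summable_LIMSEQ[OF s] by (simp add: sum_wser)
  have 2: "(\<lambda>n. SS n x0 R f (cvec x) - SS n x R'' f (cvec x)) \<longlonglongrightarrow> 0"
    by (rule SS_change_cube[OF R(2) continuous_on_subset[OF f R(3)] R'' s1])
  have 3: "(\<lambda>n. SS n x (rad U x) f (cvec x) - SS n x R'' f (cvec x)) \<longlonglongrightarrow> 0"
    by (rule SS_change_cube[OF rd(2) continuous_on_subset[OF f rd(3)] R'' s2])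
  show ?thesis using tendsto_add[OF tendsto_diff[OF 1 2] 3] by simp
qed

lemma Phi_eq:
  assumes "open U" "continuous_on U f" "0 < R" "R \<le> 1/2" "cube x0 R \<subseteq> U"
    and "x \<in> cube x0 (R / 4)" "summable (\<lambda>m. wser x0 R f m (cvec x))"
  shows "Phi U f x = (\<Sum>m. wser x0 R f m (cvec x))"
  unfolding Phi_def using Phi_tendsto[OF assms] by (rule limI)

lemma Phi_diff:
  fixes U1 U2 :: "(real^'d) set"
  assumes U: "open U1" "open U2" and f: "continuous_on U1 f1" "continuous_on U2 f2"
    and x: "x \<in> U1" "x \<in> U2"
    and conv: "convergent (\<lambda>n. SS n x (rad U1 x) f1 (cvec x) - (\<Sum>m<n. corr m (cvec x)))"
              "convergent (\<lambda>n. SS n x (rad U2 x) f2 (cvec x) - (\<Sum>m<n. corr m (cvec x)))"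
    and \<phi>: "\<And>y. y \<in> U1 \<inter> U2 \<Longrightarrow> f2 y - f1 y = \<phi> y"
    and jet: "\<And>R. cube x R \<subseteq> U1 \<inter> U2 \<Longrightarrow> for_h c (\<lambda>h. \<exists>C\<ge>0. jet_bound M h C x R \<phi>)"
  shows "Phi U2 f2 x - Phi U1 f1 x = \<phi> x"
proof -
  note r1 = rad[OF U(1) x(1)] and r2 = rad[OF U(2) x(2)]
  define R where "R = min (rad U1 x) (rad U2 x)"
  have R: "0 < R" "R \<le> 1/2" using r1 r2 by (auto simp: R_def)
  have s: "cube x R \<subseteq> cube x (rad U1 x)" "cube x R \<subseteq> cube x (rad U2 x)"
    by (rule cube_mono, simp add: R_def)+
  then have sub: "cube x R \<subseteq> U1 \<inter> U2" using r1 r2 by blast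
  obtain h C where hC: "0 < h" "0 \<le> C" "jet_bound M h C x R \<phi>"
    using for_h_ex[OF jet[OF sub]] by blast
  have lim: "(\<lambda>n. SS n x R \<phi> (cvec x)) \<longlonglongrightarrow> \<phi> x"
    by (rule SS_tendsto[OF M lc hC(1,2,3) _ R(2) R(1)]) (use R in \<open>auto simp: mem_cube\<close>)
  have c1: "(\<lambda>n. SS n x (rad U1 x) f1 (cvec x) - SS n x R f1 (cvec x)) \<longlonglongrightarrow> 0"
    by (rule SS_change_cube[OF r1(2) continuous_on_subset[OF f(1) r1(3)] R(1) s(1)])
  have c2: "(\<lambda>n. SS n x (rad U2 x) f2 (cvec x) - SS n x R f2 (cvec x)) \<longlonglongrightarrow> 0"
    by (rule SS_change_cube[OF r2(2) continuous_on_subset[OF f(2) r2(3)] R(1) s(2)])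
  have eq: "SS n x R \<phi> z = SS n x R f2 z - SS n x R f1 z" for n z
  proof -
    have "SS n x R \<phi> = SS n x R (\<lambda>y. f2 y - f1 y)"
    proof (rule SS_cong)
      show "\<phi> y = f2 y - f1 y" if "y \<in> cube x R" for y
        using \<phi>[of y] subsetD[OF sub that] by simp
    qed (use R in auto)
    then show ?thesis
      using SS_diff[of x R f2 f1 n z] continuous_on_subset[OF f(1)] continuous_on_subset[OF f(2)] sub R by simp
  qed
  have p: "(\<lambda>n. SS n x (rad U1 x) f1 (cvec x) - (\<Sum>m<n. corr m (cvec x))) \<longlonglongrightarrow> Phi U1 f1 x"
    "(\<lambda>n. SS n x (rad U2 x) f2 (cvec x) - (\<Sum>m<n. corr m (cvec x))) \<longlonglongrightarrow> Phi U2 f2 x"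
    using conv unfolding Phi_def by (simp_all add: convergent_LIMSEQ_iff)
  have "(\<lambda>n. SS n x R \<phi> (cvec x)) \<longlonglongrightarrow> Phi U2 f2 x - Phi U1 f1 x - 0 + 0"
    using tendsto_add[OF tendsto_diff[OF tendsto_diff[OF p(2,1)] c2] c1] by (simp add: eq)
  then show ?thesis using LIMSEQ_unique[OF lim] by simp
qed

lemma Phi_local:
  fixes x0 :: "real^'d"
  assumes U: "open U" and f: "continuous_on U f" and R: "0 < R" "R \<le> 1/2" "cube x0 R \<subseteq> U"
    and P: "finite P" "P \<subseteq> N" "\<And>n. n \<in> P \<Longrightarrow> cube x0 R \<subseteq> cube (p n) (2 * r n)"
      "\<And>n. n \<in> N - P \<Longrightarrow> cube x0 R \<inter> cube (p n) (r n) = {}" "k0 \<in> P" "cube x0 R \<subseteq> cube (p k0) (r k0)"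
    and \<psi>: "\<And>n y. n \<in> P \<Longrightarrow> y \<in> cube x0 R \<Longrightarrow> \<psi> n y = f y - g n y"
    and jet: "\<And>n. n \<in> P \<Longrightarrow> for_h c (\<lambda>h. \<exists>C\<ge>0. jet_bound M h C x0 R (\<psi> n))"
  shows "convergent (\<lambda>n. SS n x0 (rad U x0) f (cvec x0) - (\<Sum>m<n. corr m (cvec x0)))"
    and "\<exists>S. open S \<and> x0 \<in> S \<and> S \<subseteq> U \<and> smooth_on S (Phi U f) \<and>
      for_h c (\<lambda>h. \<exists>C. \<forall>js. \<forall>x\<in>S. norm (foldr partial_deriv js (Phi U f) x) \<le> C * h ^ length js * M (length js))"
proof -
  have fc: "continuous_on (cube x0 R) f" by (rule continuous_on_subset[OF f R(3)])
  note ser = local_series[OF R(1,2) fc P \<psi> jet]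
  define w where "w = wser x0 R f"
  define S where "S = box (lo x0 (R / 4)) (hi x0 (R / 4))"
  have S: "open S" "convex S" "S \<subseteq> cube x0 (R / 4)" "x0 \<in> S"
    using R box_subset_cbox[of "lo x0 (R / 4)" "hi x0 (R / 4)"] by (auto simp: S_def cube_def mem_box_cart open_box convex_box)
  obtain h1 C1 where h1: "\<And>js. \<exists>bb. summable bb \<and> suminf bb \<le> C1 * h1 ^ length js * M (length js) \<and>
           (\<forall>n. \<forall>x\<in>cube x0 (R / 4). norm (foldr cpd js (w n) (cvec x)) \<le> bb n)"
    using for_h_ex[OF ser] unfolding w_def by blast
  have ok: "series_ok S w"
    unfolding series_ok_def
  proof (intro conjI allI)
    show "entire (w n)" for n unfolding w_def using R by (intro entire_wser fc) auto
    show "\<exists>b. summable b \<and> (\<forall>n. \<forall>x\<in>S. norm (foldr cpd js (w n) (cvec x)) \<le> b n)" for js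
      using h1[of js] S(3) by blast
  qed
  have eq: "Phi U f x = (\<Sum>m. w m (cvec x))" if "x \<in> S" for x
    unfolding w_def
    by (rule Phi_eq[OF U f R]) (use that S series_ok_summable[OF ok that] in \<open>auto simp: w_def\<close>)
  have "(\<lambda>n. SS n x0 (rad U x0) f (cvec x0) - (\<Sum>m<n. corr m (cvec x0))) \<longlonglongrightarrow> (\<Sum>m. wser x0 R f m (cvec x0))"
    by (rule Phi_tendsto[OF U f R]) (use S series_ok_summable[OF ok S(4)] in \<open>auto simp: w_def\<close>)
  then show "convergent (\<lambda>n. SS n x0 (rad U x0) f (cvec x0) - (\<Sum>m<n. corr m (cvec x0)))"
    by (rule convergentI)
  have "S \<subseteq> U" using S(3) R cube_mono[of "R / 4" R x0] by auto
  moreover have "smooth_on S (Phi U f)"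
    using series_ok_smooth[OF ok S(1,2)] smooth_on_cong[OF S(1) eq] by simp
  moreover have "for_h c (\<lambda>h. \<exists>C. \<forall>js. \<forall>x\<in>S. norm (foldr partial_deriv js (Phi U f) x) \<le> C * h ^ length js * M (length js))"
    using ser
  proof (rule for_h_mono)
    fix h :: real assume "\<exists>C. \<forall>js. \<exists>bb. summable bb \<and> suminf bb \<le> C * h ^ length js * M (length js) \<and>
           (\<forall>n. \<forall>x\<in>cube x0 (R / 4). norm (foldr cpd js (wser x0 R f n) (cvec x)) \<le> bb n)"
    then obtain C where C: "\<And>js. \<exists>bb. summable bb \<and> suminf bb \<le> C * h ^ length js * M (length js) \<and>
           (\<forall>n. \<forall>x\<in>cube x0 (R / 4). norm (foldr cpd js (w n) (cvec x)) \<le> bb n)" unfolding w_def by blast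
    have "norm (foldr partial_deriv js (Phi U f) x) \<le> C * h ^ length js * M (length js)" if x: "x \<in> S" for js x
    proof -
      obtain bb where bb: "summable bb" "suminf bb \<le> C * h ^ length js * M (length js)"
        "\<And>n. norm (foldr cpd js (w n) (cvec x)) \<le> bb n" using C[of js] S(3) x by blast
      have "foldr partial_deriv js (Phi U f) x = foldr partial_deriv js (\<lambda>x. \<Sum>m. w m (cvec x)) x"
        by (rule foldr_partial_deriv_cong[OF S(1) eq x])
      also have "\<dots> = (\<Sum>n. foldr cpd js (w n) (cvec x))"
        by (rule series_ok_foldr_partial_deriv[OF ok S(1,2) x])
      also have "norm \<dots> \<le> suminf bb"
      proof -
        have sn: "summable (\<lambda>n. norm (foldr cpd js (w n) (cvec x)))"
          by (rule summable_comparison_test'[OF bb(1), of 0]) (simp add: bb(3))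
        have "norm (\<Sum>n. foldr cpd js (w n) (cvec x)) \<le> (\<Sum>n. norm (foldr cpd js (w n) (cvec x)))"
          by (rule summable_norm[OF sn])
        also have "\<dots> \<le> suminf bb" by (rule suminf_le[OF bb(3) sn bb(1)])
        finally show ?thesis .
      qed
      finally show ?thesis using bb(2) by linarith
    qed
    then show "\<exists>C. \<forall>js. \<forall>x\<in>S. norm (foldr partial_deriv js (Phi U f) x) \<le> C * h ^ length js * M (length js)" by blast
  qed
  ultimately show "\<exists>S. open S \<and> x0 \<in> S \<and> S \<subseteq> U \<and> smooth_on S (Phi U f) \<and>
      for_h c (\<lambda>h. \<exists>C. \<forall>js. \<forall>x\<in>S. norm (foldr partial_deriv js (Phi U f) x) \<le> C * h ^ length js * M (length js))"
    using S by blast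
qed

end


section \<open>The spaces of ultradifferentiable functions\<close>

text \<open>Iterated derivatives are treated as lists of directions, which suit induction one
  derivative at a time. A multi-index is the particular list sorted in the order that
  \<open>multi_deriv\<close> uses.\<close>

definition mi_list :: "('d::finite \<Rightarrow> nat) \<Rightarrow> 'd list" where
  "mi_list \<alpha> = concat (map (\<lambda>i. replicate (\<alpha> i) i) coordinates)"

lemma multi_deriv_mi_list: "multi_deriv \<alpha> f = foldr partial_deriv (mi_list \<alpha>) f"
proof -
  have "foldr (\<lambda>i. partial_deriv i ^^ \<alpha> i) js f = foldr partial_deriv (concat (map (\<lambda>i. replicate (\<alpha> i) i) js)) f" for js
    by (induction js) (auto simp:)
  then show ?thesis by (simp add: multi_deriv_def mi_list_def)
qed

lemma length_mi_list: "length (mi_list \<alpha>) = mi_abs \<alpha>"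
  by (simp add: mi_list_def mi_abs_def length_concat o_def sum_list_distinct_conv_sum_set coordinates)

lemma multi_deriv_single: "multi_deriv (\<lambda>i. if i = j then k else 0) f = (partial_deriv j ^^ k) f"
proof -
  have "concat (map (\<lambda>i. replicate (if i = j then k else 0) i) js) = (if j \<in> set js then replicate k j else [])"
    if "distinct js" for js
    using that by (induction js) auto
  then show ?thesis
    by (simp add: multi_deriv_mi_list mi_list_def coordinates)
qed

lemma mi_abs_single: "mi_abs (\<lambda>i. if i = j then k else 0) = k"
  by (simp add: mi_abs_def)

definition deriv_bound :: "(nat \<Rightarrow> real) \<Rightarrow> real \<Rightarrow> real \<Rightarrow> (real^'d::finite) set \<Rightarrow> (real^'d \<Rightarrow> complex) \<Rightarrow> bool" where
  "deriv_bound M h C K \<phi> \<longleftrightarrow> (\<forall>\<alpha>. \<forall>x\<in>K. norm (multi_deriv \<alpha> \<phi> x) \<le> C * (h ^ mi_abs \<alpha> * M (mi_abs \<alpha>)))"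

lemma ultra_bounded_iff:
  assumes M: "\<And>q. 0 < M q" and h: "0 < h"
  shows "ultra_bounded M h K \<phi> \<longleftrightarrow> (\<exists>C\<ge>0. deriv_bound M h C K \<phi>)"
proof
  have pos: "0 < h ^ k * M k" for k using M h by simp
  assume "ultra_bounded M h K \<phi>"
  then obtain C where C: "\<And>\<alpha> x. x \<in> K \<Longrightarrow> norm (multi_deriv \<alpha> \<phi> x) / (h ^ mi_abs \<alpha> * M (mi_abs \<alpha>)) \<le> C"
    unfolding ultra_bounded_def bdd_above_def by force
  have "norm (multi_deriv \<alpha> \<phi> x) \<le> max C 0 * (h ^ mi_abs \<alpha> * M (mi_abs \<alpha>))" if "x \<in> K" for \<alpha> x
  proof -
    have "norm (multi_deriv \<alpha> \<phi> x) \<le> C * (h ^ mi_abs \<alpha> * M (mi_abs \<alpha>))"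
      using C[OF that, of \<alpha>] pos[of "mi_abs \<alpha>"] by (simp add: divide_le_eq)
    also have "\<dots> \<le> max C 0 * (h ^ mi_abs \<alpha> * M (mi_abs \<alpha>))"
      using pos[of "mi_abs \<alpha>"] by (intro mult_right_mono) auto
    finally show ?thesis .
  qed
  then show "\<exists>C\<ge>0. deriv_bound M h C K \<phi>"
    unfolding deriv_bound_def by (intro exI[of _ "max C 0"]) auto
next
  have pos: "0 < h ^ k * M k" for k using M h by simp
  assume "\<exists>C\<ge>0. deriv_bound M h C K \<phi>"
  then obtain C where C: "\<And>\<alpha> x. x \<in> K \<Longrightarrow> norm (multi_deriv \<alpha> \<phi> x) \<le> C * (h ^ mi_abs \<alpha> * M (mi_abs \<alpha>))"
    unfolding deriv_bound_def by blast
  have "norm (multi_deriv \<alpha> \<phi> x) / (h ^ mi_abs \<alpha> * M (mi_abs \<alpha>)) \<le> C" if "x \<in> K" for \<alpha> x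
    using C[OF that, of \<alpha>] pos[of "mi_abs \<alpha>"] by (simp add: divide_le_eq)
  then show "ultra_bounded M h K \<phi>"
    unfolding ultra_bounded_def bdd_above_def by (intro exI[of _ C]) auto
qed

lemma ultra_space_iff:
  assumes M: "\<And>q. 0 < M q"
  shows "\<phi> \<in> ultra_space c M \<Omega> \<longleftrightarrow> \<phi> \<in> extensional \<Omega> \<and> smooth_on \<Omega> \<phi> \<and>
    (\<forall>K. compact K \<and> K \<subseteq> \<Omega> \<longrightarrow> for_h c (\<lambda>h. \<exists>C\<ge>0. deriv_bound M h C K \<phi>))"
proof -
  have "(case c of Beurling \<Rightarrow> \<forall>h>0. ultra_bounded M h K \<phi> | Roumieu \<Rightarrow> \<exists>h>0. ultra_bounded M h K \<phi>)
     \<longleftrightarrow> for_h c (\<lambda>h. \<exists>C\<ge>0. deriv_bound M h C K \<phi>)" for K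
    unfolding for_h_def by (cases c) (simp_all add: ultra_bounded_iff[OF M] cong: conj_cong)
  then show ?thesis by (simp add: ultra_space_def)
qed

lemma deriv_bound_mono:
  assumes M: "\<And>q. 0 < M q" and "0 < h" "h \<le> h'" "0 \<le> C" "C \<le> C'" "deriv_bound M h C K \<phi>"
  shows "deriv_bound M h' C' K \<phi>"
proof -
  have "C * (h ^ k * M k) \<le> C' * (h' ^ k * M k)" for k
    using assms less_imp_le[OF M] by (intro mult_mono power_mono) auto
  then show ?thesis
    using assms(6) unfolding deriv_bound_def by (meson order_trans)
qed

lemma ex_deriv_bound_mono:
  assumes M: "\<And>q. 0 < M q" and h: "0 < h" "h \<le> h'" and ex: "\<exists>C\<ge>0. deriv_bound M h C K \<phi>"
  shows "\<exists>C\<ge>0. deriv_bound M h' C K \<phi>"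
proof -
  obtain C where C: "0 \<le> C" "deriv_bound M h C K \<phi>" using ex by blast
  have "deriv_bound M h' C K \<phi>" by (rule deriv_bound_mono[OF M h C(1) order_refl C(2)])
  with C(1) show ?thesis by blast
qed

lemma ultra_space_jet_bound:
  fixes x :: "real^'d::finite"
  assumes M: "\<And>q. 0 < M q" and \<Omega>: "open \<Omega>" and \<phi>: "\<phi> \<in> ultra_space c M \<Omega>" and x: "cube x R \<subseteq> \<Omega>"
  shows "for_h c (\<lambda>h. \<exists>C\<ge>0. jet_bound M h C x R \<phi>)"
proof -
  have s: "smooth_on \<Omega> \<phi>" and "for_h c (\<lambda>h. \<exists>C\<ge>0. deriv_bound M h C (cube x R) \<phi>)"
    using \<phi> x by (auto simp: ultra_space_iff[OF M] cube_def)
  from this(2) show ?thesis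
  proof (rule for_h_mono)
    fix h :: real assume "\<exists>C\<ge>0. deriv_bound M h C (cube x R) \<phi>"
    then obtain C where C: "0 \<le> C" "deriv_bound M h C (cube x R) \<phi>" by blast
    have "norm ((partial_deriv j ^^ k) \<phi> y) \<le> C * h ^ k * M k" if "y \<in> cube x R" for j k y
      using C(2)[unfolded deriv_bound_def, rule_format, OF that, of "\<lambda>i. if i = j then k else 0"]
      by (simp add: multi_deriv_single mi_abs_single mult.assoc)
    then have "jet_bound M h C x R \<phi>"
      unfolding jet_bound_def using \<Omega> x s by blast
    then show "\<exists>C\<ge>0. jet_bound M h C x R \<phi>" using C(1) by blast
  qed
qed

section \<open>Local character of the spaces\<close>

lemma Ck_on_subset:
  assumes "open T" "T \<subseteq> S" "Ck_on k S f"
  shows "Ck_on k T f"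
  using assms(3)
proof (induction k arbitrary: f)
  case 0
  then show ?case using assms(2) by (auto intro: continuous_on_subset)
next
  case (Suc k)
  then show ?case using assms(2) by (auto intro: differentiable_on_subset)
qed

lemma smooth_on_subset: "open T \<Longrightarrow> T \<subseteq> S \<Longrightarrow> smooth_on S f \<Longrightarrow> smooth_on T f"
  unfolding smooth_on_def using Ck_on_subset by blast

lemma smooth_on_local:
  assumes S: "open S" and loc: "\<And>x. x \<in> S \<Longrightarrow> \<exists>T. open T \<and> x \<in> T \<and> smooth_on T f"
  shows "smooth_on S f"
proof (rule smooth_on_coinduct[OF S, where P = "\<lambda>f. \<forall>x\<in>S. \<exists>T. open T \<and> x \<in> T \<and> smooth_on T f"])
  show "\<forall>x\<in>S. \<exists>T. open T \<and> x \<in> T \<and> smooth_on T f" using loc by blast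
  fix f :: "real^'a \<Rightarrow> complex" assume f: "\<forall>x\<in>S. \<exists>T. open T \<and> x \<in> T \<and> smooth_on T f"
  have "f differentiable at x" if x: "x \<in> S" for x
  proof -
    obtain T where T: "open T" "x \<in> T" "smooth_on T f" using f x by blast
    then show ?thesis
      using smooth_on_imp_differentiable[OF T(3)] differentiable_on_eq_differentiable_at[OF T(1)] by blast
  qed
  then have "f differentiable_on S"
    using differentiable_on_eq_differentiable_at[OF S] by blast
  moreover have "\<forall>x\<in>S. \<exists>T. open T \<and> x \<in> T \<and> smooth_on T (partial_deriv i f)" for i
    using f smooth_on_partial_deriv by blast
  ultimately show "f differentiable_on S \<and> (\<forall>i. \<exists>g. (\<forall>x\<in>S. \<exists>T. open T \<and> x \<in> T \<and> smooth_on T g) \<and> (\<forall>x\<in>S. partial_deriv i f x = g x))"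
    by blast
qed

lemma multi_deriv_cong:
  assumes "open S" "\<And>y. y \<in> S \<Longrightarrow> f y = g y" "x \<in> S"
  shows "multi_deriv \<alpha> f x = multi_deriv \<alpha> g x"
  unfolding multi_deriv_mi_list by (rule foldr_partial_deriv_cong[OF assms])

lemma deriv_bound_cong:
  assumes "open S" "K \<subseteq> S" "\<And>y. y \<in> S \<Longrightarrow> f y = g y"
  shows "deriv_bound M h C K f \<longleftrightarrow> deriv_bound M h C K g"
proof -
  have "multi_deriv \<alpha> f x = multi_deriv \<alpha> g x" if "x \<in> K" for \<alpha> x
    using assms that by (intro multi_deriv_cong[OF assms(1)]) auto
  then show ?thesis by (simp add: deriv_bound_def)
qed

text \<open>A compact set is covered by finitely many of the given neighbourhoods. Monotonicity in
  \<open>h\<close> and in the constant merges the finitely many bounds into a single one; in the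
  Roumieu case this passes to the largest of the local \<open>h\<close>.\<close>

lemma restrict_in_ultra_spaceI:
  fixes f :: "real^'d::finite \<Rightarrow> complex"
  assumes M: "\<And>q. 0 < M q" and \<Omega>: "open \<Omega>"
    and loc: "\<And>x0. x0 \<in> \<Omega> \<Longrightarrow> \<exists>S. open S \<and> x0 \<in> S \<and> S \<subseteq> \<Omega> \<and> smooth_on S f \<and>
      for_h c (\<lambda>h. \<exists>C\<ge>0. deriv_bound M h C S f)"
  shows "restrict f \<Omega> \<in> ultra_space c M \<Omega>"
  unfolding ultra_space_iff[OF M]
proof (intro conjI allI impI)
  show "restrict f \<Omega> \<in> extensional \<Omega>" by simp
  have "smooth_on \<Omega> f" by (rule smooth_on_local[OF \<Omega>]) (use loc in blast)
  then show "smooth_on \<Omega> (restrict f \<Omega>)" using smooth_on_cong[OF \<Omega>, of "restrict f \<Omega>" f] by simp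
  fix K assume K: "compact K \<and> K \<subseteq> \<Omega>"
  let ?Q = "\<lambda>S x0. open S \<and> x0 \<in> S \<and> S \<subseteq> \<Omega> \<and> smooth_on S f \<and>
      for_h c (\<lambda>h. \<exists>C\<ge>0. deriv_bound M h C S f)"
  define S where "S = (\<lambda>x0. SOME S. ?Q S x0)"
  have SQ: "?Q (S x0) x0" if "x0 \<in> \<Omega>" for x0
    unfolding S_def by (rule someI_ex[OF loc[OF that]])
  have S: "open (S x0)" "x0 \<in> S x0" "S x0 \<subseteq> \<Omega>"
    "for_h c (\<lambda>h. \<exists>C\<ge>0. deriv_bound M h C (S x0) f)"
    if "x0 \<in> \<Omega>" for x0
    using SQ[OF that] by (iprover elim: conjE)+
  have "K \<subseteq> (\<Union>x0\<in>K. S x0)" using S K by blast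
  then obtain K' where K': "K' \<subseteq> K" "finite K'" "K \<subseteq> (\<Union>x0\<in>K'. S x0)"
    using compactE_image[of K K S] K S(1) by (metis subsetD)
  have b: "for_h c (\<lambda>h. \<exists>C\<ge>0. deriv_bound M h C (S x0) (restrict f \<Omega>))" if x0: "x0 \<in> K'" for x0
  proof -
    have x0\<Omega>: "x0 \<in> \<Omega>" using x0 K' K by blast
    have "deriv_bound M h C (S x0) (restrict f \<Omega>) = deriv_bound M h C (S x0) f" for h C
      by (rule deriv_bound_cong[OF S(1)[OF x0\<Omega>]]) (use S(3)[OF x0\<Omega>] in auto)
    then show ?thesis using S(4)[OF x0\<Omega>] by simp
  qed
  have "for_h c (\<lambda>h. \<forall>x0\<in>K'. \<exists>C\<ge>0. deriv_bound M h C (S x0) (restrict f \<Omega>))"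
    by (rule for_h_ball[OF K'(2)]) (erule b, erule (2) ex_deriv_bound_mono[OF M])
  then show "for_h c (\<lambda>h. \<exists>C\<ge>0. deriv_bound M h C K (restrict f \<Omega>))"
  proof (rule for_h_mono)
    fix h :: real assume h: "h > 0" and "\<forall>x0\<in>K'. \<exists>C\<ge>0. deriv_bound M h C (S x0) (restrict f \<Omega>)"
    then obtain C where C: "\<And>x0. x0 \<in> K' \<Longrightarrow> 0 \<le> C x0" "\<And>x0. x0 \<in> K' \<Longrightarrow> deriv_bound M h (C x0) (S x0) (restrict f \<Omega>)"
      by metis
    have 0: "0 \<le> (\<Sum>x0\<in>K'. C x0)" using C(1) by (rule sum_nonneg)
    have "deriv_bound M h (\<Sum>x0\<in>K'. C x0) K (restrict f \<Omega>)"
      unfolding deriv_bound_def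
    proof (intro allI ballI)
      fix \<alpha> x assume "x \<in> K"
      then obtain x0 where x0: "x0 \<in> K'" "x \<in> S x0" using K' by blast
      have "C x0 \<le> (\<Sum>x0\<in>K'. C x0)" using x0 C(1) K'(2) by (intro member_le_sum) auto
      from deriv_bound_mono[OF M h order_refl C(1)[OF x0(1)] this C(2)[OF x0(1)]]
      show "norm (multi_deriv \<alpha> (restrict f \<Omega>) x) \<le> (\<Sum>x0\<in>K'. C x0) * (h ^ mi_abs \<alpha> * M (mi_abs \<alpha>))"
        using x0(2) unfolding deriv_bound_def by blast
    qed
    then show "\<exists>C\<ge>0. deriv_bound M h C K (restrict f \<Omega>)" using 0 by blast
  qed
qed

lemma foldr_deriv_boundD:
  fixes f :: "real^'d::finite \<Rightarrow> complex"
  assumes M: "\<And>q. 0 < M q"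
    and b: "for_h c (\<lambda>h. \<exists>C. \<forall>js. \<forall>x\<in>S. norm (foldr partial_deriv js f x) \<le> C * h ^ length js * M (length js))"
  shows "for_h c (\<lambda>h. \<exists>C\<ge>0. deriv_bound M h C S f)"
proof (rule for_h_mono[OF b])
  fix h :: real assume h: "h > 0" and "\<exists>C. \<forall>js. \<forall>x\<in>S. norm (foldr partial_deriv js f x) \<le> C * h ^ length js * M (length js)"
  then obtain C where C: "\<And>js x. x \<in> S \<Longrightarrow> norm (foldr partial_deriv js f x) \<le> C * h ^ length js * M (length js)" by blast
  have "norm (multi_deriv \<alpha> f x) \<le> max C 0 * (h ^ mi_abs \<alpha> * M (mi_abs \<alpha>))" if x: "x \<in> S" for \<alpha> x
  proof -
    have "norm (multi_deriv \<alpha> f x) \<le> C * (h ^ mi_abs \<alpha> * M (mi_abs \<alpha>))"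
      using C[OF x, of "mi_list \<alpha>"] by (simp add: multi_deriv_mi_list length_mi_list mult.assoc)
    also have "\<dots> \<le> max C 0 * (h ^ mi_abs \<alpha> * M (mi_abs \<alpha>))"
      using h less_imp_le[OF M] by (intro mult_right_mono) auto
    finally show ?thesis .
  qed
  then show "\<exists>C\<ge>0. deriv_bound M h C S f"
    unfolding deriv_bound_def by (intro exI[of _ "max C 0"]) auto
qed

section \<open>Linear structure and restriction\<close>

lemma partial_deriv_lincomb:
  assumes S: "open S" "x \<in> S" and f: "f differentiable_on S" "g differentiable_on S"
  shows "partial_deriv i (\<lambda>x. f x + a * g x) x = partial_deriv i f x + a * partial_deriv i g x"
proof (rule partial_deriv_eqI)
  have x: "x + 0 *\<^sub>R axis i 1 \<in> S" using S by simp
  show "((\<lambda>t. f (x + t *\<^sub>R axis i 1) + a * g (x + t *\<^sub>R axis i 1)) has_vector_derivative partial_deriv i f x + a * partial_deriv i g x) (at 0)"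
    using has_vector_derivative_partial_deriv[OF S(1) f(1) x] has_vector_derivative_partial_deriv[OF S(1) f(2) x]
    by (intro has_vector_derivative_add has_vector_derivative_mult_right) auto
qed

lemma smooth_on_lincomb:
  assumes S: "open S" and f: "smooth_on S f" "smooth_on S g"
  shows "smooth_on S (\<lambda>x. f x + a * g x)"
proof (rule smooth_on_coinduct[OF S, where P = "\<lambda>u. \<exists>f g. smooth_on S f \<and> smooth_on S g \<and> u = (\<lambda>x. f x + a * g x)"])
  show "\<exists>f' g'. smooth_on S f' \<and> smooth_on S g' \<and> (\<lambda>x. f x + a * g x) = (\<lambda>x. f' x + a * g' x)"
    using f by blast
  fix u assume "\<exists>f g. smooth_on S f \<and> smooth_on S g \<and> u = (\<lambda>x. f x + a * g x)"
  then obtain f g where fg: "smooth_on S f" "smooth_on S g" "u = (\<lambda>x. f x + a * g x)" by blast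
  note d = smooth_on_imp_differentiable[OF fg(1)] smooth_on_imp_differentiable[OF fg(2)]
  have "u differentiable_on S"
    unfolding fg(3) differentiable_on_def
  proof
    fix x assume "x \<in> S"
    then show "(\<lambda>x. f x + a * g x) differentiable at x within S"
      using d unfolding differentiable_on_def by (intro differentiable_add differentiable_mult) auto
  qed
  moreover have "\<exists>v. (\<exists>f g. smooth_on S f \<and> smooth_on S g \<and> v = (\<lambda>x. f x + a * g x)) \<and> (\<forall>x\<in>S. partial_deriv i u x = v x)" for i
    using smooth_on_partial_deriv[OF fg(1), of i] smooth_on_partial_deriv[OF fg(2), of i] partial_deriv_lincomb[OF S _ d]
    unfolding fg(3) by blast
  ultimately show "u differentiable_on S \<and> (\<forall>i. \<exists>v. (\<exists>f g. smooth_on S f \<and> smooth_on S g \<and> v = (\<lambda>x. f x + a * g x)) \<and> (\<forall>x\<in>S. partial_deriv i u x = v x))"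
    by blast
qed

lemma foldr_partial_deriv_lincomb:
  assumes S: "open S" and f: "smooth_on S f" "smooth_on S g" and x: "x \<in> S"
  shows "foldr partial_deriv js (\<lambda>x. f x + a * g x) x = foldr partial_deriv js f x + a * foldr partial_deriv js g x"
  using x
proof (induction js arbitrary: x)
  case (Cons j js)
  have "partial_deriv j (foldr partial_deriv js (\<lambda>x. f x + a * g x)) x
    = partial_deriv j (\<lambda>x. foldr partial_deriv js f x + a * foldr partial_deriv js g x) x"
    by (rule partial_deriv_cong[OF S Cons.prems Cons.IH])
  also have "\<dots> = partial_deriv j (foldr partial_deriv js f) x + a * partial_deriv j (foldr partial_deriv js g) x"
    by (rule partial_deriv_lincomb[OF S Cons.prems])
       (intro smooth_on_imp_differentiable smooth_on_foldr f)+
  finally show ?case by simp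
qed simp

lemma ultra_space_lincomb:
  assumes M: "\<And>q. 0 < M q" and \<Omega>: "open \<Omega>" and f: "f \<in> ultra_space c M \<Omega>" "g \<in> ultra_space c M \<Omega>"
  shows "(\<lambda>x\<in>\<Omega>. f x + a * g x) \<in> ultra_space c M \<Omega>"
  unfolding ultra_space_iff[OF M]
proof (intro conjI allI impI)
  note f' = f[unfolded ultra_space_iff[OF M]]
  have sm: "smooth_on \<Omega> f" "smooth_on \<Omega> g" using f' by auto
  show "(\<lambda>x\<in>\<Omega>. f x + a * g x) \<in> extensional \<Omega>" by simp
  show "smooth_on \<Omega> (\<lambda>x\<in>\<Omega>. f x + a * g x)"
    using smooth_on_lincomb[OF \<Omega> sm, of a] smooth_on_cong[OF \<Omega>, of "\<lambda>x\<in>\<Omega>. f x + a * g x" "\<lambda>x. f x + a * g x"] by simp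
  fix K assume K: "compact K \<and> K \<subseteq> \<Omega>"
  have fK: "for_h c (\<lambda>h. \<exists>C\<ge>0. deriv_bound M h C K f)" and gK: "for_h c (\<lambda>h. \<exists>C\<ge>0. deriv_bound M h C K g)"
    using f' K by simp_all
  have "for_h c (\<lambda>h. (\<exists>C\<ge>0. deriv_bound M h C K f) \<and> (\<exists>C\<ge>0. deriv_bound M h C K g))"
    by (rule for_h_conj[OF fK gK]) (erule (2) ex_deriv_bound_mono[OF M])+
  then show "for_h c (\<lambda>h. \<exists>C\<ge>0. deriv_bound M h C K (\<lambda>x\<in>\<Omega>. f x + a * g x))"
  proof (rule for_h_mono)
    fix h :: real assume h: "h > 0" and "(\<exists>C\<ge>0. deriv_bound M h C K f) \<and> (\<exists>C\<ge>0. deriv_bound M h C K g)"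
    then obtain C1 C2 where C: "0 \<le> C1" "deriv_bound M h C1 K f" "0 \<le> C2" "deriv_bound M h C2 K g" by blast
    have "norm (multi_deriv \<alpha> (\<lambda>x\<in>\<Omega>. f x + a * g x) x) \<le> (C1 + norm a * C2) * (h ^ mi_abs \<alpha> * M (mi_abs \<alpha>))"
      if x: "x \<in> K" for \<alpha> x
    proof -
      have x\<Omega>: "x \<in> \<Omega>" using x K by blast
      have "multi_deriv \<alpha> (\<lambda>x\<in>\<Omega>. f x + a * g x) x = multi_deriv \<alpha> (\<lambda>x. f x + a * g x) x"
        by (rule multi_deriv_cong[OF \<Omega> _ x\<Omega>]) simp
      also have "\<dots> = multi_deriv \<alpha> f x + a * multi_deriv \<alpha> g x"
        unfolding multi_deriv_mi_list by (rule foldr_partial_deriv_lincomb[OF \<Omega> sm x\<Omega>])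
      also have "norm \<dots> \<le> norm (multi_deriv \<alpha> f x) + norm a * norm (multi_deriv \<alpha> g x)"
        using norm_triangle_ineq[of "multi_deriv \<alpha> f x" "a * multi_deriv \<alpha> g x"] by (simp add: norm_mult)
      also have "\<dots> \<le> C1 * (h ^ mi_abs \<alpha> * M (mi_abs \<alpha>)) + norm a * (C2 * (h ^ mi_abs \<alpha> * M (mi_abs \<alpha>)))"
        using C(2,4) x unfolding deriv_bound_def by (intro add_mono mult_left_mono) auto
      finally show ?thesis by (simp add: algebra_simps)
    qed
    then show "\<exists>C\<ge>0. deriv_bound M h C K (\<lambda>x\<in>\<Omega>. f x + a * g x)"
      unfolding deriv_bound_def using C by (intro exI[of _ "C1 + norm a * C2"]) auto
  qed
qed

lemma ultra_space_zero:
  fixes \<Omega> :: "(real^'d::finite) set"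
  assumes M: "\<And>q. 0 < M q" and \<Omega>: "open \<Omega>"
  shows "(\<lambda>x\<in>\<Omega>. 0) \<in> ultra_space c M \<Omega>"
proof (rule restrict_in_ultra_spaceI[OF M \<Omega>])
  have pd: "foldr partial_deriv js (\<lambda>_. 0) = (\<lambda>_ :: real^'d. 0)" for js
  proof (induction js)
    case (Cons j js)
    have "partial_deriv j (\<lambda>_. 0) = (\<lambda>_ :: real^'d. 0)" by (rule ext) (simp add: partial_deriv_def)
    then show ?case using Cons by simp
  qed simp
  have "smooth_on \<Omega> (\<lambda>_. 0)"
  proof (rule smooth_on_coinduct[OF \<Omega>, where P = "\<lambda>f. f = (\<lambda>_. 0)"])
    fix f :: "real^'d \<Rightarrow> complex" assume f: "f = (\<lambda>_. 0)"
    have "\<exists>g. g = (\<lambda>_. 0) \<and> (\<forall>x\<in>\<Omega>. partial_deriv i f x = g x)" for i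
      using fun_cong[OF pd[of "[i]"]] by (intro exI[of _ "\<lambda>_. 0"]) (simp add: f)
    moreover have "f differentiable_on \<Omega>" by (simp add: f)
    ultimately show "f differentiable_on \<Omega> \<and> (\<forall>i. \<exists>g. g = (\<lambda>_. 0) \<and> (\<forall>x\<in>\<Omega>. partial_deriv i f x = g x))"
      by blast
  qed simp
  moreover have "for_h c (\<lambda>h. \<exists>C\<ge>0. deriv_bound M h C \<Omega> (\<lambda>_. 0))"
  proof -
    have t: "for_h c (\<lambda>h. True)"
      by (cases c) (auto simp: for_h_def intro: exI[of _ "1::real"])
    show ?thesis
      by (rule for_h_mono[OF t]) (auto simp: deriv_bound_def multi_deriv_mi_list pd intro!: exI[of _ 0])
  qed
  ultimately show "\<exists>S. open S \<and> x0 \<in> S \<and> S \<subseteq> \<Omega> \<and> smooth_on S (\<lambda>_. 0) \<and>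
      for_h c (\<lambda>h. \<exists>C\<ge>0. deriv_bound M h C S (\<lambda>_. 0))"
    if "x0 \<in> \<Omega>" for x0
    using that \<Omega> by blast
qed

lemma ultra_space_restrict:
  assumes M: "\<And>q. 0 < M q" and \<Omega>: "open \<Omega>'" "\<Omega>' \<subseteq> \<Omega>" and f: "f \<in> ultra_space c M \<Omega>"
  shows "restrict f \<Omega>' \<in> ultra_space c M \<Omega>'"
  unfolding ultra_space_iff[OF M]
proof (intro conjI allI impI)
  note f' = f[unfolded ultra_space_iff[OF M]]
  show "restrict f \<Omega>' \<in> extensional \<Omega>'" by simp
  have "smooth_on \<Omega>' f" using f' smooth_on_subset[OF \<Omega>] by blast
  then show "smooth_on \<Omega>' (restrict f \<Omega>')" using smooth_on_cong[OF \<Omega>(1), of "restrict f \<Omega>'" f] by simp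
  fix K assume K: "compact K \<and> K \<subseteq> \<Omega>'"
  have "deriv_bound M h C K (restrict f \<Omega>') = deriv_bound M h C K f" for h C
    by (rule deriv_bound_cong[OF \<Omega>(1)]) (use K in auto)
  then show "for_h c (\<lambda>h. \<exists>C\<ge>0. deriv_bound M h C K (restrict f \<Omega>'))"
    using f' K \<Omega>(2) by auto
qed


section \<open>Locally finite coverings by cubes\<close>

definition ocube :: "real^'d::finite \<Rightarrow> real \<Rightarrow> (real^'d) set" where
  "ocube x r = {y. \<forall>i. \<bar>y $ i - x $ i\<bar> < r}"

lemma open_ocube: "open (ocube x r)"
proof -
  have "ocube x r = box (lo x r) (hi x r)"
    by (auto simp: ocube_def mem_box_cart abs_less_iff algebra_simps)
  then show ?thesis by (simp add: open_box)
qed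

lemma ocube_subset_cube: "ocube x r \<subseteq> cube x r"
  by (auto simp: ocube_def mem_cube less_imp_le)

text \<open>\<open>\<Omega>\<close> is exhausted by compact sets, and each shell \<open>L k\<close>
  is covered by finitely many small cubes that avoid \<open>K k\<close>. The interior of
  \<open>K (Suc k)\<close> then meets only cubes of the shells up to \<open>k\<close>, which gives
  local finiteness.\<close>

lemma cube_covering:
  fixes \<Omega> :: "(real^'d::finite) set" and U :: "'i \<Rightarrow> (real^'d) set"
  assumes \<Omega>: "open \<Omega>" and U: "\<And>i. i \<in> I \<Longrightarrow> open (U i)" "(\<Union>i\<in>I. U i) = \<Omega>"
  shows "\<exists>N p r \<iota>. (\<forall>n\<in>N::nat set. 0 < r n \<and> r n \<le> (1/4::real) \<and> \<iota> n \<in> I \<and> cube (p n) (2 * r n) \<subseteq> U (\<iota> n)) \<and>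
    (\<forall>x\<in>\<Omega>. \<exists>n\<in>N. x \<in> ocube (p n) (r n)) \<and>
    (\<forall>x\<in>\<Omega>. \<exists>V. open V \<and> x \<in> V \<and> finite {n\<in>N. V \<inter> cube (p n) (r n) \<noteq> {}})"
proof -
  obtain C where C: "\<And>n. compact (C n)" "\<And>n. C n \<subseteq> \<Omega>" "\<And>n. C n \<subseteq> interior (C (Suc n))" "\<Union>(range C) = \<Omega>"
    using open_Union_compact_subsets[OF \<Omega>] by metis
  \<comment> \<open>Two empty sets are put in front, so that the shells \<open>L k\<close> starting
    at \<open>k = 0\<close> cover all of \<open>\<Omega>\<close>.\<close>
  define K where "K = (\<lambda>k. if k < 2 then {} else C (k - 2))"
  have K: "compact (K k)" "K k \<subseteq> \<Omega>" "K k \<subseteq> interior (K (Suc k))" for k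
  proof -
    show "compact (K k)" "K k \<subseteq> \<Omega>" using C by (auto simp: K_def)
    show "K k \<subseteq> interior (K (Suc k))"
    proof (cases "k < 2")
      case False
      then have "Suc k - 2 = Suc (k - 2)" by simp
      then show ?thesis using False C(3)[of "k - 2"] by (simp add: K_def)
    qed (simp add: K_def)
  qed
  have Kmono: "K k \<subseteq> K l" if "k \<le> l" for k l
    using that by (rule lift_Suc_mono_le[rotated]) (use K(3) interior_subset in blast)
  define L where "L = (\<lambda>k. K (Suc (Suc k)) - interior (K (Suc k)))"
  have L: "compact (L k)" for k unfolding L_def by (intro compact_diff K open_interior)
  have LO: "L k \<subseteq> \<Omega> - K k" for k unfolding L_def using K by blast
  have exF: "\<exists>F. finite F \<and> (\<forall>(p, s, i)\<in>F. 0 < s \<and> s \<le> 1/4 \<and> i \<in> I \<and> cube p (2 * s) \<subseteq> U i \<inter> (\<Omega> - K k)) \<and>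
      L k \<subseteq> (\<Union>(p, s, i)\<in>F. ocube p s)" for k
  proof -
    have "\<exists>s i. 0 < s \<and> s \<le> 1/4 \<and> i \<in> I \<and> cube x (2 * s) \<subseteq> U i \<inter> (\<Omega> - K k)" if x: "x \<in> L k" for x
    proof -
      have x\<Omega>: "x \<in> \<Omega> - K k" using x LO by blast
      then obtain i where i: "i \<in> I" "x \<in> U i" using U(2) by blast
      have op: "open (U i \<inter> (\<Omega> - K k))"
        by (intro open_Int open_Diff U(1) i \<Omega> compact_imp_closed K)
      have xi: "x \<in> U i \<inter> (\<Omega> - K k)" using i x\<Omega> by blast
      note rd = rad[OF op xi]
      have "cube x (2 * (rad (U i \<inter> (\<Omega> - K k)) x / 2)) \<subseteq> U i \<inter> (\<Omega> - K k)" using rd by simp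
      then show ?thesis using rd i(1) by (intro exI[of _ "rad (U i \<inter> (\<Omega> - K k)) x / 2"] exI[of _ i]) auto
    qed
    then obtain s i where si: "\<And>x. x \<in> L k \<Longrightarrow> 0 < s x \<and> s x \<le> 1/4 \<and> i x \<in> I \<and> cube x (2 * s x) \<subseteq> U (i x) \<inter> (\<Omega> - K k)"
      by metis
    have "L k \<subseteq> (\<Union>x\<in>L k. ocube x (s x))" using si by (auto simp: ocube_def)
    then obtain L' where L': "L' \<subseteq> L k" "finite L'" "L k \<subseteq> (\<Union>x\<in>L'. ocube x (s x))"
      using compactE_image[OF L[of k], of "L k" "\<lambda>x. ocube x (s x)"] open_ocube by metis
    have "\<forall>(p, t, j)\<in>(\<lambda>x. (x, s x, i x)) ` L'. 0 < t \<and> t \<le> 1/4 \<and> j \<in> I \<and> cube p (2 * t) \<subseteq> U j \<inter> (\<Omega> - K k)"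
      using si L'(1) by blast
    moreover have "L k \<subseteq> (\<Union>(p, t, j)\<in>(\<lambda>x. (x, s x, i x)) ` L'. ocube p t)"
      using L'(3) by auto
    ultimately show ?thesis using L'(2) by (intro exI[of _ "(\<lambda>x. (x, s x, i x)) ` L'"]) blast
  qed
  define F where "F = (\<lambda>k. SOME F. finite F \<and> (\<forall>(p, s, i)\<in>F. 0 < s \<and> s \<le> 1/4 \<and> i \<in> I \<and> cube p (2 * s) \<subseteq> U i \<inter> (\<Omega> - K k)) \<and>
      L k \<subseteq> (\<Union>(p, s, i)\<in>F. ocube p s))"
  have "finite (F k) \<and> (\<forall>(p, s, i)\<in>F k. 0 < s \<and> s \<le> 1/4 \<and> i \<in> I \<and> cube p (2 * s) \<subseteq> U i \<inter> (\<Omega> - K k)) \<and>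
      L k \<subseteq> (\<Union>(p, s, i)\<in>F k. ocube p s)" for k
    unfolding F_def by (rule someI_ex[OF exF])
  note Fk = this[THEN conjunct1] this[THEN conjunct2, THEN conjunct1, THEN bspec] this[THEN conjunct2, THEN conjunct2]
  have F: "finite (F k)" "(p, s, i) \<in> F k \<Longrightarrow> 0 < s \<and> s \<le> 1/4 \<and> i \<in> I \<and> cube p (2 * s) \<subseteq> U i \<inter> (\<Omega> - K k)"
    "L k \<subseteq> (\<Union>(p, s, i)\<in>F k. ocube p s)" for k p s i
  proof -
    show "0 < s \<and> s \<le> 1/4 \<and> i \<in> I \<and> cube p (2 * s) \<subseteq> U i \<inter> (\<Omega> - K k)" if "(p, s, i) \<in> F k"
      using Fk(2)[OF that] by (simp only: prod.case)
  qed (rule Fk(1), rule Fk(3))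
  \<comment> \<open>The chosen cubes, each with its radius and an index of the covering, are
    numbered by natural numbers because the construction of the cutoffs uses an order on
    them.\<close>
  define T where "T = (\<Union>k. F k)"
  have T: "countable T" unfolding T_def by (rule countable_UN) (auto intro: countable_finite F(1))
  define N where "N = to_nat_on T ` T"
  define p where "p = (\<lambda>n. fst (from_nat_into T n))"
  define r where "r = (\<lambda>n. fst (snd (from_nat_into T n)))"
  define \<iota> where "\<iota> = (\<lambda>n. snd (snd (from_nat_into T n)))"
  have inv_idx: "from_nat_into T (to_nat_on T t) = t" if "t \<in> T" for t
    using that T by simp
  have coord: "p (to_nat_on T (q, s, i)) = q" "r (to_nat_on T (q, s, i)) = s" "\<iota> (to_nat_on T (q, s, i)) = i"
    if "(q, s, i) \<in> T" for q s i
    using inv_idx[OF that] by (simp_all add: p_def r_def \<iota>_def)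
  have 1: "0 < r n \<and> r n \<le> 1/4 \<and> \<iota> n \<in> I \<and> cube (p n) (2 * r n) \<subseteq> U (\<iota> n)" if n: "n \<in> N" for n
  proof -
    obtain q s i where t: "(q, s, i) \<in> T" "n = to_nat_on T (q, s, i)" using n by (auto simp: N_def)
    then obtain k where "(q, s, i) \<in> F k" by (auto simp: T_def)
    from F(2)[OF this] show ?thesis using coord[OF t(1)] unfolding t(2) by simp
  qed
  have 2: "\<exists>n\<in>N. x \<in> ocube (p n) (r n)" if x: "x \<in> \<Omega>" for x
  proof -
    have "\<exists>m. x \<in> K m"
    proof -
      obtain n where "x \<in> C n" using x C(4) by blast
      then have "x \<in> K (n + 2)" by (simp add: K_def)
      then show ?thesis by blast
    qed
    then obtain m where m: "x \<in> K m" "\<And>l. l < m \<Longrightarrow> x \<notin> K l" using exists_least_iff[of "\<lambda>m. x \<in> K m"] by blast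
    have "2 \<le> m" using m(1) by (auto simp: K_def split: if_splits)
    then obtain k where k: "m = Suc (Suc k)" by (metis add_2_eq_Suc le_Suc_ex)
    have "x \<in> L k" unfolding L_def using m k interior_subset[of "K (Suc k)"] by auto
    then obtain q s i where t: "(q, s, i) \<in> F k" "x \<in> ocube q s" using F(3)[of k] by blast
    then have "(q, s, i) \<in> T" by (auto simp: T_def)
    then show ?thesis using t(2) coord by (intro bexI[of _ "to_nat_on T (q, s, i)"]) (auto simp: N_def)
  qed
  have 3: "\<exists>V. open V \<and> x \<in> V \<and> finite {n\<in>N. V \<inter> cube (p n) (r n) \<noteq> {}}" if x: "x \<in> \<Omega>" for x
  proof -
    obtain n where "x \<in> C n" using x C(4) by blast
    then have xK: "x \<in> K (n + 2)" by (simp add: K_def)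
    define k where "k = n + 2"
    define V where "V = interior (K (Suc k))"
    have xV: "x \<in> V" using xK K(3)[of k] by (auto simp: V_def k_def)
    have "{n\<in>N. V \<inter> cube (p n) (r n) \<noteq> {}} \<subseteq> to_nat_on T ` (\<Union>l\<le>k. F l)"
    proof
      fix n assume "n \<in> {n\<in>N. V \<inter> cube (p n) (r n) \<noteq> {}}"
      then have n: "n \<in> N" "V \<inter> cube (p n) (r n) \<noteq> {}" by auto
      obtain q s i where t: "(q, s, i) \<in> T" "n = to_nat_on T (q, s, i)" using n by (auto simp: N_def)
      then obtain l where l: "(q, s, i) \<in> F l" by (auto simp: T_def)
      have "l \<le> k"
      proof (rule ccontr)
        assume "\<not> l \<le> k"
        then have "K (Suc k) \<subseteq> K l" by (intro Kmono) auto
        moreover have "cube q s \<subseteq> \<Omega> - K l" using F(2)[OF l] cube_mono[of s "2 * s" q] by auto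
        ultimately show False using n(2) coord[OF t(1)] t(2) interior_subset[of "K (Suc k)"] by (auto simp: V_def)
      qed
      then show "n \<in> to_nat_on T ` (\<Union>l\<le>k. F l)" using l t(2) by blast
    qed
    moreover have "finite (to_nat_on T ` (\<Union>l\<le>k. F l))" using F(1) by auto
    ultimately have "finite {n\<in>N. V \<inter> cube (p n) (r n) \<noteq> {}}" by (rule finite_subset)
    then show ?thesis using xV by (intro exI[of _ V]) (simp add: V_def)
  qed
  show ?thesis using 1 2 3 by (intro exI[of _ N] exI[of _ p] exI[of _ r] exI[of _ \<iota>]) blast
qed

text \<open>With the partition of unity \<open>\<beta> n / s\<close>, the function
  \<open>f i\<close> is the weighted mean of the \<open>\<phi> (\<iota> n) i\<close>, and the
  cocycle identity makes \<open>f j - f i\<close> the mean of a constant. As only continuity is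
  asked for, products of tent functions serve as weights.\<close>

lemma continuous_splitting:
  fixes U :: "'i \<Rightarrow> (real^'d::finite) set" and \<phi> :: "'i \<Rightarrow> 'i \<Rightarrow> real^'d \<Rightarrow> complex"
  assumes U: "\<And>i. i \<in> I \<Longrightarrow> open (U i)" "(\<Union>i\<in>I. U i) = \<Omega>"
    and N: "\<And>n. n \<in> N \<Longrightarrow> 0 < r n" "\<And>n. n \<in> N \<Longrightarrow> \<iota> n \<in> I" "\<And>n. n \<in> N \<Longrightarrow> cube (p n) (2 * r n) \<subseteq> U (\<iota> n)"
      "\<And>x. x \<in> \<Omega> \<Longrightarrow> \<exists>n\<in>N. x \<in> ocube (p n) (r n)"
      "\<And>x. x \<in> \<Omega> \<Longrightarrow> \<exists>V. open V \<and> x \<in> V \<and> finite {n\<in>N. V \<inter> cube (p n) (r n) \<noteq> {}}"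
    and \<phi>: "\<And>i j. i \<in> I \<Longrightarrow> j \<in> I \<Longrightarrow> continuous_on (U i \<inter> U j) (\<phi> i j)"
      "\<And>i j k x. i \<in> I \<Longrightarrow> j \<in> I \<Longrightarrow> k \<in> I \<Longrightarrow> x \<in> U i \<inter> U j \<inter> U k \<Longrightarrow> \<phi> i j x + \<phi> j k x + \<phi> k i x = 0"
  shows "\<exists>f. (\<forall>i\<in>I. continuous_on (U i) (f i)) \<and> (\<forall>i\<in>I. \<forall>j\<in>I. \<forall>x\<in>U i \<inter> U j. f j x - f i x = \<phi> i j x)"
proof -
  define \<beta> where "\<beta> = (\<lambda>n x. \<Prod>j\<in>UNIV. max 0 (r n - \<bar>x $ j - p n $ j\<bar>))"
  define A where "A = (\<lambda>x. {n\<in>N. x \<in> cube (p n) (r n)})"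
  define s where "s = (\<lambda>x. \<Sum>n\<in>A x. \<beta> n x)"
  define f where "f = (\<lambda>i x. (\<Sum>n\<in>A x. of_real (\<beta> n x) * \<phi> (\<iota> n) i x) / of_real (s x))"
  have \<beta>0: "0 \<le> \<beta> n x" for n x unfolding \<beta>_def by (intro prod_nonneg) auto
  have \<beta>z: "\<beta> n x = 0" if nx: "x \<notin> cube (p n) (r n)" for n x
  proof -
    obtain j where "r n < \<bar>x $ j - p n $ j\<bar>" using nx unfolding mem_cube by (meson not_le)
    then have "max 0 (r n - \<bar>x $ j - p n $ j\<bar>) = 0" by simp
    then show ?thesis unfolding \<beta>_def by (intro prod_zero bexI[of _ j]) auto
  qed
  have \<beta>p: "0 < \<beta> n x" if "x \<in> ocube (p n) (r n)" for n x
    using that unfolding \<beta>_def ocube_def by (intro prod_pos) auto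
  have \<beta>c: "continuous_on S (\<beta> n)" for n S unfolding \<beta>_def by (intro continuous_intros)
  have cubesub: "cube (p n) (r n) \<subseteq> U (\<iota> n)" if "n \<in> N" for n
    using N(1)[OF that] N(3)[OF that] cube_mono[of "r n" "2 * r n" "p n"] by auto
  have finA: "finite (A x)" if x: "x \<in> \<Omega>" for x
  proof -
    obtain V where V: "x \<in> V" "finite {n\<in>N. V \<inter> cube (p n) (r n) \<noteq> {}}" using N(5)[OF x] by blast
    have "A x \<subseteq> {n\<in>N. V \<inter> cube (p n) (r n) \<noteq> {}}" using V(1) by (auto simp: A_def)
    then show ?thesis using V(2) by (rule finite_subset)
  qed
  have sp: "0 < s x" if x: "x \<in> \<Omega>" for x
  proof -
    obtain n where n: "n \<in> N" "x \<in> ocube (p n) (r n)" using N(4)[OF x] by blast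
    then have "n \<in> A x" using ocube_subset_cube[of "p n" "r n"] by (auto simp: A_def)
    then have "\<beta> n x \<le> s x" unfolding s_def by (intro member_le_sum finA x \<beta>0)
    then show ?thesis using \<beta>p[OF n(2)] by linarith
  qed
  have cont: "continuous_on (U i) (f i)" if i: "i \<in> I" for i
  proof -
    have "continuous (at x) (f i)" if x: "x \<in> U i" for x
    proof -
      have x\<Omega>: "x \<in> \<Omega>" using x i U by blast
      obtain V where V: "open V" "x \<in> V" "finite {n\<in>N. V \<inter> cube (p n) (r n) \<noteq> {}}" using N(5)[OF x\<Omega>] by blast
      define Q where "Q = {n\<in>N. V \<inter> cube (p n) (r n) \<noteq> {}}"
      have Q: "finite Q" "Q \<subseteq> N" using V by (auto simp: Q_def)
      define W where "W = V \<inter> U i"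
      have W: "open W" "x \<in> W" using V x U(1)[OF i] by (auto simp: W_def)
      have sumQ: "(\<Sum>n\<in>A y. of_real (\<beta> n y) * h n) = (\<Sum>n\<in>Q. of_real (\<beta> n y) * (h n :: complex))" if y: "y \<in> W" for y h
      proof (rule sum.mono_neutral_left[OF Q(1)])
        show "A y \<subseteq> Q" using y by (auto simp: A_def Q_def W_def)
        show "\<forall>n\<in>Q - A y. of_real (\<beta> n y) * h n = 0" using Q(2) \<beta>z by (auto simp: A_def)
      qed
      \<comment> \<open>The summand is continuous on \<open>U i \<inter> U (\<iota> n)\<close> and
        vanishes off the closed cube; these two open subsets cover \<open>U i\<close>.\<close>
      have hc: "continuous_on (U i) (\<lambda>y. of_real (\<beta> n y) * \<phi> (\<iota> n) i y)" if n: "n \<in> Q" for n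
      proof -
        have nN: "n \<in> N" using n Q by blast
        have o1: "open (U i \<inter> U (\<iota> n))" using U(1) i N(2)[OF nN] by (intro open_Int)
        have o2: "open (U i - cube (p n) (r n))" using U(1)[OF i] by (intro open_Diff) (auto simp: cube_def closed_cbox)
        have "continuous_on (U i \<inter> U (\<iota> n)) (\<lambda>y. of_real (\<beta> n y) * \<phi> (\<iota> n) i y)"
          using \<phi>(1)[OF N(2)[OF nN] i] by (intro continuous_intros \<beta>c) (simp add: Int_commute)
        moreover have "continuous_on (U i - cube (p n) (r n)) (\<lambda>y. of_real (\<beta> n y) * \<phi> (\<iota> n) i y)"
          by (rule continuous_on_eq[of _ "\<lambda>_. 0"]) (auto simp: \<beta>z)
        ultimately have "continuous_on ((U i \<inter> U (\<iota> n)) \<union> (U i - cube (p n) (r n))) (\<lambda>y. of_real (\<beta> n y) * \<phi> (\<iota> n) i y)"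
          by (rule continuous_on_open_Un[OF o1 o2])
        moreover have "(U i \<inter> U (\<iota> n)) \<union> (U i - cube (p n) (r n)) = U i" using cubesub[OF nN] by blast
        ultimately show ?thesis by simp
      qed
      have fW: "f i y = (\<Sum>n\<in>Q. of_real (\<beta> n y) * \<phi> (\<iota> n) i y) / (\<Sum>n\<in>Q. of_real (\<beta> n y))" if y: "y \<in> W" for y
        using sumQ[OF y, of "\<lambda>n. \<phi> (\<iota> n) i y"] sumQ[OF y, of "\<lambda>_. 1"] by (simp add: f_def s_def)
      have nz: "(\<Sum>n\<in>Q. of_real (\<beta> n y)) \<noteq> (0 :: complex)" if y: "y \<in> W" for y
      proof -
        have "y \<in> \<Omega>" using y i U(2) by (auto simp: W_def)
        from sp[OF this] have "complex_of_real (s y) \<noteq> 0" by simp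
        then show ?thesis using sumQ[OF y, of "\<lambda>_. 1"] by (simp add: s_def)
      qed
      have "continuous_on W (\<lambda>y. (\<Sum>n\<in>Q. of_real (\<beta> n y) * \<phi> (\<iota> n) i y) / (\<Sum>n\<in>Q. of_real (\<beta> n y)))"
        by (intro continuous_on_divide continuous_on_sum continuous_on_of_real \<beta>c continuous_on_subset[OF hc]) (use nz in \<open>auto simp: W_def\<close>)
      then have "continuous_on W (f i)"
        by (rule continuous_on_eq) (simp add: fW)
      then show ?thesis using continuous_on_eq_continuous_at[OF W(1)] W(2) by blast
    qed
    then show ?thesis using continuous_at_imp_continuous_on by blast
  qed
  have diff: "f j x - f i x = \<phi> i j x" if ij: "i \<in> I" "j \<in> I" and x: "x \<in> U i \<inter> U j" for i j x
  proof -
    have x\<Omega>: "x \<in> \<Omega>" using x ij U by blast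
    have c: "\<phi> (\<iota> n) j x - \<phi> (\<iota> n) i x = \<phi> i j x" if n: "n \<in> A x" for n
    proof -
      have n': "\<iota> n \<in> I" "x \<in> U (\<iota> n)" using n N(2) cubesub by (auto simp: A_def)
      \<comment> \<open>Three equal indices in the cocycle identity give
        \<open>\<phi> j j = 0\<close>; with two equal ones this yields antisymmetry.\<close>
      have "\<phi> j j x + \<phi> j j x + \<phi> j j x = 0" using \<phi>(2)[of j j j x] ij x by auto
      then have "3 * \<phi> j j x = 0" by simp
      then have jj: "\<phi> j j x = 0" by simp
      have "\<phi> j (\<iota> n) x + \<phi> (\<iota> n) j x + \<phi> j j x = 0" using \<phi>(2)[of j "\<iota> n" j x] ij x n' by auto
      moreover have "\<phi> (\<iota> n) i x + \<phi> i j x + \<phi> j (\<iota> n) x = 0" using \<phi>(2)[of "\<iota> n" i j x] ij x n' by auto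
      ultimately show ?thesis unfolding jj by (simp add: algebra_simps) (metis add.commute add.right_neutral add_diff_cancel_left' add_diff_eq diff_add_cancel)
    qed
    have "f j x - f i x = (\<Sum>n\<in>A x. of_real (\<beta> n x) * (\<phi> (\<iota> n) j x - \<phi> (\<iota> n) i x)) / of_real (s x)"
      unfolding f_def by (simp add: diff_divide_distrib[symmetric] sum_subtractf[symmetric] right_diff_distrib)
    also have "(\<Sum>n\<in>A x. of_real (\<beta> n x) * (\<phi> (\<iota> n) j x - \<phi> (\<iota> n) i x)) = (\<Sum>n\<in>A x. of_real (\<beta> n x) * \<phi> i j x)"
      by (intro sum.cong refl) (simp add: c)
    also have "\<dots> = of_real (s x) * \<phi> i j x" by (simp add: s_def sum_distrib_right)
    also have "\<dots> / of_real (s x) = \<phi> i j x" using sp[OF x\<Omega>] by simp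
    finally show ?thesis .
  qed
  show ?thesis using cont diff by blast
qed

section \<open>The additive Cousin problem\<close>

lemma eventually_disjoint_cubes:
  assumes "x \<notin> cube y t"
  shows "\<forall>\<^sub>F R in at_right 0. cube x R \<inter> cube y t = {}"
proof -
  have "open (- cube y t)" by (simp add: cube_def closed_cbox open_Compl)
  then have "\<forall>\<^sub>F R in at_right 0. cube x R \<subseteq> - cube y t"
    using assms by (intro eventually_cube_subset) auto
  then show ?thesis by eventually_elim auto
qed

text \<open>Surjectivity of the coboundary in terms of plain functions, without the encoding by
  groups and extensional families. The analytic construction is carried out here.\<close>

theorem ultra_cousin:
  fixes M :: "nat \<Rightarrow> real" and U :: "'i \<Rightarrow> (real^'d::finite) set" and \<phi> :: "'i \<Rightarrow> 'i \<Rightarrow> real^'d \<Rightarrow> complex"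
  assumes M: "\<And>q. 0 < M q" "M 0 = 1" and lc: "M1 M" and M2: "M2' M" and fac: "dominates c M fact"
    and \<Omega>: "open \<Omega>" and U: "\<And>i. i \<in> I \<Longrightarrow> open (U i)" "(\<Union>i\<in>I. U i) = \<Omega>"
    and \<phi>: "\<And>i j. i \<in> I \<Longrightarrow> j \<in> I \<Longrightarrow> \<phi> i j \<in> ultra_space c M (U i \<inter> U j)"
      "\<And>i j k x. i \<in> I \<Longrightarrow> j \<in> I \<Longrightarrow> k \<in> I \<Longrightarrow> x \<in> U i \<inter> U j \<inter> U k \<Longrightarrow> \<phi> i j x + \<phi> j k x + \<phi> k i x = 0"
  shows "\<exists>u. (\<forall>i\<in>I. u i \<in> ultra_space c M (U i)) \<and> (\<forall>i\<in>I. \<forall>j\<in>I. \<forall>x\<in>U i \<inter> U j. u j x - u i x = \<phi> i j x)"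
proof -
  obtain N p r \<iota> where N: "\<And>n. n \<in> N \<Longrightarrow> 0 < r n" "\<And>n. n \<in> N \<Longrightarrow> r n \<le> 1/4" "\<And>n. n \<in> N \<Longrightarrow> \<iota> n \<in> I"
      "\<And>n. n \<in> N \<Longrightarrow> cube (p n) (2 * r n) \<subseteq> U (\<iota> n)"
      "\<And>x. x \<in> \<Omega> \<Longrightarrow> \<exists>n\<in>N. x \<in> ocube (p n) (r n)"
      "\<And>x. x \<in> \<Omega> \<Longrightarrow> \<exists>V. open V \<and> x \<in> V \<and> finite {n\<in>(N::nat set). V \<inter> cube (p n) (r n) \<noteq> {}}"
  proof -
    have "\<exists>N p r \<iota>. (\<forall>n\<in>N::nat set. 0 < r n \<and> r n \<le> (1/4::real) \<and> \<iota> n \<in> I \<and> cube (p n) (2 * r n) \<subseteq> U (\<iota> n)) \<and>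
      (\<forall>x\<in>\<Omega>. \<exists>n\<in>N. x \<in> ocube (p n) (r n)) \<and>
      (\<forall>x\<in>\<Omega>. \<exists>V. open V \<and> x \<in> V \<and> finite {n\<in>N. V \<inter> cube (p n) (r n) \<noteq> {}})"
      by (rule cube_covering[OF \<Omega>]) (use U in auto)
    then obtain N p r \<iota> where N: "\<forall>n\<in>N::nat set. 0 < r n \<and> r n \<le> (1/4::real) \<and> \<iota> n \<in> I \<and> cube (p n) (2 * r n) \<subseteq> U (\<iota> n)"
      "\<forall>x\<in>\<Omega>. \<exists>n\<in>N. x \<in> ocube (p n) (r n)"
      "\<forall>x\<in>\<Omega>. \<exists>V. open V \<and> x \<in> V \<and> finite {n\<in>N. V \<inter> cube (p n) (r n) \<noteq> {}}"
      by (elim exE conjE)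
    show ?thesis by (rule that[of N r \<iota> p]) (use N in blast)+
  qed
  have UU: "open (U i \<inter> U j)" if "i \<in> I" "j \<in> I" for i j using that U(1) by (intro open_Int)
  have \<phi>c: "continuous_on (U i \<inter> U j) (\<phi> i j)" if "i \<in> I" "j \<in> I" for i j
    using \<phi>(1)[OF that] smooth_on_imp_continuous by (auto simp: ultra_space_iff[OF M(1)])
  have "\<exists>f. (\<forall>i\<in>I. continuous_on (U i) (f i)) \<and> (\<forall>i\<in>I. \<forall>j\<in>I. \<forall>x\<in>U i \<inter> U j. f j x - f i x = \<phi> i j x)"
    by (rule continuous_splitting[where U = U and \<Omega> = \<Omega> and N = N and r = r and \<iota> = \<iota> and p = p, OF U N(1) N(3) N(4) N(5) N(6) \<phi>c \<phi>(2)])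
  then obtain f where f: "\<And>i. i \<in> I \<Longrightarrow> continuous_on (U i) (f i)"
    "\<And>i j x. i \<in> I \<Longrightarrow> j \<in> I \<Longrightarrow> x \<in> U i \<inter> U j \<Longrightarrow> f j x - f i x = \<phi> i j x" by blast
  define g where "g = (\<lambda>n. f (\<iota> n))"
  have gc: "continuous_on (cube (p n) (2 * r n)) (g n)" if "n \<in> N" for n
    unfolding g_def by (rule continuous_on_subset[OF f(1)[OF N(3)[OF that]] N(4)[OF that]])
  have "\<exists>B\<ge>0. n \<in> N \<longrightarrow> (\<forall>y\<in>cube (p n) (2 * r n). norm (g n y) \<le> B)" for n
  proof (cases "n \<in> N")
    case True
    have "compact (g n ` cube (p n) (2 * r n))"
      unfolding cube_def using gc[OF True] by (intro compact_continuous_image compact_cbox) (simp add: cube_def)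
    then obtain B where "B > 0" "\<forall>z\<in>g n ` cube (p n) (2 * r n). norm z \<le> B"
      using compact_imp_bounded bounded_pos by metis
    then show ?thesis by (intro exI[of _ B]) auto
  qed auto
  then obtain b where b: "\<And>n. 0 \<le> b n" "\<And>n y. n \<in> N \<Longrightarrow> y \<in> cube (p n) (2 * r n) \<Longrightarrow> norm (g n y) \<le> b n"
    by metis
  interpret glue M c N p r g b
    by unfold_locales (use M lc M2 fac N gc b in auto)
  have local: "convergent (\<lambda>n. SS n x0 (rad (U i) x0) (f i) (cvec x0) - (\<Sum>m<n. corr m (cvec x0)))
     \<and> (\<exists>S. open S \<and> x0 \<in> S \<and> S \<subseteq> U i \<and> smooth_on S (Phi (U i) (f i)) \<and>
      for_h c (\<lambda>h. \<exists>C. \<forall>js. \<forall>x\<in>S. norm (foldr partial_deriv js (Phi (U i) (f i)) x) \<le> C * h ^ length js * M (length js)))"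
    if i: "i \<in> I" and x0: "x0 \<in> U i" for i x0
  proof -
    have x\<Omega>: "x0 \<in> \<Omega>" using i x0 U(2) by blast
    obtain k0 where k0: "k0 \<in> N" "x0 \<in> ocube (p k0) (r k0)" using N(5)[OF x\<Omega>] by blast
    obtain V where V: "open V" "x0 \<in> V" "finite {n\<in>N. V \<inter> cube (p n) (r n) \<noteq> {}}" using N(6)[OF x\<Omega>] by blast
    define Q where "Q = {n\<in>N. V \<inter> cube (p n) (r n) \<noteq> {}}"
    \<comment> \<open>By local finiteness only the indices in \<open>Q\<close> can interfere near
      \<open>x0\<close>. A small cube about \<open>x0\<close> lies inside the doubled cubes of the
      indices in \<open>P\<close> and, by closedness, misses the cubes of all others.\<close>
    define P where "P = {n\<in>N. x0 \<in> cube (p n) (r n)}"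
    have PQ: "P \<subseteq> Q" "finite Q" "finite P" "P \<subseteq> N"
      using V finite_subset[of P Q] by (auto simp: P_def Q_def)
    have ev1: "\<forall>\<^sub>F R in at_right (0::real). 0 < R \<and> R \<le> 1/2"
      by (auto simp: eventually_at_right_field intro: exI[of _ "1/2"])
    have ev2: "\<forall>\<^sub>F R in at_right 0. cube x0 R \<subseteq> U i" by (rule eventually_cube_subset[OF U(1)[OF i] x0])
    have ev3: "\<forall>\<^sub>F R in at_right 0. cube x0 R \<subseteq> V" by (rule eventually_cube_subset[OF V(1,2)])
    have ev4: "\<forall>\<^sub>F R in at_right 0. cube x0 R \<subseteq> ocube (p k0) (r k0)" by (rule eventually_cube_subset[OF open_ocube k0(2)])
    have ev5: "\<forall>\<^sub>F R in at_right 0. \<forall>n\<in>P. cube x0 R \<subseteq> ocube (p n) (2 * r n)"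
    proof (intro eventually_ball_finite PQ ballI eventually_cube_subset open_ocube)
      fix n assume "n \<in> P"
      then have "n \<in> N" "\<And>j. \<bar>x0 $ j - p n $ j\<bar> \<le> r n" by (auto simp: P_def mem_cube)
      then show "x0 \<in> ocube (p n) (2 * r n)" using N(1)[of n] unfolding ocube_def by (force intro: le_less_trans)
    qed
    have ev6: "\<forall>\<^sub>F R in at_right 0. \<forall>n\<in>Q - P. cube x0 R \<inter> cube (p n) (r n) = {}"
    proof (intro eventually_ball_finite ballI eventually_disjoint_cubes)
      show "finite (Q - P)" using PQ by auto
      show "x0 \<notin> cube (p n) (r n)" if "n \<in> Q - P" for n using that by (auto simp: P_def Q_def)
    qed
    have "\<forall>\<^sub>F R in at_right 0. (0 < R \<and> R \<le> 1/2) \<and> cube x0 R \<subseteq> U i \<and> cube x0 R \<subseteq> V \<and> cube x0 R \<subseteq> ocube (p k0) (r k0) \<and>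
       (\<forall>n\<in>P. cube x0 R \<subseteq> ocube (p n) (2 * r n)) \<and> (\<forall>n\<in>Q - P. cube x0 R \<inter> cube (p n) (r n) = {})"
      by (intro eventually_conj ev1 ev2 ev3 ev4 ev5 ev6)
    then have "\<exists>R. (0 < R \<and> R \<le> 1/2) \<and> cube x0 R \<subseteq> U i \<and> cube x0 R \<subseteq> V \<and> cube x0 R \<subseteq> ocube (p k0) (r k0) \<and>
       (\<forall>n\<in>P. cube x0 R \<subseteq> ocube (p n) (2 * r n)) \<and> (\<forall>n\<in>Q - P. cube x0 R \<inter> cube (p n) (r n) = {})"
      by (rule eventually_happens'[OF trivial_limit_at_right_real])
    then obtain R where R: "0 < R" "R \<le> 1/2" "cube x0 R \<subseteq> U i" "cube x0 R \<subseteq> V" "cube x0 R \<subseteq> ocube (p k0) (r k0)"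
       "\<And>n. n \<in> P \<Longrightarrow> cube x0 R \<subseteq> ocube (p n) (2 * r n)" "\<And>n. n \<in> Q - P \<Longrightarrow> cube x0 R \<inter> cube (p n) (r n) = {}"
      by blast
    have k0P: "k0 \<in> P" using k0 ocube_subset_cube[of "p k0" "r k0"] by (auto simp: P_def)
    have sub2: "cube x0 R \<subseteq> cube (p n) (2 * r n)" if "n \<in> P" for n
      using R(6)[OF that] ocube_subset_cube[of "p n" "2 * r n"] by blast
    have far: "cube x0 R \<inter> cube (p n) (r n) = {}" if "n \<in> N - P" for n
      using R(4) R(7)[of n] that by (cases "n \<in> Q") (auto simp: Q_def)
    have sub1: "cube x0 R \<subseteq> cube (p k0) (r k0)" using R(5) ocube_subset_cube[of "p k0" "r k0"] by blast
    have inter: "cube x0 R \<subseteq> U (\<iota> n) \<inter> U i" if "n \<in> P" for n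
      using sub2[OF that] N(4)[of n] R(3) PQ(4) that by blast
    have \<psi>: "\<phi> (\<iota> n) i y = f i y - g n y" if "n \<in> P" "y \<in> cube x0 R" for n y
    proof -
      have "n \<in> N" "y \<in> U (\<iota> n) \<inter> U i" using inter[OF that(1)] PQ(4) that by blast+
      from f(2)[OF N(3)[OF this(1)] i this(2)] show ?thesis by (simp add: g_def)
    qed
    have jet: "for_h c (\<lambda>h. \<exists>C\<ge>0. jet_bound M h C x0 R (\<phi> (\<iota> n) i))" if "n \<in> P" for n
      using that PQ(4) N(3)[of n] i by (intro ultra_space_jet_bound[OF M(1) UU \<phi>(1) inter]) auto
    show ?thesis
      by (intro conjI Phi_local[OF U(1)[OF i] f(1)[OF i] R(1-3) PQ(3,4) sub2 far k0P sub1 \<psi> jet])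
  qed
  define u where "u = (\<lambda>i. restrict (Phi (U i) (f i)) (U i))"
  have "u i \<in> ultra_space c M (U i)" if i: "i \<in> I" for i
    unfolding u_def
  proof (rule restrict_in_ultra_spaceI[OF M(1) U(1)[OF i]])
    fix x0 assume x0: "x0 \<in> U i"
    obtain S where S: "open S" "x0 \<in> S" "S \<subseteq> U i" "smooth_on S (Phi (U i) (f i))"
      "for_h c (\<lambda>h. \<exists>C. \<forall>js. \<forall>x\<in>S. norm (foldr partial_deriv js (Phi (U i) (f i)) x) \<le> C * h ^ length js * M (length js))"
      using local[OF i x0, THEN conjunct2] by (elim exE conjE) (rule that)
    have "for_h c (\<lambda>h. \<exists>C\<ge>0. deriv_bound M h C S (Phi (U i) (f i)))"
      by (rule foldr_deriv_boundD[OF M(1) S(5)])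
    with S(1-4) show "\<exists>S. open S \<and> x0 \<in> S \<and> S \<subseteq> U i \<and> smooth_on S (Phi (U i) (f i)) \<and>
        for_h c (\<lambda>h. \<exists>C\<ge>0. deriv_bound M h C S (Phi (U i) (f i)))"
      by (intro exI[of _ S] conjI)
  qed
  moreover have "u j x - u i x = \<phi> i j x" if ij: "i \<in> I" "j \<in> I" and x: "x \<in> U i \<inter> U j" for i j x
  proof -
    have "Phi (U j) (f j) x - Phi (U i) (f i) x = \<phi> i j x"
    proof (rule Phi_diff[OF U(1)[OF ij(1)] U(1)[OF ij(2)] f(1)[OF ij(1)] f(1)[OF ij(2)]])
      show xi: "x \<in> U i" and xj: "x \<in> U j" using x by auto
      show "convergent (\<lambda>n. SS n x (rad (U i) x) (f i) (cvec x) - (\<Sum>m<n. corr m (cvec x)))"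
        "convergent (\<lambda>n. SS n x (rad (U j) x) (f j) (cvec x) - (\<Sum>m<n. corr m (cvec x)))"
        by (rule local[OF ij(1) xi, THEN conjunct1], rule local[OF ij(2) xj, THEN conjunct1])
      show "f j y - f i y = \<phi> i j y" if "y \<in> U i \<inter> U j" for y by (rule f(2)[OF ij that])
      show "for_h c (\<lambda>h. \<exists>C\<ge>0. jet_bound M h C x R (\<phi> i j))" if "cube x R \<subseteq> U i \<inter> U j" for R
        by (rule ultra_space_jet_bound[OF M(1) UU[OF ij] \<phi>(1)[OF ij] that])
    qed
    then show ?thesis using x by (simp add: u_def)
  qed
  ultimately show ?thesis by blast
qed


section \<open>The Cech complex\<close>

lemma ultra_group_simps [simp]:
  "carrier (ultra_group c M \<Omega>) = ultra_space c M \<Omega>"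
  "f \<otimes>\<^bsub>ultra_group c M \<Omega>\<^esub> g = (\<lambda>x\<in>\<Omega>. f x + g x)"
  "\<one>\<^bsub>ultra_group c M \<Omega>\<^esub> = (\<lambda>x\<in>\<Omega>. 0)"
  by (simp_all add: ultra_group_def)

lemma ultra_space_extensional: "f \<in> ultra_space c M \<Omega> \<Longrightarrow> f \<in> extensional \<Omega>"
  by (simp add: ultra_space_def)

lemma
  assumes M: "\<And>q. 0 < M q" and \<Omega>: "open \<Omega>" and f: "f \<in> ultra_space c M \<Omega>"
  shows ultra_space_add: "g \<in> ultra_space c M \<Omega> \<Longrightarrow> (\<lambda>x\<in>\<Omega>. f x + g x) \<in> ultra_space c M \<Omega>"
    and ultra_space_diff: "g \<in> ultra_space c M \<Omega> \<Longrightarrow> (\<lambda>x\<in>\<Omega>. f x - g x) \<in> ultra_space c M \<Omega>"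
    and ultra_space_uminus: "(\<lambda>x\<in>\<Omega>. - f x) \<in> ultra_space c M \<Omega>"
proof -
  show "(\<lambda>x\<in>\<Omega>. f x + g x) \<in> ultra_space c M \<Omega>" if "g \<in> ultra_space c M \<Omega>"
    using ultra_space_lincomb[OF M \<Omega> f that, of 1] by simp
  show "(\<lambda>x\<in>\<Omega>. f x - g x) \<in> ultra_space c M \<Omega>" if "g \<in> ultra_space c M \<Omega>"
    using ultra_space_lincomb[OF M \<Omega> f that, of "-1"] by simp
  have "(\<lambda>x\<in>\<Omega>. (\<lambda>x\<in>\<Omega>. 0) x + (- 1) * f x) = (\<lambda>x\<in>\<Omega>. - f x)"
    by (rule ext) simp
  then show "(\<lambda>x\<in>\<Omega>. - f x) \<in> ultra_space c M \<Omega>"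
    using ultra_space_lincomb[OF M \<Omega> ultra_space_zero[OF M \<Omega>] f, of "-1"] by simp
qed

lemma group_ultra_group:
  assumes M: "\<And>q. 0 < M q" and \<Omega>: "open \<Omega>"
  shows "group (ultra_group c M \<Omega>)"
proof (rule groupI)
  fix f assume f: "f \<in> carrier (ultra_group c M \<Omega>)"
  then have e: "f \<in> extensional \<Omega>" by (simp add: ultra_space_extensional)
  show "\<one>\<^bsub>ultra_group c M \<Omega>\<^esub> \<otimes>\<^bsub>ultra_group c M \<Omega>\<^esub> f = f"
    using e by (intro ext) (simp add: extensional_def restrict_def)
  show "\<exists>g\<in>carrier (ultra_group c M \<Omega>). g \<otimes>\<^bsub>ultra_group c M \<Omega>\<^esub> f = \<one>\<^bsub>ultra_group c M \<Omega>\<^esub>"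
    using f ultra_space_uminus[OF M \<Omega>, of f c] by (intro bexI[of _ "\<lambda>x\<in>\<Omega>. - f x"]) (auto intro!: restrict_ext)
qed (auto simp: ultra_space_add[OF M \<Omega>] ultra_space_zero[OF M \<Omega>] intro!: restrict_ext)

lemma inv_ultra_group:
  assumes M: "\<And>q. 0 < M q" and \<Omega>: "open \<Omega>" and f: "f \<in> ultra_space c M \<Omega>"
  shows "inv\<^bsub>ultra_group c M \<Omega>\<^esub> f = (\<lambda>x\<in>\<Omega>. - f x)"
  by (rule group.inv_equality[OF group_ultra_group[OF M \<Omega>]])
     (use f ultra_space_uminus[OF M \<Omega> f] in \<open>auto intro!: restrict_ext\<close>)

text \<open>The gluing axiom of the sheaf. Compatibility makes the choice of an index at each point
  immaterial, and membership in the space can be checked on neighbourhoods.\<close>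

lemma ultra_space_glue:
  fixes U :: "'i \<Rightarrow> (real^'d::finite) set"
  assumes M: "\<And>q. 0 < M q" and \<Omega>: "open \<Omega>" and U: "\<And>i. i \<in> I \<Longrightarrow> open (U i)" "(\<Union>i\<in>I. U i) = \<Omega>"
    and f: "\<And>i. i \<in> I \<Longrightarrow> f i \<in> ultra_space c M (U i)"
    and eq: "\<And>i j x. i \<in> I \<Longrightarrow> j \<in> I \<Longrightarrow> x \<in> U i \<inter> U j \<Longrightarrow> f i x = f j x"
  shows "\<exists>g\<in>ultra_space c M \<Omega>. \<forall>i\<in>I. \<forall>x\<in>U i. g x = f i x"
proof -
  define \<iota> where "\<iota> = (\<lambda>x. SOME i. i \<in> I \<and> x \<in> U i)"
  define g where "g = (\<lambda>x. f (\<iota> x) x)"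
  have g: "g x = f i x" if i: "i \<in> I" and x: "x \<in> U i" for i x
  proof -
    have "\<iota> x \<in> I \<and> x \<in> U (\<iota> x)" unfolding \<iota>_def by (rule someI[of _ i]) (use i x in simp)
    then show ?thesis using eq[of "\<iota> x" i x] i x by (simp add: g_def)
  qed
  have "restrict g \<Omega> \<in> ultra_space c M \<Omega>"
  proof (rule restrict_in_ultra_spaceI[OF M \<Omega>])
    fix x assume "x \<in> \<Omega>"
    then obtain i where i: "i \<in> I" "x \<in> U i" using U(2) by blast
    note fi = f[OF i(1), unfolded ultra_space_iff[OF M]]
    define S where "S = ocube x (rad (U i) x)"
    note rd = rad[OF U(1)[OF i(1)] i(2)]
    have S: "open S" "x \<in> S" "S \<subseteq> cube x (rad (U i) x)"
      using rd ocube_subset_cube by (simp_all add: S_def open_ocube) (simp add: ocube_def)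
    then have S': "S \<subseteq> U i" "S \<subseteq> \<Omega>" using rd(3) U(2) i(1) by blast+
    note S = S S'
    have "smooth_on S (f i)" using fi by (intro smooth_on_subset[OF S(1,4)]) blast
    then have sm: "smooth_on S g"
      using smooth_on_cong[OF S(1), of g "f i"] g[OF i(1)] S(4) by blast
    have "for_h c (\<lambda>h. \<exists>C\<ge>0. deriv_bound M h C (cube x (rad (U i) x)) (f i))"
      using fi rd by (simp add: cube_def)
    then have "for_h c (\<lambda>h. \<exists>C\<ge>0. deriv_bound M h C S g)"
    proof (rule for_h_mono)
      fix h :: real assume "\<exists>C\<ge>0. deriv_bound M h C (cube x (rad (U i) x)) (f i)"
      then obtain C where C: "0 \<le> C" "deriv_bound M h C (cube x (rad (U i) x)) (f i)" by blast
      have "deriv_bound M h C S (f i)" using C(2) S(3) unfolding deriv_bound_def by blast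
      then have "deriv_bound M h C S g"
        using deriv_bound_cong[OF S(1) order_refl, of g "f i"] g[OF i(1)] S(4) by blast
      then show "\<exists>C\<ge>0. deriv_bound M h C S g" using C(1) by blast
    qed
    with S sm show "\<exists>S. open S \<and> x \<in> S \<and> S \<subseteq> \<Omega> \<and> smooth_on S g \<and> for_h c (\<lambda>h. \<exists>C\<ge>0. deriv_bound M h C S g)"
      by blast
  qed
  moreover have "restrict g \<Omega> x = f i x" if "i \<in> I" "x \<in> U i" for i x
    using g[OF that] that U(2) by auto
  ultimately show ?thesis by blast
qed

section \<open>Groups and homomorphisms of the complex\<close>

locale cech_covering =
  fixes M :: "nat \<Rightarrow> real" and c :: ultra_case and \<Omega> :: "(real^'d::finite) set"
    and I :: "'i set" and U :: "'i \<Rightarrow> (real^'d) set"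
  assumes M: "\<And>q. 0 < M q" and \<Omega>: "open \<Omega>"
    and U: "\<And>i. i \<in> I \<Longrightarrow> open (U i)" "(\<Union>i\<in>I. U i) = \<Omega>"
begin

lemma U2: "i \<in> I \<Longrightarrow> j \<in> I \<Longrightarrow> open (U i \<inter> U j)"
  using U(1) by (intro open_Int)

lemma carrier_cochains0: "carrier (cochains0 c M I U) = (\<Pi>\<^sub>E i\<in>I. ultra_space c M (U i))"
  by (simp add: cochains0_def)

lemma carrier_cochains1: "carrier (cochains1 c M I U) = (\<Pi>\<^sub>E (i, j)\<in>I \<times> I. ultra_space c M (U i \<inter> U j))"
  by (simp add: cochains1_def case_prod_unfold)

lemma mult_cochains0: "u \<otimes>\<^bsub>cochains0 c M I U\<^esub> v = (\<lambda>i\<in>I. \<lambda>x\<in>U i. u i x + v i x)"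
  by (simp add: cochains0_def)

lemma mult_cochains1: "u \<otimes>\<^bsub>cochains1 c M I U\<^esub> v = (\<lambda>(i, j)\<in>I \<times> I. \<lambda>x\<in>U i \<inter> U j. u (i, j) x + v (i, j) x)"
  by (simp add: cochains1_def case_prod_unfold)

lemma one_cochains0: "\<one>\<^bsub>cochains0 c M I U\<^esub> = (\<lambda>i\<in>I. \<lambda>x\<in>U i. 0)"
  by (simp add: cochains0_def)

lemma one_cochains1: "\<one>\<^bsub>cochains1 c M I U\<^esub> = (\<lambda>(i, j)\<in>I \<times> I. \<lambda>x\<in>U i \<inter> U j. 0)"
  by (simp add: cochains1_def case_prod_unfold)

lemma group_cochains0: "group (cochains0 c M I U)"
  unfolding cochains0_def by (intro product_group group_ultra_group M U)

lemma group_cochains1: "group (cochains1 c M I U)"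
  unfolding cochains1_def by (intro product_group) (auto intro!: group_ultra_group M U2)

lemma inv_cochains1:
  assumes "u \<in> carrier (cochains1 c M I U)"
  shows "inv\<^bsub>cochains1 c M I U\<^esub> u = (\<lambda>(i, j)\<in>I \<times> I. \<lambda>x\<in>U i \<inter> U j. - u (i, j) x)"
proof -
  have "inv\<^bsub>cochains1 c M I U\<^esub> u = (\<lambda>k\<in>I \<times> I. inv\<^bsub>case k of (i, j) \<Rightarrow> ultra_group c M (U i \<inter> U j)\<^esub> u k)"
    unfolding cochains1_def
    by (rule inv_product_group) (use assms in \<open>auto simp: cochains1_def intro!: group_ultra_group M U2\<close>)
  also have "\<dots> = (\<lambda>(i, j)\<in>I \<times> I. \<lambda>x\<in>U i \<inter> U j. - u (i, j) x)"
  proof (rule restrict_ext, clarify)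
    fix i j assume ij: "i \<in> I" "j \<in> I"
    then have "u (i, j) \<in> ultra_space c M (U i \<inter> U j)" using assms by (force simp: carrier_cochains1)
    then show "inv\<^bsub>ultra_group c M (U i \<inter> U j)\<^esub> u (i, j) = (\<lambda>x\<in>U i \<inter> U j. - u (i, j) x)"
      by (rule inv_ultra_group[OF M U2[OF ij]])
  qed
  finally show ?thesis .
qed

abbreviation "Z \<equiv> carrier (cocycles1 c M I U)"

lemma in_cocycles1:
  "u \<in> Z \<longleftrightarrow> u \<in> carrier (cochains1 c M I U) \<and>
    (\<forall>i\<in>I. \<forall>j\<in>I. \<forall>k\<in>I. \<forall>x\<in>U i \<inter> U j \<inter> U k. u (i, j) x + u (j, k) x + u (k, i) x = 0)"
  by (simp add: cocycles1_def)

lemma mult_cocycles1: "mult (cocycles1 c M I U) = mult (cochains1 c M I U)"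
  and one_cocycles1: "one (cocycles1 c M I U) = one (cochains1 c M I U)"
  by (simp_all add: cocycles1_def)

lemma group_cocycles1: "group (cocycles1 c M I U)"
proof -
  interpret C: group "cochains1 c M I U" by (rule group_cochains1)
  have "subgroup Z (cochains1 c M I U)"
  proof (rule C.subgroupI)
    show "Z \<subseteq> carrier (cochains1 c M I U)" by (auto simp: in_cocycles1)
    have "\<one>\<^bsub>cochains1 c M I U\<^esub> \<in> Z"
      using C.one_closed by (simp add: in_cocycles1) (simp add: one_cochains1)
    then show "Z \<noteq> {}" by blast
    fix u assume u: "u \<in> Z"
    then have uC: "u \<in> carrier (cochains1 c M I U)" by (simp add: in_cocycles1)
    have "- u (i, j) x + - u (j, k) x + - u (k, i) x = 0"
      if "i \<in> I" "j \<in> I" "k \<in> I" "x \<in> U i \<inter> U j \<inter> U k" for i j k x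
    proof -
      have "- u (i, j) x + - u (j, k) x + - u (k, i) x = - (u (i, j) x + u (j, k) x + u (k, i) x)" by simp
      also have "\<dots> = 0" using u that by (simp add: in_cocycles1)
      finally show ?thesis .
    qed
    then show "inv\<^bsub>cochains1 c M I U\<^esub> u \<in> Z"
      using C.inv_closed[OF uC] by (simp add: in_cocycles1) (simp add: inv_cochains1[OF uC])
    fix v assume v: "v \<in> Z"
    then have vC: "v \<in> carrier (cochains1 c M I U)" by (simp add: in_cocycles1)
    have "(u (i, j) x + v (i, j) x) + (u (j, k) x + v (j, k) x) + (u (k, i) x + v (k, i) x) = 0"
      if "i \<in> I" "j \<in> I" "k \<in> I" "x \<in> U i \<inter> U j \<inter> U k" for i j k x
    proof -
      have "(u (i, j) x + v (i, j) x) + (u (j, k) x + v (j, k) x) + (u (k, i) x + v (k, i) x)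
        = (u (i, j) x + u (j, k) x + u (k, i) x) + (v (i, j) x + v (j, k) x + v (k, i) x)" by simp
      also have "\<dots> = 0" using u v that by (simp add: in_cocycles1)
      finally show ?thesis .
    qed
    then show "u \<otimes>\<^bsub>cochains1 c M I U\<^esub> v \<in> Z"
      using C.m_closed[OF uC vC] by (simp add: in_cocycles1) (simp add: mult_cochains1)
  qed
  then show ?thesis
    using C.subgroup_imp_group by (simp add: cocycles1_def)
qed

lemma restr_hom: "group_hom (ultra_group c M \<Omega>) (cochains0 c M I U) (restr I U)"
proof (intro group_hom.intro group_hom_axioms.intro group_ultra_group M \<Omega> group_cochains0 homI)
  fix f g assume f: "f \<in> carrier (ultra_group c M \<Omega>)"
  have "restrict f (U i) \<in> ultra_space c M (U i)" if "i \<in> I" for i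
    using f that U by (intro ultra_space_restrict[OF M, of _ \<Omega>]) auto
  then show "restr I U f \<in> carrier (cochains0 c M I U)"
    by (simp add: carrier_cochains0 restr_def)
  show "restr I U (f \<otimes>\<^bsub>ultra_group c M \<Omega>\<^esub> g) = restr I U f \<otimes>\<^bsub>cochains0 c M I U\<^esub> restr I U g"
    unfolding mult_cochains0 restr_def ultra_group_simps
    using U(2) by (intro restrict_ext) (auto intro!: restrict_ext)
qed

lemma cobound_cocycle:
  assumes u: "u \<in> carrier (cochains0 c M I U)"
  shows "cobound I U u \<in> Z"
proof -
  have "(\<lambda>x\<in>U i \<inter> U j. u j x - u i x) \<in> ultra_space c M (U i \<inter> U j)" if ij: "i \<in> I" "j \<in> I" for i j
  proof -
    have r: "restrict (u k) (U i \<inter> U j) \<in> ultra_space c M (U i \<inter> U j)" if "k = i \<or> k = j" for k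
      using that ij u by (intro ultra_space_restrict[OF M U2[OF ij], of "U k"]) (auto simp: carrier_cochains0)
    have "(\<lambda>x\<in>U i \<inter> U j. restrict (u j) (U i \<inter> U j) x - restrict (u i) (U i \<inter> U j) x) = (\<lambda>x\<in>U i \<inter> U j. u j x - u i x)"
      by (rule restrict_ext) simp
    then show ?thesis using ultra_space_diff[OF M U2[OF ij] r[of j] r[of i]] by simp
  qed
  then have "cobound I U u \<in> carrier (cochains1 c M I U)"
    by (auto simp: carrier_cochains1 cobound_def)
  then show ?thesis by (auto simp: in_cocycles1 cobound_def)
qed

lemma cobound_hom: "group_hom (cochains0 c M I U) (cocycles1 c M I U) (cobound I U)"
proof (intro group_hom.intro group_hom_axioms.intro group_cochains0 group_cocycles1 homI cobound_cocycle)
  fix u v assume "u \<in> carrier (cochains0 c M I U)" "v \<in> carrier (cochains0 c M I U)"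
  show "cobound I U (u \<otimes>\<^bsub>cochains0 c M I U\<^esub> v) = cobound I U u \<otimes>\<^bsub>cocycles1 c M I U\<^esub> cobound I U v"
    unfolding mult_cocycles1 mult_cochains0 mult_cochains1 cobound_def
    by (rule restrict_ext) (auto intro!: restrict_ext)
qed

lemma restr_inj:
  assumes f: "f \<in> ultra_space c M \<Omega>" and "restr I U f = \<one>\<^bsub>cochains0 c M I U\<^esub>"
  shows "f = (\<lambda>x\<in>\<Omega>. 0)"
proof
  fix x
  show "f x = (\<lambda>x\<in>\<Omega>. 0) x"
  proof (cases "x \<in> \<Omega>")
    case True
    then obtain i where i: "i \<in> I" "x \<in> U i" using U(2) by blast
    have "restr I U f i x = (\<lambda>i\<in>I. \<lambda>x\<in>U i. 0) i x" using assms(2) by (simp only: one_cochains0)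
    then show ?thesis using i True by (simp add: restr_def)
  next
    case False
    then show ?thesis using ultra_space_extensional[OF f] by (simp add: extensional_def)
  qed
qed

lemma kernel_cobound:
  "restr I U ` ultra_space c M \<Omega> = kernel (cochains0 c M I U) (cocycles1 c M I U) (cobound I U)"
proof (intro equalityI subsetI)
  fix u assume "u \<in> restr I U ` ultra_space c M \<Omega>"
  then obtain f where f: "f \<in> ultra_space c M \<Omega>" "u = restr I U f" by blast
  have "u \<in> carrier (cochains0 c M I U)"
    using group_hom.hom_closed[OF restr_hom, of f] f by simp
  moreover have "cobound I U u = \<one>\<^bsub>cocycles1 c M I U\<^esub>"
    unfolding one_cocycles1 one_cochains1 cobound_def f(2) restr_def
    by (rule restrict_ext) (auto intro!: restrict_ext)
  ultimately show "u \<in> kernel (cochains0 c M I U) (cocycles1 c M I U) (cobound I U)"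
    by (simp add: kernel_def)
next
  fix u assume "u \<in> kernel (cochains0 c M I U) (cocycles1 c M I U) (cobound I U)"
  then have u: "u \<in> carrier (cochains0 c M I U)" "cobound I U u = \<one>\<^bsub>cochains1 c M I U\<^esub>"
    by (simp_all add: kernel_def one_cocycles1)
  have ui: "u i \<in> ultra_space c M (U i)" if "i \<in> I" for i
    using u(1) that by (auto simp: carrier_cochains0)
  have eq: "u i x = u j x" if "i \<in> I" "j \<in> I" "x \<in> U i \<inter> U j" for i j x
    using fun_cong[OF fun_cong[OF u(2), of "(i, j)"], of x] that by (simp add: cobound_def one_cochains1)
  obtain f where f: "f \<in> ultra_space c M \<Omega>" "\<forall>i\<in>I. \<forall>x\<in>U i. f x = u i x"
    using ultra_space_glue[where U = U and I = I and f = u, OF M \<Omega> U ui eq] by blast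
  have "restr I U f = u"
  proof
    fix i show "restr I U f i = u i"
    proof (cases "i \<in> I")
      case True
      then show ?thesis
        using f(2) ultra_space_extensional[OF ui[OF True]] by (auto simp: restr_def restrict_def extensional_def)
    next
      case False
      then show ?thesis using u(1) by (simp add: carrier_cochains0 PiE_def extensional_def restr_def)
    qed
  qed
  then show "u \<in> restr I U ` ultra_space c M \<Omega>" using f(1) by blast
qed

lemma cobound_surj:
  assumes "M 0 = 1" "M1 M" "M2' M" "dominates c M fact"
  shows "cobound I U ` carrier (cochains0 c M I U) = Z"
proof (intro equalityI subsetI)
  fix \<phi> assume \<phi>: "\<phi> \<in> Z"
  then have \<phi>C: "\<phi> \<in> carrier (cochains1 c M I U)" by (simp add: in_cocycles1)
  have mem: "\<phi> (i, j) \<in> ultra_space c M (U i \<inter> U j)" if "i \<in> I" "j \<in> I" for i j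
    using PiE_mem[OF \<phi>C[unfolded carrier_cochains1], of "(i, j)"] that by simp
  have cocycle: "\<phi> (i, j) x + \<phi> (j, k) x + \<phi> (k, i) x = 0"
    if "i \<in> I" "j \<in> I" "k \<in> I" "x \<in> U i \<inter> U j \<inter> U k" for i j k x
    using that \<phi> by (simp add: in_cocycles1)
  have "\<exists>u. (\<forall>i\<in>I. u i \<in> ultra_space c M (U i)) \<and>
      (\<forall>i\<in>I. \<forall>j\<in>I. \<forall>x\<in>U i \<inter> U j. u j x - u i x = \<phi> (i, j) x)"
  proof (rule ultra_cousin[where \<phi> = "\<lambda>i j. \<phi> (i, j)"])
    show "0 < M q" for q by (rule M)
    show "open (U i)" if "i \<in> I" for i by (rule U(1)[OF that])
    show "\<phi> (i, j) \<in> ultra_space c M (U i \<inter> U j)" if "i \<in> I" "j \<in> I" for i j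
      by (rule mem[OF that])
    show "\<phi> (i, j) x + \<phi> (j, k) x + \<phi> (k, i) x = 0"
      if "i \<in> I" "j \<in> I" "k \<in> I" "x \<in> U i \<inter> U j \<inter> U k" for i j k x
      by (rule cocycle[OF that])
  qed (rule assms \<Omega> U(2))+
  then obtain u where "\<forall>i\<in>I. u i \<in> ultra_space c M (U i)"
    "\<forall>i\<in>I. \<forall>j\<in>I. \<forall>x\<in>U i \<inter> U j. u j x - u i x = \<phi> (i, j) x"
    by (elim exE conjE)
  then have u: "i \<in> I \<Longrightarrow> u i \<in> ultra_space c M (U i)"
    "i \<in> I \<Longrightarrow> j \<in> I \<Longrightarrow> x \<in> U i \<inter> U j \<Longrightarrow> u j x - u i x = \<phi> (i, j) x" for i j x
    by simp_all
  \<comment> \<open>Equality of representatives has to be checked off the overlaps and off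
    \<open>I \<times> I\<close> too, where both sides are \<open>undefined\<close>.\<close>
  have "cobound I U (restrict u I) = \<phi>"
  proof
    fix k show "cobound I U (restrict u I) k = \<phi> k"
    proof (cases "k \<in> I \<times> I")
      case True
      then obtain i j where k: "k = (i, j)" "i \<in> I" "j \<in> I" by blast
      have ext: "\<phi> k \<in> extensional (U i \<inter> U j)"
        unfolding k(1) by (rule ultra_space_extensional[OF mem[OF k(2,3)]])
      show ?thesis
      proof
        fix x show "cobound I U (restrict u I) k x = \<phi> k x"
          using u(2)[OF k(2,3), of x] k extensional_arb[OF ext, of x]
          by (cases "x \<in> U i \<inter> U j") (simp_all add: cobound_def)
      qed
    next
      case False
      have "\<phi> \<in> extensional (I \<times> I)" using \<phi>C by (simp add: carrier_cochains1 PiE_def)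
      then have "\<phi> k = undefined" using False by (rule extensional_arb)
      then show ?thesis using False by (simp add: cobound_def restrict_def)
    qed
  qed
  moreover have "restrict u I \<in> carrier (cochains0 c M I U)"
    using u(1) by (simp add: carrier_cochains0)
  ultimately show "\<phi> \<in> cobound I U ` carrier (cochains0 c M I U)" by blast
qed (use cobound_cocycle in blast)

end

section \<open>Vanishing of the cohomology and exactness\<close>

lemma (in group) trivial_group_Mod_carrier: "trivial_group (G Mod carrier G)"
proof -
  interpret N: normal "carrier G" G
    by (rule normal_invI) (auto intro: subgroup_self)
  have "carrier (G Mod carrier G) = {carrier G}"
    using rcosets_part_G[OF subgroup_self] coset_join2[OF _ subgroup_self] 
    by (auto simp: FactGroup_def RCOSETS_def)
  then show ?thesis using N.factorgroup_is_group by (simp add: trivial_group_def)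
qed

lemma dominates_factI:
  assumes "case c of Beurling \<Rightarrow> seq_prec fact M | Roumieu \<Rightarrow> seq_subset fact M"
  shows "dominates c M fact"
  using assms by (cases c) (force simp: dominates_def for_h_def seq_prec_def seq_subset_def)+

theorem theorem6p1:
  fixes M :: "nat \<Rightarrow> real"
    and c :: ultra_case
    and \<Omega> :: "(real^'d::finite) set"
    and I :: "'i set"
    and U :: "'i \<Rightarrow> (real^'d) set"
  assumes "weight_sequence M" and "M1 M" and "M2' M" and "QA M"
    and "case c of Beurling \<Rightarrow> seq_prec fact M | Roumieu \<Rightarrow> seq_subset fact M"
    and "open \<Omega>"
    and "\<And>i. i \<in> I \<Longrightarrow> open (U i)" and "(\<Union>i\<in>I. U i) = \<Omega>"
  shows "trivial_group (cohomology1 c M I U)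
    \<and> exact_at zero_group (\<lambda>_. \<one>\<^bsub>ultra_group c M \<Omega>\<^esub>)
        (ultra_group c M \<Omega>) (restr I U) (cochains0 c M I U)
    \<and> exact_at (ultra_group c M \<Omega>) (restr I U)
        (cochains0 c M I U) (cobound I U) (cocycles1 c M I U)
    \<and> exact_at (cochains0 c M I U) (cobound I U)
        (cocycles1 c M I U) (\<lambda>_. \<one>\<^bsub>zero_group\<^esub>) zero_group"
proof -
  have W: "\<And>q. 0 < M q" "M 0 = 1" using assms(1) by (auto simp: weight_sequence_def)
  interpret cech_covering M c \<Omega> I U
    by unfold_locales (use W assms(6-8) in auto)
  have surj: "cobound I U ` carrier (cochains0 c M I U) = Z"
    by (rule cobound_surj[OF W(2) assms(2,3) dominates_factI[OF assms(5)]])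
  have hom0: "group_hom zero_group (ultra_group c M \<Omega>) (\<lambda>_. \<one>\<^bsub>ultra_group c M \<Omega>\<^esub>)"
    using group_ultra_group[OF W(1) \<Omega>] ultra_space_zero[OF W(1) \<Omega>]
    by (intro group_hom.intro group_hom_axioms.intro homI singleton_group) auto
  have hom3: "group_hom (cocycles1 c M I U) zero_group (\<lambda>_. \<one>\<^bsub>zero_group\<^esub>)"
    by (intro group_hom.intro group_hom_axioms.intro homI singleton_group group_cocycles1)
       (auto simp: singleton_group_def)
  show ?thesis
  proof (intro conjI)
    show "trivial_group (cohomology1 c M I U)"
      unfolding cohomology1_def surj by (rule group.trivial_group_Mod_carrier[OF group_cocycles1])
    have "kernel (ultra_group c M \<Omega>) (cochains0 c M I U) (restr I U) = {\<one>\<^bsub>ultra_group c M \<Omega>\<^esub>}"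
      using restr_inj group_hom.hom_one[OF restr_hom] ultra_space_zero[OF W(1) \<Omega>, of c]
      by (auto simp: kernel_def)
    then show "exact_at zero_group (\<lambda>_. \<one>\<^bsub>ultra_group c M \<Omega>\<^esub>)
        (ultra_group c M \<Omega>) (restr I U) (cochains0 c M I U)"
      unfolding exact_at_def using hom0 restr_hom by (simp add: singleton_group_def)
    show "exact_at (ultra_group c M \<Omega>) (restr I U)
        (cochains0 c M I U) (cobound I U) (cocycles1 c M I U)"
      unfolding exact_at_def using restr_hom cobound_hom kernel_cobound by simp
    show "exact_at (cochains0 c M I U) (cobound I U)
        (cocycles1 c M I U) (\<lambda>_. \<one>\<^bsub>zero_group\<^esub>) zero_group"
      unfolding exact_at_def using cobound_hom hom3 surj by (simp add: kernel_def)
  qed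
qed

end
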